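(* Let $(W,\mathfrak h)$ be an irreducible complex reflection group with $n=\dim\mathfrak h>1$, let $c:\mathcal S\to\mathbb C$ be a conjugation-invariant function, $\zeta\in\mathbb C$, and suppose $t\in\mathbb C$, $t\neq0$. Then the algebra $eA_{t,c,\zeta}e$ is a filtered quantization of $\overline{\mathcal O}_{\min}/W$ (that is, of the graded Poisson algebra $\mathbb C[\overline{\mathcal O}_{\min}]^W$).
   Context: $\mathfrak h$ is a finite-dimensional complex vector space, $n=\dim\mathfrak h$. A complex reflection is a finite-order $s\in GL(\mathfrak h)$ with $\operatorname{rank}(s-1)=1$. A complex reflection group $(W,\mathfrak h)$ is a finite subgroup $W\subset GL(\mathfrak h)$ generated by complex reflections; it is irreducible if $\mathfrak h$ is an irreducible representation. $\mathcal S$ is the set of complex reflections in $W$. For $s\in\mathcal S$, $\alpha_s\in\mathfrak h^*$ is such that $\ker\alpha_s$ is the hyperplane fixed by $s$, $\lambda_s$ is defined by $s(\alpha_s)=\lambda_s\alpha_s$, and $\alpha_s^\vee\in\mathfrak h$ is an eigenvector of $s$ with eigenvalue $\ne1$. The rational Cherednik algebra $H_{t,c}$ is the quotient of $T(\mathfrak h\oplus\mathfrak h^* )\rtimes W$ by $[x,x']=0$, $[y,y']=0$, $[y,x]=t\,x(y)-\sum_{s\in\mathcal S}\frac{2c_s}{\alpha_s(\alpha_s^\vee)}x(\alpha_s^\vee)\alpha_s(y)\,s$ for $x,x'\in\mathfrak h^*$, $y,y'\in\mathfrak h$. Let $y_1,\dots,y_n$ be a basis of $\mathfrak h$ with dual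 basis $x_1,\dots,x_n$. $H_{t,c}^{\mathfrak{gl}(n)}$ is the subalgebra generated by all $x_iy_j$ and $W$. The Euler element is $\mathrm{eu}_c=\sum_ix_iy_i-\sum_{s\in\mathcal S}\frac{2c_s}{1-\lambda_s}s$. Put $\mathbf a=\frac1{|Z(W)|}\sum_{z\in Z(W)}z$ and $e=\frac1{|W|}\sum_{w\in W}w$. For $\zeta\in\mathbb C$, $A_{t,c,\zeta}=\mathbf aH_{t,c}^{\mathfrak{gl}(n)}\mathbf a/\langle\mathbf a\,\mathrm{eu}_c-\zeta\rangle$ ($\zeta$ meaning $\zeta\mathbf a$). Filtration: $H_{t,c}$ is filtered with $W$ in degree $0$ and $\mathfrak h,\mathfrak h^*$ in degree $1$; subalgebras get the restricted filtration and $A_{t,c,\zeta}$ the quotient filtration. For a filtered algebra $A$ with commutative associated graded algebra, $\operatorname{gr}A$ carries the Poisson bracket induced by the commutator (here $[\mathcal F_i,\mathcal F_j]\subset\mathcal F_{i+j-2}$ and the bracket of symbols is the class of the commutator in $\mathcal F_{i+j-2}/\mathcal F_{i+j-3}$). $A$ is a filtered quantization of an $\mathbb N$-graded Poisson algebra $B$ if there is a graded Poisson isomorphism $\operatorname{gr}A\cong B$. $\mathcal O_{\min}\subset\mathfrak{gl}(n)=\operatorname{End}(\mathfrak h)$ is the minimal nilpotent orbit (nilpotent matrices of rank one), with closure $\overline{\mathcal O}_{\min}$; its coordinate ring has the Kirillov--Kostant--Souriau Poisson structure and is graded with linear functions on $\mathfrak{gl}(n)$ in degree $2$. $W\subset GL(\mathfrak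 h)$ acts by conjugation, preserving the Poisson structure. *)

theory Defs
  imports
    "HOL-Analysis.Analysis"
    "HOL-Library.Poly_Mapping"
    "HOL-Algebra.QuotRing"
    "HOL-Algebra.Module"
    "HOL-Algebra.Generated_Groups"
    "HOL-Algebra.Subrings"
    "HOL-Algebra.Algebraic_Closure_Type"
begin

section \<open>Complex reflection groups\<close>

text \<open>
  The space \<open>\<hh>\<close> is \<^typ>\<open>complex ^ 'n\<close> (column vectors), with basis \<open>y\<^sub>j = axis j 1\<close>, and
  \<open>n = CARD('n)\<close>.  The dual space is represented by row vectors, also of type
  \<^typ>\<open>complex ^ 'n\<close>, and the dual basis is \<open>x\<^sub>j = axis j 1\<close>.
  Linear maps are square matrices; their product is \<open>**\<close> (the type class operations \<open>*\<close> and
  \<open>^\<close> on \<^typ>\<open>complex ^ 'n ^ 'n\<close> are componentwise and are not used).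
\<close>

type_synonym 'n cmat = "complex ^ 'n ^ 'n"

text \<open>The bilinear evaluation of a covector on a vector (not a Hermitian product).\<close>

definition pairing :: "complex ^ 'n \<Rightarrow> complex ^ 'n \<Rightarrow> complex" where
  "pairing x y = (\<Sum>i\<in>UNIV. x $ i * y $ i)"

definition GL :: "('n::finite) cmat monoid" where
  "GL = \<lparr>carrier = {A. invertible A}, mult = (**), one = mat 1\<rparr>"

text \<open>The contragredient action: \<open>(w \<cdot> x)(v) = x(w\<inverse> v)\<close>.\<close>

definition dual_act :: "('n::finite) cmat \<Rightarrow> complex ^ 'n \<Rightarrow> complex ^ 'n" where
  "dual_act w x = x v* matrix_inv w"

definition complex_reflection :: "('n::finite) cmat \<Rightarrow> bool" where
  "complex_reflection s \<longleftrightarrow>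
     s \<in> carrier GL \<and> (\<exists>k::nat. k > 0 \<and> s [^]\<^bsub>GL\<^esub> k = mat 1) \<and> rank (s - mat 1) = 1"

definition reflections :: "('n::finite) cmat set \<Rightarrow> 'n cmat set" where
  "reflections W = {s \<in> W. complex_reflection s}"

definition complex_reflection_group :: "('n::finite) cmat set \<Rightarrow> bool" where
  "complex_reflection_group W \<longleftrightarrow>
     finite W \<and> subgroup W GL \<and> W = generate GL (reflections W)"

definition irreducible_group :: "('n::finite) cmat set \<Rightarrow> bool" where
  "irreducible_group W \<longleftrightarrow>
     (\<forall>U :: (complex ^ 'n) set. vec.subspace U \<and> (\<forall>w\<in>W. \<forall>u\<in>U. w *v u \<in> U) \<longrightarrow> U = {0} \<or> U = UNIV)"

text \<open>
  \<open>\<alpha> s\<close>, \<open>\<alpha>' s\<close> and \<open>lam s\<close> are the root, the coroot and the eigenvalue of \<open>s\<close> on \<open>\<alpha> s\<close>.  They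
  are constrained only for reflections \<open>s\<close> in \<open>W\<close>.
\<close>

definition reflection_data ::
  "('n::finite) cmat set \<Rightarrow> ('n cmat \<Rightarrow> complex ^ 'n) \<Rightarrow> ('n cmat \<Rightarrow> complex ^ 'n) \<Rightarrow>
   ('n cmat \<Rightarrow> complex) \<Rightarrow> bool" where
  "reflection_data W \<alpha> \<alpha>' lam \<longleftrightarrow> (\<forall>s\<in>reflections W.
     {v. pairing (\<alpha> s) v = 0} = {v. s *v v = v} \<and>
     dual_act s (\<alpha> s) = lam s *s \<alpha> s \<and>
     \<alpha>' s \<noteq> 0 \<and> (\<exists>\<mu>. \<mu> \<noteq> 1 \<and> s *v \<alpha>' s = \<mu> *s \<alpha>' s))"

definition conj_invariant :: "('n::finite) cmat set \<Rightarrow> ('n cmat \<Rightarrow> complex) \<Rightarrow> bool" where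
  "conj_invariant W c \<longleftrightarrow>
     (\<forall>w\<in>W. \<forall>s\<in>reflections W. c (w ** s ** matrix_inv w) = c s)"

section \<open>Algebras over the complex numbers\<close>

text \<open>
  A (possibly noncommutative) algebra is a record of type \<^typ>\<open>(complex, 'a) module\<close>, which
  has a ring structure and a scalar multiplication.
\<close>

definition complex_algebra :: "(complex, 'a, 'm) module_scheme \<Rightarrow> bool" where
  "complex_algebra A \<longleftrightarrow> ring A \<and> Module.module (ring_of_type_algebra :: complex ring) A \<and>
     (\<forall>k. \<forall>x\<in>carrier A. \<forall>y\<in>carrier A.
        (k \<odot>\<^bsub>A\<^esub> x) \<otimes>\<^bsub>A\<^esub> y = k \<odot>\<^bsub>A\<^esub> (x \<otimes>\<^bsub>A\<^esub> y) \<and>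
        x \<otimes>\<^bsub>A\<^esub> (k \<odot>\<^bsub>A\<^esub> y) = k \<odot>\<^bsub>A\<^esub> (x \<otimes>\<^bsub>A\<^esub> y))"

abbreviation subspace_of :: "'a set \<Rightarrow> (complex, 'a, 'm) module_scheme \<Rightarrow> bool" where
  "subspace_of V A \<equiv> submodule V (ring_of_type_algebra :: complex ring) A"

definition commutator :: "(complex, 'a, 'm) module_scheme \<Rightarrow> 'a \<Rightarrow> 'a \<Rightarrow> 'a" where
  "commutator A x y = x \<otimes>\<^bsub>A\<^esub> y \<ominus>\<^bsub>A\<^esub> y \<otimes>\<^bsub>A\<^esub> x"

definition quot_alg :: "(complex, 'a, 'm) module_scheme \<Rightarrow> 'a set \<Rightarrow> (complex, 'a set) module" where
  "quot_alg A I =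
     \<lparr>carrier = carrier (A Quot I), mult = mult (A Quot I), one = one (A Quot I),
      zero = zero (A Quot I), add = add (A Quot I),
      smult = (\<lambda>k V. \<Union>x\<in>V. I +>\<^bsub>A\<^esub> (k \<odot>\<^bsub>A\<^esub> x))\<rparr>"

definition generated_subalgebra :: "(complex, 'a, 'm) module_scheme \<Rightarrow> 'a set \<Rightarrow> 'a set" where
  "generated_subalgebra A S = \<Inter>{B. subring B A \<and> subspace_of B A \<and> S \<subseteq> B}"

text \<open>The algebra \<open>p A p\<close> with unit \<open>p\<close>, for an idempotent \<open>p\<close>.\<close>

definition corner :: "(complex, 'a) module \<Rightarrow> 'a \<Rightarrow> (complex, 'a) module" where
  "corner A p = A\<lparr>carrier := {p \<otimes>\<^bsub>A\<^esub> x \<otimes>\<^bsub>A\<^esub> p | x. x \<in> carrier A}, one := p\<rparr>"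

section \<open>The rational Cherednik algebra\<close>

text \<open>
  The tensor algebra of \<open>\<hh> \<oplus> \<hh>\<^sup>*\<close> is the free algebra on the letters \<open>Ly j\<close> (for \<open>y\<^sub>j\<close>) and
  \<open>Lx j\<close> (for \<open>x\<^sub>j\<close>), that is, the monoid algebra of the free monoid of words.
\<close>

datatype 'n letter = Lx 'n | Ly 'n

datatype 'a word = Word (letters: "'a list")

instantiation word :: (type) monoid_add
begin
definition zero_word :: "'a word" where "zero_word = Word []"
definition plus_word :: "'a word \<Rightarrow> 'a word \<Rightarrow> 'a word" where
  "plus_word u v = Word (letters u @ letters v)"
instance by standard (auto simp: zero_word_def plus_word_def)
end

type_synonym 'n tensor = "'n letter word \<Rightarrow>\<^sub>0 complex"

definition tensor_scalar :: "complex \<Rightarrow> 'n tensor" where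
  "tensor_scalar k = Poly_Mapping.single 0 k"

definition tensor_vec :: "complex ^ 'n \<Rightarrow> ('n::finite) tensor" where
  "tensor_vec y = (\<Sum>i\<in>UNIV. Poly_Mapping.single (Word [Ly i]) (y $ i))"

definition tensor_covec :: "complex ^ 'n \<Rightarrow> ('n::finite) tensor" where
  "tensor_covec x = (\<Sum>i\<in>UNIV. Poly_Mapping.single (Word [Lx i]) (x $ i))"

fun letter_act :: "('n::finite) cmat \<Rightarrow> 'n letter \<Rightarrow> 'n tensor" where
  "letter_act w (Ly j) = tensor_vec (w *v axis j 1)"
| "letter_act w (Lx j) = tensor_covec (dual_act w (axis j 1))"

text \<open>The action of \<open>w\<close> by the algebra automorphism extending its action on letters.\<close>

definition tensor_act :: "('n::finite) cmat \<Rightarrow> 'n tensor \<Rightarrow> 'n tensor" where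
  "tensor_act w p =
     (\<Sum>u\<in>Poly_Mapping.keys p. tensor_scalar (Poly_Mapping.lookup p u) *
        prod_list (map (letter_act w) (letters u)))"

text \<open>
  The smash product \<open>T(\<hh> \<oplus> \<hh>\<^sup>*) \<rtimes> W\<close>.  A function \<open>F\<close> stands for the sum of the \<open>F w \<cdot> w\<close>
  over \<open>w \<in> W\<close>, and \<open>(p \<cdot> a)(q \<cdot> b) = p (a \<cdot> q) \<cdot> ab\<close>.
\<close>

type_synonym 'n smash_elem = "'n cmat \<Rightarrow> 'n tensor"

definition smash :: "('n::finite) cmat set \<Rightarrow> (complex, 'n smash_elem) module" where
  "smash W =
     \<lparr>carrier = {F. \<forall>w. w \<notin> W \<longrightarrow> F w = 0},
      mult = (\<lambda>F G w. \<Sum>a\<in>W. \<Sum>b\<in>W. if a ** b = w then F a * tensor_act a (G b) else 0),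
      one = (\<lambda>w. if w = mat 1 then 1 else 0),
      zero = (\<lambda>_. 0),
      add = (\<lambda>F G w. F w + G w),
      smult = (\<lambda>k F w. tensor_scalar k * F w)\<rparr>"

definition smash_tensor :: "('n::finite) tensor \<Rightarrow> 'n smash_elem" where
  "smash_tensor p = (\<lambda>w. if w = mat 1 then p else 0)"

definition smash_grp :: "('n::finite) cmat \<Rightarrow> 'n smash_elem" where
  "smash_grp g = (\<lambda>w. if w = g then 1 else 0)"

abbreviation smash_vec :: "complex ^ 'n \<Rightarrow> ('n::finite) smash_elem" where
  "smash_vec y \<equiv> smash_tensor (tensor_vec y)"

abbreviation smash_covec :: "complex ^ 'n \<Rightarrow> ('n::finite) smash_elem" where
  "smash_covec x \<equiv> smash_tensor (tensor_covec x)"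

definition cherednik_rhs ::
  "('n::finite) cmat set \<Rightarrow> ('n cmat \<Rightarrow> complex ^ 'n) \<Rightarrow> ('n cmat \<Rightarrow> complex ^ 'n) \<Rightarrow>
   complex \<Rightarrow> ('n cmat \<Rightarrow> complex) \<Rightarrow> complex ^ 'n \<Rightarrow> complex ^ 'n \<Rightarrow> 'n smash_elem" where
  "cherednik_rhs W \<alpha> \<alpha>' t c x y =
     (t * pairing x y) \<odot>\<^bsub>smash W\<^esub> \<one>\<^bsub>smash W\<^esub> \<ominus>\<^bsub>smash W\<^esub>
     (\<Oplus>\<^bsub>smash W\<^esub>s\<in>reflections W.
        (2 * c s / pairing (\<alpha> s) (\<alpha>' s) * pairing x (\<alpha>' s) * pairing (\<alpha> s) y)
          \<odot>\<^bsub>smash W\<^esub> smash_grp s)"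

definition cherednik_relations ::
  "('n::finite) cmat set \<Rightarrow> ('n cmat \<Rightarrow> complex ^ 'n) \<Rightarrow> ('n cmat \<Rightarrow> complex ^ 'n) \<Rightarrow>
   complex \<Rightarrow> ('n cmat \<Rightarrow> complex) \<Rightarrow> 'n smash_elem set" where
  "cherednik_relations W \<alpha> \<alpha>' t c =
     {commutator (smash W) (smash_covec x) (smash_covec x') | x x'. True} \<union>
     {commutator (smash W) (smash_vec y) (smash_vec y') | y y'. True} \<union>
     {commutator (smash W) (smash_vec y) (smash_covec x)
        \<ominus>\<^bsub>smash W\<^esub> cherednik_rhs W \<alpha> \<alpha>' t c x y | x y. True}"

definition cherednik_ideal ::
  "('n::finite) cmat set \<Rightarrow> ('n cmat \<Rightarrow> complex ^ 'n) \<Rightarrow> ('n cmat \<Rightarrow> complex ^ 'n) \<Rightarrow>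
   complex \<Rightarrow> ('n cmat \<Rightarrow> complex) \<Rightarrow> 'n smash_elem set" where
  "cherednik_ideal W \<alpha> \<alpha>' t c = Idl\<^bsub>smash W\<^esub> (cherednik_relations W \<alpha> \<alpha>' t c)"

definition cherednik ::
  "('n::finite) cmat set \<Rightarrow> ('n cmat \<Rightarrow> complex ^ 'n) \<Rightarrow> ('n cmat \<Rightarrow> complex ^ 'n) \<Rightarrow>
   complex \<Rightarrow> ('n cmat \<Rightarrow> complex) \<Rightarrow> (complex, 'n smash_elem set) module" where
  "cherednik W \<alpha> \<alpha>' t c = quot_alg (smash W) (cherednik_ideal W \<alpha> \<alpha>' t c)"

definition cherednik_class ::
  "('n::finite) cmat set \<Rightarrow> ('n cmat \<Rightarrow> complex ^ 'n) \<Rightarrow> ('n cmat \<Rightarrow> complex ^ 'n) \<Rightarrow>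
   complex \<Rightarrow> ('n cmat \<Rightarrow> complex) \<Rightarrow> 'n smash_elem \<Rightarrow> 'n smash_elem set" where
  "cherednik_class W \<alpha> \<alpha>' t c F = cherednik_ideal W \<alpha> \<alpha>' t c +>\<^bsub>smash W\<^esub> F"

text \<open>
  Filtrations are indexed by integers so that \<open>\<F>\<^sub>i\<^sub>-\<^sub>1\<close> and \<open>\<F>\<^sub>i\<^sub>+\<^sub>j\<^sub>-\<^sub>2\<close> always make sense; they vanish
  in negative degrees.  Below, \<open>\<F>\<^sub>i\<close> is the image of the elements of word length at most \<open>i\<close>.
\<close>

definition cherednik_filtration ::
  "('n::finite) cmat set \<Rightarrow> ('n cmat \<Rightarrow> complex ^ 'n) \<Rightarrow> ('n cmat \<Rightarrow> complex ^ 'n) \<Rightarrow>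
   complex \<Rightarrow> ('n cmat \<Rightarrow> complex) \<Rightarrow> int \<Rightarrow> 'n smash_elem set set" where
  "cherednik_filtration W \<alpha> \<alpha>' t c i = cherednik_class W \<alpha> \<alpha>' t c `
     {F \<in> carrier (smash W). \<forall>w. \<forall>u\<in>Poly_Mapping.keys (F w). int (length (letters u)) \<le> i}"

definition gl_subalgebra ::
  "('n::finite) cmat set \<Rightarrow> ('n cmat \<Rightarrow> complex ^ 'n) \<Rightarrow> ('n cmat \<Rightarrow> complex ^ 'n) \<Rightarrow>
   complex \<Rightarrow> ('n cmat \<Rightarrow> complex) \<Rightarrow> (complex, 'n smash_elem set) module" where
  "gl_subalgebra W \<alpha> \<alpha>' t c = (cherednik W \<alpha> \<alpha>' t c)\<lparr>carrier :=
     generated_subalgebra (cherednik W \<alpha> \<alpha>' t c)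
       ({cherednik_class W \<alpha> \<alpha>' t c (smash_covec (axis i 1)) \<otimes>\<^bsub>cherednik W \<alpha> \<alpha>' t c\<^esub>
           cherednik_class W \<alpha> \<alpha>' t c (smash_vec (axis j 1)) | i j. True} \<union>
        {cherednik_class W \<alpha> \<alpha>' t c (smash_grp w) | w. w \<in> W})\<rparr>"

definition euler ::
  "('n::finite) cmat set \<Rightarrow> ('n cmat \<Rightarrow> complex ^ 'n) \<Rightarrow> ('n cmat \<Rightarrow> complex ^ 'n) \<Rightarrow>
   ('n cmat \<Rightarrow> complex) \<Rightarrow> complex \<Rightarrow> ('n cmat \<Rightarrow> complex) \<Rightarrow> 'n smash_elem set" where
  "euler W \<alpha> \<alpha>' lam t c = cherednik_class W \<alpha> \<alpha>' t c
     ((\<Oplus>\<^bsub>smash W\<^esub>i\<in>UNIV. smash_covec (axis i 1) \<otimes>\<^bsub>smash W\<^esub> smash_vec (axis i 1)) \<ominus>\<^bsub>smash W\<^esub>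
      (\<Oplus>\<^bsub>smash W\<^esub>s\<in>reflections W. (2 * c s / (1 - lam s)) \<odot>\<^bsub>smash W\<^esub> smash_grp s))"

definition group_center :: "('n::finite) cmat set \<Rightarrow> 'n cmat set" where
  "group_center W = {z \<in> W. \<forall>w\<in>W. z ** w = w ** z}"

definition average ::
  "('n::finite) cmat set \<Rightarrow> ('n cmat \<Rightarrow> complex ^ 'n) \<Rightarrow> ('n cmat \<Rightarrow> complex ^ 'n) \<Rightarrow>
   complex \<Rightarrow> ('n cmat \<Rightarrow> complex) \<Rightarrow> 'n cmat set \<Rightarrow> 'n smash_elem set" where
  "average W \<alpha> \<alpha>' t c K = cherednik_class W \<alpha> \<alpha>' t c
     ((1 / of_nat (card K)) \<odot>\<^bsub>smash W\<^esub> (\<Oplus>\<^bsub>smash W\<^esub>w\<in>K. smash_grp w))"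

definition a_gl_a ::
  "('n::finite) cmat set \<Rightarrow> ('n cmat \<Rightarrow> complex ^ 'n) \<Rightarrow> ('n cmat \<Rightarrow> complex ^ 'n) \<Rightarrow>
   complex \<Rightarrow> ('n cmat \<Rightarrow> complex) \<Rightarrow> (complex, 'n smash_elem set) module" where
  "a_gl_a W \<alpha> \<alpha>' t c =
     corner (gl_subalgebra W \<alpha> \<alpha>' t c) (average W \<alpha> \<alpha>' t c (group_center W))"

definition euler_ideal ::
  "('n::finite) cmat set \<Rightarrow> ('n cmat \<Rightarrow> complex ^ 'n) \<Rightarrow> ('n cmat \<Rightarrow> complex ^ 'n) \<Rightarrow>
   ('n cmat \<Rightarrow> complex) \<Rightarrow> complex \<Rightarrow> ('n cmat \<Rightarrow> complex) \<Rightarrow> complex \<Rightarrow>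
   'n smash_elem set set" where
  "euler_ideal W \<alpha> \<alpha>' lam t c \<zeta> =
     (let H = cherednik W \<alpha> \<alpha>' t c; a = average W \<alpha> \<alpha>' t c (group_center W)
      in Idl\<^bsub>a_gl_a W \<alpha> \<alpha>' t c\<^esub> {a \<otimes>\<^bsub>H\<^esub> euler W \<alpha> \<alpha>' lam t c \<ominus>\<^bsub>H\<^esub> \<zeta> \<odot>\<^bsub>H\<^esub> a})"

definition A_alg ::
  "('n::finite) cmat set \<Rightarrow> ('n cmat \<Rightarrow> complex ^ 'n) \<Rightarrow> ('n cmat \<Rightarrow> complex ^ 'n) \<Rightarrow>
   ('n cmat \<Rightarrow> complex) \<Rightarrow> complex \<Rightarrow> ('n cmat \<Rightarrow> complex) \<Rightarrow> complex \<Rightarrow>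
   (complex, 'n smash_elem set set) module" where
  "A_alg W \<alpha> \<alpha>' lam t c \<zeta> = quot_alg (a_gl_a W \<alpha> \<alpha>' t c) (euler_ideal W \<alpha> \<alpha>' lam t c \<zeta>)"

definition A_class ::
  "('n::finite) cmat set \<Rightarrow> ('n cmat \<Rightarrow> complex ^ 'n) \<Rightarrow> ('n cmat \<Rightarrow> complex ^ 'n) \<Rightarrow>
   ('n cmat \<Rightarrow> complex) \<Rightarrow> complex \<Rightarrow> ('n cmat \<Rightarrow> complex) \<Rightarrow> complex \<Rightarrow>
   'n smash_elem set \<Rightarrow> 'n smash_elem set set" where
  "A_class W \<alpha> \<alpha>' lam t c \<zeta> h = euler_ideal W \<alpha> \<alpha>' lam t c \<zeta> +>\<^bsub>a_gl_a W \<alpha> \<alpha>' t c\<^esub> h"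

definition A_filtration ::
  "('n::finite) cmat set \<Rightarrow> ('n cmat \<Rightarrow> complex ^ 'n) \<Rightarrow> ('n cmat \<Rightarrow> complex ^ 'n) \<Rightarrow>
   ('n cmat \<Rightarrow> complex) \<Rightarrow> complex \<Rightarrow> ('n cmat \<Rightarrow> complex) \<Rightarrow> complex \<Rightarrow> int \<Rightarrow>
   'n smash_elem set set set" where
  "A_filtration W \<alpha> \<alpha>' lam t c \<zeta> i = A_class W \<alpha> \<alpha>' lam t c \<zeta> `
     (cherednik_filtration W \<alpha> \<alpha>' t c i \<inter> carrier (a_gl_a W \<alpha> \<alpha>' t c))"

text \<open>
  The algebra \<open>e A e\<close>.  Since \<open>Z(W) \<subseteq> W\<close>, one has \<open>e = a e a\<close>, so \<open>e\<close> lies in \<open>a H\<^sup>g\<^sup>l a\<close>.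
\<close>

definition eAe ::
  "('n::finite) cmat set \<Rightarrow> ('n cmat \<Rightarrow> complex ^ 'n) \<Rightarrow> ('n cmat \<Rightarrow> complex ^ 'n) \<Rightarrow>
   ('n cmat \<Rightarrow> complex) \<Rightarrow> complex \<Rightarrow> ('n cmat \<Rightarrow> complex) \<Rightarrow> complex \<Rightarrow>
   (complex, 'n smash_elem set set) module" where
  "eAe W \<alpha> \<alpha>' lam t c \<zeta> = corner (A_alg W \<alpha> \<alpha>' lam t c \<zeta>)
     (A_class W \<alpha> \<alpha>' lam t c \<zeta> (average W \<alpha> \<alpha>' t c W))"

definition eAe_filtration ::
  "('n::finite) cmat set \<Rightarrow> ('n cmat \<Rightarrow> complex ^ 'n) \<Rightarrow> ('n cmat \<Rightarrow> complex ^ 'n) \<Rightarrow>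
   ('n cmat \<Rightarrow> complex) \<Rightarrow> complex \<Rightarrow> ('n cmat \<Rightarrow> complex) \<Rightarrow> complex \<Rightarrow> int \<Rightarrow>
   'n smash_elem set set set" where
  "eAe_filtration W \<alpha> \<alpha>' lam t c \<zeta> i =
     A_filtration W \<alpha> \<alpha>' lam t c \<zeta> i \<inter> carrier (eAe W \<alpha> \<alpha>' lam t c \<zeta>)"

section \<open>Graded Poisson algebras and filtered quantizations\<close>

record 'a poisson = "(complex, 'a) module" +
  pbracket :: "'a \<Rightarrow> 'a \<Rightarrow> 'a"
  homog :: "nat \<Rightarrow> 'a set"

text \<open>A commutative \<open>\<nat>\<close>-graded algebra with a Poisson bracket of degree \<open>-2\<close>.\<close>

definition graded_poisson_algebra :: "'a poisson \<Rightarrow> bool" where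
  "graded_poisson_algebra B \<longleftrightarrow>
     complex_algebra B \<and> cring B \<and>
     (\<forall>k. subspace_of (homog B k) B) \<and>
     (\<forall>b\<in>carrier B. \<exists>!f. (\<forall>k. f k \<in> homog B k) \<and> finite {k. f k \<noteq> \<zero>\<^bsub>B\<^esub>} \<and>
        b = (\<Oplus>\<^bsub>B\<^esub>k\<in>{k. f k \<noteq> \<zero>\<^bsub>B\<^esub>}. f k)) \<and>
     \<one>\<^bsub>B\<^esub> \<in> homog B 0 \<and>
     (\<forall>i j. \<forall>x\<in>homog B i. \<forall>y\<in>homog B j. x \<otimes>\<^bsub>B\<^esub> y \<in> homog B (i + j)) \<and>
     (\<forall>x\<in>carrier B. \<forall>y\<in>carrier B. pbracket B x y \<in> carrier B) \<and>
     (\<forall>x\<in>carrier B. \<forall>y\<in>carrier B. \<forall>z\<in>carrier B.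
        pbracket B (x \<oplus>\<^bsub>B\<^esub> y) z = pbracket B x z \<oplus>\<^bsub>B\<^esub> pbracket B y z) \<and>
     (\<forall>k. \<forall>x\<in>carrier B. \<forall>y\<in>carrier B. pbracket B (k \<odot>\<^bsub>B\<^esub> x) y = k \<odot>\<^bsub>B\<^esub> pbracket B x y) \<and>
     (\<forall>x\<in>carrier B. \<forall>y\<in>carrier B. pbracket B x y = \<ominus>\<^bsub>B\<^esub> pbracket B y x) \<and>
     (\<forall>x\<in>carrier B. \<forall>y\<in>carrier B. \<forall>z\<in>carrier B.
        pbracket B x (pbracket B y z) \<oplus>\<^bsub>B\<^esub> pbracket B y (pbracket B z x)
          \<oplus>\<^bsub>B\<^esub> pbracket B z (pbracket B x y) = \<zero>\<^bsub>B\<^esub>) \<and>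
     (\<forall>x\<in>carrier B. \<forall>y\<in>carrier B. \<forall>z\<in>carrier B.
        pbracket B x (y \<otimes>\<^bsub>B\<^esub> z) = pbracket B x y \<otimes>\<^bsub>B\<^esub> z \<oplus>\<^bsub>B\<^esub> y \<otimes>\<^bsub>B\<^esub> pbracket B x z) \<and>
     (\<forall>i j. \<forall>x\<in>homog B i. \<forall>y\<in>homog B j.
        pbracket B x y \<in> (if i + j < 2 then {\<zero>\<^bsub>B\<^esub>} else homog B (i + j - 2)))"

definition graded_poisson_iso :: "('a \<Rightarrow> 'b) \<Rightarrow> 'a poisson \<Rightarrow> 'b poisson \<Rightarrow> bool" where
  "graded_poisson_iso \<phi> A B \<longleftrightarrow>
     \<phi> \<in> ring_iso A B \<and>
     (\<forall>k. \<forall>x\<in>carrier A. \<phi> (k \<odot>\<^bsub>A\<^esub> x) = k \<odot>\<^bsub>B\<^esub> \<phi> x) \<and>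
     (\<forall>x\<in>carrier A. \<forall>y\<in>carrier A. \<phi> (pbracket A x y) = pbracket B (\<phi> x) (\<phi> y)) \<and>
     (\<forall>k. \<phi> ` homog A k = homog B k)"

definition filtered_algebra :: "(complex, 'a) module \<Rightarrow> (int \<Rightarrow> 'a set) \<Rightarrow> bool" where
  "filtered_algebra A F \<longleftrightarrow>
     complex_algebra A \<and>
     (\<forall>i. subspace_of (F i) A) \<and>
     (\<forall>i j. i \<le> j \<longrightarrow> F i \<subseteq> F j) \<and>
     (\<forall>i<0. F i = {\<zero>\<^bsub>A\<^esub>}) \<and>
     \<one>\<^bsub>A\<^esub> \<in> F 0 \<and>
     (\<forall>i j. \<forall>x\<in>F i. \<forall>y\<in>F j. x \<otimes>\<^bsub>A\<^esub> y \<in> F (i + j)) \<and>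
     (\<Union>i. F i) = carrier A"

text \<open>
  The vector space \<open>\<F>\<^sub>k / \<F>\<^sub>k\<^sub>-\<^sub>1\<close>; the fields \<^const>\<open>mult\<close> and \<^const>\<open>one\<close> of this record are junk.
\<close>

definition gr_piece :: "(complex, 'a) module \<Rightarrow> (int \<Rightarrow> 'a set) \<Rightarrow> nat \<Rightarrow> (complex, 'a set) module" where
  "gr_piece A F k = quot_alg (A\<lparr>carrier := F (int k)\<rparr>) (F (int k - 1))"

text \<open>Products and brackets of symbols: \<open>V \<in> \<F>\<^sub>i / \<F>\<^sub>i\<^sub>-\<^sub>1\<close> and \<open>U \<in> \<F>\<^sub>j / \<F>\<^sub>j\<^sub>-\<^sub>1\<close>.\<close>

definition symbol_mult ::
  "(complex, 'a) module \<Rightarrow> (int \<Rightarrow> 'a set) \<Rightarrow> nat \<Rightarrow> nat \<Rightarrow> 'a set \<Rightarrow> 'a set \<Rightarrow> 'a set" where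
  "symbol_mult A F i j V U = (\<Union>x\<in>V. \<Union>y\<in>U. F (int i + int j - 1) +>\<^bsub>A\<^esub> (x \<otimes>\<^bsub>A\<^esub> y))"

definition symbol_bracket ::
  "(complex, 'a) module \<Rightarrow> (int \<Rightarrow> 'a set) \<Rightarrow> nat \<Rightarrow> nat \<Rightarrow> 'a set \<Rightarrow> 'a set \<Rightarrow> 'a set" where
  "symbol_bracket A F i j V U = (\<Union>x\<in>V. \<Union>y\<in>U. F (int i + int j - 3) +>\<^bsub>A\<^esub> commutator A x y)"

text \<open>
  The associated graded algebra.  An element is a finitely supported family \<open>f\<close> with
  \<open>f k \<in> \<F>\<^sub>k / \<F>\<^sub>k\<^sub>-\<^sub>1\<close>.  The bracket of symbols of degrees \<open>i\<close> and \<open>j\<close> has degree \<open>i + j - 2\<close>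
  (it is zero if \<open>i + j < 2\<close>, where \<open>\<F>\<^sub>i\<^sub>+\<^sub>j\<^sub>-\<^sub>2\<close> is zero), so its component in degree \<open>k\<close>
  collects the pairs with \<open>i + j = k + 2\<close>.
\<close>

definition assoc_graded :: "(complex, 'a) module \<Rightarrow> (int \<Rightarrow> 'a set) \<Rightarrow> (nat \<Rightarrow> 'a set) poisson" where
  "assoc_graded A F =
     (let C = {f. (\<forall>k. f k \<in> carrier (gr_piece A F k)) \<and> finite {k. f k \<noteq> \<zero>\<^bsub>gr_piece A F k\<^esub>}}
      in \<lparr>carrier = C,
          mult = (\<lambda>f g k. \<Oplus>\<^bsub>gr_piece A F k\<^esub>i\<in>{..k}. symbol_mult A F i (k - i) (f i) (g (k - i))),
          one = (\<lambda>k. if k = 0 then F (-1) +>\<^bsub>A\<^esub> \<one>\<^bsub>A\<^esub> else \<zero>\<^bsub>gr_piece A F k\<^esub>),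
          zero = (\<lambda>k. \<zero>\<^bsub>gr_piece A F k\<^esub>),
          add = (\<lambda>f g k. f k \<oplus>\<^bsub>gr_piece A F k\<^esub> g k),
          smult = (\<lambda>a f k. a \<odot>\<^bsub>gr_piece A F k\<^esub> f k),
          pbracket = (\<lambda>f g k. \<Oplus>\<^bsub>gr_piece A F k\<^esub>i\<in>{..k + 2}.
             symbol_bracket A F i (k + 2 - i) (f i) (g (k + 2 - i))),
          homog = (\<lambda>k. {f \<in> C. \<forall>i. i \<noteq> k \<longrightarrow> f i = \<zero>\<^bsub>gr_piece A F i\<^esub>})\<rparr>)"

text \<open>
  The condition on commutators makes the associated graded algebra commutative and its bracket
  well defined.
\<close>

definition filtered_quantization ::
  "(complex, 'a) module \<Rightarrow> (int \<Rightarrow> 'a set) \<Rightarrow> 'b poisson \<Rightarrow> bool" where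
  "filtered_quantization A F B \<longleftrightarrow>
     filtered_algebra A F \<and>
     (\<forall>i j. \<forall>x\<in>F i. \<forall>y\<in>F j. commutator A x y \<in> F (i + j - 2)) \<and>
     graded_poisson_algebra B \<and>
     (\<exists>\<phi>. graded_poisson_iso \<phi> (assoc_graded A F) B)"

section \<open>The closure of the minimal nilpotent orbit\<close>

inductive_set polynomial_fun :: "(('n::finite) cmat \<Rightarrow> complex) set" where
  const: "(\<lambda>_. k) \<in> polynomial_fun"
| coord: "(\<lambda>A. A $ i $ j) \<in> polynomial_fun"
| add: "\<lbrakk>p \<in> polynomial_fun; q \<in> polynomial_fun\<rbrakk> \<Longrightarrow> (\<lambda>A. p A + q A) \<in> polynomial_fun"
| mult: "\<lbrakk>p \<in> polynomial_fun; q \<in> polynomial_fun\<rbrakk> \<Longrightarrow> (\<lambda>A. p A * q A) \<in> polynomial_fun"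

inductive homog_polynomial_fun :: "nat \<Rightarrow> (('n::finite) cmat \<Rightarrow> complex) \<Rightarrow> bool" where
  const: "homog_polynomial_fun 0 (\<lambda>_. k)"
| coord: "homog_polynomial_fun d p \<Longrightarrow> homog_polynomial_fun (Suc d) (\<lambda>A. p A * A $ i $ j)"
| add: "\<lbrakk>homog_polynomial_fun d p; homog_polynomial_fun d q\<rbrakk> \<Longrightarrow>
        homog_polynomial_fun d (\<lambda>A. p A + q A)"

definition zariski_closure :: "('n::finite) cmat set \<Rightarrow> 'n cmat set" where
  "zariski_closure S = {A. \<forall>p\<in>polynomial_fun. (\<forall>B\<in>S. p B = 0) \<longrightarrow> p A = 0}"

definition nilpotent_mat :: "('n::finite) cmat \<Rightarrow> bool" where
  "nilpotent_mat A \<longleftrightarrow> (\<exists>k. (((**) A) ^^ k) (mat 1) = 0)"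

definition O_min :: "('n::finite) cmat set" where
  "O_min = {A. nilpotent_mat A \<and> rank A = 1}"

definition O_min_closure :: "('n::finite) cmat set" where
  "O_min_closure = zariski_closure O_min"

text \<open>
  The Kirillov-Kostant-Souriau bracket on \<open>gl(n) \<cong> gl(n)\<^sup>*\<close>, identified by the trace form:
  \<open>{p, q}(A) = tr (A [dp\<^sub>A, dq\<^sub>A])\<close>, where \<open>dp\<^sub>A\<close> is the matrix with
  \<open>(d/dz) p (A + z Z) = tr (dp\<^sub>A Z)\<close> at \<open>z = 0\<close>.
\<close>

definition gradient :: "(('n::finite) cmat \<Rightarrow> complex) \<Rightarrow> 'n cmat \<Rightarrow> 'n cmat" where
  "gradient p A =
     (\<chi> i j. deriv (\<lambda>z. p (A + (\<chi> k l. if k = j \<and> l = i then z else 0))) 0)"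

definition kks_bracket ::
  "(('n::finite) cmat \<Rightarrow> complex) \<Rightarrow> ('n cmat \<Rightarrow> complex) \<Rightarrow> 'n cmat \<Rightarrow> complex" where
  "kks_bracket p q A =
     trace (A ** (gradient p A ** gradient q A - gradient q A ** gradient p A))"

text \<open>
  The coordinate ring of a Zariski closed set \<open>V\<close>: restrictions to \<open>V\<close> of polynomial functions.
  For \<open>V\<close> stable under conjugation, the bracket does not depend on the chosen extensions.
  Linear functions have degree \<open>2\<close>.
\<close>

definition polynomial_extension ::
  "('n::finite) cmat set \<Rightarrow> ('n cmat \<Rightarrow> complex) \<Rightarrow> 'n cmat \<Rightarrow> complex" where
  "polynomial_extension V f = (SOME p. p \<in> polynomial_fun \<and> restrict p V = f)"

definition coordinate_ring :: "('n::finite) cmat set \<Rightarrow> ('n cmat \<Rightarrow> complex) poisson" where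
  "coordinate_ring V =
     \<lparr>carrier = {restrict p V | p. p \<in> polynomial_fun},
      mult = (\<lambda>f g. \<lambda>A\<in>V. f A * g A),
      one = (\<lambda>A\<in>V. 1),
      zero = (\<lambda>A\<in>V. 0),
      add = (\<lambda>f g. \<lambda>A\<in>V. f A + g A),
      smult = (\<lambda>k f. \<lambda>A\<in>V. k * f A),
      pbracket = (\<lambda>f g. \<lambda>A\<in>V.
         kks_bracket (polynomial_extension V f) (polynomial_extension V g) A),
      homog = (\<lambda>k. if even k then {restrict p V | p. homog_polynomial_fun (k div 2) p}
                   else {\<lambda>A\<in>V. 0})\<rparr>"

definition W_invariant ::
  "('n::finite) cmat set \<Rightarrow> 'n cmat set \<Rightarrow> ('n cmat \<Rightarrow> complex) set" where
  "W_invariant W V = {f. \<forall>w\<in>W. \<forall>A\<in>V. f (w ** A ** matrix_inv w) = f A}"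

definition invariant_ring ::
  "('n::finite) cmat set \<Rightarrow> 'n cmat set \<Rightarrow> ('n cmat \<Rightarrow> complex) poisson" where
  "invariant_ring W V = (coordinate_ring V)
     \<lparr>carrier := carrier (coordinate_ring V) \<inter> W_invariant W V,
      homog := (\<lambda>k. homog (coordinate_ring V) k \<inter> W_invariant W V)\<rparr>"

end

theory Submission
  imports Defs "HOL-Library.Function_Algebras"
begin

text \<open>
  The module \<open>He\<close> is the space of polynomials \<open>P(v, \<xi>)\<close> on \<open>\<hh> \<oplus> \<hh>\<^sup>*\<close>: covectors act by
  multiplication, \<open>W\<close> acts diagonally, and \<open>y\<close> acts by \<open>\<xi>(y)\<close> plus a Dunkl operator in \<open>v\<close>.
  By the Poincare-Birkhoff-Witt property, \<open>u \<mapsto> u \<cdot> 1\<close> identifies \<open>e H\<^sup>g\<^sup>l e\<close> with the space \<open>S\<close> of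
  \<open>W\<close>-invariant polynomials fixed by all \<open>(v, \<xi>) \<mapsto> (r v, r\<inverse> \<xi>)\<close>, and word length becomes degree.
  The Euler element acts as multiplication by \<open>q = \<xi>(v)\<close> up to lower order, so that the associated
  graded algebra of \<open>eAe = S / (eu - \<zeta>) S\<close> is \<open>S / q S\<close>.  The part of the subleading term of a product
  that depends on \<open>c\<close> is symmetric on invariants, hence commutators are, to leading order, \<open>t\<close> times
  the canonical Poisson bracket of \<open>\<hh> \<oplus> \<hh>\<^sup>*\<close>.

  The map \<open>(v, \<xi>) \<mapsto> v \<xi>\<close> sends the cone \<open>q = 0\<close> onto the closure of the minimal nilpotent orbit.
  Polynomials of weight zero are pulled back from \<open>gl(n)\<close>, those vanishing on the cone are divisible
  by \<open>q\<close>, as \<open>n > 1\<close>, and the bracket is preserved up to sign.  Hence \<open>S / q S\<close> is the ring of invariant functions.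
\<close>

text \<open>\<open>cherednik\<close> is an abstract quotient in which nothing is visibly nonzero;
  lower bounds come from a concrete module, the one induced from the trivial representation of
  \<open>W\<close>. Only \<open>He\<close> is treated, not all of \<open>H\<close>: sorting letters
  into normal order bounds it from above, and the action on the constant 1, which turns a sorted
  word into exactly its monomial, bounds it from below. Two steps are not formal. Leading terms
  settle the commutative product, but the bracket sits two degrees lower, where the terms with
  \<open>c\<close> live too. So the subleading term \<open>E1\<close> is computed exactly, with an
  error four degrees below the product. Secondly, passing to the quotient by
  \<open>eu - \<zeta>\<close> could disturb the filtration: an element of low degree in the ideal
  might be \<open>eu - \<zeta>\<close> times something of high degree. Polynomials have no zero
  divisors, so leading terms cannot cancel against \<open>q\<close>, and this is excluded
  (\<open>pdeg_quad_lower\<close>). The sign between the two brackets and the constant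
  \<open>t\<close> are removed by rescaling degree \<open>k\<close> by the \<open>k\<close>-th power
  of a square root of \<open>- t\<close>.\<close>

text \<open>Functions of a vector \<open>v\<close> and a covector \<open>\<xi>\<close>.\<close>

type_synonym 'n pf = "complex ^ 'n \<Rightarrow> complex ^ 'n \<Rightarrow> complex"

section \<open>Polynomial functions of \<open>v\<close> and \<open>\<xi>\<close> with a bound on the
  total degree\<close>

definition cst :: "complex \<Rightarrow> ('n::finite) pf" where "cst k = (\<lambda>_ _. k)"
definition vco :: "('n::finite) \<Rightarrow> 'n pf" where "vco i = (\<lambda>v \<xi>. v $ i)"
definition xco :: "('n::finite) \<Rightarrow> 'n pf" where "xco i = (\<lambda>v \<xi>. \<xi> $ i)"

lemma pf_apply: "cst k v \<xi> = k" "vco i v \<xi> = v $ i" "xco i v \<xi> = \<xi> $ i"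
  by (simp_all add: cst_def vco_def xco_def)

text \<open>Pointwise evaluation is switched off by default, so that sums and products of functions
  remain ring expressions; \<open>pfs\<close> switches it on where values are compared.\<close>

declare plus_fun_apply [simp del] times_fun_apply [simp del] zero_fun_apply [simp del] one_fun_apply [simp del]
  minus_apply [simp del] uminus_apply [simp del]

lemmas pfs = pf_apply plus_fun_apply times_fun_apply zero_fun_apply one_fun_apply minus_apply uminus_apply

lemma pf_eqI: "(\<And>v \<xi>. P v \<xi> = Q v \<xi>) \<Longrightarrow> P = (Q :: ('n::finite) pf)"
  by blast

lemma cst_simps: "cst 0 = 0" "cst 1 = 1" "cst a * cst b = cst (a * b)" "cst a + cst b = cst (a + b)" "- cst a = cst (- a)"
  by (auto intro!: pf_eqI simp: pfs)

text \<open>The bound is an integer, so that corrections such as \<open>m - 4\<close> need no case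
  distinction; a negative bound forces the zero polynomial (\<open>pdeg_neg\<close>).\<close>

inductive pdeg :: "int \<Rightarrow> ('n::finite) pf \<Rightarrow> bool" where
  zero_raw: "pdeg m 0"
| cst_raw: "0 \<le> m \<Longrightarrow> pdeg m (cst k)"
| vco_raw: "pdeg m P \<Longrightarrow> pdeg (m + 1) (vco i * P)"
| xco_raw: "pdeg m P \<Longrightarrow> pdeg (m + 1) (xco i * P)"
| add_raw: "\<lbrakk>pdeg m P; pdeg m Q\<rbrakk> \<Longrightarrow> pdeg m (P + Q)"

text \<open>The generated rules mention eta-expanded functions and do not match in rewriting.\<close>

lemma pdeg_zero: "pdeg m 0" by (rule zero_raw)
lemma pdeg_cst: "0 \<le> m \<Longrightarrow> pdeg m (cst k)" by (rule cst_raw)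
lemma pdeg_vco: "pdeg m P \<Longrightarrow> pdeg (m + 1) (vco i * P)" by (rule vco_raw)
lemma pdeg_xco: "pdeg m P \<Longrightarrow> pdeg (m + 1) (xco i * P)" by (rule xco_raw)
lemma pdeg_add: "pdeg m P \<Longrightarrow> pdeg m Q \<Longrightarrow> pdeg m (P + Q)" by (rule add_raw)

lemmas pdeg_intros = pdeg_zero pdeg_cst pdeg_vco pdeg_xco pdeg_add

lemma pdeg_induct [consumes 1, case_names zero cst vco xco add]:
  assumes "pdeg m P" "\<And>m. R m 0" "\<And>m k. 0 \<le> m \<Longrightarrow> R m (cst k)"
    "\<And>m P i. pdeg m P \<Longrightarrow> R m P \<Longrightarrow> R (m + 1) (vco i * P)"
    "\<And>m P i. pdeg m P \<Longrightarrow> R m P \<Longrightarrow> R (m + 1) (xco i * P)"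
    "\<And>m P Q. pdeg m P \<Longrightarrow> R m P \<Longrightarrow> pdeg m Q \<Longrightarrow> R m Q \<Longrightarrow> R m (P + Q)"
  shows "R m P"
  using assms(1) by (rule pdeg.induct) (use assms(2-) in blast)+

definition pol :: "('n::finite) pf \<Rightarrow> bool" where "pol P \<longleftrightarrow> (\<exists>m. pdeg m P)"

lemma pdeg_mono: "pdeg m P \<Longrightarrow> m \<le> m' \<Longrightarrow> pdeg m' P"
proof (induction arbitrary: m' rule: pdeg_induct)
  case (vco m P i) then show ?case using pdeg_vco[of "m' - 1" P i] by simp
next
  case (xco m P i) then show ?case using pdeg_xco[of "m' - 1" P i] by simp
qed (auto intro: pdeg_intros)

lemma pdeg_neg: "pdeg m P \<Longrightarrow> m < 0 \<Longrightarrow> P = 0"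
  by (induction rule: pdeg_induct) auto

lemma pdeg_vco': "pdeg (m - 1) P \<Longrightarrow> pdeg m (vco i * P)" using pdeg_vco[of "m - 1" P i] by simp
lemma pdeg_xco': "pdeg (m - 1) P \<Longrightarrow> pdeg m (xco i * P)" using pdeg_xco[of "m - 1" P i] by simp

lemma pdeg_cmult: "pdeg m P \<Longrightarrow> pdeg m (cst k * P)"
proof (induction rule: pdeg_induct)
  case (cst m l) then show ?case by (simp add: cst_simps pdeg_cst)
next
  case (vco m P i) then show ?case using pdeg_vco[of m "cst k * P" i] by (simp add: mult.left_commute)
next
  case (xco m P i) then show ?case using pdeg_xco[of m "cst k * P" i] by (simp add: mult.left_commute)
qed (auto simp: distrib_left intro: pdeg_intros)

lemma pdeg_uminus: "pdeg m P \<Longrightarrow> pdeg m (- P)"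
proof -
  have "- P = cst (-1) * P" by (rule pf_eqI) (simp add: pfs)
  then show "pdeg m P \<Longrightarrow> pdeg m (- P)" using pdeg_cmult by metis
qed

lemma pdeg_diff: "pdeg m P \<Longrightarrow> pdeg m Q \<Longrightarrow> pdeg m (P - Q)"
  using pdeg_add[of m P "- Q"] pdeg_uminus by fastforce

lemma pdeg_sum: "(\<And>i. i \<in> I \<Longrightarrow> pdeg m (f i)) \<Longrightarrow> pdeg m (\<Sum>i\<in>I. f i)"
  by (induction I rule: infinite_finite_induct) (auto intro: pdeg_intros)

lemma pdeg_mult: "pdeg m P \<Longrightarrow> pdeg m' Q \<Longrightarrow> pdeg (m + m') (P * Q)"
proof (induction rule: pdeg_induct)
  case (cst m k) then show ?case using pdeg_mono[OF pdeg_cmult, of m' Q "m + m'" k] by simp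
next
  case (vco m P i) then show ?case using pdeg_vco[of "m + m'" "P * Q" i] by (simp add: algebra_simps)
next
  case (xco m P i) then show ?case using pdeg_xco[of "m + m'" "P * Q" i] by (simp add: algebra_simps)
qed (auto simp: distrib_right intro: pdeg_intros)

lemma pdeg_one: "0 \<le> m \<Longrightarrow> pdeg m 1" using pdeg_cst[of m 1] by (simp add: cst_simps)
lemma pdeg_vco1: "pdeg 1 (vco i)" using pdeg_vco[of 0 1 i] by (simp add: pdeg_one)
lemma pdeg_xco1: "pdeg 1 (xco i)" using pdeg_xco[of 0 1 i] by (simp add: pdeg_one)

lemma pol_two: assumes "pol P" "pol Q" obtains m where "pdeg m P" "pdeg m Q" "0 \<le> m"
proof -
  obtain a b where "pdeg a P" "pdeg b Q" using assms unfolding pol_def by blast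
  then show ?thesis using that[of "max 0 (max a b)"] by (meson max.cobounded1 max.cobounded2 max.coboundedI2 pdeg_mono)
qed

lemma pdeg_pol: "pdeg m P \<Longrightarrow> pol P" by (auto simp: pol_def)

lemma pol_add: "pol P \<Longrightarrow> pol Q \<Longrightarrow> pol (P + Q)"
  by (metis pol_two pdeg_add pdeg_pol)
lemma pol_mult: "pol P \<Longrightarrow> pol Q \<Longrightarrow> pol (P * Q)"
  by (metis pol_two pdeg_mult pdeg_pol)
lemma pol_uminus: "pol P \<Longrightarrow> pol (- P)" by (metis pol_def pdeg_uminus)
lemma pol_diff: "pol P \<Longrightarrow> pol Q \<Longrightarrow> pol (P - Q)"
  by (metis pol_two pdeg_diff pdeg_pol)
lemma pol_cst: "pol (cst k)" using pdeg_cst[of 0 k] pdeg_pol by blast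
lemma pol_zero: "pol 0" using pdeg_zero pdeg_pol by blast
lemma pol_one: "pol 1" using pdeg_one[of 0] pdeg_pol by blast
lemma pol_vco: "pol (vco i)" using pdeg_vco1 pdeg_pol by blast
lemma pol_xco: "pol (xco i)" using pdeg_xco1 pdeg_pol by blast
lemma pol_sum: "(\<And>i. i \<in> I \<Longrightarrow> pol (f i)) \<Longrightarrow> pol (\<Sum>i\<in>I. f i)"
  by (induction I rule: infinite_finite_induct) (auto intro: pol_add pol_zero)

lemmas pol_intros = pol_add pol_mult pol_uminus pol_diff pol_cst pol_zero pol_one pol_vco pol_xco pol_sum

lemma pol_induct [consumes 1, case_names cst vco xco add]:
  assumes "pol P" "\<And>k. R (cst k)" "\<And>P i. pol P \<Longrightarrow> R P \<Longrightarrow> R (vco i * P)"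
    "\<And>P i. pol P \<Longrightarrow> R P \<Longrightarrow> R (xco i * P)" "\<And>P Q. pol P \<Longrightarrow> pol Q \<Longrightarrow> R P \<Longrightarrow> R Q \<Longrightarrow> R (P + Q)"
  shows "R P"
proof -
  obtain m where "pdeg m P" using assms(1) pol_def by blast
  then show ?thesis
  proof (induction rule: pdeg_induct)
    case zero then show ?case using assms(2)[of 0] by (simp add: cst_simps)
  qed (auto intro: assms pdeg_pol)
qed

section \<open>Linear forms and linear substitutions\<close>

definition lin_v :: "complex ^ 'n \<Rightarrow> ('n::finite) pf" where "lin_v x = (\<lambda>v \<xi>. pairing x v)"
definition lin_x :: "complex ^ 'n \<Rightarrow> ('n::finite) pf" where "lin_x y = (\<lambda>v \<xi>. pairing \<xi> y)"

lemma lin_apply: "lin_v x v \<xi> = pairing x v" "lin_x y v \<xi> = pairing \<xi> y"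
  by (simp_all add: lin_v_def lin_x_def)

lemma sum_fun_apply: "(\<Sum>i\<in>I. f i) x = (\<Sum>i\<in>I. f i x)"
  by (induction I rule: infinite_finite_induct) (auto simp: pfs)

lemma lin_v_sum: "lin_v x = (\<Sum>i\<in>UNIV. cst (x $ i) * vco i)"
  by (rule pf_eqI) (simp add: pfs lin_apply sum_fun_apply pairing_def)
lemma lin_x_sum: "lin_x y = (\<Sum>i\<in>UNIV. cst (y $ i) * xco i)"
  by (rule pf_eqI) (simp add: pfs lin_apply sum_fun_apply pairing_def mult.commute)

lemma pdeg_lin_v: "pdeg 1 (lin_v x)" unfolding lin_v_sum by (intro pdeg_sum pdeg_cmult pdeg_vco1)
lemma pdeg_lin_x: "pdeg 1 (lin_x y)" unfolding lin_x_sum by (intro pdeg_sum pdeg_cmult pdeg_xco1)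
lemma pol_lin: "pol (lin_v x)" "pol (lin_x x)" using pdeg_lin_v pdeg_lin_x pdeg_pol by blast+

lemma pairing_simps [simp]:
  "pairing (x + x') y = pairing x y + pairing x' y" "pairing x (y + y') = pairing x y + pairing x y'"
  "pairing (k *s x) y = k * pairing x y" "pairing x (k *s y) = k * pairing x y"
  "pairing (x - x') y = pairing x y - pairing x' y" "pairing x (y - y') = pairing x y - pairing x y'"
  "pairing 0 y = 0" "pairing x 0 = 0" "pairing (axis i 1) y = y $ i" "pairing y (axis i 1) = y $ i"
  by (auto simp: pairing_def algebra_simps sum.distrib sum_distrib_left sum_subtractf axis_def if_distrib if_distribR
      cong: if_cong)

lemma pairing_matrix: "pairing x (M *v y) = pairing (x v* M) y"
proof -
  have "pairing x (M *v y) = (\<Sum>i\<in>UNIV. \<Sum>j\<in>UNIV. x $ i * (M $ i $ j * y $ j))"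
    by (simp add: pairing_def matrix_vector_mult_def sum_distrib_left)
  also have "\<dots> = (\<Sum>j\<in>UNIV. \<Sum>i\<in>UNIV. x $ i * (M $ i $ j * y $ j))" by (rule sum.swap)
  also have "\<dots> = pairing (x v* M) y"
    by (simp add: pairing_def vector_matrix_mult_def sum_distrib_right sum_distrib_left mult_ac)
  finally show ?thesis .
qed

text \<open>\<open>M\<close> acts on vectors from the left and \<open>N\<close> on covectors from
  the right. The diagonal action of \<open>W\<close>, its two one-sided halves and the scaling
  action are all instances.\<close>

definition subst :: "('n::finite) cmat \<Rightarrow> 'n cmat \<Rightarrow> 'n pf \<Rightarrow> 'n pf" where
  "subst M N P = (\<lambda>v \<xi>. P (M *v v) (\<xi> v* N))"

lemma subst_apply: "subst M N P v \<xi> = P (M *v v) (\<xi> v* N)" by (simp add: subst_def)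

lemma subst_simps: "subst M N (P + Q) = subst M N P + subst M N Q" "subst M N (P * Q) = subst M N P * subst M N Q"
   "subst M N (P - Q) = subst M N P - subst M N Q" "subst M N (- P) = - subst M N P"
   "subst M N 0 = 0" "subst M N 1 = 1" "subst M N (cst k) = cst k"
   "subst M N (lin_v x) = lin_v (x v* M)" "subst M N (lin_x y) = lin_x (N *v y)"
  by (auto intro!: pf_eqI simp: pfs lin_apply subst_def pairing_matrix)

lemma vco_lin: "vco i = lin_v (axis i 1)" and xco_lin: "xco i = lin_x (axis i 1)"
  by (auto intro!: pf_eqI simp: pfs lin_apply)

lemma pdeg_subst: "pdeg m P \<Longrightarrow> pdeg m (subst M N P)"
proof (induction rule: pdeg_induct)
  case (vco m P i)
  then show ?case using pdeg_mult[OF pdeg_lin_v vco(2)] by (simp add: subst_simps vco_lin add.commute)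
next
  case (xco m P i)
  then show ?case using pdeg_mult[OF pdeg_lin_x xco(2)] by (simp add: subst_simps xco_lin add.commute)
qed (auto simp: subst_simps intro: pdeg_intros)

lemma pol_subst: "pol P \<Longrightarrow> pol (subst M N P)" by (metis pol_def pdeg_subst)

lemma subst_subst: "subst M N (subst M' N' P) = subst (M' ** M) (N ** N') P"
  by (rule pf_eqI) (simp add: subst_def matrix_vector_mul_assoc vector_matrix_mul_assoc)

lemma subst_id: "subst (mat 1) (mat 1) P = P"
  by (rule pf_eqI) (simp add: subst_def)

section \<open>Restriction to lines and rays, absence of zero divisors, homogeneous parts\<close>

lemma pol_line: "pol P \<Longrightarrow> \<exists>p :: complex poly. \<forall>z. P (a + z *s b) (a' + z *s b') = poly p z"
proof (induction rule: pol_induct)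
  case (cst k) then show ?case by (intro exI[of _ "[:k:]"]) (simp add: pfs)
next
  case (vco P i)
  then obtain p where "\<forall>z. P (a + z *s b) (a' + z *s b') = poly p z" by blast
  then show ?case by (intro exI[of _ "[:a $ i, b $ i:] * p"]) (simp add: pfs algebra_simps)
next
  case (xco P i)
  then obtain p where "\<forall>z. P (a + z *s b) (a' + z *s b') = poly p z" by blast
  then show ?case by (intro exI[of _ "[:a' $ i, b' $ i:] * p"]) (simp add: pfs algebra_simps)
next
  case (add P Q)
  then obtain p q where "\<forall>z. P (a + z *s b) (a' + z *s b') = poly p z" "\<forall>z. Q (a + z *s b) (a' + z *s b') = poly q z" by blast
  then show ?case by (intro exI[of _ "p + q"]) (simp add: pfs)
qed

text \<open>On rays through the origin the degree bound survives as well, so that homogeneous parts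
  become coefficients of a univariate polynomial.\<close>

lemma pdeg_ray: "pdeg m P \<Longrightarrow> \<exists>p :: complex poly. (\<forall>r. P (r *s v) (r *s \<xi>) = poly p r) \<and> (p = 0 \<or> int (Polynomial.degree p) \<le> m)"
proof (induction rule: pdeg_induct)
  case (zero m) then show ?case by (intro exI[of _ 0]) (simp add: pfs)
next
  case (cst m k) then show ?case by (intro exI[of _ "[:k:]"]) (simp add: pfs)
next
  case (vco m P i)
  then obtain p where p: "\<forall>r. P (r *s v) (r *s \<xi>) = poly p r" "p = 0 \<or> int (Polynomial.degree p) \<le> m" by blast
  have "int (Polynomial.degree ([:0, v $ i:] * p)) \<le> m + 1" if "p \<noteq> 0"
    using that degree_mult_le[of "[:0, v $ i:]" p] p(2) by (auto split: if_splits)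
  with p show ?case by (intro exI[of _ "[:0, v $ i:] * p"]) (auto simp: pfs algebra_simps)
next
  case (xco m P i)
  then obtain p where p: "\<forall>r. P (r *s v) (r *s \<xi>) = poly p r" "p = 0 \<or> int (Polynomial.degree p) \<le> m" by blast
  have "int (Polynomial.degree ([:0, \<xi> $ i:] * p)) \<le> m + 1" if "p \<noteq> 0"
    using that degree_mult_le[of "[:0, \<xi> $ i:]" p] p(2) by (auto split: if_splits)
  with p show ?case by (intro exI[of _ "[:0, \<xi> $ i:] * p"]) (auto simp: pfs algebra_simps)
next
  case (add m P Q)
  then obtain p q where "\<forall>r. P (r *s v) (r *s \<xi>) = poly p r" "p = 0 \<or> int (Polynomial.degree p) \<le> m"
      "\<forall>r. Q (r *s v) (r *s \<xi>) = poly q r" "q = 0 \<or> int (Polynomial.degree q) \<le> m" by blast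
  moreover have "p + q = 0 \<or> int (Polynomial.degree (p + q)) \<le> m"
    using calculation(2,4) degree_add_le_max[of p q] by auto
  ultimately show ?case by (intro exI[of _ "p + q"]) (simp add: pfs)
qed

text \<open>On the line joining a point where \<open>P\<close> is nonzero to one where
  \<open>Q\<close> is nonzero, both restrict to nonzero univariate polynomials, whose product cannot
  vanish identically.\<close>

lemma pol_domain:
  assumes "pol P" "pol Q" "P * Q = 0"
  shows "P = 0 \<or> Q = 0"
proof (rule ccontr)
  assume "\<not> ?thesis"
  then obtain a a' b b' where ab: "P a a' \<noteq> 0" "Q b b' \<noteq> 0"
    by (metis zero_fun_apply pf_eqI)
  obtain p where p: "\<And>z. P (a + z *s (b - a)) (a' + z *s (b' - a')) = poly p z" using pol_line[OF assms(1)] by blast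
  obtain q where q: "\<And>z. Q (a + z *s (b - a)) (a' + z *s (b' - a')) = poly q z" using pol_line[OF assms(2)] by blast
  have "poly p 0 \<noteq> 0" using ab p[of 0] by simp
  moreover have "poly q 1 \<noteq> 0" using ab q[of 1] by simp
  ultimately have "p * q \<noteq> 0" by auto
  moreover have "poly (p * q) z = 0" for z
    using fun_cong[OF fun_cong[OF assms(3)], of "a + z *s (b - a)" "a' + z *s (b' - a')"] by (simp add: p q pfs del: vector_ssub_ldistrib)
  ultimately show False using poly_all_0_iff_0 by blast
qed

lemma pol_cancel: "pol A \<Longrightarrow> A \<noteq> 0 \<Longrightarrow> pol P \<Longrightarrow> pol Q \<Longrightarrow> A * P = A * Q \<Longrightarrow> P = Q"
  using pol_domain[of A "P - Q"] by (auto simp: algebra_simps intro: pol_diff)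

text \<open>For negative \<open>m\<close> the factor \<open>r ^ nat m\<close> is 1, but the degree
  bound then already forces \<open>P = 0\<close>.\<close>

definition phom :: "int \<Rightarrow> ('n::finite) pf \<Rightarrow> bool" where
  "phom m P \<longleftrightarrow> pdeg m P \<and> (\<forall>r v \<xi>. P (r *s v) (r *s \<xi>) = r ^ nat m * P v \<xi>)"

lemma matrix_vector_mult_scale: "M *v (r *s v) = (r :: complex) *s (M *v v)"
  by (simp add: vec_eq_iff matrix_vector_mult_def sum_distrib_left mult_ac)
lemma vector_matrix_mult_scale: "(r *s v) v* M = (r :: complex) *s (v v* M)"
  by (simp add: vec_eq_iff vector_matrix_mult_def sum_distrib_left mult_ac)

lemma phom_zero: "phom m 0" by (simp add: phom_def pdeg_zero pfs)

text \<open>For \<open>m\<close> at least 0, the coefficient of \<open>r ^ m\<close> along a ray is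
  \<open>P v \<xi>\<close> by homogeneity and 0 by the degree bound.\<close>

lemma phom_unique:
  assumes "phom m P" "pdeg (m - 1) P" shows "P = 0"
proof (cases "m < 0")
  case True then show ?thesis using assms pdeg_neg phom_def by blast
next
  case False
  show ?thesis
  proof (rule pf_eqI)
    fix v \<xi>
    obtain p where p: "\<And>r. P (r *s v) (r *s \<xi>) = poly p r" "p = 0 \<or> int (Polynomial.degree p) \<le> m - 1"
      using pdeg_ray[OF assms(2)] by blast
    have "poly p r = poly (Polynomial.monom (P v \<xi>) (nat m)) r" for r
      using p(1)[of r] assms(1) by (simp add: phom_def poly_monom mult.commute)
    then have "p = Polynomial.monom (P v \<xi>) (nat m)" by (simp add: poly_eq_poly_eq_iff[symmetric] fun_eq_iff)
    then have "P v \<xi> = Polynomial.coeff p (nat m)" by simp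
    also have "\<dots> = 0" using p(2) False by (cases "p = 0") (auto intro!: coeff_eq_0)
    finally show "P v \<xi> = 0 v \<xi>" by (simp add: pfs)
  qed
qed

lemma phom_add: "phom m P \<Longrightarrow> phom m Q \<Longrightarrow> phom m (P + Q)"
  by (auto simp: phom_def pfs distrib_left intro: pdeg_add)
lemma phom_cmult: "phom m P \<Longrightarrow> phom m (cst k * P)"
  by (auto simp: phom_def pfs intro: pdeg_cmult)
lemma phom_uminus: "phom m P \<Longrightarrow> phom m (- P)"
  by (auto simp: phom_def pfs intro: pdeg_uminus)
lemma phom_diff: "phom m P \<Longrightarrow> phom m Q \<Longrightarrow> phom m (P - Q)"
  by (auto simp: phom_def pfs right_diff_distrib intro: pdeg_diff)
lemma phom_sum: "(\<And>i. i \<in> I \<Longrightarrow> phom m (f i)) \<Longrightarrow> phom m (\<Sum>i\<in>I. f i)"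
  by (induction I rule: infinite_finite_induct) (auto intro: phom_add phom_zero)
lemma phom_mult: assumes "phom m P" "phom m' Q" "0 \<le> m" "0 \<le> m'" shows "phom (m + m') (P * Q)"
  using assms by (auto simp: phom_def pfs nat_add_distrib power_add intro: pdeg_mult)
lemma phom_vco: "phom m P \<Longrightarrow> 0 \<le> m \<Longrightarrow> phom (m + 1) (vco i * P)"
  by (auto simp: phom_def pfs nat_add_distrib intro: pdeg_vco)
lemma phom_xco: "phom m P \<Longrightarrow> 0 \<le> m \<Longrightarrow> phom (m + 1) (xco i * P)"
  by (auto simp: phom_def pfs nat_add_distrib intro: pdeg_xco)
lemma phom_subst: "phom m P \<Longrightarrow> phom m (subst M N P)"
  by (auto simp: phom_def subst_apply matrix_vector_mult_scale vector_matrix_mult_scale intro: pdeg_subst)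

lemma pdeg_top: "pdeg m P \<Longrightarrow> \<exists>T. phom m T \<and> pdeg (m - 1) (P - T)"
proof (induction rule: pdeg_induct)
  case (zero m) then show ?case by (intro exI[of _ 0]) (simp add: phom_zero pdeg_zero)
next
  case (cst m k)
  show ?case
  proof (cases "m = 0")
    case True then show ?thesis by (intro exI[of _ "cst k"]) (simp add: phom_def pdeg_zero pdeg_cst, simp add: pf_apply)
  next
    case False then show ?thesis using cst by (intro exI[of _ 0]) (simp add: phom_zero pdeg_cst)
  qed
next
  case (vco m P i)
  show ?case
  proof (cases "0 \<le> m")
    case True
    from vco obtain T where "phom m T" "pdeg (m - 1) (P - T)" by blast
    then show ?thesis using phom_vco[of m T i] True pdeg_vco[of "m - 1" "P - T" i]
      by (intro exI[of _ "vco i * T"]) (simp add: right_diff_distrib)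
  next
    case False then show ?thesis using pdeg_neg[OF vco(1)] by (intro exI[of _ 0]) (simp add: phom_zero pdeg_zero)
  qed
next
  case (xco m P i)
  show ?case
  proof (cases "0 \<le> m")
    case True
    from xco obtain T where "phom m T" "pdeg (m - 1) (P - T)" by blast
    then show ?thesis using phom_xco[of m T i] True pdeg_xco[of "m - 1" "P - T" i]
      by (intro exI[of _ "xco i * T"]) (simp add: right_diff_distrib)
  next
    case False then show ?thesis using pdeg_neg[OF xco(1)] by (intro exI[of _ 0]) (simp add: phom_zero pdeg_zero)
  qed
next
  case (add m P Q)
  then obtain T T' where "phom m T" "pdeg (m - 1) (P - T)" "phom m T'" "pdeg (m - 1) (Q - T')" by blast
  then show ?case using pdeg_add[of "m - 1" "P - T" "Q - T'"]
    by (intro exI[of _ "T + T'"]) (auto simp: algebra_simps intro: phom_add)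
qed

text \<open>The part of degree exactly \<open>m\<close>, hence 0 when the true degree is smaller;
  \<open>phom_unique\<close> makes the choice unambiguous.\<close>

definition ptop :: "int \<Rightarrow> ('n::finite) pf \<Rightarrow> 'n pf" where
  "ptop m P = (SOME T. phom m T \<and> pdeg (m - 1) (P - T))"

lemma ptop: "pdeg m P \<Longrightarrow> phom m (ptop m P)" "pdeg m P \<Longrightarrow> pdeg (m - 1) (P - ptop m P)"
  using someI_ex[OF pdeg_top] unfolding ptop_def by blast+

text \<open>Scaling behaviour alone determines the degree: leading forms of degree above
  \<open>d\<close> are stripped one by one, each being zero.\<close>

lemma pdeg_phom:
  assumes "pol P" "\<And>r v \<xi>. P (r *s v) (r *s \<xi>) = r ^ d * P v \<xi>"
  shows "phom (int d) P"
proof -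
  obtain m where "pdeg m P" using assms pol_def by blast
  then have "pdeg (int (nat m)) P" by (rule pdeg_mono) simp
  then have "pdeg (int d) P"
  proof (induction "nat m" arbitrary: m)
    case 0 then show ?case by (auto intro: pdeg_mono)
  next
    case (Suc k)
    show ?case
    proof (cases "Suc k \<le> d")
      case True
      have "int (nat m) \<le> int d" using True Suc(2) by linarith
      then show ?thesis using pdeg_mono[OF Suc(3)] by blast
    next
      case False
      define T where "T = ptop (int (Suc k)) P"
      have T: "phom (int (Suc k)) T" "pdeg (int (Suc k) - 1) (P - T)" using ptop[of "int (Suc k)" P] Suc by (auto simp: T_def)
      \<comment> \<open>Along a ray the coefficient of \<open>r ^ Suc k\<close> in
        \<open>P - T\<close> is minus the value of \<open>T\<close>, as \<open>P\<close> contributes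
        only in degree \<open>d\<close>; but \<open>P - T\<close> has degree at most
        \<open>k\<close>.\<close>
      have "T = 0"
      proof (rule pf_eqI)
        fix v \<xi>
        obtain p where p: "\<And>r. (P - T) (r *s v) (r *s \<xi>) = poly p r" "p = 0 \<or> int (Polynomial.degree p) \<le> int (Suc k) - 1"
          using pdeg_ray[OF T(2)] by blast
        have "poly p r = poly (Polynomial.monom (P v \<xi>) d - Polynomial.monom (T v \<xi>) (Suc k)) r" for r
          using p(1)[of r] T(1) assms(2) by (simp add: phom_def poly_monom mult.commute nat_add_distrib pfs)
        then have *: "p = Polynomial.monom (P v \<xi>) d - Polynomial.monom (T v \<xi>) (Suc k)" by (simp add: poly_eq_poly_eq_iff[symmetric] fun_eq_iff)
        have "Polynomial.coeff p (Suc k) = 0" using p(2) by (auto intro!: coeff_eq_0)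
        then show "T v \<xi> = 0 v \<xi>" using False unfolding * by (simp add: pfs)
      qed
      then show ?thesis using Suc(1)[of "int k"] T(2) by simp
    qed
  qed
  then show ?thesis using assms(2) by (simp add: phom_def)
qed

definition quad :: "('n::finite) pf" where "quad = (\<Sum>i\<in>UNIV. vco i * xco i)"

subsection \<open>Derivatives\<close>

text \<open>Analytic derivatives of functions, so that no formal calculus is needed; for polynomials
  they exist because the restriction to a line is a univariate polynomial.\<close>

definition dv :: "complex ^ 'n \<Rightarrow> ('n::finite) pf \<Rightarrow> 'n pf" where
  "dv y P = (\<lambda>v \<xi>. deriv (\<lambda>z. P (v + z *s y) \<xi>) 0)"
definition dx :: "complex ^ 'n \<Rightarrow> ('n::finite) pf \<Rightarrow> 'n pf" where
  "dx y P = (\<lambda>v \<xi>. deriv (\<lambda>z. P v (\<xi> + z *s y)) 0)"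

lemma dv_has: assumes "pol P" shows "((\<lambda>z. P (v + z *s y) \<xi>) has_field_derivative dv y P v \<xi>) (at 0)"
proof -
  obtain p where "\<And>z. P (v + z *s y) (\<xi> + z *s 0) = poly p z" using pol_line[OF assms] by blast
  then have "(\<lambda>z. P (v + z *s y) \<xi>) = poly p" by auto
  then show ?thesis unfolding dv_def by (metis DERIV_deriv_iff_field_differentiable field_differentiable_def poly_DERIV)
qed

lemma dx_has: assumes "pol P" shows "((\<lambda>z. P v (\<xi> + z *s y)) has_field_derivative dx y P v \<xi>) (at 0)"
proof -
  obtain p where "\<And>z. P (v + z *s 0) (\<xi> + z *s y) = poly p z" using pol_line[OF assms] by blast
  then have "(\<lambda>z. P v (\<xi> + z *s y)) = poly p" by auto
  then show ?thesis unfolding dx_def by (metis DERIV_deriv_iff_field_differentiable field_differentiable_def poly_DERIV)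
qed

lemma dv_eqI: "(\<And>v \<xi>. ((\<lambda>z. P (v + z *s y) \<xi>) has_field_derivative Q v \<xi>) (at 0)) \<Longrightarrow> dv y P = Q"
  unfolding dv_def by (rule pf_eqI) (rule DERIV_imp_deriv)
lemma dx_eqI: "(\<And>v \<xi>. ((\<lambda>z. P v (\<xi> + z *s y)) has_field_derivative Q v \<xi>) (at 0)) \<Longrightarrow> dx y P = Q"
  unfolding dx_def by (rule pf_eqI) (rule DERIV_imp_deriv)

lemma dv_basic: "dv y (cst k) = 0" "dv y (vco i) = cst (y $ i)" "dv y (xco i) = 0" "dv y (lin_x x) = 0"
  "dv y (lin_v x) = cst (pairing x y)"
  by (rule dv_eqI; auto simp: pfs lin_apply intro!: derivative_eq_intros)+
lemma dx_basic: "dx y (cst k) = 0" "dx y (xco i) = cst (y $ i)" "dx y (vco i) = 0" "dx y (lin_v x) = 0"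
  "dx y (lin_x x) = cst (pairing y x)"
  by (rule dx_eqI; auto simp: pfs lin_apply intro!: derivative_eq_intros)+

lemma dv_add: "pol P \<Longrightarrow> pol Q \<Longrightarrow> dv y (P + Q) = dv y P + dv y Q"
  by (rule dv_eqI) (auto simp: pfs lin_apply intro!: derivative_eq_intros dv_has)
lemma dx_add: "pol P \<Longrightarrow> pol Q \<Longrightarrow> dx y (P + Q) = dx y P + dx y Q"
  by (rule dx_eqI) (auto simp: pfs lin_apply intro!: derivative_eq_intros dx_has)
lemma dv_mult: "pol P \<Longrightarrow> pol Q \<Longrightarrow> dv y (P * Q) = dv y P * Q + P * dv y Q"
  by (rule dv_eqI, simp only: times_fun_apply, rule DERIV_cong, rule DERIV_mult, erule dv_has, erule dv_has, simp add: pfs)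
lemma dx_mult: "pol P \<Longrightarrow> pol Q \<Longrightarrow> dx y (P * Q) = dx y P * Q + P * dx y Q"
  by (rule dx_eqI, simp only: times_fun_apply, rule DERIV_cong, rule DERIV_mult, erule dx_has, erule dx_has, simp add: pfs)
lemma dv_cmult: "pol P \<Longrightarrow> dv y (cst k * P) = cst k * dv y P"
  by (simp add: dv_mult pol_cst dv_basic)
lemma dx_cmult: "pol P \<Longrightarrow> dx y (cst k * P) = cst k * dx y P"
  by (simp add: dx_mult pol_cst dx_basic)

lemma pdeg_dv: "pdeg m P \<Longrightarrow> pdeg (m - 1) (dv y P)"
proof (induction rule: pdeg_induct)
  case (zero m) then show ?case using dv_basic(1)[of y 0] by (simp add: cst_simps pdeg_zero)
next
  case (vco m P i)
  have "pdeg m (vco i * dv y P)" by (rule pdeg_vco') (rule vco)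
  then show ?case using vco by (simp add: dv_mult pol_vco pdeg_pol dv_basic pdeg_add pdeg_cmult)
next
  case (xco m P i)
  have "pdeg m (xco i * dv y P)" by (rule pdeg_xco') (rule xco)
  then show ?case using xco by (simp add: dv_mult pol_xco pdeg_pol dv_basic pdeg_add pdeg_cmult)
qed (auto simp: dv_basic dv_add pdeg_pol intro: pdeg_intros)

lemma pdeg_dx: "pdeg m P \<Longrightarrow> pdeg (m - 1) (dx y P)"
proof (induction rule: pdeg_induct)
  case (zero m) then show ?case using dx_basic(1)[of y 0] by (simp add: cst_simps pdeg_zero)
next
  case (vco m P i)
  have "pdeg m (vco i * dx y P)" by (rule pdeg_vco') (rule vco)
  then show ?case using vco by (simp add: dx_mult pol_vco pdeg_pol dx_basic pdeg_add pdeg_cmult)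
next
  case (xco m P i)
  have "pdeg m (xco i * dx y P)" by (rule pdeg_xco') (rule xco)
  then show ?case using xco by (simp add: dx_mult pol_xco pdeg_pol dx_basic pdeg_add pdeg_cmult)
qed (auto simp: dx_basic dx_add pdeg_pol intro: pdeg_intros)

lemma pol_dv: "pol P \<Longrightarrow> pol (dv y P)" and pol_dx: "pol P \<Longrightarrow> pol (dx y P)"
  by (metis pol_def pdeg_dv pdeg_dx)+

lemma dv_linear: "pol P \<Longrightarrow> dv (a *s y + b *s y') P = cst a * dv y P + cst b * dv y' P"
proof (induction rule: pol_induct)
qed (simp_all add: dv_basic dv_mult dv_add pol_intros cst_simps, (rule pf_eqI, simp add: pfs algebra_simps)+)

lemma dx_linear: "pol P \<Longrightarrow> dx (a *s y + b *s y') P = cst a * dx y P + cst b * dx y' P"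
proof (induction rule: pol_induct)
qed (simp_all add: dx_basic dx_mult dx_add pol_intros cst_simps, (rule pf_eqI, simp add: pfs algebra_simps)+)

lemma dv_subst: "pol P \<Longrightarrow> dv y (subst M N P) = subst M N (dv (M *v y) P)"
proof (induction rule: pol_induct)
qed (simp_all add: vco_lin xco_lin dv_basic dv_mult dv_add pol_intros pol_lin pol_subst subst_simps pairing_matrix pol_dv)

lemma dx_subst: "pol P \<Longrightarrow> dx y (subst M N P) = subst M N (dx (y v* N) P)"
proof (induction rule: pol_induct)
qed (simp_all add: vco_lin xco_lin dx_basic dx_mult dx_add pol_intros pol_lin pol_subst subst_simps pairing_matrix pol_dx)

section \<open>Dunkl operators\<close>

lemma matrix_inv_left: "invertible (A :: ('n::finite) cmat) \<Longrightarrow> matrix_inv A ** A = mat 1"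
  and matrix_inv_right: "invertible (A :: ('n::finite) cmat) \<Longrightarrow> A ** matrix_inv A = mat 1"
proof -
  assume "invertible A"
  then have "\<exists>B. A ** B = mat 1 \<and> B ** A = mat 1" by (simp add: invertible_def)
  from someI_ex[OF this] show "matrix_inv A ** A = mat 1" "A ** matrix_inv A = mat 1"
    by (simp_all add: matrix_inv_def)
qed

lemma invertible_mat_1: "invertible (mat 1 :: ('n::finite) cmat)"
  unfolding invertible_def by (metis matrix_mul_lid)

lemma group_GL: "group (GL :: ('n::finite) cmat monoid)"
proof (rule groupI)
  fix x :: "'n cmat" assume "x \<in> carrier GL"
  then show "\<exists>y\<in>carrier GL. y \<otimes>\<^bsub>GL\<^esub> x = \<one>\<^bsub>GL\<^esub>"
    by (auto simp: GL_def invertible_def)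
qed (auto simp: GL_def invertible_mult matrix_mul_assoc invertible_mat_1)

lemma GL_inv: assumes "invertible (x :: ('n::finite) cmat)" shows "inv\<^bsub>GL\<^esub> x = matrix_inv x"
proof -
  interpret group "GL :: 'n cmat monoid" by (rule group_GL)
  have "matrix_inv x \<otimes>\<^bsub>GL\<^esub> x = \<one>\<^bsub>GL\<^esub>" "matrix_inv x \<in> carrier GL"
    using assms matrix_inv_left[OF assms] matrix_inv_right[OF assms] by (auto simp: GL_def invertible_def)
  then show ?thesis using assms inv_equality[of "matrix_inv x" x] by (simp add: GL_def)
qed

lemma matrix_inv_eqI: assumes "x ** y = mat 1" "y ** x = mat 1" shows "matrix_inv (x :: ('n::finite) cmat) = y"
proof -
  have "invertible x" using assms invertible_def by blast
  then have "matrix_inv x ** x = mat 1" by (rule matrix_inv_left)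
  then show ?thesis using assms by (metis matrix_mul_assoc matrix_mul_lid matrix_mul_rid)
qed

definition outer :: "complex ^ 'n \<Rightarrow> complex ^ 'n \<Rightarrow> ('n::finite) cmat" where
  "outer v \<xi> = (\<chi> i j. v $ i * \<xi> $ j)"

lemma mult_outer: "A ** outer v \<xi> = outer (A *v v) \<xi>" and outer_mult': "outer v \<xi> ** B = outer v (\<xi> v* B)"
  by (simp_all add: vec_eq_iff outer_def matrix_matrix_mult_def matrix_vector_mult_def vector_matrix_mult_def
      sum_distrib_left sum_distrib_right mult_ac)

lemma outer_mult: "(A :: ('n::finite) cmat) ** outer v \<xi> ** B = outer (A *v v) (\<xi> v* B)"
  unfolding mult_outer outer_mult' by (rule refl)

lemma row_outer: "row i (outer v \<xi>) = v $ i *s \<xi>"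
  by (simp add: row_def outer_def vec_eq_iff)

text \<open>In a matrix of rank one all rows are multiples of one vector: that vector is
  \<open>\<xi>\<close>, the factors form \<open>v\<close>. The criterion serves for reflections and
  for the minimal orbit alike.\<close>

lemma rank_eq_1: "rank (A :: ('n::finite) cmat) = 1 \<longleftrightarrow> A \<noteq> 0 \<and> (\<exists>v \<xi>. A = outer v \<xi>)"
proof
  assume r: "rank A = 1"
  then have d: "vec.dim (rows A) = 1" by (simp add: row_rank_def_gen)
  obtain B where B: "B \<subseteq> rows A" "vec.independent B" "rows A \<subseteq> vec.span B" "card B = vec.dim (rows A)"
    using vec.basis_exists by blast
  then obtain b where b: "B = {b}" using d card_1_singletonE by metis
  have "\<exists>k. row i A = k *s b" for i
  proof -
    have "row i A \<in> vec.span {b}" using B(3) b by (auto simp: rows_def)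
    then show ?thesis by (auto simp: vec.span_singleton)
  qed
  then obtain k where k: "\<And>i. row i A = k i *s b" by metis
  have "A = outer (\<chi> i. k i) b"
    using k by (simp add: vec_eq_iff row_def outer_def)
  moreover have "A \<noteq> 0"
  proof
    assume "A = 0"
    then have "rows A \<subseteq> {0}" by (auto simp: rows_def row_def vec_eq_iff)
    with B b have "b = 0" by auto
    then show False using B b vec.dependent_zero by auto
  qed
  ultimately show "A \<noteq> 0 \<and> (\<exists>v \<xi>. A = outer v \<xi>)" by blast
next
  assume "A \<noteq> 0 \<and> (\<exists>v \<xi>. A = outer v \<xi>)"
  then obtain v \<xi> where A: "A = outer v \<xi>" "A \<noteq> 0" by blast
  then obtain i where i: "v $ i \<noteq> 0" by (auto simp: outer_def vec_eq_iff)
  have x0: "\<xi> \<noteq> 0" using A by (auto simp: outer_def vec_eq_iff)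
  have "vec.dim (rows A) = card {\<xi>}"
  proof (rule vec.dim_unique[of "{v $ i *s \<xi>}", THEN trans])
    show "{v $ i *s \<xi>} \<subseteq> rows A" using A row_outer[of i v \<xi>] by (auto simp: rows_def) (metis)
    show "rows A \<subseteq> vec.span {v $ i *s \<xi>}"
    proof
      fix x assume "x \<in> rows A"
      then obtain j where "x = v $ j *s \<xi>" using A by (auto simp: rows_def row_outer)
      then have "x = (v $ j / v $ i) *s (v $ i *s \<xi>)" using i by simp
      then show "x \<in> vec.span {v $ i *s \<xi>}" by (metis vec.span_base vec.span_scale singletonI)
    qed
    show "vec.independent {v $ i *s \<xi>}" using i x0 by (simp add: vec.dependent_single)
  qed auto
  then show "rank A = 1" by (simp add: row_rank_def_gen)
qed

lemma matrix_mult_diff: "(A :: ('n::finite) cmat) ** (B - C) = A ** B - A ** C" "(B - C) ** A = B ** A - C ** A"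
  by (simp_all add: vec_eq_iff matrix_matrix_mult_def algebra_simps sum_subtractf)

lemma axis_sum: "(\<Sum>i\<in>UNIV. x $ i *s axis i 1) = (x :: complex ^ 'n::finite)"
  by (simp add: vec_eq_iff axis_def if_distrib cong: if_cong)

section \<open>Reflections with their roots and coroots\<close>

locale refl_data =
  fixes W :: "('n::finite) cmat set" and \<alpha> \<alpha>' :: "'n cmat \<Rightarrow> complex ^ 'n"
    and lam :: "'n cmat \<Rightarrow> complex" and t :: complex and c :: "'n cmat \<Rightarrow> complex"
  assumes fin: "finite W" and sub: "subgroup W GL" and data: "reflection_data W \<alpha> \<alpha>' lam"
    and conjc: "conj_invariant W c"
begin

abbreviation "R \<equiv> reflections W"

lemma R_W: "s \<in> R \<Longrightarrow> s \<in> W" by (simp add: reflections_def)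
lemma finR: "finite R" using fin by (simp add: reflections_def)

lemma W_invertible: "w \<in> W \<Longrightarrow> invertible w" using subgroup.subset[OF sub] by (auto simp: GL_def)
lemma W_one: "mat 1 \<in> W" using subgroup.one_closed[OF sub] by (simp add: GL_def)
lemma W_mult: "a \<in> W \<Longrightarrow> b \<in> W \<Longrightarrow> a ** b \<in> W" using subgroup.m_closed[OF sub] by (auto simp: GL_def)
lemma W_inv: "a \<in> W \<Longrightarrow> matrix_inv a \<in> W"
  using subgroup.m_inv_closed[OF sub] GL_inv[OF W_invertible] by metis
lemma inv_l: "a \<in> W \<Longrightarrow> matrix_inv a ** a = mat 1" using matrix_inv_left W_invertible by blast
lemma inv_r: "a \<in> W \<Longrightarrow> a ** matrix_inv a = mat 1" using matrix_inv_right W_invertible by blast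
lemma inv_vec: "a \<in> W \<Longrightarrow> matrix_inv a *v (a *v x) = x" "a \<in> W \<Longrightarrow> a *v (matrix_inv a *v x) = x"
  by (simp_all add: matrix_vector_mul_assoc inv_l inv_r)
lemma inv_covec: "a \<in> W \<Longrightarrow> (x v* a) v* matrix_inv a = x" "a \<in> W \<Longrightarrow> (x v* matrix_inv a) v* a = x"
  by (simp_all add: vector_matrix_mul_assoc inv_l inv_r)
lemma inv_mult: "a \<in> W \<Longrightarrow> b \<in> W \<Longrightarrow> matrix_inv (a ** b) = matrix_inv b ** matrix_inv a"
  by (intro matrix_inv_eqI) (metis inv_l inv_r matrix_mul_assoc matrix_mul_lid)+
lemma inv_one: "matrix_inv (mat 1) = (mat 1 :: 'n cmat)" by (intro matrix_inv_eqI) simp_all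

definition br :: "'n cmat \<Rightarrow> complex" where "br s = pairing (\<alpha> s) (\<alpha>' s)"

lemma refl_ker: "s \<in> R \<Longrightarrow> pairing (\<alpha> s) v = 0 \<longleftrightarrow> s *v v = v"
  using data by (auto simp: reflection_data_def)

lemma refl_facts:
  assumes s: "s \<in> R"
  shows br: "br s \<noteq> 0" and lam_nz: "lam s \<noteq> 0" and lam_ne_1: "lam s \<noteq> 1"
    and refl_act: "s *v v = v - ((1 - inverse (lam s)) / br s * pairing (\<alpha> s) v) *s \<alpha>' s"
    and refl_inv: "matrix_inv s *v v = v - ((1 - lam s) / br s * pairing (\<alpha> s) v) *s \<alpha>' s"
proof -
  obtain m where m: "m \<noteq> 1" "s *v \<alpha>' s = m *s \<alpha>' s" and a': "\<alpha>' s \<noteq> 0"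
    and d: "dual_act s (\<alpha> s) = lam s *s \<alpha> s"
    using data s by (auto simp: reflection_data_def)
  have sW: "s \<in> W" using s R_W by blast
  show b: "br s \<noteq> 0"
  proof
    assume "br s = 0"
    then have "s *v \<alpha>' s = \<alpha>' s" using refl_ker[OF s] by (simp add: br_def)
    then have e: "m *s \<alpha>' s = \<alpha>' s" using m by simp
    obtain i where "\<alpha>' s $ i \<noteq> 0" using a' by (auto simp: vec_eq_iff)
    with arg_cong[OF e, of "\<lambda>x. x $ i"] show False using m by simp
  qed
  have p: "pairing (\<alpha> s) (matrix_inv s *v x) = lam s * pairing (\<alpha> s) x" for x
    using d by (simp add: pairing_matrix dual_act_def)
  \<comment> \<open>Evaluating the root on \<open>matrix_inv s *v (s *v \<alpha>' s)\<close> in two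
    ways shows that the eigenvalue of the coroot is inverse to \<open>lam s\<close>.\<close>
  have lm: "lam s * m = 1"
    using p[of "s *v \<alpha>' s"] b unfolding inv_vec(1)[OF sW] unfolding m(2) by (simp add: br_def)
  then show l0: "lam s \<noteq> 0" and "lam s \<noteq> 1" using m by auto
  have mm: "m = inverse (lam s)" using lm l0 by (simp add: field_simps)
  show 1: "s *v v = v - ((1 - inverse (lam s)) / br s * pairing (\<alpha> s) v) *s \<alpha>' s" for v
  proof -
    \<comment> \<open>Removing the coroot component of \<open>v\<close> leaves a vector of the fixed
      hyperplane.\<close>
    define k where "k = pairing (\<alpha> s) v / br s"
    have "pairing (\<alpha> s) (v - k *s \<alpha>' s) = 0" using b by (simp add: k_def br_def)
    then have "s *v (v - k *s \<alpha>' s) = v - k *s \<alpha>' s" using refl_ker[OF s] by blast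
    then have "s *v v = v - k *s \<alpha>' s + k *s (m *s \<alpha>' s)"
      by (simp add: matrix_vector_mult_diff_distrib matrix_vector_mult_scale m(2) algebra_simps)
    then show ?thesis by (simp add: k_def mm vec_eq_iff) (simp add: divide_inverse algebra_simps)
  qed
  show "matrix_inv s *v v = v - ((1 - lam s) / br s * pairing (\<alpha> s) v) *s \<alpha>' s"
  proof -
    have e: "pairing (\<alpha> s) (v - ((1 - lam s) / br s * pairing (\<alpha> s) v) *s \<alpha>' s) = lam s * pairing (\<alpha> s) v"
      using b by (simp add: br_def[symmetric] field_simps)
    have "s *v (v - ((1 - lam s) / br s * pairing (\<alpha> s) v) *s \<alpha>' s) = v"
      by (subst 1, subst e) (use l0 b in \<open>simp add: vec_eq_iff divide_simps, simp add: algebra_simps\<close>)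
    then show ?thesis using inv_vec[OF sW] by metis
  qed
qed

text \<open>The roots are not chosen equivariantly, so conjugation transports them only up to a
  factor \<open>r\<close>. In the Dunkl operators the root occurs once as a factor and once as a
  divisor, so that \<open>r\<close> cancels there.\<close>

lemma refl_conj:
  assumes s: "s \<in> R" and w: "w \<in> W"
  defines "s' \<equiv> w ** s ** matrix_inv w"
  shows refl_conj_R: "s' \<in> R" and refl_conj_lam: "lam s' = lam s" and refl_conj_c: "c s' = c s"
    and refl_conj_root: "\<exists>r. r \<noteq> 0 \<and> (\<forall>v. pairing (\<alpha> s') (w *v v) = r * pairing (\<alpha> s) v)"
proof -
  interpret group "GL :: 'n cmat monoid" by (rule group_GL)
  have sW: "s \<in> W" using s R_W by blast
  have s'W: "s' \<in> W" using W_mult W_inv w sW by (simp add: s'_def)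
  have cr: "complex_reflection s" using s by (simp add: reflections_def)
  have wG: "w \<in> carrier GL" "s \<in> carrier GL" "s' \<in> carrier GL" using w sW s'W subgroup.subset[OF sub] by auto
  have pw: "s' [^]\<^bsub>GL\<^esub> (k::nat) = w ** (s [^]\<^bsub>GL\<^esub> k) ** matrix_inv w" for k
  proof (induction k)
    case 0 then show ?case using inv_r[OF w] by (simp add: GL_def)
  next
    case (Suc k)
    have "s' [^]\<^bsub>GL\<^esub> Suc k = (w ** (s [^]\<^bsub>GL\<^esub> k) ** matrix_inv w) ** (w ** s ** matrix_inv w)"
      using Suc by (simp add: GL_def s'_def)
    also have "\<dots> = w ** (s [^]\<^bsub>GL\<^esub> k ** s) ** matrix_inv w"
      by (metis inv_l[OF w] matrix_mul_assoc matrix_mul_rid)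
    finally show ?case by (simp add: GL_def)
  qed
  have "s' - mat 1 = w ** (s - mat 1) ** matrix_inv w"
    using inv_r[OF w] by (simp add: s'_def matrix_mult_diff)
  moreover obtain u \<xi> where u: "s - mat 1 = outer u \<xi>" "s - mat 1 \<noteq> 0"
    using cr rank_eq_1 unfolding complex_reflection_def by blast
  ultimately have o: "s' - mat 1 = outer (w *v u) (\<xi> v* matrix_inv w)" by (simp add: outer_mult)
  have "s' - mat 1 \<noteq> 0"
  proof
    assume "s' - mat 1 = 0"
    then have "s' = mat 1" by simp
    then have "s = mat 1" unfolding s'_def
      by (metis inv_l[OF w] matrix_mul_assoc matrix_mul_lid matrix_mul_rid)
    then show False using u by simp
  qed
  then have "rank (s' - mat 1) = 1" using o rank_eq_1 by blast
  moreover have "\<exists>k::nat. k > 0 \<and> s' [^]\<^bsub>GL\<^esub> k = mat 1"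
    using cr pw inv_r[OF w] unfolding complex_reflection_def by (metis matrix_mul_rid)
  ultimately show s'R: "s' \<in> R" using s'W wG by (auto simp: reflections_def complex_reflection_def)
  show "c s' = c s" using conjc w s by (simp add: conj_invariant_def s'_def)
  have k: "pairing (\<alpha> s') (w *v v) = 0 \<longleftrightarrow> pairing (\<alpha> s) v = 0" for v
  proof -
    have "s' *v (w *v v) = w *v (s *v v)"
      by (simp add: s'_def inv_vec[OF w] flip: matrix_vector_mul_assoc)
    then show ?thesis using refl_ker[OF s] refl_ker[OF s'R] inv_vec(1)[OF w] by metis
  qed
  \<comment> \<open>Both functionals have the same kernel, so their ratio can be read off at the
    coroot, where the root does not vanish.\<close>
  define r where "r = pairing (\<alpha> s') (w *v \<alpha>' s) / br s"
  have r: "pairing (\<alpha> s') (w *v v) = r * pairing (\<alpha> s) v" for v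
  proof -
    have "pairing (\<alpha> s) (v - (pairing (\<alpha> s) v / br s) *s \<alpha>' s) = 0" using br[OF s] by (simp add: br_def)
    then have "pairing (\<alpha> s') (w *v (v - (pairing (\<alpha> s) v / br s) *s \<alpha>' s)) = 0" using k by blast
    then show ?thesis by (simp add: matrix_vector_mult_diff_distrib matrix_vector_mult_scale r_def)
  qed
  have r0: "r \<noteq> 0" using k[of "\<alpha>' s"] r[of "\<alpha>' s"] br[OF s] by (simp add: br_def)
  then show "\<exists>r. r \<noteq> 0 \<and> (\<forall>v. pairing (\<alpha> s') (w *v v) = r * pairing (\<alpha> s) v)" using r by blast
  \<comment> \<open>A reflection multiplies its own root by \<open>inverse (lam x)\<close>;
    comparing this for \<open>s'\<close> and \<open>s\<close> at the coroot of \<open>s\<close>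
    gives equality of the eigenvalues.\<close>
  have p: "pairing (\<alpha> x) (x *v v) = inverse (lam x) * pairing (\<alpha> x) v" if "x \<in> R" for x v
    by (subst refl_act[OF that]) (use br[OF that] in \<open>simp add: br_def[symmetric] field_simps\<close>)
  have "pairing (\<alpha> s') (s' *v (w *v \<alpha>' s)) = pairing (\<alpha> s') (w *v (s *v \<alpha>' s))"
    by (simp add: s'_def inv_vec[OF w] flip: matrix_vector_mul_assoc)
  then have "inverse (lam s') * (r * br s) = r * (inverse (lam s) * br s)"
    by (simp only: p[OF s'R] r p[OF s] br_def)
  then show "lam s' = lam s" using r0 br[OF s] by simp
qed

section \<open>Actions of \<open>W\<close> on polynomials and divided differences\<close>

definition gact :: "'n cmat \<Rightarrow> 'n pf \<Rightarrow> 'n pf" where "gact w P = subst (matrix_inv w) w P"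

lemma gact_simps: "gact w (P + Q) = gact w P + gact w Q" "gact w (P * Q) = gact w P * gact w Q"
   "gact w (P - Q) = gact w P - gact w Q" "gact w (- P) = - gact w P"
   "gact w 0 = 0" "gact w 1 = 1" "gact w (cst k) = cst k"
   "gact w (lin_v x) = lin_v (x v* matrix_inv w)" "gact w (lin_x y) = lin_x (w *v y)"
  by (simp_all add: gact_def subst_simps)

lemma gact_sum: "gact w (\<Sum>i\<in>I. f i) = (\<Sum>i\<in>I. gact w (f i))"
  by (induction I rule: infinite_finite_induct) (simp_all add: gact_simps)

lemma pol_gact: "pol P \<Longrightarrow> pol (gact w P)" and pdeg_gact: "pdeg m P \<Longrightarrow> pdeg m (gact w P)"
  by (simp_all add: gact_def pol_subst pdeg_subst)

lemma gact_gact: "a \<in> W \<Longrightarrow> b \<in> W \<Longrightarrow> gact a (gact b P) = gact (a ** b) P"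
  by (simp add: gact_def subst_subst inv_mult)
lemma gact_one: "gact (mat 1) P = P" by (simp add: gact_def inv_one subst_id)
text \<open>The two commuting halves of the diagonal action. Dunkl operators need them separately:
  the divided difference acts in \<open>v\<close>, while the reflection it leaves behind acts on
  \<open>\<xi>\<close>.\<close>

definition sv :: "'n cmat \<Rightarrow> 'n pf \<Rightarrow> 'n pf" where "sv s = subst (matrix_inv s) (mat 1)"
definition sx :: "'n cmat \<Rightarrow> 'n pf \<Rightarrow> 'n pf" where "sx s = subst (mat 1) s"

lemma sv_simps: "sv w (P + Q) = sv w P + sv w Q" "sv w (P * Q) = sv w P * sv w Q"
   "sv w (P - Q) = sv w P - sv w Q" "sv w (- P) = - sv w P"
   "sv w 0 = 0" "sv w 1 = 1" "sv w (cst k) = cst k"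
   "sv w (lin_v x) = lin_v (x v* matrix_inv w)" "sv w (lin_x y) = lin_x y"
  by (simp_all add: sv_def subst_simps)
lemma sx_simps: "sx w (P + Q) = sx w P + sx w Q" "sx w (P * Q) = sx w P * sx w Q"
   "sx w (P - Q) = sx w P - sx w Q" "sx w (- P) = - sx w P"
   "sx w 0 = 0" "sx w 1 = 1" "sx w (cst k) = cst k"
   "sx w (lin_v x) = lin_v x" "sx w (lin_x y) = lin_x (w *v y)"
  by (simp_all add: sx_def subst_simps)

lemma pol_sv: "pol P \<Longrightarrow> pol (sv w P)" "pol P \<Longrightarrow> pol (sx w P)" by (simp_all add: sv_def sx_def pol_subst)
lemma pdeg_sv: "pdeg m P \<Longrightarrow> pdeg m (sv w P)" "pdeg m P \<Longrightarrow> pdeg m (sx w P)" by (simp_all add: sv_def sx_def pdeg_subst)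

lemma sv_sx: "sv s (sx s P) = gact s P" "sx s (sv s P) = gact s P"
  by (simp_all add: sv_def sx_def gact_def subst_subst)

lemma covec_inv: "s \<in> R \<Longrightarrow> x v* matrix_inv s = x - ((1 - lam s) / br s * pairing x (\<alpha>' s)) *s \<alpha> s"
proof -
  assume s: "s \<in> R"
  have "pairing (x v* matrix_inv s) v = pairing (x - ((1 - lam s) / br s * pairing x (\<alpha>' s)) *s \<alpha> s) v" for v
    by (simp add: pairing_matrix[symmetric] refl_inv[OF s])
  from this[of "axis i 1" for i] show ?thesis by (simp add: vec_eq_iff)
qed

lemma lin_linear: "lin_v (a *s x + b *s y) = cst a * lin_v x + cst b * lin_v y"
  "lin_x (a *s x + b *s y) = cst a * lin_x x + cst b * lin_x y"
  "lin_v (x - y) = lin_v x - lin_v y" "lin_x (x - y) = lin_x x - lin_x y"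
  "lin_v (a *s x) = cst a * lin_v x" "lin_x (a *s x) = cst a * lin_x x"
  "lin_v (x + y) = lin_v x + lin_v y" "lin_x (x + y) = lin_x x + lin_x y" "lin_v 0 = 0" "lin_x 0 = 0"
  by (rule pf_eqI, simp add: pfs lin_apply)+

text \<open>The divided difference in \<open>v\<close>. It is chosen as a polynomial quotient, since
  pointwise division fails on the reflecting hyperplane; \<open>Delta_eqI\<close> gives
  uniqueness.\<close>

definition Delta :: "'n cmat \<Rightarrow> 'n pf \<Rightarrow> 'n pf" where
  "Delta s P = (SOME Q. pol Q \<and> lin_v (\<alpha> s) * Q = P - sv s P)"

lemma root_nz: "s \<in> R \<Longrightarrow> lin_v (\<alpha> s) \<noteq> 0"
proof
  assume s: "s \<in> R" and "lin_v (\<alpha> s) = 0"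
  then have "lin_v (\<alpha> s) (\<alpha>' s) 0 = 0" by (simp add: pfs)
  then show False using br[OF s] by (simp add: lin_apply br_def)
qed

text \<open>Twisted Leibniz rule: \<open>v_i P - s(v_i) s(P)\<close> equals
  \<open>v_i (P - s(P)) + (v_i - s(v_i)) s(P)\<close>, and by \<open>covec_inv\<close> the second
  bracket is a multiple of the root.\<close>

lemma Delta_exists:
  assumes s: "s \<in> R" shows "pdeg m P \<Longrightarrow> \<exists>Q. pdeg (m - 1) Q \<and> lin_v (\<alpha> s) * Q = P - sv s P"
proof (induction rule: pdeg_induct)
  case (zero m) then show ?case by (intro exI[of _ 0]) (simp add: pdeg_zero sv_simps)
next
  case (cst m k) then show ?case by (intro exI[of _ 0]) (simp add: pdeg_zero sv_simps)
next
  case (vco m P i)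
  then obtain Q where Q: "pdeg (m - 1) Q" "lin_v (\<alpha> s) * Q = P - sv s P" by blast
  let ?k = "cst ((1 - lam s) / br s * pairing (axis i 1) (\<alpha>' s))"
  have "lin_v (\<alpha> s) * (vco i * Q + ?k * sv s P) = vco i * (lin_v (\<alpha> s) * Q) + (?k * lin_v (\<alpha> s)) * sv s P"
    by (simp add: algebra_simps)
  also have "\<dots> = vco i * P - sv s (vco i * P)"
    unfolding Q(2) vco_lin sv_simps covec_inv[OF s] lin_linear by (simp add: algebra_simps)
  finally show ?case using Q vco pdeg_vco[of "m - 1" Q i]
    by (intro exI[of _ "vco i * Q + ?k * sv s P"]) (simp add: pdeg_add pdeg_cmult pdeg_sv)
next
  case (xco m P i)
  then obtain Q where Q: "pdeg (m - 1) Q" "lin_v (\<alpha> s) * Q = P - sv s P" by blast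
  have "lin_v (\<alpha> s) * (xco i * Q) = xco i * (lin_v (\<alpha> s) * Q)" by (simp add: algebra_simps)
  also have "\<dots> = xco i * P - sv s (xco i * P)"
    unfolding Q(2) xco_lin sv_simps by (simp add: algebra_simps)
  finally show ?case using pdeg_xco[OF Q(1), of i] by (intro exI[of _ "xco i * Q"]) simp
next
  case (add m P P')
  then obtain Q Q' where Q: "pdeg (m - 1) Q" "lin_v (\<alpha> s) * Q = P - sv s P"
    "pdeg (m - 1) Q'" "lin_v (\<alpha> s) * Q' = P' - sv s P'" by blast
  then show ?case by (intro exI[of _ "Q + Q'"]) (simp add: pdeg_add distrib_left sv_simps)
qed

lemma Delta: assumes "s \<in> R" "pol P" shows "pol (Delta s P)" "lin_v (\<alpha> s) * Delta s P = P - sv s P"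
proof -
  have "\<exists>Q. pol Q \<and> lin_v (\<alpha> s) * Q = P - sv s P" using Delta_exists[OF assms(1)] assms(2) unfolding pol_def by blast
  from someI_ex[OF this] show "pol (Delta s P)" "lin_v (\<alpha> s) * Delta s P = P - sv s P" by (simp_all add: Delta_def)
qed

lemma Delta_eqI: assumes "s \<in> R" "pol P" "pol Q" "lin_v (\<alpha> s) * Q = P - sv s P" shows "Delta s P = Q"
  using pol_cancel[of "lin_v (\<alpha> s)" "Delta s P" Q] Delta[OF assms(1,2)] assms root_nz pol_lin by metis

lemma pdeg_Delta: assumes "s \<in> R" "pdeg m P" shows "pdeg (m - 1) (Delta s P)"
  using Delta_exists[OF assms] Delta_eqI[OF assms(1)] assms(2) pdeg_pol by metis

lemma Delta_add: "s \<in> R \<Longrightarrow> pol P \<Longrightarrow> pol Q \<Longrightarrow> Delta s (P + Q) = Delta s P + Delta s Q"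
  by (rule Delta_eqI) (simp_all add: pol_add Delta distrib_left sv_simps)

lemma Delta_lin_v: "s \<in> R \<Longrightarrow> pol P \<Longrightarrow> Delta s (lin_v x * P) =
    lin_v x * Delta s P + cst ((1 - lam s) / br s * pairing x (\<alpha>' s)) * sv s P"
proof (rule Delta_eqI)
  assume s: "s \<in> R" and P: "pol P"
  let ?k = "cst ((1 - lam s) / br s * pairing x (\<alpha>' s))"
  have "lin_v (\<alpha> s) * (lin_v x * Delta s P + ?k * sv s P) = lin_v x * (lin_v (\<alpha> s) * Delta s P) + (?k * lin_v (\<alpha> s)) * sv s P"
    by (simp add: algebra_simps)
  also have "\<dots> = lin_v x * P - sv s (lin_v x * P)"
    unfolding Delta(2)[OF s P] sv_simps covec_inv[OF s] lin_linear by (simp add: algebra_simps)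
  finally show "lin_v (\<alpha> s) * (lin_v x * Delta s P + ?k * sv s P) = lin_v x * P - sv s (lin_v x * P)" .
qed (auto intro: pol_intros pol_lin pol_sv Delta)

lemma Delta_invar: "s \<in> R \<Longrightarrow> pol P \<Longrightarrow> pol f \<Longrightarrow> sv s f = f \<Longrightarrow> Delta s (f * P) = f * Delta s P"
proof (rule Delta_eqI)
  assume a: "s \<in> R" "pol P" "pol f" "sv s f = f"
  have "lin_v (\<alpha> s) * (f * Delta s P) = f * (lin_v (\<alpha> s) * Delta s P)" by (simp add: algebra_simps)
  also have "\<dots> = f * P - sv s (f * P)" using a by (simp add: Delta sv_simps algebra_simps)
  finally show "lin_v (\<alpha> s) * (f * Delta s P) = f * P - sv s (f * P)" .
qed (auto intro: pol_intros Delta)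

lemma Delta_cmult: "s \<in> R \<Longrightarrow> pol P \<Longrightarrow> Delta s (cst k * P) = cst k * Delta s P"
  by (rule Delta_invar) (auto simp: sv_simps pol_cst)

lemma Delta_zero: "s \<in> R \<Longrightarrow> pol f \<Longrightarrow> sv s f = f \<Longrightarrow> Delta s f = 0"
  by (rule Delta_eqI) (auto intro: pol_zero)

text \<open>The factor \<open>r\<close> between the roots enters the pairing directly and the
  divided difference inversely; only the product of the two is equivariant.\<close>

lemma gact_Delta:
  assumes s: "s \<in> R" and w: "w \<in> W" and P: "pol P"
  shows "cst (pairing (\<alpha> s) y) * gact w (Delta s P) =
    cst (pairing (\<alpha> (w ** s ** matrix_inv w)) (w *v y)) * Delta (w ** s ** matrix_inv w) (gact w P)"
proof -
  let ?s = "w ** s ** matrix_inv w"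
  obtain r where r: "r \<noteq> 0" "\<And>v. pairing (\<alpha> ?s) (w *v v) = r * pairing (\<alpha> s) v"
    using refl_conj_root[OF s w] by blast
  have sW: "s \<in> W" using s R_W by blast
  have l: "gact w (lin_v (\<alpha> s)) = cst (1 / r) * lin_v (\<alpha> ?s)"
  proof (rule pf_eqI)
    fix v \<xi>
    show "gact w (lin_v (\<alpha> s)) v \<xi> = (cst (1 / r) * lin_v (\<alpha> ?s)) v \<xi>"
      using r(2)[of "matrix_inv w *v v"] r(1) inv_vec(2)[OF w, of v]
      by (simp add: gact_def subst_apply pfs lin_apply)
  qed
  have inv: "matrix_inv ?s = w ** matrix_inv s ** matrix_inv w"
    by (intro matrix_inv_eqI) (metis inv_l[OF w] inv_r[OF w] inv_l[OF sW] inv_r[OF sW] matrix_mul_assoc matrix_mul_lid)+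
  have g: "gact w (sv s P) = sv ?s (gact w P)"
    unfolding gact_def sv_def subst_subst inv
    by (metis inv_l[OF w] matrix_mul_assoc matrix_mul_lid matrix_mul_rid)
  have "Delta ?s (gact w P) = cst (1 / r) * gact w (Delta s P)"
  proof (rule Delta_eqI)
    have "gact w (lin_v (\<alpha> s) * Delta s P) = gact w P - sv ?s (gact w P)"
      by (simp only: Delta(2)[OF s P] gact_simps g)
    then show "lin_v (\<alpha> ?s) * (cst (1 / r) * gact w (Delta s P)) = gact w P - sv ?s (gact w P)"
      by (simp add: gact_simps(2) l algebra_simps)
  qed (use refl_conj_R[OF s w] P s in \<open>auto intro: pol_gact pol_intros Delta\<close>)
  then show ?thesis using r by (simp add: mult.assoc[symmetric] cst_simps)
qed

text \<open>The coefficient of \<open>s\<close> in the Euler element. It is also the right one for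
  the Dunkl operator: \<open>Delta\<close> of a linear form brings in
  \<open>(1 - lam s) / br s\<close>, and the product of both has the constant
  \<open>2 * c s / br s\<close> of the defining relation.\<close>

definition K :: "'n cmat \<Rightarrow> complex" where "K s = 2 * c s / (1 - lam s)"

text \<open>Action of \<open>y\<close> on a product of covectors and vectors applied to the
  generator. Moving \<open>y\<close> to the right past the covectors yields the derivative and the
  divided differences in \<open>v\<close>; the reflection left behind acts on the vectors, hence
  \<open>sx s\<close>.\<close>

definition dunkl :: "complex ^ 'n \<Rightarrow> 'n pf \<Rightarrow> 'n pf" where
  "dunkl y P = lin_x y * P + cst t * dv y P - (\<Sum>s\<in>R. cst (K s * pairing (\<alpha> s) y) * Delta s (sx s P))"

text \<open>The operator by which the right-hand side of the relation for \<open>[y, x]\<close>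
  acts.\<close>

definition kap :: "complex ^ 'n \<Rightarrow> complex ^ 'n \<Rightarrow> 'n pf \<Rightarrow> 'n pf" where
  "kap y x P = cst (t * pairing x y) * P -
     (\<Sum>s\<in>R. cst (2 * c s / br s * pairing x (\<alpha>' s) * pairing (\<alpha> s) y) * gact s P)"

lemma pdeg_dunkl_low: "pdeg m P \<Longrightarrow> pdeg (m - 1) (dunkl y P - lin_x y * P)"
  unfolding dunkl_def by (auto intro!: pdeg_diff pdeg_sum pdeg_cmult pdeg_Delta pdeg_dv pdeg_sv)

lemma pdeg_dunkl: "pdeg m P \<Longrightarrow> pdeg (m + 1) (dunkl y P)"
  using pdeg_add[OF pdeg_mult[OF pdeg_lin_x, of m P y] pdeg_mono[OF pdeg_dunkl_low[of m P y]]]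
  by (simp add: add.commute)

lemma pol_dunkl: "pol P \<Longrightarrow> pol (dunkl y P)" by (metis pol_def pdeg_dunkl)
lemma pol_kap: "pol P \<Longrightarrow> pol (kap y x P)" unfolding kap_def by (auto intro!: pol_intros pol_gact)

lemma dunkl_add: "pol P \<Longrightarrow> pol Q \<Longrightarrow> dunkl y (P + Q) = dunkl y P + dunkl y Q"
  by (simp add: dunkl_def dv_add sx_simps Delta_add pol_sv sum.distrib distrib_left algebra_simps)

lemma dunkl_cmult: "pol P \<Longrightarrow> dunkl y (cst k * P) = cst k * dunkl y P"
  by (simp add: dunkl_def dv_cmult sx_simps Delta_cmult pol_sv sum_distrib_left right_diff_distrib distrib_left mult.left_commute)

lemma dunkl_zero: "dunkl y 0 = 0" using dunkl_cmult[of 0 y 0] by (simp add: pol_zero cst_simps)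

lemma dunkl_diff: "pol P \<Longrightarrow> pol Q \<Longrightarrow> dunkl y (P - Q) = dunkl y P - dunkl y Q"
  using dunkl_add[of "P - Q" Q y] by (simp add: pol_diff)

lemma dunkl_sum: "(\<And>i. i \<in> I \<Longrightarrow> pol (f i)) \<Longrightarrow> dunkl y (\<Sum>i\<in>I. f i) = (\<Sum>i\<in>I. dunkl y (f i))"
  by (induction I rule: infinite_finite_induct) (simp_all add: dunkl_zero dunkl_add pol_sum)

lemma dunkl_linear: assumes "pol P" shows "dunkl (a *s y + b *s y') P = cst a * dunkl y P + cst b * dunkl y' P"
proof -
  have "(\<Sum>s\<in>R. cst (K s * pairing (\<alpha> s) (a *s y + b *s y')) * Delta s (sx s P)) =
    cst a * (\<Sum>s\<in>R. cst (K s * pairing (\<alpha> s) y) * Delta s (sx s P)) +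
    cst b * (\<Sum>s\<in>R. cst (K s * pairing (\<alpha> s) y') * Delta s (sx s P))"
    unfolding sum_distrib_left sum.distrib[symmetric]
    by (rule sum.cong, simp, rule pf_eqI, simp add: pfs algebra_simps)
  then show ?thesis unfolding dunkl_def dv_linear[OF assms] lin_linear(2) by (simp add: algebra_simps)
qed

lemma dunkl_linear': assumes "pol P" shows "dunkl (a *s y) P = cst a * dunkl y P" "dunkl (y - y') P = dunkl y P - dunkl y' P"
  "dunkl (y + y') P = dunkl y P + dunkl y' P" "dunkl 0 P = 0"
  using dunkl_linear[OF assms, of a y 0 0] dunkl_linear[OF assms, of 1 y "-1" y'] dunkl_linear[OF assms, of 1 y "1" y'] dunkl_linear[OF assms, of 0 0 0 0]
  by (simp_all add: cst_simps) (simp add: cst_simps(5)[symmetric] cst_simps)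

lemma dunkl_sum_vec: "pol P \<Longrightarrow> dunkl (\<Sum>i\<in>I. a i *s y i) P = (\<Sum>i\<in>I. cst (a i) * dunkl (y i) P)"
  by (induction I rule: infinite_finite_induct) (simp_all add: dunkl_linear')

text \<open>In the twisted Leibniz rule for \<open>Delta s\<close> the half \<open>sv s\<close>
  meets the half \<open>sx s\<close> already present; together they form the diagonal action of
  \<open>s\<close>, as the relation demands.\<close>

lemma dunkl_lin_v: assumes P: "pol P" shows "dunkl y (lin_v x * P) = lin_v x * dunkl y P + kap y x P"
proof -
  have "cst (K s * pairing (\<alpha> s) y) * Delta s (sx s (lin_v x * P)) =
    lin_v x * (cst (K s * pairing (\<alpha> s) y) * Delta s (sx s P)) +
    cst (2 * c s / br s * pairing x (\<alpha>' s) * pairing (\<alpha> s) y) * gact s P" if s: "s \<in> R" for s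
  proof -
    have kk: "2 * c s / br s * pairing x (\<alpha>' s) = K s * ((1 - lam s) / br s * pairing x (\<alpha>' s))"
      using lam_ne_1[OF s] by (simp add: K_def)
    show ?thesis unfolding sx_simps Delta_lin_v[OF s pol_sv(2)[OF P]] sv_sx kk
      by (rule pf_eqI) (simp add: pfs algebra_simps)
  qed
  then have "(\<Sum>s\<in>R. cst (K s * pairing (\<alpha> s) y) * Delta s (sx s (lin_v x * P))) =
    lin_v x * (\<Sum>s\<in>R. cst (K s * pairing (\<alpha> s) y) * Delta s (sx s P)) +
    (\<Sum>s\<in>R. cst (2 * c s / br s * pairing x (\<alpha>' s) * pairing (\<alpha> s) y) * gact s P)"
    by (simp add: sum.distrib sum_distrib_left)
  then show ?thesis unfolding dunkl_def kap_def dv_mult[OF pol_lin(1) P] dv_basic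
    by (simp add: algebra_simps cst_simps(3)[symmetric])
qed

lemma conj_bij: "w \<in> W \<Longrightarrow> bij_betw (\<lambda>s. w ** s ** matrix_inv w) R R"
proof (rule bij_betwI[where g = "\<lambda>s. matrix_inv w ** s ** w"])
  assume w: "w \<in> W"
  then have i: "matrix_inv (matrix_inv w) = w" by (intro matrix_inv_eqI inv_l inv_r)
  show "(\<lambda>s. w ** s ** matrix_inv w) \<in> R \<rightarrow> R" using refl_conj_R[OF _ w] by blast
  show "(\<lambda>s. matrix_inv w ** s ** w) \<in> R \<rightarrow> R" using refl_conj_R[OF _ W_inv[OF w]] i by auto
  show "matrix_inv w ** (w ** x ** matrix_inv w) ** w = x" for x
    by (metis inv_l[OF w] matrix_mul_assoc matrix_mul_lid matrix_mul_rid)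
  show "w ** (matrix_inv w ** x ** w) ** matrix_inv w = x" for x
    by (metis inv_r[OF w] matrix_mul_assoc matrix_mul_lid matrix_mul_rid)
qed

lemma gact_sx: "w \<in> W \<Longrightarrow> s \<in> W \<Longrightarrow> gact w (sx s P) = sx (w ** s ** matrix_inv w) (gact w P)"
  unfolding gact_def sx_def subst_subst
  by (metis inv_l matrix_mul_assoc matrix_mul_lid matrix_mul_rid)

lemma gact_dunkl: assumes w: "w \<in> W" and P: "pol P" shows "gact w (dunkl y P) = dunkl (w *v y) (gact w P)"
proof -
  let ?h = "\<lambda>s. w ** s ** matrix_inv w"
  have "(\<Sum>s\<in>R. cst (K s * pairing (\<alpha> s) (w *v y)) * Delta s (sx s (gact w P))) =
    (\<Sum>s\<in>R. cst (K (?h s) * pairing (\<alpha> (?h s)) (w *v y)) * Delta (?h s) (sx (?h s) (gact w P)))"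
    by (rule sum.reindex_bij_betw[OF conj_bij[OF w], symmetric])
  also have "\<dots> = (\<Sum>s\<in>R. gact w (cst (K s * pairing (\<alpha> s) y) * Delta s (sx s P)))"
  proof (rule sum.cong, simp)
    fix s assume s: "s \<in> R"
    have k: "K (?h s) = K s" by (simp add: K_def refl_conj_lam[OF s w] refl_conj_c[OF s w])
    show "cst (K (?h s) * pairing (\<alpha> (?h s)) (w *v y)) * Delta (?h s) (sx (?h s) (gact w P)) =
      gact w (cst (K s * pairing (\<alpha> s) y) * Delta s (sx s P))"
      using gact_Delta[OF s w pol_sv(2)[OF P], of y s]
      by (simp add: k gact_simps cst_simps(3)[symmetric] mult.assoc gact_sx[OF w R_W[OF s]])
  qed
  finally show ?thesis
    by (simp add: dunkl_def gact_simps gact_sum) (simp add: gact_def dv_subst[OF P] matrix_vector_mul_assoc inv_l[OF w])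
qed

text \<open>Functions of \<open>\<xi>\<close> alone are the right base case, because
  \<open>dunkl\<close> merely multiplies them (\<open>dunkl_const\<close>). The rest is generated by
  the coordinates of \<open>v\<close>, whose commutators with \<open>dunkl\<close> are
  known.\<close>

lemma pol_induct_v [consumes 1, case_names base vco add]:
  assumes "pol P" "\<And>f. pol f \<Longrightarrow> (\<And>v v' \<xi>. f v \<xi> = f v' \<xi>) \<Longrightarrow> Q f"
    "\<And>P i. pol P \<Longrightarrow> Q P \<Longrightarrow> Q (lin_v (axis i 1) * P)" "\<And>P P'. pol P \<Longrightarrow> pol P' \<Longrightarrow> Q P \<Longrightarrow> Q P' \<Longrightarrow> Q (P + P')"
  shows "Q P"
proof -
  \<comment> \<open>The factor \<open>f\<close> collects the coordinates of \<open>\<xi>\<close> met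
    on the way.\<close>
  have "pol f \<Longrightarrow> pol P \<Longrightarrow> (\<And>v v' \<xi>. f v \<xi> = f v' \<xi>) \<Longrightarrow> Q (f * P)" if "pol P" for P f
    using that
  proof (induction arbitrary: f rule: pol_induct)
    case (cst k)
    show ?case
    proof (rule assms(2))
      show "pol (f * cst k)" using cst by (intro pol_intros)
      show "(f * cst k) v \<xi> = (f * cst k) v' \<xi>" for v v' \<xi>
      proof -
        have "f v \<xi> = f v' \<xi>" using cst by blast
        then show ?thesis by (simp add: pfs)
      qed
    qed
  next
    case (vco P i)
    have "Q (lin_v (axis i 1) * (f * P))" using vco by (intro assms(3) vco) (auto intro: pol_intros)
    then show ?case by (simp add: vco_lin mult.left_commute)
  next
    case (xco P i)
    have "Q ((f * xco i) * P)"
    proof (rule xco.IH)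
      show "pol (f * xco i)" using xco by (intro pol_intros)
      show "(f * xco i) v \<xi> = (f * xco i) v' \<xi>" for v v' \<xi>
      proof -
        have "f v \<xi> = f v' \<xi>" using xco by blast
        then show ?thesis by (simp add: pfs)
      qed
    qed (rule xco.hyps)
    then show ?case by (simp add: mult.assoc)
  next
    case (add P P')
    have "Q (f * P + f * P')" using add by (intro assms(4)) (auto intro: pol_intros)
    then show ?case by (simp add: distrib_left)
  qed
  from this[OF assms(1), of 1] assms(1) show ?thesis by (simp add: pol_one pfs)
qed

lemma dunkl_const: assumes f: "pol f" "\<And>v v' \<xi>. f v \<xi> = f v' \<xi>" shows "dunkl y f = lin_x y * f"
proof -
  have "(\<lambda>z. f (v + z *s y) \<xi>) = (\<lambda>z. f v \<xi>)" for v \<xi> using f(2) by blast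
  then have "dv y f = 0" by (intro dv_eqI) (simp add: pfs)
  moreover have "sv s (sx s f) = sx s f" for s
    by (rule pf_eqI) (simp add: sv_def sx_def subst_apply, rule f(2))
  ultimately show ?thesis by (simp add: dunkl_def Delta_zero pol_sv f)
qed

lemma dunkl_kap: "pol P \<Longrightarrow> dunkl y (kap y' x P) = cst (t * pairing x y') * dunkl y P -
     (\<Sum>s\<in>R. cst (2 * c s / br s * pairing x (\<alpha>' s) * pairing (\<alpha> s) y') * dunkl y (gact s P))"
  unfolding kap_def
  by (simp add: dunkl_diff dunkl_cmult dunkl_sum pol_intros pol_gact)

lemma refl_vec: "s \<in> R \<Longrightarrow> s *v y = y - ((1 - inverse (lam s)) / br s * pairing (\<alpha> s) y) *s \<alpha>' s"
  by (rule refl_act)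

text \<open>On functions of \<open>\<xi>\<close> alone both operators are multiplications. A
  covector factor \<open>x\<close> reduces the claim to the symmetry of the double commutator of
  \<open>x\<close> with \<open>y\<close> and \<open>y'\<close>, the inner one being
  \<open>kap\<close>.\<close>

lemma dunkl_comm: assumes "pol P" shows "dunkl y (dunkl y' P) = dunkl y' (dunkl y P)"
  using assms
proof (induction rule: pol_induct_v)
  case (base f)
  have "dunkl y f = lin_x y * f" "dunkl y' f = lin_x y' * f" using base dunkl_const by auto
  moreover have "dunkl a (lin_x b * f) = lin_x a * (lin_x b * f)" for a b
    using base by (intro dunkl_const) (auto simp: pfs lin_apply intro: pol_intros pol_lin)
  ultimately show ?case by (simp add: mult.left_commute)
next
  case (add P P') then show ?case by (simp add: dunkl_add pol_dunkl)
next
  case (vco P i)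
  let ?x = "axis i 1"
  have *: "kap y ?x (dunkl y' P) + dunkl y (kap y' ?x P) = kap y' ?x (dunkl y P) + dunkl y' (kap y ?x P)"
  proof -
    \<comment> \<open>Moving \<open>y'\<close> past \<open>s\<close> changes it by a multiple of the
      coroot with factor \<open>pairing (\<alpha> s) y'\<close>. The extra term carries the root
      values at both \<open>y\<close> and \<open>y'\<close> and is therefore symmetric.\<close>
    have "cst (2 * c s / br s * pairing ?x (\<alpha>' s) * pairing (\<alpha> s) y) * gact s (dunkl y' P)
        + cst (2 * c s / br s * pairing ?x (\<alpha>' s) * pairing (\<alpha> s) y') * dunkl y (gact s P)
      = cst (2 * c s / br s * pairing ?x (\<alpha>' s) * pairing (\<alpha> s) y') * gact s (dunkl y P)
        + cst (2 * c s / br s * pairing ?x (\<alpha>' s) * pairing (\<alpha> s) y) * dunkl y' (gact s P)" if s: "s \<in> R" for s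
      unfolding gact_dunkl[OF R_W[OF s] vco(1)] refl_vec[OF s] dunkl_linear'[OF pol_gact[OF vco(1)]]
      by (rule pf_eqI) (simp add: pfs algebra_simps)
    then have "(\<Sum>s\<in>R. cst (2 * c s / br s * pairing ?x (\<alpha>' s) * pairing (\<alpha> s) y) * gact s (dunkl y' P))
        + (\<Sum>s\<in>R. cst (2 * c s / br s * pairing ?x (\<alpha>' s) * pairing (\<alpha> s) y') * dunkl y (gact s P))
      = (\<Sum>s\<in>R. cst (2 * c s / br s * pairing ?x (\<alpha>' s) * pairing (\<alpha> s) y') * gact s (dunkl y P))
        + (\<Sum>s\<in>R. cst (2 * c s / br s * pairing ?x (\<alpha>' s) * pairing (\<alpha> s) y) * dunkl y' (gact s P))"
      unfolding sum.distrib[symmetric] by (rule sum.cong[OF refl])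
    then show ?thesis unfolding dunkl_kap[OF vco(1)] by (simp add: kap_def algebra_simps)
  qed
  have "dunkl a (dunkl b (lin_v ?x * P)) = lin_v ?x * dunkl a (dunkl b P) + kap a ?x (dunkl b P) + dunkl a (kap b ?x P)" for a b
    using vco(1) by (simp add: dunkl_lin_v dunkl_add pol_intros pol_lin pol_dunkl pol_kap)
  then show ?case using vco(2) * by (simp add: algebra_simps)
qed

section \<open>The Euler operator and its commutation relations\<close>

definition euler_op :: "'n pf \<Rightarrow> 'n pf" where
  "euler_op P = (\<Sum>i\<in>UNIV. vco i * dunkl (axis i 1) P) - (\<Sum>s\<in>R. cst (K s) * gact s P)"

lemma pol_euler_op: "pol P \<Longrightarrow> pol (euler_op P)"
  unfolding euler_op_def by (auto intro!: pol_intros pol_dunkl pol_gact)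

lemma euler_op_add: "pol P \<Longrightarrow> pol Q \<Longrightarrow> euler_op (P + Q) = euler_op P + euler_op Q"
  unfolding euler_op_def by (simp add: dunkl_add gact_simps distrib_left sum.distrib algebra_simps)
lemma euler_op_cmult: "pol P \<Longrightarrow> euler_op (cst k * P) = cst k * euler_op P"
  unfolding euler_op_def by (simp add: dunkl_cmult gact_simps sum_distrib_left right_diff_distrib mult.left_commute)

lemma vco_sum: "(\<Sum>i\<in>UNIV. vco i * (cst (k * x $ i) * P)) = cst k * lin_v x * P"
  by (rule pf_eqI) (simp add: pfs lin_apply sum_fun_apply pairing_def sum_distrib_left sum_distrib_right mult_ac)

lemma vco_kap_sum: "pol P \<Longrightarrow> (\<Sum>i\<in>UNIV. vco i * kap (axis i 1) x P) = cst t * lin_v x * P -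
    (\<Sum>s\<in>R. cst (2 * c s / br s * pairing x (\<alpha>' s)) * lin_v (\<alpha> s) * gact s P)"
proof -
  have 1: "(\<Sum>i\<in>UNIV. vco i * (cst (t * pairing x (axis i 1)) * P)) = cst t * lin_v x * P"
    using vco_sum[of t x P] by (simp only: pairing_simps)
  have "(\<Sum>i\<in>UNIV. vco i * (\<Sum>s\<in>R. cst (2 * c s / br s * pairing x (\<alpha>' s) * pairing (\<alpha> s) (axis i 1)) * gact s P))
    = (\<Sum>s\<in>R. \<Sum>i\<in>UNIV. vco i * (cst (2 * c s / br s * pairing x (\<alpha>' s) * pairing (\<alpha> s) (axis i 1)) * gact s P))"
    by (simp only: sum_distrib_left) (rule sum.swap)
  also have "\<dots> = (\<Sum>s\<in>R. cst (2 * c s / br s * pairing x (\<alpha>' s)) * lin_v (\<alpha> s) * gact s P)"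
  proof (rule sum.cong[OF refl], rule pf_eqI)
    fix s v \<xi>
    have "(\<Sum>i\<in>UNIV. v $ i * (k * \<alpha> s $ i * g)) = k * pairing (\<alpha> s) v * g" for k g
      by (simp add: pairing_def sum_distrib_left sum_distrib_right mult_ac)
    then show "(\<Sum>i\<in>UNIV. vco i * (cst (2 * c s / br s * pairing x (\<alpha>' s) * pairing (\<alpha> s) (axis i 1)) * gact s P)) v \<xi>
       = (cst (2 * c s / br s * pairing x (\<alpha>' s)) * lin_v (\<alpha> s) * gact s P) v \<xi>"
      by (simp only: pfs lin_apply sum_fun_apply pairing_simps)
  qed
  finally show ?thesis unfolding kap_def by (simp only: right_diff_distrib sum_subtractf 1)
qed

text \<open>This is \<open>[eu, x] = t x\<close>. The reflection terms from passing \<open>x\<close>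
  over the vectors cancel those from passing it over the reflections; the coefficients
  \<open>K s\<close> are made for this.\<close>

lemma euler_op_lin_v: assumes P: "pol P" shows "euler_op (lin_v x * P) = lin_v x * euler_op P + cst t * (lin_v x * P)"
proof -
  have 1: "(\<Sum>i\<in>UNIV. vco i * dunkl (axis i 1) (lin_v x * P)) =
    lin_v x * (\<Sum>i\<in>UNIV. vco i * dunkl (axis i 1) P) + (\<Sum>i\<in>UNIV. vco i * kap (axis i 1) x P)"
    by (simp add: dunkl_lin_v[OF P] distrib_left sum.distrib sum_distrib_left mult.left_commute)
  have "cst (K s) * gact s (lin_v x * P) = lin_v x * (cst (K s) * gact s P) -
      cst (2 * c s / br s * pairing x (\<alpha>' s)) * lin_v (\<alpha> s) * gact s P" if s: "s \<in> R" for s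
    unfolding gact_simps covec_inv[OF s] lin_linear
    by (rule pf_eqI) (use lam_ne_1[OF s] br[OF s] in \<open>simp add: pfs K_def divide_simps, simp add: algebra_simps\<close>)
  then have 2: "(\<Sum>s\<in>R. cst (K s) * gact s (lin_v x * P)) = lin_v x * (\<Sum>s\<in>R. cst (K s) * gact s P) -
      (\<Sum>s\<in>R. cst (2 * c s / br s * pairing x (\<alpha>' s)) * lin_v (\<alpha> s) * gact s P)"
    by (simp add: sum_subtractf sum_distrib_left)
  show ?thesis unfolding euler_op_def 1 2 vco_kap_sum[OF P] by (simp add: algebra_simps)
qed

text \<open>This is \<open>[eu, y] = - t y\<close>, by the same cancellation with \<open>y\<close>
  passed over the covectors; \<open>dunkl_comm\<close> removes the commutators among the
  vectors.\<close>

lemma euler_op_dunkl: assumes P: "pol P" shows "euler_op (dunkl y P) = dunkl y (euler_op P) - cst t * dunkl y P"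
proof -
  have k: "(\<Sum>i\<in>UNIV. kap y (axis i 1) (dunkl (axis i 1) P)) = cst t * dunkl y P -
    (\<Sum>s\<in>R. cst (2 * c s / br s * pairing (\<alpha> s) y) * gact s (dunkl (\<alpha>' s) P))"
  proof -
    have 1: "(\<Sum>i\<in>UNIV. cst (t * pairing (axis i 1) y) * dunkl (axis i 1) P) = cst t * dunkl y P"
      unfolding dunkl_sum_vec[OF P, of "($) y" "\<lambda>i. axis i 1" UNIV, unfolded axis_sum] sum_distrib_left
      by (rule sum.cong[OF refl], rule pf_eqI) (simp add: pfs mult_ac)
    have "(\<Sum>i\<in>UNIV. \<Sum>s\<in>R. cst (2 * c s / br s * pairing (axis i 1) (\<alpha>' s) * pairing (\<alpha> s) y) * gact s (dunkl (axis i 1) P))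
      = (\<Sum>s\<in>R. \<Sum>i\<in>UNIV. cst (2 * c s / br s * pairing (axis i 1) (\<alpha>' s) * pairing (\<alpha> s) y) * gact s (dunkl (axis i 1) P))"
      by (rule sum.swap)
    also have "\<dots> = (\<Sum>s\<in>R. cst (2 * c s / br s * pairing (\<alpha> s) y) * gact s (dunkl (\<alpha>' s) P))"
    proof (rule sum.cong[OF refl])
      fix s
      show "(\<Sum>i\<in>UNIV. cst (2 * c s / br s * pairing (axis i 1) (\<alpha>' s) * pairing (\<alpha> s) y) * gact s (dunkl (axis i 1) P)) =
         cst (2 * c s / br s * pairing (\<alpha> s) y) * gact s (dunkl (\<alpha>' s) P)"
        unfolding dunkl_sum_vec[OF P, of "($) (\<alpha>' s)" "\<lambda>i. axis i 1" UNIV, unfolded axis_sum] gact_sum sum_distrib_left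
        by (rule sum.cong[OF refl], rule pf_eqI) (simp add: gact_simps pfs mult_ac)
    qed
    finally show ?thesis unfolding kap_def by (simp only: sum_subtractf 1)
  qed
  have 1: "dunkl y (\<Sum>i\<in>UNIV. vco i * dunkl (axis i 1) P) = (\<Sum>i\<in>UNIV. vco i * dunkl (axis i 1) (dunkl y P))
     + (\<Sum>i\<in>UNIV. kap y (axis i 1) (dunkl (axis i 1) P))"
    by (simp add: dunkl_sum P pol_intros pol_dunkl vco_lin pol_lin dunkl_lin_v sum.distrib dunkl_comm[OF P, of y])
  have "cst (K s) * dunkl y (gact s P) = cst (K s) * gact s (dunkl y P)
       - cst (2 * c s / br s * pairing (\<alpha> s) y) * gact s (dunkl (\<alpha>' s) P)" if s: "s \<in> R" for s
  proof -
    have sW: "s \<in> W" using s R_W by blast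
    have "dunkl y (gact s P) = gact s (dunkl (matrix_inv s *v y) P)"
      by (simp add: gact_dunkl[OF sW P] inv_vec[OF sW])
    then show ?thesis unfolding refl_inv[OF s] dunkl_linear'[OF P] gact_simps
      by (intro pf_eqI) (use lam_ne_1[OF s] br[OF s] in \<open>simp add: pfs K_def divide_simps, simp add: algebra_simps\<close>)
  qed
  then have 2: "(\<Sum>s\<in>R. cst (K s) * dunkl y (gact s P)) = (\<Sum>s\<in>R. cst (K s) * gact s (dunkl y P))
       - (\<Sum>s\<in>R. cst (2 * c s / br s * pairing (\<alpha> s) y) * gact s (dunkl (\<alpha>' s) P))"
    by (simp add: sum_subtractf)
  have "dunkl y (euler_op P) = dunkl y (\<Sum>i\<in>UNIV. vco i * dunkl (axis i 1) P) - (\<Sum>s\<in>R. cst (K s) * dunkl y (gact s P))"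
    unfolding euler_op_def by (simp add: P dunkl_diff dunkl_sum dunkl_cmult pol_intros pol_dunkl pol_gact)
  then show ?thesis unfolding euler_op_def 1 2 k by (simp add: algebra_simps)
qed

lemma euler_op_gact: assumes w: "w \<in> W" and P: "pol P" shows "euler_op (gact w P) = gact w (euler_op P)"
proof -
  have 1: "gact w (\<Sum>i\<in>UNIV. vco i * dunkl (axis i 1) P) = (\<Sum>i\<in>UNIV. vco i * dunkl (axis i 1) (gact w P))"
  proof -
    have vc: "gact w (vco i) = (\<Sum>k\<in>UNIV. cst (matrix_inv w $ i $ k) * vco k)" for i
    proof -
      have "axis i 1 v* matrix_inv w = (\<chi> k. matrix_inv w $ i $ k)"
        by (simp add: vec_eq_iff vector_matrix_mult_def axis_def if_distrib if_distribR cong: if_cong)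
      then show ?thesis unfolding vco_lin[of i] gact_simps lin_v_sum[of "axis i 1 v* matrix_inv w"] by simp
    qed
    have dk: "dunkl (w *v axis i 1) (gact w P) = (\<Sum>l\<in>UNIV. cst (w $ l $ i) * dunkl (axis l 1) (gact w P))" for i
    proof -
      have "w *v axis i 1 = (\<Sum>l\<in>UNIV. w $ l $ i *s axis l 1)"
        by (simp add: vec_eq_iff matrix_vector_mult_def axis_def if_distrib if_distribR cong: if_cong)
      then show ?thesis by (simp only: dunkl_sum_vec[OF pol_gact[OF P]])
    qed
    \<comment> \<open>Entries of \<open>w ** matrix_inv w = mat 1\<close>: the sum over a pair of
      dual bases does not depend on the pair.\<close>
    have e: "(\<Sum>i\<in>UNIV. matrix_inv w $ i $ k * w $ l $ i) = (if l = k then 1 else 0)" for k l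
      using inv_r[OF w] by (simp add: vec_eq_iff matrix_matrix_mult_def mat_def mult.commute)
    have "gact w (\<Sum>i\<in>UNIV. vco i * dunkl (axis i 1) P) =
      (\<Sum>i\<in>UNIV. (\<Sum>k\<in>UNIV. cst (matrix_inv w $ i $ k) * vco k) * (\<Sum>l\<in>UNIV. cst (w $ l $ i) * dunkl (axis l 1) (gact w P)))"
      by (simp add: gact_sum gact_simps(2) gact_dunkl[OF w P] vc dk)
    also have "\<dots> = (\<Sum>i\<in>UNIV. \<Sum>k\<in>UNIV. \<Sum>l\<in>UNIV. cst (matrix_inv w $ i $ k * w $ l $ i) * (vco k * dunkl (axis l 1) (gact w P)))"
      by (simp add: sum_product cst_simps(3)[symmetric] mult_ac)
    also have "\<dots> = (\<Sum>k\<in>UNIV. \<Sum>l\<in>UNIV. \<Sum>i\<in>UNIV. cst (matrix_inv w $ i $ k * w $ l $ i) * (vco k * dunkl (axis l 1) (gact w P)))"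
      by (subst sum.swap, rule sum.cong[OF refl], rule sum.swap)
    also have "\<dots> = (\<Sum>k\<in>UNIV. \<Sum>l\<in>UNIV. cst (if l = k then 1 else 0) * (vco k * dunkl (axis l 1) (gact w P)))"
    proof -
      have cs: "(\<Sum>i\<in>I. cst (f i)) = cst (\<Sum>i\<in>I. f i)" for f :: "'n \<Rightarrow> complex" and I
        by (induction I rule: infinite_finite_induct) (simp_all add: cst_simps)
      show ?thesis by (simp only: sum_distrib_right[symmetric] cs e)
    qed
    also have "\<dots> = (\<Sum>k\<in>UNIV. vco k * dunkl (axis k 1) (gact w P))"
      by (rule sum.cong[OF refl]) (simp add: if_distrib if_distribR cst_simps cong: if_cong)
    finally show ?thesis .
  qed
  let ?h = "\<lambda>s. w ** s ** matrix_inv w"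
  have "(\<Sum>s\<in>R. cst (K s) * gact s (gact w P)) = (\<Sum>s\<in>R. cst (K (?h s)) * gact (?h s) (gact w P))"
    by (rule sum.reindex_bij_betw[OF conj_bij[OF w], symmetric])
  also have "\<dots> = (\<Sum>s\<in>R. gact w (cst (K s) * gact s P))"
  proof (rule sum.cong[OF refl])
    fix s assume s: "s \<in> R"
    have k: "K (?h s) = K s" by (simp add: K_def refl_conj_lam[OF s w] refl_conj_c[OF s w])
    have "?h s ** w = w ** s" by (metis inv_l[OF w] matrix_mul_assoc matrix_mul_rid)
    then show "cst (K (?h s)) * gact (?h s) (gact w P) = gact w (cst (K s) * gact s P)"
      using refl_conj_R[OF s w] by (simp add: k gact_simps gact_gact w s R_W)
  qed
  finally have 2: "(\<Sum>s\<in>R. cst (K s) * gact s (gact w P)) = gact w (\<Sum>s\<in>R. cst (K s) * gact s P)"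
    by (simp only: gact_sum)
  show ?thesis by (simp only: euler_op_def gact_simps(3) 1 2)
qed

end

section \<open>The smash product and its polynomial representation\<close>

abbreviation "CC \<equiv> (ring_of_type_algebra :: complex ring)"

lemma CC_simps: "carrier CC = UNIV" "a \<oplus>\<^bsub>CC\<^esub> b = a + b" "a \<otimes>\<^bsub>CC\<^esub> b = a * b" "\<one>\<^bsub>CC\<^esub> = 1" "\<zero>\<^bsub>CC\<^esub> = 0"
  by (simp_all add: ring_of_type_algebra_def)

lemma complex_algebraI:
  fixes A :: "(complex, 'a, 'm) module_scheme" (structure)
  assumes "ring A" "\<And>k x. x \<in> carrier A \<Longrightarrow> k \<odot> x \<in> carrier A"
    "\<And>k l x. x \<in> carrier A \<Longrightarrow> (k + l) \<odot> x = k \<odot> x \<oplus> l \<odot> x"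
    "\<And>k x y. x \<in> carrier A \<Longrightarrow> y \<in> carrier A \<Longrightarrow> k \<odot> (x \<oplus> y) = k \<odot> x \<oplus> k \<odot> y"
    "\<And>k l x. x \<in> carrier A \<Longrightarrow> (k * l) \<odot> x = k \<odot> (l \<odot> x)"
    "\<And>x. x \<in> carrier A \<Longrightarrow> 1 \<odot> x = x"
    "\<And>k x y. x \<in> carrier A \<Longrightarrow> y \<in> carrier A \<Longrightarrow> (k \<odot> x) \<otimes> y = k \<odot> (x \<otimes> y)"
    "\<And>k x y. x \<in> carrier A \<Longrightarrow> y \<in> carrier A \<Longrightarrow> x \<otimes> (k \<odot> y) = k \<odot> (x \<otimes> y)"
  shows "complex_algebra A"
proof -
  interpret ring A by fact
  have "Module.module CC A"
    by (rule moduleI) (auto simp: assms CC_simps cring_from_type_algebra is_abelian_group)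
  then show ?thesis using assms by (simp add: complex_algebra_def)
qed

locale calg =
  fixes A :: "(complex, 'a, 'm) module_scheme" (structure)
  assumes complex_algebra: "complex_algebra A"
begin

sublocale ring A using complex_algebra by (simp add: complex_algebra_def)
sublocale M: Module.module CC A using complex_algebra by (simp add: complex_algebra_def)

lemma sm_closed [simp, intro]: "x \<in> carrier A \<Longrightarrow> k \<odot> x \<in> carrier A" using M.smult_closed by (simp add: CC_simps)
lemma sm_l_distr: "x \<in> carrier A \<Longrightarrow> (k + l) \<odot> x = k \<odot> x \<oplus> l \<odot> x" using M.smult_l_distr[of k l x] by (simp add: CC_simps)
lemma sm_r_distr: "x \<in> carrier A \<Longrightarrow> y \<in> carrier A \<Longrightarrow> k \<odot> (x \<oplus> y) = k \<odot> x \<oplus> k \<odot> y" using M.smult_r_distr[of k x y] by (simp add: CC_simps)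
lemma sm_assoc: "x \<in> carrier A \<Longrightarrow> k \<odot> (l \<odot> x) = (k * l) \<odot> x" using M.smult_assoc1[of k l x] by (simp add: CC_simps)
lemma sm_one [simp]: "x \<in> carrier A \<Longrightarrow> 1 \<odot> x = x" using M.smult_one[of x] by (simp add: CC_simps)
lemma sm_zero [simp]: "x \<in> carrier A \<Longrightarrow> 0 \<odot> x = \<zero>" using M.smult_l_null[of x] by (simp add: CC_simps)
lemma sm_r_zero [simp]: "k \<odot> \<zero> = \<zero>" using M.smult_r_null[of k] by (simp add: CC_simps)
lemma sm_mult_l: "x \<in> carrier A \<Longrightarrow> y \<in> carrier A \<Longrightarrow> (k \<odot> x) \<otimes> y = k \<odot> (x \<otimes> y)"
  using complex_algebra by (simp add: complex_algebra_def)
lemma sm_mult_r: "x \<in> carrier A \<Longrightarrow> y \<in> carrier A \<Longrightarrow> x \<otimes> (k \<odot> y) = k \<odot> (x \<otimes> y)"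
  using complex_algebra by (simp add: complex_algebra_def)
lemma sm_minus: "x \<in> carrier A \<Longrightarrow> (-1) \<odot> x = \<ominus> x"
proof -
  assume x: "x \<in> carrier A"
  have "(-1) \<odot> x \<oplus> x = ((-1) + 1) \<odot> x" using sm_l_distr[OF x, of "-1" 1] x by simp
  then show ?thesis using x by (intro minus_equality[symmetric]) auto
qed
lemma minus_sm: "x \<in> carrier A \<Longrightarrow> y \<in> carrier A \<Longrightarrow> x \<ominus> y = x \<oplus> (-1) \<odot> y"
  by (simp add: a_minus_def sm_minus)

lemma subspaceI: "V \<subseteq> carrier A \<Longrightarrow> \<zero> \<in> V \<Longrightarrow> (\<And>x y. x \<in> V \<Longrightarrow> y \<in> V \<Longrightarrow> x \<oplus> y \<in> V) \<Longrightarrow>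
    (\<And>k x. x \<in> V \<Longrightarrow> k \<odot> x \<in> V) \<Longrightarrow> subspace_of V A"
  by (rule M.submoduleI) (auto simp: CC_simps sm_minus[symmetric] subset_iff)

lemma subspaceD: assumes "subspace_of V A"
  shows "V \<subseteq> carrier A" "\<zero> \<in> V" "\<And>x y. x \<in> V \<Longrightarrow> y \<in> V \<Longrightarrow> x \<oplus> y \<in> V"
    "\<And>k x. x \<in> V \<Longrightarrow> k \<odot> x \<in> V" "\<And>x y. x \<in> V \<Longrightarrow> y \<in> V \<Longrightarrow> x \<ominus> y \<in> V"
proof -
  note E = M.submoduleE[OF assms]
  show V: "V \<subseteq> carrier A" using E(1) .
  show a: "\<And>x y. x \<in> V \<Longrightarrow> y \<in> V \<Longrightarrow> x \<oplus> y \<in> V" using E by simp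
  show k: "\<And>k x. x \<in> V \<Longrightarrow> k \<odot> x \<in> V" using E by (simp add: CC_simps)
  show "\<zero> \<in> V" 
  proof -
    obtain x where x: "x \<in> V" using E(2) by blast
    then show ?thesis using k[OF x, of 0] V by (simp add: subset_iff)
  qed
  show "\<And>x y. x \<in> V \<Longrightarrow> y \<in> V \<Longrightarrow> x \<ominus> y \<in> V"
  proof -
    fix x y assume "x \<in> V" "y \<in> V"
    then show "x \<ominus> y \<in> V" using a k[of y "-1"] V by (simp add: minus_sm subset_iff)
  qed
qed

end

section \<open>Calculus in the free algebra\<close>

lemma poly_mapping_monomials: "(\<Sum>a\<in>Poly_Mapping.keys p. Poly_Mapping.single a (Poly_Mapping.lookup p a)) = p"
  by (rule poly_mapping_eqI)
     (simp add: lookup_sum lookup_single when_def in_keys_iff if_distrib cong: if_cong)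

lemma tensor_induct [case_names scalar letter add]:
  fixes p :: "'n tensor"
  assumes "\<And>k. P (tensor_scalar k)" "\<And>l p. P p \<Longrightarrow> P (Poly_Mapping.single (Word [l]) 1 * p)"
    "\<And>p q. P p \<Longrightarrow> P q \<Longrightarrow> P (p + q)"
  shows "P p"
proof -
  have 1: "P (Poly_Mapping.single (Word us) k)" for us k
  proof (induction us)
    case Nil then show ?case using assms(1)[of k] by (simp add: tensor_scalar_def zero_word_def)
  next
    case (Cons l us)
    show ?case using assms(2)[OF Cons, of l] by (simp add: mult_single plus_word_def)
  qed
  have 2: "P (Poly_Mapping.single u k)" for u k using 1[of "letters u"] by simp
  have 3: "P 0" using assms(1)[of 0] by (simp add: tensor_scalar_def)
  have "P (\<Sum>a\<in>K. Poly_Mapping.single a (Poly_Mapping.lookup p a))" if "finite K" for K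
    using that by (induction K rule: finite_induct) (auto intro: assms(3) 2 3)
  then show ?thesis using poly_mapping_monomials[of p] finite_keys[of p] by metis
qed

text \<open>The coefficient is passed to \<open>g\<close>, as scalars enter differently in the
  targets: through \<open>tensor_scalar\<close> for tensors and through \<open>cst\<close> for
  polynomials.\<close>

definition linext :: "('a \<Rightarrow> complex \<Rightarrow> 'b) \<Rightarrow> ('a \<Rightarrow>\<^sub>0 complex) \<Rightarrow> 'b :: comm_monoid_add" where
  "linext g p = (\<Sum>u\<in>Poly_Mapping.keys p. g u (Poly_Mapping.lookup p u))"

lemma linext_superset: assumes "\<And>u. g u 0 = 0" "finite K" "Poly_Mapping.keys p \<subseteq> K"
  shows "linext g p = (\<Sum>u\<in>K. g u (Poly_Mapping.lookup p u))"
  unfolding linext_def using assms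
  by (intro sum.mono_neutral_left) (auto simp: in_keys_iff)

lemma linext_add: assumes "\<And>u. g u 0 = 0" "\<And>u a b. g u (a + b) = g u a + g u b"
  shows "linext g (p + q) = linext g p + linext g q"
proof -
  let ?K = "Poly_Mapping.keys p \<union> Poly_Mapping.keys q"
  have "linext g (p + q) = (\<Sum>u\<in>?K. g u (Poly_Mapping.lookup (p + q) u))"
    by (rule linext_superset) (use assms Poly_Mapping.keys_add[of p q] in auto)
  also have "\<dots> = linext g p + linext g q"
    by (subst (1 2) linext_superset[where K = ?K]) (auto simp: assms lookup_add sum.distrib)
  finally show ?thesis .
qed

lemma linext_single: "g u 0 = 0 \<Longrightarrow> linext g (Poly_Mapping.single u k) = g u k"
  by (cases "k = 0") (simp_all add: linext_def)

lemma tensor_scalar_simps: "tensor_scalar 0 = 0" "tensor_scalar 1 = 1" "tensor_scalar (a + b) = tensor_scalar a + tensor_scalar b"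
  "tensor_scalar a * tensor_scalar b = tensor_scalar (a * b)"
  by (simp_all add: tensor_scalar_def single_add mult_single)

lemma tensor_scalar_comm: "tensor_scalar k * p = p * tensor_scalar k"
proof (induction p rule: tensor_induct)
  case (scalar l) then show ?case by (simp add: tensor_scalar_simps mult.commute)
next
  case (letter l p)
  have *: "tensor_scalar k * Poly_Mapping.single (Word [l]) 1 = Poly_Mapping.single (Word [l]) 1 * tensor_scalar k"
    by (simp add: tensor_scalar_def mult_single)
  show ?case by (simp only: mult.assoc[symmetric] *) (simp only: mult.assoc letter)
qed (simp add: algebra_simps)

lemma tensor_scalar_left: "p * (tensor_scalar k * q) = tensor_scalar k * (p * q)"
  by (simp only: tensor_scalar_comm[of k] mult.assoc)

lemma tensor_act_linext: "tensor_act w = linext (\<lambda>u k. tensor_scalar k * prod_list (map (letter_act w) (letters u)))"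
  by (simp add: fun_eq_iff tensor_act_def linext_def)

lemma tensor_act_add: "tensor_act w (p + q) = tensor_act w p + tensor_act w q"
  unfolding tensor_act_linext by (rule linext_add) (simp_all add: tensor_scalar_simps distrib_right)

lemma tensor_act_single: "tensor_act w (Poly_Mapping.single u k) = tensor_scalar k * prod_list (map (letter_act w) (letters u))"
  unfolding tensor_act_linext by (subst linext_single) (simp_all add: tensor_scalar_simps)

lemma tensor_act_scalar: "tensor_act w (tensor_scalar k) = tensor_scalar k"
  using tensor_act_single[of w 0 k] by (simp add: tensor_scalar_def zero_word_def)

lemma tensor_act_letter: "tensor_act w (Poly_Mapping.single (Word [l]) 1 * p) = letter_act w l * tensor_act w p"
proof -
  have 1: "tensor_act w (Poly_Mapping.single (Word [l]) 1 * Poly_Mapping.single u k) = letter_act w l * tensor_act w (Poly_Mapping.single u k)" for u k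
    by (simp add: mult_single tensor_act_single plus_word_def tensor_scalar_left)
  have 0: "tensor_act w 0 = 0" by (simp add: tensor_act_def)
  have "tensor_act w (Poly_Mapping.single (Word [l]) 1 * (\<Sum>a\<in>K. Poly_Mapping.single a (Poly_Mapping.lookup p a))) =
      letter_act w l * tensor_act w (\<Sum>a\<in>K. Poly_Mapping.single a (Poly_Mapping.lookup p a))" if "finite K" for K
    using that by (induction K rule: finite_induct) (simp_all add: 0 1 tensor_act_add distrib_left)
  then show ?thesis using poly_mapping_monomials[of p] finite_keys[of p] by metis
qed

lemma tensor_act_mult: "tensor_act w (p * q) = tensor_act w p * tensor_act w q"
proof (induction p rule: tensor_induct)
  case (scalar k)
  show ?case
  proof (induction q rule: tensor_induct)
    case (letter l q)
    have "tensor_scalar k * (Poly_Mapping.single (Word [l]) 1 * q) = Poly_Mapping.single (Word [l]) 1 * (tensor_scalar k * q)"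
      by (simp only: tensor_scalar_left)
    then show ?case by (simp only: tensor_act_letter letter.IH tensor_act_scalar) (simp only: tensor_scalar_left)
  qed (simp_all add: tensor_scalar_simps tensor_act_scalar tensor_act_add distrib_left)
next
  case (letter l p)
  then show ?case by (simp add: mult.assoc tensor_act_letter)
qed (simp add: distrib_right tensor_act_add)

lemma tensor_act_zero: "tensor_act w 0 = 0" by (simp add: tensor_act_def)
lemma tensor_act_one: "tensor_act w 1 = 1" using tensor_act_scalar[of w 1] by (simp add: tensor_scalar_simps)
lemma tensor_act_sum: "tensor_act w (\<Sum>i\<in>I. f i) = (\<Sum>i\<in>I. tensor_act w (f i))"
  by (induction I rule: infinite_finite_induct) (simp_all add: tensor_act_zero tensor_act_add)

lemma tensor_vec_sum: "tensor_vec y = (\<Sum>i\<in>UNIV. tensor_scalar (y $ i) * Poly_Mapping.single (Word [Ly i]) 1)"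
  and tensor_covec_sum: "tensor_covec y = (\<Sum>i\<in>UNIV. tensor_scalar (y $ i) * Poly_Mapping.single (Word [Lx i]) 1)"
  by (simp_all add: tensor_vec_def tensor_covec_def tensor_scalar_def mult_single)

lemma tensor_vec_linear: "tensor_vec (\<Sum>i\<in>I. k i *s y i) = (\<Sum>i\<in>I. tensor_scalar (k i) * tensor_vec (y i))"
  and tensor_covec_linear: "tensor_covec (\<Sum>i\<in>I. k i *s y i) = (\<Sum>i\<in>I. tensor_scalar (k i) * tensor_covec (y i))"
proof -
  have s: "tensor_scalar (\<Sum>i\<in>I. f i) = (\<Sum>i\<in>I. tensor_scalar (f i))" for f :: "'b \<Rightarrow> complex" and I
    by (induction I rule: infinite_finite_induct) (simp_all add: tensor_scalar_simps)
  show "tensor_vec (\<Sum>i\<in>I. k i *s y i) = (\<Sum>i\<in>I. tensor_scalar (k i) * tensor_vec (y i))"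
    "tensor_covec (\<Sum>i\<in>I. k i *s y i) = (\<Sum>i\<in>I. tensor_scalar (k i) * tensor_covec (y i))"
    by (simp_all add: tensor_vec_sum tensor_covec_sum s sum_distrib_left sum_distrib_right
        tensor_scalar_simps(4)[symmetric] mult.assoc) (rule sum.swap)+
qed

lemma tensor_act_vec: "tensor_act w (tensor_vec y) = tensor_vec (w *v y)"
proof -
  have 1: "tensor_act w (Poly_Mapping.single (Word [Ly i]) 1) = tensor_vec (w *v axis i 1)" for i
    by (simp add: tensor_act_single tensor_scalar_simps)
  have "w *v y = (\<Sum>i\<in>UNIV. y $ i *s (w *v axis i 1))"
    by (subst axis_sum[of y, symmetric]) (simp only: vec.linear_sum[OF matrix_vector_mul_linear_gen] matrix_vector_mult_scale)
  then show ?thesis unfolding tensor_vec_sum[of y] by (simp only: tensor_vec_linear tensor_act_sum tensor_act_mult tensor_act_scalar 1)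
qed

lemma vector_matrix_sum: "(\<Sum>i\<in>I. f i) v* M = (\<Sum>i\<in>I. f i v* M :: complex ^ 'n::finite)"
  by (induction I rule: infinite_finite_induct) (simp_all add: vec_eq_iff vector_matrix_mult_def algebra_simps sum.distrib)

lemma tensor_act_covec: "tensor_act w (tensor_covec y) = tensor_covec (dual_act w y)"
proof -
  have 1: "tensor_act w (Poly_Mapping.single (Word [Lx i]) 1) = tensor_covec (dual_act w (axis i 1))" for i
    by (simp add: tensor_act_single tensor_scalar_simps)
  have "dual_act w y = (\<Sum>i\<in>UNIV. y $ i *s (dual_act w (axis i 1)))"
    unfolding dual_act_def
    by (subst axis_sum[of y, symmetric]) (simp only: vector_matrix_sum vector_matrix_mult_scale)
  then show ?thesis unfolding tensor_covec_sum[of y] by (simp only: tensor_covec_linear tensor_act_sum tensor_act_mult tensor_act_scalar 1)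
qed

lemma single_letter: "Poly_Mapping.single (Word [Ly i]) 1 = tensor_vec (axis i 1)"
  "Poly_Mapping.single (Word [Lx i]) 1 = tensor_covec (axis i 1)"
proof -
  have "tensor_scalar (axis i 1 $ j) * Poly_Mapping.single (Word [l j]) 1 = (if j = i then Poly_Mapping.single (Word [l j]) 1 else 0)" for j l
    by (simp add: axis_def tensor_scalar_simps)
  note * = this
  show "Poly_Mapping.single (Word [Ly i]) 1 = tensor_vec (axis i 1)"
    unfolding tensor_vec_sum * by simp
  show "Poly_Mapping.single (Word [Lx i]) 1 = tensor_covec (axis i 1)"
    unfolding tensor_covec_sum * by simp
qed

context refl_data
begin

lemma tensor_act_comp: assumes a: "a \<in> W" and b: "b \<in> W" shows "tensor_act a (tensor_act b p) = tensor_act (a ** b) p"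
proof (induction p rule: tensor_induct)
  case (letter l p)
  have "tensor_act a (letter_act b l) = letter_act (a ** b) l"
    by (cases l) (simp_all add: tensor_act_vec tensor_act_covec matrix_vector_mul_assoc dual_act_def
        vector_matrix_mul_assoc inv_mult[OF a b])
  then show ?case unfolding tensor_act_letter tensor_act_mult[of a "letter_act b l"] using letter by simp
qed (simp_all add: tensor_act_scalar tensor_act_add)

lemma tensor_act_id: "tensor_act (mat 1) p = (p :: 'n tensor)"
proof (induction p rule: tensor_induct)
  case (letter l p)
  have "letter_act (mat 1) l = Poly_Mapping.single (Word [l]) 1"
    by (cases l) (simp_all add: dual_act_def inv_one single_letter)
  then show ?case using letter by (simp add: tensor_act_letter)
qed (simp_all add: tensor_act_scalar tensor_act_add)

section \<open>The smash product is an algebra\<close>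

abbreviation "Sm \<equiv> smash W"

lemma Sm_simps: "carrier Sm = {F. \<forall>w. w \<notin> W \<longrightarrow> F w = 0}" "\<one>\<^bsub>Sm\<^esub> = (\<lambda>w. if w = mat 1 then 1 else 0)"
  "\<zero>\<^bsub>Sm\<^esub> = 0" "F \<oplus>\<^bsub>Sm\<^esub> G = F + G" "k \<odot>\<^bsub>Sm\<^esub> F = (\<lambda>w. tensor_scalar k * F w)"
  by (simp_all add: smash_def zero_fun_def plus_fun_def)

lemma W_reindex: assumes "a \<in> W" shows "(\<Sum>w\<in>W. f w) = (\<Sum>b\<in>W. f (a ** b))"
proof (rule sum.reindex_bij_betw[symmetric], rule bij_betwI[where g = "\<lambda>w. matrix_inv a ** w"])
  show "matrix_inv a ** (a ** b) = b" "a ** (matrix_inv a ** b) = b" for b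
    by (simp_all add: matrix_mul_assoc inv_l inv_r assms)
qed (auto simp: assms W_mult W_inv)

lemma Sm_mult: "w \<in> W \<Longrightarrow> (F \<otimes>\<^bsub>Sm\<^esub> G) w = (\<Sum>a\<in>W. F a * tensor_act a (G (matrix_inv a ** w)))"
proof -
  assume w: "w \<in> W"
  have "(\<Sum>b\<in>W. if a ** b = w then F a * tensor_act a (G b) else 0) = F a * tensor_act a (G (matrix_inv a ** w))" if a: "a \<in> W" for a
  proof -
    have "a ** b = w \<longleftrightarrow> b = matrix_inv a ** w" for b
      by (metis a inv_l inv_r matrix_mul_assoc matrix_mul_lid)
    then show ?thesis using fin W_mult[OF W_inv[OF a] w] by simp
  qed
  then show ?thesis by (simp add: smash_def)
qed

lemma Sm_mult_out: "w \<notin> W \<Longrightarrow> (F \<otimes>\<^bsub>Sm\<^esub> G) w = 0"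
  by (auto simp: smash_def W_mult intro!: sum.neutral)

lemma Sm_eqI: "F \<in> carrier Sm \<Longrightarrow> G \<in> carrier Sm \<Longrightarrow> (\<And>w. w \<in> W \<Longrightarrow> F w = G w) \<Longrightarrow> F = G"
  by (rule ext) (metis (mono_tags, lifting) Sm_simps(1) mem_Collect_eq)

lemma Sm_mult_closed: "F \<otimes>\<^bsub>Sm\<^esub> G \<in> carrier Sm" using Sm_mult_out by (simp add: Sm_simps)

lemma Sm_ring: "ring Sm"
proof (rule ringI)
  show "abelian_group Sm"
  proof (rule abelian_groupI)
    fix x assume "x \<in> carrier Sm"
    then show "\<exists>y\<in>carrier Sm. y \<oplus>\<^bsub>Sm\<^esub> x = \<zero>\<^bsub>Sm\<^esub>"
      by (intro bexI[of _ "- x"]) (auto simp: Sm_simps uminus_apply)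
  qed (auto simp: Sm_simps pfs add.assoc add.commute)
  show "Group.monoid Sm"
  proof (rule monoidI)
    fix F G H assume FGH: "F \<in> carrier Sm" "G \<in> carrier Sm" "H \<in> carrier Sm"
    show "F \<otimes>\<^bsub>Sm\<^esub> G \<otimes>\<^bsub>Sm\<^esub> H = F \<otimes>\<^bsub>Sm\<^esub> (G \<otimes>\<^bsub>Sm\<^esub> H)"
    proof (rule Sm_eqI[OF Sm_mult_closed Sm_mult_closed])
      fix w assume w: "w \<in> W"
      have "(F \<otimes>\<^bsub>Sm\<^esub> G \<otimes>\<^bsub>Sm\<^esub> H) w = (\<Sum>a\<in>W. (\<Sum>d\<in>W. F d * tensor_act d (G (matrix_inv d ** a))) * tensor_act a (H (matrix_inv a ** w)))"
        by (simp add: Sm_mult[OF w] Sm_mult)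
      also have "\<dots> = (\<Sum>d\<in>W. \<Sum>a\<in>W. F d * (tensor_act d (G (matrix_inv d ** a)) * tensor_act a (H (matrix_inv a ** w))))"
        by (simp only: sum_distrib_right mult.assoc) (rule sum.swap)
      \<comment> \<open>Substitution \<open>a = d ** b\<close> in the inner sum.\<close>
      also have "\<dots> = (\<Sum>d\<in>W. \<Sum>b\<in>W. F d * (tensor_act d (G b) * tensor_act d (tensor_act b (H (matrix_inv b ** (matrix_inv d ** w))))))"
      proof (rule sum.cong[OF refl])
        fix d assume d: "d \<in> W"
        show "(\<Sum>a\<in>W. F d * (tensor_act d (G (matrix_inv d ** a)) * tensor_act a (H (matrix_inv a ** w)))) =
          (\<Sum>b\<in>W. F d * (tensor_act d (G b) * tensor_act d (tensor_act b (H (matrix_inv b ** (matrix_inv d ** w))))))"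
          by (subst W_reindex[OF d]) (simp add: tensor_act_comp d inv_mult matrix_mul_assoc inv_l)
      qed
      also have "\<dots> = (F \<otimes>\<^bsub>Sm\<^esub> (G \<otimes>\<^bsub>Sm\<^esub> H)) w"
        by (simp add: Sm_mult[OF w] Sm_mult W_mult W_inv w tensor_act_sum tensor_act_mult sum_distrib_left)
      finally show "(F \<otimes>\<^bsub>Sm\<^esub> G \<otimes>\<^bsub>Sm\<^esub> H) w = (F \<otimes>\<^bsub>Sm\<^esub> (G \<otimes>\<^bsub>Sm\<^esub> H)) w" .
    qed
  next
    fix F assume F: "F \<in> carrier Sm"
    have i: "(matrix_inv a ** w = mat 1) = (a = w)" if "a \<in> W" "w \<in> W" for a w
      using that by (metis inv_l inv_r matrix_mul_assoc matrix_mul_lid matrix_mul_rid)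
    show "\<one>\<^bsub>Sm\<^esub> \<otimes>\<^bsub>Sm\<^esub> F = F"
    proof (rule Sm_eqI[OF Sm_mult_closed F])
      fix w assume w: "w \<in> W"
      have "(\<one>\<^bsub>Sm\<^esub> \<otimes>\<^bsub>Sm\<^esub> F) w = (\<Sum>a\<in>W. if a = mat 1 then tensor_act (mat 1) (F (matrix_inv (mat 1) ** w)) else 0)"
        unfolding Sm_mult[OF w] by (rule sum.cong) (auto simp: Sm_simps)
      then show "(\<one>\<^bsub>Sm\<^esub> \<otimes>\<^bsub>Sm\<^esub> F) w = F w" using fin W_one by (simp add: inv_one tensor_act_id)
    qed
    show "F \<otimes>\<^bsub>Sm\<^esub> \<one>\<^bsub>Sm\<^esub> = F"
    proof (rule Sm_eqI[OF Sm_mult_closed F])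
      fix w assume w: "w \<in> W"
      have "(F \<otimes>\<^bsub>Sm\<^esub> \<one>\<^bsub>Sm\<^esub>) w = (\<Sum>a\<in>W. if a = w then F w else 0)"
        unfolding Sm_mult[OF w] by (rule sum.cong) (auto simp: Sm_simps i w tensor_act_one tensor_act_zero)
      then show "(F \<otimes>\<^bsub>Sm\<^esub> \<one>\<^bsub>Sm\<^esub>) w = F w" using fin w by simp
    qed
  qed (auto simp: Sm_mult_closed Sm_simps W_one simp del: Sm_simps(1), auto simp: Sm_simps W_one)
next
  fix F G H assume "F \<in> carrier Sm" "G \<in> carrier Sm" "H \<in> carrier Sm"
  show "(F \<oplus>\<^bsub>Sm\<^esub> G) \<otimes>\<^bsub>Sm\<^esub> H = F \<otimes>\<^bsub>Sm\<^esub> H \<oplus>\<^bsub>Sm\<^esub> G \<otimes>\<^bsub>Sm\<^esub> H"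
    by (rule ext, case_tac "x \<in> W") (simp_all add: Sm_simps pfs Sm_mult Sm_mult_out distrib_right sum.distrib)
  show "H \<otimes>\<^bsub>Sm\<^esub> (F \<oplus>\<^bsub>Sm\<^esub> G) = H \<otimes>\<^bsub>Sm\<^esub> F \<oplus>\<^bsub>Sm\<^esub> H \<otimes>\<^bsub>Sm\<^esub> G"
    by (rule ext, case_tac "x \<in> W") (simp_all add: Sm_simps pfs Sm_mult Sm_mult_out distrib_left tensor_act_add sum.distrib)
qed

lemma Sm_alg: "complex_algebra Sm"
proof (rule complex_algebraI[OF Sm_ring])
  fix k F G assume "F \<in> carrier Sm" "G \<in> carrier Sm"
  show "(k \<odot>\<^bsub>Sm\<^esub> F) \<otimes>\<^bsub>Sm\<^esub> G = k \<odot>\<^bsub>Sm\<^esub> (F \<otimes>\<^bsub>Sm\<^esub> G)"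
    by (rule ext, case_tac "x \<in> W") (simp_all add: Sm_simps Sm_mult Sm_mult_out mult.assoc sum_distrib_left)
  show "F \<otimes>\<^bsub>Sm\<^esub> (k \<odot>\<^bsub>Sm\<^esub> G) = k \<odot>\<^bsub>Sm\<^esub> (F \<otimes>\<^bsub>Sm\<^esub> G)"
    by (rule ext, case_tac "x \<in> W")
      (simp_all add: Sm_simps Sm_mult Sm_mult_out tensor_act_mult tensor_act_scalar sum_distrib_left tensor_scalar_left)
qed (auto simp: Sm_simps pfs tensor_scalar_simps(2) algebra_simps fun_eq_iff tensor_scalar_simps(3) tensor_scalar_simps(4)[symmetric])

sublocale S: calg Sm by unfold_locales (rule Sm_alg)

lemma Sm_minus: "F \<in> carrier Sm \<Longrightarrow> G \<in> carrier Sm \<Longrightarrow> F \<ominus>\<^bsub>Sm\<^esub> G = F - G"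
proof -
  assume FG: "F \<in> carrier Sm" "G \<in> carrier Sm"
  then have "\<ominus>\<^bsub>Sm\<^esub> G = - G"
    by (intro S.minus_equality) (auto simp: Sm_simps uminus_apply)
  then show ?thesis by (simp add: a_minus_def Sm_simps)
qed

lemma Sm_finsum: "finite I \<Longrightarrow> (\<And>i. i \<in> I \<Longrightarrow> f i \<in> carrier Sm) \<Longrightarrow> finsum Sm f I = (\<Sum>i\<in>I. f i)"
proof (induction I rule: finite_induct)
  case (insert i I)
  then have "finsum Sm f (insert i I) = f i \<oplus>\<^bsub>Sm\<^esub> finsum Sm f I" by (intro S.finsum_insert) auto
  then show ?case using insert by (simp add: Sm_simps)
qed (simp add: Sm_simps)

lemma Sm_tensor: "smash_tensor p \<in> carrier Sm" using W_one by (auto simp: Sm_simps smash_tensor_def)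
lemma Sm_grp: "w \<in> W \<Longrightarrow> smash_grp w \<in> carrier Sm" by (auto simp: Sm_simps smash_grp_def)

section \<open>The representation of the smash product by Dunkl operators\<close>

primrec lop :: "'n letter \<Rightarrow> 'n pf \<Rightarrow> 'n pf" where
  "lop (Lx i) P = vco i * P"
| "lop (Ly i) P = dunkl (axis i 1) P"

lemma pol_lop: "pol P \<Longrightarrow> pol (lop l P)" by (cases l) (auto intro: pol_intros pol_dunkl)
lemma pdeg_lop: "pdeg m P \<Longrightarrow> pdeg (m + 1) (lop l P)" by (cases l) (auto intro: pdeg_vco pdeg_dunkl)
lemma lop_add: "pol P \<Longrightarrow> pol Q \<Longrightarrow> lop l (P + Q) = lop l P + lop l Q"
  by (cases l) (simp_all add: distrib_left dunkl_add)
lemma lop_cmult: "pol P \<Longrightarrow> lop l (cst k * P) = cst k * lop l P"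
  by (cases l) (simp_all add: mult.left_commute dunkl_cmult)

lemma pol_lops: "pol P \<Longrightarrow> pol (foldr lop us P)" by (induction us) (simp_all add: pol_lop)
lemma pdeg_lops: "pdeg m P \<Longrightarrow> pdeg (m + int (length us)) (foldr lop us P)"
proof (induction us)
  case (Cons u us)
  then show ?case using pdeg_lop[of "m + int (length us)" "foldr lop us P" u] by (simp add: algebra_simps)
qed simp
lemma lops_add: "pol P \<Longrightarrow> pol Q \<Longrightarrow> foldr lop us (P + Q) = foldr lop us P + foldr lop us Q"
  by (induction us) (simp_all add: lop_add pol_lops)
lemma lops_cmult: "pol P \<Longrightarrow> foldr lop us (cst k * P) = cst k * foldr lop us P"
  by (induction us) (simp_all add: lop_cmult pol_lops)

definition tens :: "'n tensor \<Rightarrow> 'n pf \<Rightarrow> 'n pf" where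
  "tens p P = linext (\<lambda>u k. cst k * foldr lop (letters u) P) p"

lemma tens_add: "tens (p + q) P = tens p P + tens q P"
  unfolding tens_def by (rule linext_add) (simp_all add: cst_simps(1) cst_simps(4)[symmetric] distrib_right)
lemma tens_single: "tens (Poly_Mapping.single u k) P = cst k * foldr lop (letters u) P"
  unfolding tens_def by (rule linext_single) (simp add: cst_simps)
lemma tens_scalar: "tens (tensor_scalar k) P = cst k * P"
  by (simp add: tensor_scalar_def tens_single zero_word_def)
lemma tens_zero: "tens 0 P = 0" by (simp add: tens_def linext_def)
lemma tens_one: "tens 1 P = P" using tens_scalar[of 1] by (simp add: tensor_scalar_simps cst_simps)
lemma tens_sum: "tens (\<Sum>i\<in>I. f i) P = (\<Sum>i\<in>I. tens (f i) P)"
  by (induction I rule: infinite_finite_induct) (simp_all add: tens_add tens_zero)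
lemma tens_uminus: "tens (- p) P = - tens p P"
  using tens_add[of p "- p" P] by (simp add: tens_zero eq_neg_iff_add_eq_0 add.commute)

lemma pol_tens: "pol P \<Longrightarrow> pol (tens p P)"
  unfolding tens_def linext_def by (auto intro!: pol_intros pol_lops)

lemma pdeg_tens: "pdeg m P \<Longrightarrow> (\<And>u. u \<in> Poly_Mapping.keys p \<Longrightarrow> int (length (letters u)) \<le> d) \<Longrightarrow> pdeg (m + d) (tens p P)"
  unfolding tens_def linext_def
  by (rule pdeg_sum, rule pdeg_cmult, rule pdeg_mono, erule pdeg_lops) simp

lemma tens_padd: "pol P \<Longrightarrow> pol Q \<Longrightarrow> tens p (P + Q) = tens p P + tens p Q"
  unfolding tens_def linext_def by (simp add: lops_add distrib_left sum.distrib)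
lemma tens_pcmult: "pol P \<Longrightarrow> tens p (cst k * P) = cst k * tens p P"
  unfolding tens_def linext_def by (simp add: lops_cmult sum_distrib_left mult.left_commute)
lemma tens_pzero: "tens p 0 = 0" using tens_pcmult[OF pol_zero, of p 0] by (simp add: cst_simps)
lemma tens_psum: "(\<And>i. i \<in> I \<Longrightarrow> pol (f i)) \<Longrightarrow> tens p (\<Sum>i\<in>I. f i) = (\<Sum>i\<in>I. tens p (f i))"
  by (induction I rule: infinite_finite_induct) (simp_all add: tens_pzero tens_padd pol_sum)

lemma tens_letter: assumes P: "pol P" shows "tens (Poly_Mapping.single (Word [l]) 1 * p) P = lop l (tens p P)"
proof -
  have 1: "tens (Poly_Mapping.single (Word [l]) 1 * Poly_Mapping.single u k) P = lop l (tens (Poly_Mapping.single u k) P)" for u k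
    by (simp add: mult_single plus_word_def tens_single lop_cmult P pol_lops)
  have z: "lop l 0 = 0" using lop_cmult[OF pol_zero, of l 0] by (simp add: cst_simps)
  have "tens (Poly_Mapping.single (Word [l]) 1 * (\<Sum>a\<in>K. Poly_Mapping.single a (Poly_Mapping.lookup p a))) P =
      lop l (tens (\<Sum>a\<in>K. Poly_Mapping.single a (Poly_Mapping.lookup p a)) P)" if "finite K" for K
    using that by (induction K rule: finite_induct) (simp_all add: 1 z tens_zero tens_add distrib_left lop_add pol_tens P)
  then show ?thesis using poly_mapping_monomials[of p] finite_keys[of p] by metis
qed

lemma tens_mult: assumes P: "pol P" shows "tens (p * q) P = tens p (tens q P)"
proof (induction p rule: tensor_induct)
  case (scalar k)
  show ?case
  proof (induction q rule: tensor_induct)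
    case (letter l q)
    have "tensor_scalar k * (Poly_Mapping.single (Word [l]) 1 * q) = Poly_Mapping.single (Word [l]) 1 * (tensor_scalar k * q)"
      by (simp only: tensor_scalar_left)
    then show ?case using letter by (simp add: tens_letter P tens_scalar lop_cmult pol_tens)
  qed (simp_all add: tensor_scalar_simps tens_scalar cst_simps(3)[symmetric] mult.assoc distrib_left tens_add)
next
  case (letter l p)
  then show ?case by (simp add: mult.assoc tens_letter P pol_tens)
qed (simp add: distrib_right tens_add)

lemma tens_vec: assumes P: "pol P" shows "tens (tensor_vec y) P = dunkl y P"
proof -
  have "tens (tensor_vec y) P = (\<Sum>i\<in>UNIV. cst (y $ i) * dunkl (axis i 1) P)"
    unfolding tensor_vec_sum tens_sum by (simp add: tens_mult P tens_scalar tens_single cst_simps)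
  then show ?thesis using dunkl_sum_vec[OF P, of "($) y" "\<lambda>i. axis i 1" UNIV, unfolded axis_sum] by simp
qed

lemma tens_covec: assumes P: "pol P" shows "tens (tensor_covec x) P = lin_v x * P"
  unfolding tensor_covec_sum tens_sum lin_v_sum
  by (simp add: tens_mult P tens_scalar tens_single cst_simps sum_distrib_right mult.assoc)

text \<open>For a single letter this is the equivariance of linear forms and of Dunkl operators. It
  is the compatibility that makes \<open>rho\<close> respect the twisted product.\<close>

lemma tens_act: assumes P: "pol P" and w: "w \<in> W" shows "tens (tensor_act w p) (gact w P) = gact w (tens p P)"
proof (induction p rule: tensor_induct)
  case (letter l p)
  have "tens (letter_act w l) (gact w Q) = gact w (lop l Q)" if "pol Q" for Q
    using that by (cases l) (simp_all add: tens_vec tens_covec pol_gact gact_dunkl w vco_lin gact_simps dual_act_def)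
  then show ?case unfolding tensor_act_letter tens_letter[OF P]
    using letter by (simp add: tens_mult pol_gact P pol_tens)
qed (simp_all add: tensor_act_scalar tens_scalar gact_simps tensor_act_add tens_add)

definition rho :: "'n smash_elem \<Rightarrow> 'n pf \<Rightarrow> 'n pf" where
  "rho F P = (\<Sum>w\<in>W. tens (F w) (gact w P))"

lemma pol_rho: "pol P \<Longrightarrow> pol (rho F P)" unfolding rho_def by (auto intro!: pol_sum pol_tens pol_gact)
lemma rho_add: "rho (F + G) P = rho F P + rho G P"
  by (simp add: rho_def pfs tens_add sum.distrib)
lemma rho_uminus: "rho (- F) P = - rho F P"
  by (simp add: rho_def pfs tens_uminus sum_negf)
lemma rho_diff: "rho (F - G) P = rho F P - rho G P"
  using rho_add[of F "- G"] rho_uminus[of G] by simp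
lemma rho_zero: "rho 0 P = 0" by (simp add: rho_def pfs tens_zero)
lemma rho_sum: "rho (\<Sum>i\<in>I. f i) P = (\<Sum>i\<in>I. rho (f i) P)"
  by (induction I rule: infinite_finite_induct) (simp_all add: rho_zero rho_add)
lemma rho_smult: "pol P \<Longrightarrow> rho (k \<odot>\<^bsub>Sm\<^esub> F) P = cst k * rho F P"
  by (simp add: rho_def Sm_simps tens_mult pol_gact tens_scalar sum_distrib_left)
lemma rho_padd: "pol P \<Longrightarrow> pol Q \<Longrightarrow> rho F (P + Q) = rho F P + rho F Q"
  by (simp add: rho_def gact_simps tens_padd pol_gact sum.distrib)
lemma rho_pcmult: "pol P \<Longrightarrow> rho F (cst k * P) = cst k * rho F P"
  by (simp add: rho_def gact_simps tens_pcmult pol_gact sum_distrib_left)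
lemma rho_pzero: "rho F 0 = 0" by (simp add: rho_def gact_simps tens_pzero)

lemma rho_tensor: "rho (smash_tensor p) P = tens p P"
proof -
  have "rho (smash_tensor p) P = (\<Sum>w\<in>W. if w = mat 1 then tens p P else 0)"
    unfolding rho_def by (rule sum.cong) (auto simp: smash_tensor_def gact_one tens_zero)
  then show ?thesis using fin W_one by simp
qed

lemma rho_grp: "w \<in> W \<Longrightarrow> rho (smash_grp w) P = gact w P"
proof -
  assume w: "w \<in> W"
  have "rho (smash_grp w) P = (\<Sum>a\<in>W. if a = w then gact w P else 0)"
    unfolding rho_def by (rule sum.cong) (auto simp: smash_grp_def tens_one tens_zero)
  then show ?thesis using fin w by simp
qed

lemma rho_one: "rho \<one>\<^bsub>Sm\<^esub> P = P"
  using rho_grp[OF W_one, of P] by (simp add: Sm_simps smash_grp_def gact_one)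

lemma rho_mult: assumes P: "pol P" shows "rho (F \<otimes>\<^bsub>Sm\<^esub> G) P = rho F (rho G P)"
proof -
  have "rho (F \<otimes>\<^bsub>Sm\<^esub> G) P = (\<Sum>w\<in>W. \<Sum>a\<in>W. tens (F a) (tens (tensor_act a (G (matrix_inv a ** w))) (gact w P)))"
    by (simp add: rho_def Sm_mult tens_sum tens_mult pol_gact P)
  also have "\<dots> = (\<Sum>a\<in>W. \<Sum>w\<in>W. tens (F a) (tens (tensor_act a (G (matrix_inv a ** w))) (gact w P)))"
    by (rule sum.swap)
  also have "\<dots> = (\<Sum>a\<in>W. \<Sum>b\<in>W. tens (F a) (gact a (tens (G b) (gact b P))))"
  proof (rule sum.cong[OF refl])
    fix a assume a: "a \<in> W"
    show "(\<Sum>w\<in>W. tens (F a) (tens (tensor_act a (G (matrix_inv a ** w))) (gact w P))) = (\<Sum>b\<in>W. tens (F a) (gact a (tens (G b) (gact b P))))"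
      by (subst W_reindex[OF a], rule sum.cong[OF refl])
         (simp add: matrix_mul_assoc inv_l a gact_gact[symmetric] tens_act pol_gact P)
  qed
  also have "\<dots> = rho F (rho G P)"
    by (simp add: rho_def gact_sum tens_psum pol_tens pol_gact P)
  finally show ?thesis .
qed

lemma pdeg_rho: "pdeg m P \<Longrightarrow> (\<And>w u. w \<in> W \<Longrightarrow> u \<in> Poly_Mapping.keys (F w) \<Longrightarrow> int (length (letters u)) \<le> d) \<Longrightarrow> pdeg (m + d) (rho F P)"
  unfolding rho_def by (intro pdeg_sum pdeg_tens pdeg_gact)

definition rker :: "'n smash_elem set" where "rker = {F \<in> carrier Sm. \<forall>P. pol P \<longrightarrow> rho F P = 0}"

lemma rker_ideal: "ideal rker Sm"
proof (rule idealI[OF Sm_ring])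
  show "subgroup rker (add_monoid Sm)"
  proof (rule S.add.subgroupI)
    show "rker \<noteq> {}" using S.zero_closed rho_zero by (auto simp: rker_def Sm_simps(3))
    fix a assume a: "a \<in> rker"
    then have "\<ominus>\<^bsub>Sm\<^esub> a = - a"
      by (intro S.minus_equality) (auto simp: rker_def Sm_simps uminus_apply)
    then show "\<ominus>\<^bsub>Sm\<^esub> a \<in> rker" using a by (auto simp: rker_def Sm_simps pfs rho_uminus)
  qed (auto simp: rker_def Sm_simps pfs rho_add)
qed (auto simp: rker_def rho_mult pol_rho rho_pzero)

lemma rho_minus: "F \<in> carrier Sm \<Longrightarrow> G \<in> carrier Sm \<Longrightarrow> rho (F \<ominus>\<^bsub>Sm\<^esub> G) P = rho F P - rho G P"
  by (simp add: Sm_minus rho_diff)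

abbreviation "Rel \<equiv> cherednik_relations W \<alpha> \<alpha>' t c"
abbreviation "II \<equiv> cherednik_ideal W \<alpha> \<alpha>' t c"

lemma rhs_closed: "cherednik_rhs W \<alpha> \<alpha>' t c x y \<in> carrier Sm"
  unfolding cherednik_rhs_def by (intro S.minus_closed S.sm_closed S.one_closed S.finsum_closed) (auto intro: Sm_grp R_W)

lemma comm_closed: "F \<in> carrier Sm \<Longrightarrow> G \<in> carrier Sm \<Longrightarrow> commutator Sm F G \<in> carrier Sm"
  unfolding commutator_def by auto

lemma rho_comm: "F \<in> carrier Sm \<Longrightarrow> G \<in> carrier Sm \<Longrightarrow> pol P \<Longrightarrow> rho (commutator Sm F G) P = rho F (rho G P) - rho G (rho F P)"
  unfolding commutator_def by (simp add: rho_minus rho_mult)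

lemma rho_rhs: assumes P: "pol P" shows "rho (cherednik_rhs W \<alpha> \<alpha>' t c x y) P = kap y x P"
proof -
  have g: "(\<lambda>s. k s \<odot>\<^bsub>Sm\<^esub> smash_grp s) \<in> R \<rightarrow> carrier Sm" for k by (auto intro: Sm_grp R_W)
  have "rho (finsum Sm (\<lambda>s. k s \<odot>\<^bsub>Sm\<^esub> smash_grp s) R) P = (\<Sum>s\<in>R. cst (k s) * gact s P)" for k
    using g by (subst Sm_finsum) (auto simp: finR rho_sum rho_smult P rho_grp R_W)
  then show ?thesis unfolding cherednik_rhs_def kap_def
    by (subst rho_minus) (auto simp: rho_smult P rho_one br_def intro!: S.finsum_closed S.sm_closed Sm_grp R_W)
qed

text \<open>The three kinds of relation hold by commutativity of multiplication, by
  \<open>dunkl_comm\<close> and by \<open>dunkl_lin_v\<close>. As the annihilator is an ideal, the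
  whole defining ideal acts by zero.\<close>

lemma Rel_rker: "Rel \<subseteq> rker"
proof
  fix F assume "F \<in> Rel"
  then consider x x' where "F = commutator Sm (smash_covec x) (smash_covec x')"
    | y y' where "F = commutator Sm (smash_vec y) (smash_vec y')"
    | x y where "F = commutator Sm (smash_vec y) (smash_covec x) \<ominus>\<^bsub>Sm\<^esub> cherednik_rhs W \<alpha> \<alpha>' t c x y"
    unfolding cherednik_relations_def by blast
  then show "F \<in> rker"
  proof cases
    case 1 then show ?thesis
      by (auto simp: rker_def comm_closed Sm_tensor rho_comm rho_tensor tens_covec pol_intros pol_lin)
  next
    case 2 then show ?thesis
      by (auto simp: rker_def comm_closed Sm_tensor rho_comm rho_tensor tens_vec pol_dunkl dunkl_comm[of _ y y'])
  next
    case 3 then show ?thesis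
      by (auto simp: rker_def comm_closed Sm_tensor rhs_closed rho_minus rho_comm rho_rhs rho_tensor tens_vec tens_covec
          pol_intros pol_lin pol_dunkl dunkl_lin_v)
  qed
qed

lemma Rel_carrier: "Rel \<subseteq> carrier Sm" using Rel_rker by (auto simp: rker_def)

lemma II_ideal: "ideal II Sm" unfolding cherednik_ideal_def by (rule S.genideal_ideal[OF Rel_carrier])
lemma Rel_II: "Rel \<subseteq> II" unfolding cherednik_ideal_def by (rule S.genideal_self[OF Rel_carrier])
lemma II_rker: "II \<subseteq> rker" unfolding cherednik_ideal_def by (rule S.genideal_minimal[OF rker_ideal Rel_rker])

end

section \<open>Quotients, subalgebras and corners\<close>

text \<open>\<open>quot_alg\<close> and the quotient ring are records of different types; the ring
  axioms only see the fields they share.\<close>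

lemma ring_transfer:
  assumes "ring R" "carrier R' = carrier R" "mult R' = mult R" "one R' = one R" "zero R' = zero R" "add R' = add R"
  shows "ring R'"
proof -
  interpret ring R by fact
  have "Group.monoid R'" by (rule monoidI) (auto simp: assms m_assoc)
  moreover have "abelian_group R'"
  proof (rule abelian_groupI)
    fix x assume "x \<in> carrier R'"
    then show "\<exists>y\<in>carrier R'. y \<oplus>\<^bsub>R'\<^esub> x = \<zero>\<^bsub>R'\<^esub>"
      by (intro bexI[of _ "\<ominus>\<^bsub>R\<^esub> x"]) (auto simp: assms l_neg)
  qed (auto simp: assms a_ac)
  ultimately show ?thesis by (intro ringI) (auto simp: assms l_distr r_distr)
qed

locale qalg = calg A + ideal I A for A :: "(complex, 'a) module" (structure) and I
begin

abbreviation "Q \<equiv> quot_alg A I"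
abbreviation "cls x \<equiv> I +> x"

lemma Q_simps: "carrier Q = carrier (A Quot I)" "mult Q = mult (A Quot I)" "one Q = one (A Quot I)"
    "zero Q = zero (A Quot I)" "add Q = add (A Quot I)"
  by (simp_all add: quot_alg_def)

lemma carrier_Q: "carrier Q = cls ` carrier A"
  by (auto simp: Q_simps FactRing_simps)

lemma cls_closed: "x \<in> carrier A \<Longrightarrow> cls x \<in> carrier Q" by (simp add: carrier_Q)
lemma cls_mult: "x \<in> carrier A \<Longrightarrow> y \<in> carrier A \<Longrightarrow> cls x \<otimes>\<^bsub>Q\<^esub> cls y = cls (x \<otimes> y)"
  by (simp add: Q_simps FactRing_def rcoset_mult_add)
lemma cls_add: "x \<in> carrier A \<Longrightarrow> y \<in> carrier A \<Longrightarrow> cls x \<oplus>\<^bsub>Q\<^esub> cls y = cls (x \<oplus> y)"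
  by (simp add: Q_simps FactRing_def a_rcos_sum)
lemma cls_one: "\<one>\<^bsub>Q\<^esub> = cls \<one>" by (simp add: Q_simps FactRing_def)
lemma zero_Q: "\<zero>\<^bsub>Q\<^esub> = I" by (simp add: Q_simps FactRing_def)

lemma cls_eq: "x \<in> carrier A \<Longrightarrow> y \<in> carrier A \<Longrightarrow> cls x = cls y \<longleftrightarrow> x \<ominus> y \<in> I"
  using a_rcos_module[of y x] a_repr_independence'[of x y] a_rcos_self[of x] by (auto simp: a_minus_def)

lemma cls_zero_iff: "x \<in> carrier A \<Longrightarrow> cls x = \<zero>\<^bsub>Q\<^esub> \<longleftrightarrow> x \<in> I"
  using cls_eq[of x \<zero>] a_coset_add_zero[of I] a_subset by (simp add: zero_Q a_minus_def)

text \<open>A scalar can be moved onto the unit, so every ring ideal is a subspace.\<close>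

lemma I_smult: "x \<in> I \<Longrightarrow> k \<odot> x \<in> I"
proof -
  assume x: "x \<in> I"
  then have xA: "x \<in> carrier A" using a_subset by blast
  have "(k \<odot> \<one>) \<otimes> x \<in> I" using x by (intro I_l_closed) auto
  then show ?thesis using xA by (simp add: sm_mult_l)
qed

text \<open>The scalar multiplication of the quotient is a union over representatives; all of them
  give the same coset, so the union collapses.\<close>

lemma cls_smult: assumes x: "x \<in> carrier A" shows "k \<odot>\<^bsub>Q\<^esub> cls x = cls (k \<odot> x)"
proof -
  have "cls (k \<odot> y) = cls (k \<odot> x)" if y: "y \<in> cls x" for y
  proof -
    obtain i where i: "i \<in> I" "y = i \<oplus> x" using y by (auto simp: a_r_coset_def')
    have iA: "i \<in> carrier A" using i a_subset by blast
    then have "k \<odot> y \<ominus> k \<odot> x = k \<odot> i" using i x by (simp add: sm_r_distr a_minus_def a_assoc r_neg)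
    then show ?thesis using i I_smult[of i k] x iA by (simp add: cls_eq)
  qed
  moreover have "x \<in> cls x" using x a_rcos_self by blast
  moreover have "k \<odot>\<^bsub>Q\<^esub> cls x = (\<Union>y\<in>cls x. cls (k \<odot> y))" by (simp add: quot_alg_def)
  ultimately show ?thesis by (metis (no_types, lifting) SUP_cong SUP_const empty_iff)
qed

lemma Q_ring: "ring Q" by (rule ring_transfer[OF quotient_is_ring]) (simp_all add: Q_simps)

lemma Q_alg: "complex_algebra Q"
  by (rule complex_algebraI[OF Q_ring])
    (auto simp: carrier_Q cls_smult cls_add cls_mult sm_l_distr sm_r_distr sm_assoc sm_mult_l sm_mult_r)

lemma cls_minus: assumes "x \<in> carrier A" "y \<in> carrier A" shows "cls x \<ominus>\<^bsub>Q\<^esub> cls y = cls (x \<ominus> y)"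
proof -
  interpret QA: calg Q by unfold_locales (rule Q_alg)
  show ?thesis using assms by (simp add: minus_sm QA.minus_sm cls_closed cls_smult cls_add)
qed

lemma cls_finsum: "finite K \<Longrightarrow> (\<And>i. i \<in> K \<Longrightarrow> f i \<in> carrier A) \<Longrightarrow> cls (finsum A f K) = finsum Q (\<lambda>i. cls (f i)) K"
proof (induction K rule: finite_induct)
  case empty
  interpret QA: calg Q by unfold_locales (rule Q_alg)
  show ?case using cls_zero_iff[of \<zero>] by simp
next
  case (insert x K)
  interpret QA: calg Q by unfold_locales (rule Q_alg)
  have "finsum A f (insert x K) = f x \<oplus> finsum A f K" using insert by (intro finsum_insert) auto
  moreover have "finsum Q (\<lambda>i. cls (f i)) (insert x K) = cls (f x) \<oplus>\<^bsub>Q\<^esub> finsum Q (\<lambda>i. cls (f i)) K"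
    using insert by (intro QA.finsum_insert) (auto simp: cls_closed)
  moreover have "finsum A f K \<in> carrier A" using insert by (intro finsum_closed) auto
  moreover have "cls (f x \<oplus> finsum A f K) = cls (f x) \<oplus>\<^bsub>Q\<^esub> cls (finsum A f K)"
    using insert calculation(3) by (intro cls_add[symmetric]) auto
  ultimately show ?case using insert by simp
qed

end

context calg
begin

lemma subalg: assumes "subring B A" "subspace_of B A" shows "complex_algebra (A\<lparr>carrier := B\<rparr>)"
proof (rule complex_algebraI)
  show "ring (A\<lparr>carrier := B\<rparr>)" using subring_is_ring[OF assms(1)] .
qed (use subspaceD[OF assms(2)] in \<open>auto simp: sm_l_distr sm_r_distr sm_assoc sm_mult_l sm_mult_r subset_iff\<close>)

end

lemma corner_simps: "mult (corner A p) = mult A" "one (corner A p) = p" "zero (corner A p) = zero A"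
  "add (corner A p) = add A" "smult (corner A p) = smult A"
  "carrier (corner A p) = {p \<otimes>\<^bsub>A\<^esub> x \<otimes>\<^bsub>A\<^esub> p | x. x \<in> carrier A}"
  by (simp_all add: corner_def)

lemma corner_carrier:
  fixes A :: "(complex, 'a) module" (structure)
  assumes "complex_algebra A" "p \<in> carrier A" "p \<otimes> p = p"
  shows "carrier (corner A p) = {x \<in> carrier A. p \<otimes> x = x \<and> x \<otimes> p = x}"
proof -
  interpret calg A by unfold_locales fact
  show ?thesis unfolding corner_simps
  proof safe
    fix x assume "x \<in> carrier A"
    then show "p \<otimes> x \<otimes> p \<in> carrier A" "p \<otimes> (p \<otimes> x \<otimes> p) = p \<otimes> x \<otimes> p" "p \<otimes> x \<otimes> p \<otimes> p = p \<otimes> x \<otimes> p"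
      using assms by (auto simp: m_assoc) (simp add: m_assoc[symmetric] assms)
  next
    fix x assume "x \<in> carrier A" "p \<otimes> x = x" "x \<otimes> p = x"
    then show "\<exists>xa. x = p \<otimes> xa \<otimes> p \<and> xa \<in> carrier A" by (intro exI[of _ x]) simp
  qed
qed

lemma corner_alg:
  fixes A :: "(complex, 'a) module" (structure)
  assumes "complex_algebra A" "p \<in> carrier A" "p \<otimes> p = p"
  shows "complex_algebra (corner A p)"
proof -
  interpret calg A by unfold_locales fact
  note cc = corner_carrier[OF assms]
  have r: "ring (corner A p)"
  proof (rule ringI)
    show "abelian_group (corner A p)"
    proof (rule abelian_groupI)
      fix x assume x: "x \<in> carrier (corner A p)"
      then show "\<exists>y\<in>carrier (corner A p). y \<oplus>\<^bsub>corner A p\<^esub> x = \<zero>\<^bsub>corner A p\<^esub>"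
        using assms by (intro bexI[of _ "\<ominus> x"]) (auto simp: cc corner_simps(1-5) l_neg l_minus r_minus)
    qed (use assms in \<open>auto simp: cc corner_simps(1-5) l_distr r_distr a_ac\<close>)
    show "Group.monoid (corner A p)"
      by (rule monoidI) (use assms in \<open>auto simp: cc corner_simps(1-5) m_assoc\<close>, simp add: m_assoc[symmetric])
  qed (auto simp: cc corner_simps(1-5) l_distr r_distr)
  show ?thesis
    by (rule complex_algebraI[OF r])
      (use assms in \<open>auto simp: cc corner_simps(1-5) sm_l_distr sm_r_distr sm_assoc sm_mult_l sm_mult_r\<close>)
qed

section \<open>The Poincare-Birkhoff-Witt property\<close>

text \<open>Induction on the variables: with \<open>l\<close> set to \<open>z\<close> the relation
  becomes a polynomial in \<open>z\<close>, and its coefficient at \<open>z ^ k\<close> is a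
  relation in fewer variables.\<close>

lemma monomials_independent_aux:
  assumes "finite L" "finite K" "\<And>M. M \<in> K \<Longrightarrow> set_mset M \<subseteq> L"
    "\<And>x :: 'a \<Rightarrow> complex. (\<Sum>M\<in>K. a M * (\<Prod>l\<in>#M. x l)) = 0" "M \<in> K"
  shows "a M = 0"
  using assms
proof (induction L arbitrary: K a M rule: finite_induct)
  case empty
  then have "N = {#}" if "N \<in> K" for N using that by auto
  then have "K = {{#}}" using empty by blast
  then show ?case using empty(3)[of undefined] empty(4) by simp
next
  case (insert l L)
  let ?f = "filter_mset (\<lambda>b. b \<noteq> l)"
  define k where "k = count M l"
  define K' where "K' = {N \<in> K. count N l = k}"
  have split: "N = ?f N + replicate_mset (count N l) l" for N
    by (rule multiset_eqI) auto
  \<comment> \<open>With the exponent of \<open>l\<close> fixed, deleting \<open>l\<close> loses no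
    information.\<close>
  have inj: "inj_on ?f K'"
    by (rule inj_onI) (metis (mono_tags, lifting) K'_def mem_Collect_eq split)
  have pz: "(\<Prod>b\<in>#N. (x(l := z)) b) = z ^ count N l * (\<Prod>b\<in>#?f N. x b)" for x :: "'a \<Rightarrow> complex" and z N
  proof -
    have "(\<Prod>b\<in>#N. (x(l := z)) b) = (\<Prod>b\<in>#?f N. (x(l := z)) b) * (\<Prod>b\<in>#replicate_mset (count N l) l. (x(l := z)) b)"
      by (subst split[of N]) simp
    moreover have "image_mset (x(l := z)) (?f N) = image_mset x (?f N)" by (rule image_mset_cong) auto
    moreover have "(\<Prod>b\<in>#replicate_mset (count N l) l. (x(l := z)) b) = z ^ count N l" by simp
    ultimately show ?thesis by (simp only: mult.commute)
  qed
  have "(\<Sum>N\<in>K'. a N * (\<Prod>b\<in>#?f N. x b)) = 0" for x :: "'a \<Rightarrow> complex"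
  proof -
    define p where "p = (\<Sum>N\<in>K. Polynomial.monom (a N * (\<Prod>b\<in>#?f N. x b)) (count N l))"
    have "poly p z = 0" for z
    proof -
      have "poly p z = (\<Sum>N\<in>K. a N * (\<Prod>b\<in>#N. (x(l := z)) b))"
        unfolding p_def by (simp only: poly_sum poly_monom pz mult_ac)
      then show ?thesis using insert(6)[of "x(l := z)"] by simp
    qed
    then have "p = 0" using poly_all_0_iff_0 by blast
    then have "0 = Polynomial.coeff p k" by simp
    also have "\<dots> = (\<Sum>N\<in>K. if count N l = k then a N * (\<Prod>b\<in>#?f N. x b) else 0)"
      unfolding p_def by (simp add: coeff_sum)
    also have "\<dots> = (\<Sum>N\<in>K'. a N * (\<Prod>b\<in>#?f N. x b))"
      unfolding K'_def using insert(4) by (simp add: sum.inter_filter)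
    finally show ?thesis by simp
  qed
  then have s: "(\<Sum>N\<in>?f ` K'. a (inv_into K' ?f N) * (\<Prod>b\<in>#N. x b)) = 0" for x :: "'a \<Rightarrow> complex"
    by (subst sum.reindex[OF inj]) (simp add: inv_into_f_f[OF inj])
  have M: "M \<in> K'" using insert by (simp add: K'_def k_def)
  have "a (inv_into K' ?f (?f M)) = 0"
  proof (rule insert(3)[of "?f ` K'" "\<lambda>N. a (inv_into K' ?f N)" "?f M"])
    show "finite (?f ` K')" using insert(4) by (simp add: K'_def)
    show "?f M \<in> ?f ` K'" using M by blast
    show "set_mset N \<subseteq> L" if "N \<in> ?f ` K'" for N using that insert(5) by (fastforce simp: K'_def)
  qed (rule s)
  then show ?case using M by (simp add: inv_into_f_f[OF inj])
qed

primrec lval :: "complex ^ 'n \<Rightarrow> complex ^ 'n \<Rightarrow> ('n::finite) letter \<Rightarrow> complex" where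
  "lval v \<xi> (Lx i) = v $ i"
| "lval v \<xi> (Ly i) = \<xi> $ i"

text \<open>Commutative monomials are indexed by multisets of the letters of the tensor algebra, so
  that sorted words and monomials share an index set.\<close>

definition monM :: "('n::finite) letter multiset \<Rightarrow> 'n pf" where
  "monM M = (\<lambda>v \<xi>. \<Prod>l\<in>#M. lval v \<xi> l)"

lemma finite_letters: "finite (UNIV :: ('n::finite) letter set)"
proof -
  have "(UNIV :: 'n letter set) = range Lx \<union> range Ly" by (auto, metis letter.exhaust rangeI)
  then show ?thesis by (metis finite finite_Un finite_imageI)
qed

lemma monomials_independent:
  fixes a :: "('n::finite) letter multiset \<Rightarrow> complex"
  assumes "finite K" "(\<Sum>M\<in>K. cst (a M) * monM M) = 0" "M \<in> K"
  shows "a M = 0"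
proof (rule monomials_independent_aux[OF finite_letters assms(1) _ _ assms(3)])
  fix x :: "'n letter \<Rightarrow> complex"
  have "x = lval (\<chi> i. x (Lx i)) (\<chi> i. x (Ly i))"
  proof
    fix l show "x l = lval (\<chi> i. x (Lx i)) (\<chi> i. x (Ly i)) l" by (cases l) simp_all
  qed
  then have "(\<Sum>M\<in>K. a M * (\<Prod>l\<in>#M. x l)) = (\<Sum>M\<in>K. cst (a M) * monM M) (\<chi> i. x (Lx i)) (\<chi> i. x (Ly i))"
    by (simp add: sum_fun_apply pfs monM_def)
  then show "(\<Sum>M\<in>K. a M * (\<Prod>l\<in>#M. x l)) = 0" using assms(2) by (simp add: pfs)
qed simp

text \<open>The linear span, grown by one multiple of a generator at a time; the induction rule then
  carries coefficients along, as needed for normal forms.\<close>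

inductive_set spn :: "(complex, 'a, 'm) module_scheme \<Rightarrow> 'a set \<Rightarrow> 'a set" for A B where
  zero: "\<zero>\<^bsub>A\<^esub> \<in> spn A B"
| add: "h \<in> spn A B \<Longrightarrow> b \<in> B \<Longrightarrow> h \<oplus>\<^bsub>A\<^esub> k \<odot>\<^bsub>A\<^esub> b \<in> spn A B"

context calg
begin

lemma spn_closed: assumes "B \<subseteq> carrier A" "h \<in> spn A B" shows "h \<in> carrier A"
  using assms(2) by induction (use assms(1) in auto)

lemma spn_add: assumes "B \<subseteq> carrier A" "h \<in> spn A B" "h' \<in> spn A B" shows "h \<oplus> h' \<in> spn A B"
  using assms(3)
proof induction
  case zero then show ?case using spn_closed[OF assms(1,2)] assms by simp
next
  case (add h' b k)
  have "h \<oplus> (h' \<oplus> k \<odot> b) = (h \<oplus> h') \<oplus> k \<odot> b"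
    using spn_closed[OF assms(1)] add assms by (subst a_assoc) auto
  then show ?case using spn.add[OF add(3) add(2)] by simp
qed

lemma spn_smult: assumes "B \<subseteq> carrier A" "h \<in> spn A B" shows "k \<odot> h \<in> spn A B"
  using assms(2)
proof induction
  case zero then show ?case by (simp add: spn.zero)
next
  case (add h b l)
  have "k \<odot> (h \<oplus> l \<odot> b) = k \<odot> h \<oplus> (k * l) \<odot> b"
    using spn_closed[OF assms(1)] add assms by (simp add: sm_r_distr sm_assoc subset_iff)
  then show ?case using spn.add[OF add(3) add(2)] by simp
qed

lemma spn_base: assumes "B \<subseteq> carrier A" "b \<in> B" shows "b \<in> spn A B"
proof -
  have "\<zero> \<oplus> 1 \<odot> b \<in> spn A B" using assms by (intro spn.intros)
  then show ?thesis using assms by (simp add: subset_iff)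
qed

lemma spn_mono: "B \<subseteq> B' \<Longrightarrow> spn A B \<subseteq> spn A B'"
proof
  fix h assume "h \<in> spn A B" "B \<subseteq> B'"
  then show "h \<in> spn A B'" by induction (auto intro: spn.intros)
qed

lemma spn_subspace: "B \<subseteq> carrier A \<Longrightarrow> subspace_of (spn A B) A"
  by (rule subspaceI) (auto simp: spn_closed spn.zero spn_add spn_smult)

lemma spn_image:
  assumes "B \<subseteq> carrier A" "a \<in> carrier A" "subspace_of V A" "\<And>b. b \<in> B \<Longrightarrow> a \<otimes> b \<in> V" "h \<in> spn A B"
  shows "a \<otimes> h \<in> V"
  using assms(5)
proof induction
  case zero then show ?case using assms subspaceD[OF assms(3)] by simp
next
  case (add h b k)
  have c: "b \<in> carrier A" "h \<in> carrier A" using add assms spn_closed[OF assms(1)] by auto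
  have "a \<otimes> (h \<oplus> k \<odot> b) = a \<otimes> h \<oplus> k \<odot> (a \<otimes> b)"
    using assms(2) c by (simp add: r_distr sm_mult_r)
  then show ?case using subspaceD[OF assms(3)] add assms(4) by simp
qed

lemma subspace_finsum: assumes "subspace_of V A" "finite K" "\<And>i. i \<in> K \<Longrightarrow> f i \<in> V" shows "finsum A f K \<in> V"
  using assms(2,3)
proof (induction K rule: finite_induct)
  case empty then show ?case using subspaceD[OF assms(1)] by simp
next
  case (insert x K)
  have "finsum A f (insert x K) = f x \<oplus> finsum A f K"
    using insert subspaceD(1)[OF assms(1)] by (intro finsum_insert) auto
  then show ?case using insert subspaceD[OF assms(1)] by auto
qed

end

context refl_data
begin

section \<open>Relations in the Cherednik algebra\<close>

sublocale HQ: qalg Sm II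
  by (intro qalg.intro S.calg_axioms II_ideal)

abbreviation "HH \<equiv> quot_alg Sm II"
abbreviation "cl F \<equiv> II +>\<^bsub>Sm\<^esub> F"

lemma HH_cherednik: "cherednik W \<alpha> \<alpha>' t c = HH" "cherednik_class W \<alpha> \<alpha>' t c = (\<lambda>F. cl F)"
  by (simp_all add: cherednik_def cherednik_class_def fun_eq_iff)

sublocale H: calg HH by unfold_locales (rule HQ.Q_alg)

definition Xc :: "complex ^ 'n \<Rightarrow> 'n smash_elem set" where "Xc x = cl (smash_covec x)"
definition Yc :: "complex ^ 'n \<Rightarrow> 'n smash_elem set" where "Yc y = cl (smash_vec y)"
definition Gc :: "'n cmat \<Rightarrow> 'n smash_elem set" where "Gc w = cl (smash_grp w)"

lemma XYG_closed [simp]: "Xc x \<in> carrier HH" "Yc y \<in> carrier HH" "w \<in> W \<Longrightarrow> Gc w \<in> carrier HH"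
  by (simp_all add: Xc_def Yc_def Gc_def HQ.cls_closed Sm_tensor Sm_grp)

lemma comm_zero: "F \<in> carrier Sm \<Longrightarrow> F' \<in> carrier Sm \<Longrightarrow> commutator Sm F F' \<in> II \<Longrightarrow> cl F \<otimes>\<^bsub>HH\<^esub> cl F' = cl F' \<otimes>\<^bsub>HH\<^esub> cl F"
  by (simp add: HQ.cls_mult HQ.cls_eq commutator_def)

lemma X_comm: "Xc x \<otimes>\<^bsub>HH\<^esub> Xc x' = Xc x' \<otimes>\<^bsub>HH\<^esub> Xc x"
  unfolding Xc_def by (rule comm_zero) (use Rel_II in \<open>auto simp: Sm_tensor cherednik_relations_def\<close>)
lemma Y_comm: "Yc x \<otimes>\<^bsub>HH\<^esub> Yc x' = Yc x' \<otimes>\<^bsub>HH\<^esub> Yc x"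
  unfolding Yc_def by (rule comm_zero) (use Rel_II in \<open>auto simp: Sm_tensor cherednik_relations_def\<close>)

lemma YX_comm: "Yc y \<otimes>\<^bsub>HH\<^esub> Xc x = Xc x \<otimes>\<^bsub>HH\<^esub> Yc y \<oplus>\<^bsub>HH\<^esub> cl (cherednik_rhs W \<alpha> \<alpha>' t c x y)"
proof -
  let ?r = "cherednik_rhs W \<alpha> \<alpha>' t c x y"
  let ?y = "smash_vec y" and ?x = "smash_covec x"
  have c: "?y \<in> carrier Sm" "?x \<in> carrier Sm" "?r \<in> carrier Sm" by (simp_all add: Sm_tensor rhs_closed)
  have i: "commutator Sm ?y ?x \<ominus>\<^bsub>Sm\<^esub> ?r \<in> II"
    using Rel_II unfolding cherednik_relations_def by blast
  have "(?y \<otimes>\<^bsub>Sm\<^esub> ?x) \<ominus>\<^bsub>Sm\<^esub> ((?x \<otimes>\<^bsub>Sm\<^esub> ?y) \<oplus>\<^bsub>Sm\<^esub> ?r) = commutator Sm ?y ?x \<ominus>\<^bsub>Sm\<^esub> ?r"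
    using c by (simp add: commutator_def a_minus_def S.minus_add S.a_assoc)
  then show ?thesis using c i unfolding Xc_def Yc_def by (simp add: HQ.cls_mult HQ.cls_add HQ.cls_eq)
qed

lemma smash_tensor_linear: "smash_tensor (p + q) = smash_tensor p \<oplus>\<^bsub>Sm\<^esub> smash_tensor q"
  "smash_tensor (tensor_scalar k * p) = k \<odot>\<^bsub>Sm\<^esub> smash_tensor p" "smash_tensor 0 = \<zero>\<^bsub>Sm\<^esub>"
  by (auto simp: smash_tensor_def Sm_simps fun_eq_iff pfs)

lemma grp_mult: assumes a: "a \<in> W" shows "(smash_grp a \<otimes>\<^bsub>Sm\<^esub> F) = (\<lambda>w. if w \<in> W then tensor_act a (F (matrix_inv a ** w)) else 0)"
proof
  fix w
  show "(smash_grp a \<otimes>\<^bsub>Sm\<^esub> F) w = (if w \<in> W then tensor_act a (F (matrix_inv a ** w)) else 0)"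
  proof (cases "w \<in> W")
    case True
    then have "(smash_grp a \<otimes>\<^bsub>Sm\<^esub> F) w = (\<Sum>b\<in>W. if b = a then tensor_act a (F (matrix_inv a ** w)) else 0)"
      unfolding Sm_mult[OF True] by (intro sum.cong) (auto simp: smash_grp_def)
    then show ?thesis using True a fin by simp
  qed (simp add: Sm_mult_out)
qed

lemma mult_grp: assumes a: "a \<in> W" shows "(F \<otimes>\<^bsub>Sm\<^esub> smash_grp a) = (\<lambda>w. if w \<in> W then F (w ** matrix_inv a) else 0)"
proof
  fix w
  show "(F \<otimes>\<^bsub>Sm\<^esub> smash_grp a) w = (if w \<in> W then F (w ** matrix_inv a) else 0)"
  proof (cases "w \<in> W")
    case True
    have e: "matrix_inv b ** w = a \<longleftrightarrow> b = w ** matrix_inv a" if "b \<in> W" for b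
      using that a by (metis inv_l inv_r matrix_mul_assoc matrix_mul_lid matrix_mul_rid)
    have "(F \<otimes>\<^bsub>Sm\<^esub> smash_grp a) w = (\<Sum>b\<in>W. if b = w ** matrix_inv a then F (w ** matrix_inv a) else 0)"
      unfolding Sm_mult[OF True] by (intro sum.cong) (auto simp: smash_grp_def e tensor_act_one tensor_act_zero)
    then show ?thesis using True a fin by (simp add: W_mult W_inv)
  qed (simp add: Sm_mult_out)
qed

lemma inv_mult_eq: "a \<in> W \<Longrightarrow> matrix_inv a ** w = b \<longleftrightarrow> w = a ** b" "a \<in> W \<Longrightarrow> w ** matrix_inv a = b \<longleftrightarrow> w = b ** a"
  by (auto simp: matrix_mul_assoc inv_l inv_r) (simp_all add: matrix_mul_assoc[symmetric] inv_l inv_r)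

lemma grp_grp: assumes a: "a \<in> W" and b: "b \<in> W" shows "smash_grp a \<otimes>\<^bsub>Sm\<^esub> smash_grp b = smash_grp (a ** b)"
  unfolding grp_mult[OF a] unfolding smash_grp_def fun_eq_iff using a b
  by (auto simp: tensor_act_one tensor_act_zero W_mult inv_mult_eq)

lemma grp_tensor: assumes a: "a \<in> W" shows "smash_grp a \<otimes>\<^bsub>Sm\<^esub> smash_tensor p = smash_tensor (tensor_act a p) \<otimes>\<^bsub>Sm\<^esub> smash_grp a"
  unfolding grp_mult[OF a] mult_grp[OF a] smash_tensor_def fun_eq_iff using a
  by (auto simp: tensor_act_zero inv_mult_eq)

lemma X_linear: "Xc (x + y) = Xc x \<oplus>\<^bsub>HH\<^esub> Xc y" "Xc (k *s x) = k \<odot>\<^bsub>HH\<^esub> Xc x" "Xc 0 = \<zero>\<^bsub>HH\<^esub>"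
  and Y_linear: "Yc (x + y) = Yc x \<oplus>\<^bsub>HH\<^esub> Yc y" "Yc (k *s x) = k \<odot>\<^bsub>HH\<^esub> Yc x" "Yc 0 = \<zero>\<^bsub>HH\<^esub>"
proof -
  have "tensor_covec (x + y) = tensor_covec x + tensor_covec y" "tensor_covec (k *s x) = tensor_scalar k * tensor_covec x"
    "tensor_vec (x + y) = tensor_vec x + tensor_vec y" "tensor_vec (k *s x) = tensor_scalar k * tensor_vec x"
    "tensor_vec (0 :: complex ^ 'n) = 0" "tensor_covec (0 :: complex ^ 'n) = 0"
    by (simp_all add: tensor_vec_sum tensor_covec_sum tensor_scalar_simps(1,3) distrib_right sum.distrib sum_distrib_left
        mult.assoc tensor_scalar_simps(4)[symmetric])
  moreover have "cl \<zero>\<^bsub>Sm\<^esub> = \<zero>\<^bsub>HH\<^esub>" using HQ.cls_zero_iff by simp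
  ultimately show "Xc (x + y) = Xc x \<oplus>\<^bsub>HH\<^esub> Xc y" "Xc (k *s x) = k \<odot>\<^bsub>HH\<^esub> Xc x" "Xc 0 = \<zero>\<^bsub>HH\<^esub>"
    "Yc (x + y) = Yc x \<oplus>\<^bsub>HH\<^esub> Yc y" "Yc (k *s x) = k \<odot>\<^bsub>HH\<^esub> Yc x" "Yc 0 = \<zero>\<^bsub>HH\<^esub>"
    by (simp_all add: Xc_def Yc_def smash_tensor_linear HQ.cls_add HQ.cls_smult Sm_tensor)
qed

lemma G_X: "w \<in> W \<Longrightarrow> Gc w \<otimes>\<^bsub>HH\<^esub> Xc x = Xc (dual_act w x) \<otimes>\<^bsub>HH\<^esub> Gc w"
  and G_Y: "w \<in> W \<Longrightarrow> Gc w \<otimes>\<^bsub>HH\<^esub> Yc y = Yc (w *v y) \<otimes>\<^bsub>HH\<^esub> Gc w"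
  and G_G: "a \<in> W \<Longrightarrow> b \<in> W \<Longrightarrow> Gc a \<otimes>\<^bsub>HH\<^esub> Gc b = Gc (a ** b)"
  by (simp_all add: Gc_def Xc_def Yc_def HQ.cls_mult Sm_grp Sm_tensor grp_tensor tensor_act_vec tensor_act_covec grp_grp)

section \<open>Averages over subgroups\<close>

definition av :: "'n cmat set \<Rightarrow> 'n smash_elem" where
  "av L = (1 / of_nat (card L)) \<odot>\<^bsub>Sm\<^esub> (finsum Sm smash_grp L)"

lemma av_eq: assumes "L \<subseteq> W" shows "av L = (\<lambda>w. if w \<in> L then tensor_scalar (1 / of_nat (card L)) else 0)"
proof -
  have f: "finite L" using assms fin finite_subset by blast
  have "finsum Sm smash_grp L = (\<Sum>w\<in>L. smash_grp w)" using assms f by (intro Sm_finsum) (auto intro: Sm_grp)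
  also have "\<dots> = (\<lambda>w. if w \<in> L then 1 else 0)"
  proof
    fix w
    have "(\<Sum>a\<in>L. smash_grp a) w = (\<Sum>a\<in>L. if a = w then 1 else (0 :: 'n tensor))"
      unfolding sum_fun_apply by (rule sum.cong) (auto simp: smash_grp_def)
    then show "(\<Sum>a\<in>L. smash_grp a) w = (if w \<in> L then 1 else 0)" using f by simp
  qed
  finally show ?thesis by (auto simp: av_def Sm_simps)
qed

lemma av_closed: "L \<subseteq> W \<Longrightarrow> av L \<in> carrier Sm" by (auto simp: av_eq Sm_simps)

lemma grp_av: assumes L: "L \<subseteq> W" "\<And>a b. a \<in> L \<Longrightarrow> b \<in> L \<Longrightarrow> a ** b \<in> L" "\<And>a. a \<in> L \<Longrightarrow> matrix_inv a \<in> L" and a: "a \<in> L"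
  shows "smash_grp a \<otimes>\<^bsub>Sm\<^esub> av L = av L" "av L \<otimes>\<^bsub>Sm\<^esub> smash_grp a = av L"
proof -
  have aW: "a \<in> W" using L a by blast
  have e: "matrix_inv a ** w \<in> L \<longleftrightarrow> w \<in> L" "w ** matrix_inv a \<in> L \<longleftrightarrow> w \<in> L" if "w \<in> W" for w
  proof -
    have "a ** (matrix_inv a ** w) = w" "(w ** matrix_inv a) ** a = w"
      by (simp_all add: matrix_mul_assoc inv_r[OF aW]) (simp add: matrix_mul_assoc[symmetric] inv_l[OF aW])
    then show "matrix_inv a ** w \<in> L \<longleftrightarrow> w \<in> L" "w ** matrix_inv a \<in> L \<longleftrightarrow> w \<in> L" using L a by metis+
  qed
  show "smash_grp a \<otimes>\<^bsub>Sm\<^esub> av L = av L" "av L \<otimes>\<^bsub>Sm\<^esub> smash_grp a = av L"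
    unfolding grp_mult[OF aW] mult_grp[OF aW] av_eq[OF L(1)] fun_eq_iff using L(1)
    by (auto simp: e tensor_act_scalar tensor_act_zero)
qed

lemma av_mult: assumes L: "L \<subseteq> W" "L \<noteq> {}" and F: "F \<in> carrier Sm"
  shows "(\<And>a. a \<in> L \<Longrightarrow> smash_grp a \<otimes>\<^bsub>Sm\<^esub> F = F) \<Longrightarrow> av L \<otimes>\<^bsub>Sm\<^esub> F = F"
    "(\<And>a. a \<in> L \<Longrightarrow> F \<otimes>\<^bsub>Sm\<^esub> smash_grp a = F) \<Longrightarrow> F \<otimes>\<^bsub>Sm\<^esub> av L = F"
proof -
  have f: "finite L" using L fin finite_subset by blast
  have g: "smash_grp \<in> L \<rightarrow> carrier Sm" using L Sm_grp by auto
  have c: "of_nat (card L) \<noteq> (0::complex)" using f L by simp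
  have s: "finsum Sm (\<lambda>_. F) L = of_nat (card L) \<odot>\<^bsub>Sm\<^esub> F"
  proof -
    have "finsum Sm (\<lambda>_. F) L = (\<Sum>w\<in>L. F)" using f F by (intro Sm_finsum) auto
    moreover have "(\<Sum>w\<in>L. F) w = of_nat (card L) * F w" for w
      unfolding sum_fun_apply by (rule sum_constant)
    moreover have "tensor_scalar (of_nat n) = (of_nat n :: 'n tensor)" for n
      by (induction n) (simp_all add: tensor_scalar_simps)
    ultimately show ?thesis by (simp only: Sm_simps) (simp add: fun_eq_iff)
  qed
  show "av L \<otimes>\<^bsub>Sm\<^esub> F = F" if a: "\<And>a. a \<in> L \<Longrightarrow> smash_grp a \<otimes>\<^bsub>Sm\<^esub> F = F"
  proof -
    have "finsum Sm smash_grp L \<otimes>\<^bsub>Sm\<^esub> F = finsum Sm (\<lambda>a. smash_grp a \<otimes>\<^bsub>Sm\<^esub> F) L"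
      by (rule S.finsum_ldistr[OF f F g])
    also have "\<dots> = finsum Sm (\<lambda>_. F) L" using F by (intro S.finsum_cong') (auto simp: a)
    finally show ?thesis using c F g by (simp add: av_def S.sm_mult_l s S.sm_assoc)
  qed
  show "F \<otimes>\<^bsub>Sm\<^esub> av L = F" if a: "\<And>a. a \<in> L \<Longrightarrow> F \<otimes>\<^bsub>Sm\<^esub> smash_grp a = F"
  proof -
    have "F \<otimes>\<^bsub>Sm\<^esub> finsum Sm smash_grp L = finsum Sm (\<lambda>a. F \<otimes>\<^bsub>Sm\<^esub> smash_grp a) L"
      by (rule S.finsum_rdistr[OF f F g])
    also have "\<dots> = finsum Sm (\<lambda>_. F) L" using F by (intro S.finsum_cong') (auto simp: a)
    finally show ?thesis using c F g by (simp add: av_def S.sm_mult_r s S.sm_assoc)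
  qed
qed

definition ee :: "'n smash_elem set" where "ee = cl (av W)"

lemma ee_closed [simp]: "ee \<in> carrier HH" by (simp add: ee_def HQ.cls_closed av_closed)

lemma G_ee: "w \<in> W \<Longrightarrow> Gc w \<otimes>\<^bsub>HH\<^esub> ee = ee" "w \<in> W \<Longrightarrow> ee \<otimes>\<^bsub>HH\<^esub> Gc w = ee"
  using grp_av[of W w] by (simp_all add: Gc_def ee_def HQ.cls_mult Sm_grp av_closed W_mult W_inv)

lemma ee_ee: "ee \<otimes>\<^bsub>HH\<^esub> ee = ee"
proof -
  have "W \<noteq> {}" using W_one by blast
  then have "av W \<otimes>\<^bsub>Sm\<^esub> av W = av W"
    using grp_av[of W] by (intro av_mult(1)) (auto simp: av_closed W_mult W_inv)
  then show ?thesis by (simp add: ee_def HQ.cls_mult av_closed)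
qed

text \<open>Independent of the chosen representative, because the ideal acts by zero
  (\<open>II_rker\<close>).\<close>

definition rhoH :: "'n smash_elem set \<Rightarrow> 'n pf \<Rightarrow> 'n pf" where
  "rhoH h P = rho (SOME F. F \<in> carrier Sm \<and> h = cl F) P"

lemma rhoH_cl: assumes F: "F \<in> carrier Sm" and P: "pol P" shows "rhoH (cl F) P = rho F P"
proof -
  define F' where "F' = (SOME F'. F' \<in> carrier Sm \<and> cl F = cl F')"
  have "\<exists>F'. F' \<in> carrier Sm \<and> cl F = cl F'" using F by blast
  then have F': "F' \<in> carrier Sm" "cl F = cl F'" using someI_ex[of "\<lambda>F'. F' \<in> carrier Sm \<and> cl F = cl F'"] unfolding F'_def by blast+
  then have "F \<ominus>\<^bsub>Sm\<^esub> F' \<in> II" using F by (simp add: HQ.cls_eq)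
  then have "rho (F \<ominus>\<^bsub>Sm\<^esub> F') P = 0" using II_rker P by (auto simp: rker_def)
  then have "rho F' P = rho F P" using F F'(1) by (simp add: rho_minus)
  then show ?thesis by (simp only: rhoH_def F'_def)
qed

lemma HH_cases: assumes "h \<in> carrier HH" obtains F where "F \<in> carrier Sm" "h = cl F"
  using assms by (auto simp: HQ.carrier_Q)

lemma rhoH_mult: "h \<in> carrier HH \<Longrightarrow> h' \<in> carrier HH \<Longrightarrow> pol P \<Longrightarrow> rhoH (h \<otimes>\<^bsub>HH\<^esub> h') P = rhoH h (rhoH h' P)"
  by (elim HH_cases) (simp add: HQ.cls_mult rhoH_cl rho_mult pol_rho)
lemma rhoH_add: "h \<in> carrier HH \<Longrightarrow> h' \<in> carrier HH \<Longrightarrow> pol P \<Longrightarrow> rhoH (h \<oplus>\<^bsub>HH\<^esub> h') P = rhoH h P + rhoH h' P"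
  by (elim HH_cases) (simp add: HQ.cls_add rhoH_cl Sm_simps(4)[symmetric], simp add: Sm_simps(4) rho_add)
lemma rhoH_smult: "h \<in> carrier HH \<Longrightarrow> pol P \<Longrightarrow> rhoH (k \<odot>\<^bsub>HH\<^esub> h) P = cst k * rhoH h P"
  by (elim HH_cases) (simp add: HQ.cls_smult rhoH_cl rho_smult)
lemma pol_rhoH: "h \<in> carrier HH \<Longrightarrow> pol P \<Longrightarrow> pol (rhoH h P)"
  by (elim HH_cases) (simp add: rhoH_cl pol_rho)
lemma rhoH_minus: "h \<in> carrier HH \<Longrightarrow> h' \<in> carrier HH \<Longrightarrow> pol P \<Longrightarrow> rhoH (h \<ominus>\<^bsub>HH\<^esub> h') P = rhoH h P - rhoH h' P"
  by (simp add: H.minus_sm rhoH_add rhoH_smult cst_simps(5)[symmetric] cst_simps(2))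
lemma rhoH_zero: "pol P \<Longrightarrow> rhoH \<zero>\<^bsub>HH\<^esub> P = 0"
  using rhoH_minus[of "\<zero>\<^bsub>HH\<^esub>" "\<zero>\<^bsub>HH\<^esub>" P] by (simp add: a_minus_def)
lemma rhoH_one: "pol P \<Longrightarrow> rhoH \<one>\<^bsub>HH\<^esub> P = P"
  by (simp add: HQ.cls_one rhoH_cl rho_one)
lemma rhoH_padd: "h \<in> carrier HH \<Longrightarrow> pol P \<Longrightarrow> pol Q \<Longrightarrow> rhoH h (P + Q) = rhoH h P + rhoH h Q"
  by (elim HH_cases) (simp add: rhoH_cl pol_add rho_padd)
lemma rhoH_pcmult: "h \<in> carrier HH \<Longrightarrow> pol P \<Longrightarrow> rhoH h (cst k * P) = cst k * rhoH h P"
  by (elim HH_cases) (simp add: rhoH_cl pol_cst pol_mult rho_pcmult)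
lemma rhoH_X: "pol P \<Longrightarrow> rhoH (Xc x) P = lin_v x * P" and rhoH_Y: "pol P \<Longrightarrow> rhoH (Yc y) P = dunkl y P"
  and rhoH_G: "w \<in> W \<Longrightarrow> pol P \<Longrightarrow> rhoH (Gc w) P = gact w P"
  by (simp_all add: Xc_def Yc_def Gc_def rhoH_cl Sm_tensor Sm_grp rho_tensor tens_vec tens_covec rho_grp)

lemma rhoH_ee: "pol P \<Longrightarrow> rhoH ee P = cst (1 / of_nat (card W)) * (\<Sum>w\<in>W. gact w P)"
proof -
  assume P: "pol P"
  have g: "finsum Sm smash_grp W = (\<Sum>w\<in>W. smash_grp w)" using fin by (intro Sm_finsum) (auto intro: Sm_grp)
  have "finsum Sm smash_grp W \<in> carrier Sm" by (rule S.finsum_closed) (auto intro: Sm_grp)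
  then show ?thesis
    using P by (simp add: ee_def rhoH_cl av_closed) (simp add: av_def rho_smult g rho_sum rho_grp)
qed

definition Winv :: "'n pf \<Rightarrow> bool" where "Winv P \<longleftrightarrow> (\<forall>w\<in>W. gact w P = P)"

lemma rhoH_ee_inv: assumes "pol P" "Winv P" shows "rhoH ee P = P"
proof -
  have "(\<Sum>w\<in>W. gact w P) = (\<Sum>w\<in>W. P)" using assms(2) by (intro sum.cong) (auto simp: Winv_def)
  moreover have "cst (1 / of_nat (card W)) * (\<Sum>w\<in>W. P) = P"
    using fin W_one by (intro pf_eqI) (auto simp: pfs sum_fun_apply)
  ultimately show ?thesis using assms by (simp add: rhoH_ee)
qed

lemma Winv_rhoH_ee: assumes "pol P" shows "Winv (rhoH ee P)"
  unfolding Winv_def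
proof
  fix w assume w: "w \<in> W"
  have "gact w (rhoH ee P) = rhoH (Gc w \<otimes>\<^bsub>HH\<^esub> ee) P"
    using w assms by (simp add: rhoH_mult rhoH_G pol_rhoH)
  then show "gact w (rhoH ee P) = rhoH ee P" using w by (simp add: G_ee)
qed

section \<open>Normally ordered words span \<open>He\<close>\<close>

definition nwl :: "'n list \<Rightarrow> 'n list \<Rightarrow> 'n smash_elem set" where
  "nwl xs ys = foldr (\<lambda>i h. Xc (axis i 1) \<otimes>\<^bsub>HH\<^esub> h) xs (foldr (\<lambda>j h. Yc (axis j 1) \<otimes>\<^bsub>HH\<^esub> h) ys ee)"

lemma nwl_Nil: "nwl [] [] = ee" "nwl (i # xs) ys = Xc (axis i 1) \<otimes>\<^bsub>HH\<^esub> nwl xs ys"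
  "nwl [] (j # ys) = Yc (axis j 1) \<otimes>\<^bsub>HH\<^esub> nwl [] ys"
  by (simp_all add: nwl_def)

lemma nwl_closed [simp]: "nwl xs ys \<in> carrier HH"
proof (induction xs)
  case Nil then show ?case by (induction ys) (simp_all add: nwl_Nil)
qed (simp_all add: nwl_Nil)

definition BD :: "nat \<Rightarrow> 'n smash_elem set set" where "BD d = {nwl xs ys | xs ys. length xs + length ys \<le> d}"
text \<open>Words without covectors. Multiplication by a vector or a group element never creates
  covectors, so their span is a self-contained base case for moving letters into full words.\<close>

definition BY :: "nat \<Rightarrow> 'n smash_elem set set" where "BY d = {nwl [] ys | ys. length ys \<le> d}"

lemma B_carrier: "BD d \<subseteq> carrier HH" "BY d \<subseteq> carrier HH" by (auto simp: BD_def BY_def)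

definition DD :: "nat \<Rightarrow> 'n smash_elem set set" where "DD d = spn HH (BD d)"

lemma DD_subspace: "subspace_of (DD d) HH" unfolding DD_def by (rule H.spn_subspace[OF B_carrier(1)])
lemma DD_closed: "h \<in> DD d \<Longrightarrow> h \<in> carrier HH" using H.subspaceD(1)[OF DD_subspace] by blast
lemma DD_mono: "d \<le> d' \<Longrightarrow> DD d \<subseteq> DD d'" unfolding DD_def BD_def by (rule H.spn_mono) (blast intro: order_trans)
lemma BY_DD: "spn HH (BY d) \<subseteq> DD d" unfolding DD_def BD_def BY_def 
  by (rule H.spn_mono) (clarsimp, rule exI[of _ "[]"], rule_tac x = ys in exI, simp)
lemma nwl_DD: "nwl xs ys \<in> DD (length xs + length ys)"
  unfolding DD_def by (rule H.spn_base[OF B_carrier(1)]) (auto simp: BD_def)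

text \<open>The spanning words use basis letters only, but group elements turn basis letters into
  arbitrary vectors and covectors; linearity brings these back.\<close>

lemma linear_closure:
  assumes "\<And>x y. f (x + y) = f x \<oplus>\<^bsub>HH\<^esub> f y" "\<And>k x. f (k *s x) = k \<odot>\<^bsub>HH\<^esub> f x" "f 0 = \<zero>\<^bsub>HH\<^esub>"
    "\<And>x. f x \<in> carrier HH" "subspace_of V HH" "h \<in> carrier HH" "\<And>i. f (axis i 1) \<otimes>\<^bsub>HH\<^esub> h \<in> V"
  shows "f (x :: complex ^ 'n) \<otimes>\<^bsub>HH\<^esub> h \<in> V"
proof -
  have "f (\<Sum>i\<in>K. x $ i *s axis i 1) \<otimes>\<^bsub>HH\<^esub> h \<in> V" if "finite K" for K
    using that
  proof (induction K rule: finite_induct)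
    case empty then show ?case using assms H.subspaceD[OF assms(5)] by simp
  next
    case (insert i K)
    then show ?case using assms H.subspaceD[OF assms(5)] by (simp add: H.l_distr H.sm_mult_l)
  qed
  from this[of UNIV] show ?thesis by (simp add: axis_sum)
qed

lemma Y_spnY: assumes "h \<in> spn HH (BY d)" shows "Yc y \<otimes>\<^bsub>HH\<^esub> h \<in> spn HH (BY (Suc d))"
proof -
  have h: "h \<in> carrier HH" using H.spn_closed[OF B_carrier(2) assms] .
  have "Yc (axis i 1) \<otimes>\<^bsub>HH\<^esub> h \<in> spn HH (BY (Suc d))" for i
  proof (rule H.spn_image[OF B_carrier(2) _ H.spn_subspace[OF B_carrier(2)] _ assms])
    fix b assume "b \<in> BY d"
    then obtain ys where "b = nwl [] ys" "length ys \<le> d" by (auto simp: BY_def)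
    then have "Yc (axis i 1) \<otimes>\<^bsub>HH\<^esub> b = nwl [] (i # ys)" "length (i # ys) \<le> Suc d"
      by (simp_all only: nwl_Nil(3) list.size)
    then have "Yc (axis i 1) \<otimes>\<^bsub>HH\<^esub> b \<in> BY (Suc d)"
      unfolding BY_def by (intro CollectI exI[of _ "i # ys"] conjI)
    then show "Yc (axis i 1) \<otimes>\<^bsub>HH\<^esub> b \<in> spn HH (BY (Suc d))" by (rule H.spn_base[OF B_carrier(2)])
  qed simp
  then show ?thesis 
    by (rule linear_closure[of Yc, OF Y_linear XYG_closed(2) H.spn_subspace[OF B_carrier(2)] h])
qed

lemma X_DD: assumes "h \<in> DD d" shows "Xc x \<otimes>\<^bsub>HH\<^esub> h \<in> DD (Suc d)"
proof -
  have "Xc (axis i 1) \<otimes>\<^bsub>HH\<^esub> h \<in> DD (Suc d)" for i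
  proof (rule H.spn_image[OF B_carrier(1) _ DD_subspace _ assms[unfolded DD_def]])
    fix b assume "b \<in> BD d"
    then obtain xs ys where "b = nwl xs ys" "length xs + length ys \<le> d" by (auto simp: BD_def)
    then have "Xc (axis i 1) \<otimes>\<^bsub>HH\<^esub> b = nwl (i # xs) ys" "length (i # xs) + length ys \<le> Suc d"
      by (simp_all only: nwl_Nil(2) list.size)
    then have "Xc (axis i 1) \<otimes>\<^bsub>HH\<^esub> b \<in> BD (Suc d)"
      unfolding BD_def by (metis (mono_tags, lifting) mem_Collect_eq)
    then show "Xc (axis i 1) \<otimes>\<^bsub>HH\<^esub> b \<in> DD (Suc d)" unfolding DD_def by (rule H.spn_base[OF B_carrier(1)])
  qed simp
  then show ?thesis 
    by (rule linear_closure[of Xc, OF X_linear XYG_closed(1) DD_subspace DD_closed[OF assms]])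
qed

lemma G_nwlY: "w \<in> W \<Longrightarrow> Gc w \<otimes>\<^bsub>HH\<^esub> nwl [] ys \<in> spn HH (BY (length ys))"
proof (induction ys)
  case Nil
  then show ?case by (simp add: nwl_Nil G_ee) (rule H.spn_base[OF B_carrier(2)], auto simp: BY_def nwl_Nil(1)[symmetric])
next
  case (Cons j ys)
  have "Gc w \<otimes>\<^bsub>HH\<^esub> nwl [] (j # ys) = Yc (w *v axis j 1) \<otimes>\<^bsub>HH\<^esub> (Gc w \<otimes>\<^bsub>HH\<^esub> nwl [] ys)"
    using Cons by (simp add: nwl_Nil H.m_assoc[symmetric] G_Y)
  then show ?case using Y_spnY[OF Cons(1)[OF Cons(2)]] by simp
qed

lemma G_nwl: "w \<in> W \<Longrightarrow> Gc w \<otimes>\<^bsub>HH\<^esub> nwl xs ys \<in> DD (length xs + length ys)"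
proof (induction xs)
  case Nil then show ?case using G_nwlY[of w ys] BY_DD by auto
next
  case (Cons i xs)
  have "Gc w \<otimes>\<^bsub>HH\<^esub> nwl (i # xs) ys = Xc (dual_act w (axis i 1)) \<otimes>\<^bsub>HH\<^esub> (Gc w \<otimes>\<^bsub>HH\<^esub> nwl xs ys)"
    using Cons by (simp add: nwl_Nil H.m_assoc[symmetric] G_X)
  then show ?case using X_DD[OF Cons(1)[OF Cons(2)]] by simp
qed

lemma G_DD: assumes "w \<in> W" "h \<in> DD d" shows "Gc w \<otimes>\<^bsub>HH\<^esub> h \<in> DD d"
proof (rule H.spn_image[OF B_carrier(1) _ DD_subspace _ assms(2)[unfolded DD_def]])
  fix b assume "b \<in> BD d"
  then show "Gc w \<otimes>\<^bsub>HH\<^esub> b \<in> DD d" using G_nwl[OF assms(1)] DD_mono by (fastforce simp: BD_def)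
qed (use assms in simp)

text \<open>The right-hand side of the relation is a combination of group elements, and these do not
  lengthen words.\<close>

lemma rhs_DD: assumes h: "h \<in> DD d" shows "cl (cherednik_rhs W \<alpha> \<alpha>' t c x y) \<otimes>\<^bsub>HH\<^esub> h \<in> DD d"
proof -
  let ?k = "\<lambda>s. 2 * c s / pairing (\<alpha> s) (\<alpha>' s) * pairing x (\<alpha>' s) * pairing (\<alpha> s) y"
  have hH: "h \<in> carrier HH" using DD_closed[OF h] .
  have fc: "finsum Sm (\<lambda>s. ?k s \<odot>\<^bsub>Sm\<^esub> smash_grp s) R \<in> carrier Sm" by (intro S.finsum_closed) (auto intro: Sm_grp R_W)
  have gc: "(\<lambda>s. ?k s \<odot>\<^bsub>HH\<^esub> Gc s) \<in> R \<rightarrow> carrier HH" by (auto intro!: H.sm_closed XYG_closed R_W)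
  have "cl (finsum Sm (\<lambda>s. ?k s \<odot>\<^bsub>Sm\<^esub> smash_grp s) R) = finsum HH (\<lambda>s. cl (?k s \<odot>\<^bsub>Sm\<^esub> smash_grp s)) R"
    by (rule HQ.cls_finsum[OF finR]) (auto intro: Sm_grp R_W)
  also have "\<dots> = finsum HH (\<lambda>s. ?k s \<odot>\<^bsub>HH\<^esub> Gc s) R"
    by (rule H.finsum_cong'[OF refl gc]) (simp add: Gc_def HQ.cls_smult Sm_grp R_W)
  finally have e: "cl (cherednik_rhs W \<alpha> \<alpha>' t c x y) = (t * pairing x y) \<odot>\<^bsub>HH\<^esub> \<one>\<^bsub>HH\<^esub> \<ominus>\<^bsub>HH\<^esub> finsum HH (\<lambda>s. ?k s \<odot>\<^bsub>HH\<^esub> Gc s) R"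
    unfolding cherednik_rhs_def using fc by (simp add: HQ.cls_minus[symmetric] HQ.cls_smult[symmetric] HQ.cls_one[symmetric])
  have fs: "finsum HH (\<lambda>s. ?k s \<odot>\<^bsub>HH\<^esub> Gc s) R \<otimes>\<^bsub>HH\<^esub> h = finsum HH (\<lambda>s. (?k s \<odot>\<^bsub>HH\<^esub> Gc s) \<otimes>\<^bsub>HH\<^esub> h) R"
    by (rule H.finsum_ldistr[OF finR hH gc])
  have "\<dots> \<in> DD d"
    by (rule H.subspace_finsum[OF DD_subspace finR])
       (use H.subspaceD[OF DD_subspace] G_DD[OF R_W h] hH R_W in \<open>auto simp: H.sm_mult_l\<close>)
  then show ?thesis unfolding e using H.subspaceD[OF DD_subspace] h hH H.finsum_closed[OF gc] fs
    by (simp add: a_minus_def H.l_distr H.l_minus H.sm_mult_l)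
qed

text \<open>Passing \<open>y\<close> over one covector leaves a term in the group algebra that is
  two letters shorter; past all covectors, \<open>y\<close> joins the vectors.\<close>

lemma Y_nwl: "Yc y \<otimes>\<^bsub>HH\<^esub> nwl xs ys \<in> DD (Suc (length xs + length ys))"
proof (induction xs)
  case Nil
  have "nwl [] ys \<in> spn HH (BY (length ys))" by (rule H.spn_base[OF B_carrier(2)]) (auto simp: BY_def)
  then show ?case using Y_spnY[of "nwl [] ys" "length ys" y] BY_DD by auto
next
  case (Cons i xs)
  have r: "cl (cherednik_rhs W \<alpha> \<alpha>' t c (axis i 1) y) \<in> carrier HH" by (simp add: HQ.cls_closed rhs_closed)
  have "Yc y \<otimes>\<^bsub>HH\<^esub> nwl (i # xs) ys = Xc (axis i 1) \<otimes>\<^bsub>HH\<^esub> (Yc y \<otimes>\<^bsub>HH\<^esub> nwl xs ys) \<oplus>\<^bsub>HH\<^esub>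
      cl (cherednik_rhs W \<alpha> \<alpha>' t c (axis i 1) y) \<otimes>\<^bsub>HH\<^esub> nwl xs ys"
    using r by (simp add: nwl_Nil H.m_assoc[symmetric] YX_comm H.l_distr)
  moreover have "cl (cherednik_rhs W \<alpha> \<alpha>' t c (axis i 1) y) \<otimes>\<^bsub>HH\<^esub> nwl xs ys \<in> DD (Suc (Suc (length xs + length ys)))"
    using rhs_DD[OF nwl_DD] DD_mono[of "length xs + length ys" "Suc (Suc (length xs + length ys))"] by auto
  ultimately show ?case using X_DD[OF Cons, of "axis i 1"] H.subspaceD[OF DD_subspace] by simp
qed

lemma Y_DD: assumes "h \<in> DD d" shows "Yc y \<otimes>\<^bsub>HH\<^esub> h \<in> DD (Suc d)"
proof (rule H.spn_image[OF B_carrier(1) _ DD_subspace _ assms[unfolded DD_def]])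
  fix b assume "b \<in> BD d"
  then obtain xs ys where "b = nwl xs ys" "length xs + length ys \<le> d" by (auto simp: BD_def)
  then show "Yc y \<otimes>\<^bsub>HH\<^esub> b \<in> DD (Suc d)" using Y_nwl[of y xs ys] DD_mono[of "Suc (length xs + length ys)" "Suc d"] by auto
qed simp

lemma ee_DD: "ee \<in> DD 0" using nwl_DD[of "[]" "[]"] by (simp add: nwl_Nil)

lemma word_DD: "cl (smash_tensor (Poly_Mapping.single (Word us) 1)) \<otimes>\<^bsub>HH\<^esub> ee \<in> DD (length us)"
proof (induction us)
  case Nil
  have "smash_tensor (Poly_Mapping.single (Word []) 1) = \<one>\<^bsub>Sm\<^esub>"
    by (auto simp: smash_tensor_def Sm_simps zero_word_def[symmetric])
  then show ?case using ee_DD by (simp add: HQ.cls_one[symmetric])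
next
  case (Cons l us)
  have st: "smash_tensor (p * q) = smash_tensor p \<otimes>\<^bsub>Sm\<^esub> smash_tensor q" for p q :: "'n tensor"
  proof (rule Sm_eqI[OF Sm_tensor Sm_mult_closed])
    fix w assume w: "w \<in> W"
    have "(smash_tensor p \<otimes>\<^bsub>Sm\<^esub> smash_tensor q) w = (\<Sum>a\<in>W. if a = mat 1 then p * tensor_act (mat 1) (smash_tensor q (matrix_inv (mat 1) ** w)) else 0)"
      unfolding Sm_mult[OF w] by (rule sum.cong) (auto simp: smash_tensor_def)
    then show "smash_tensor (p * q) w = (smash_tensor p \<otimes>\<^bsub>Sm\<^esub> smash_tensor q) w"
      using fin W_one by (auto simp: inv_one tensor_act_id smash_tensor_def)
  qed
  have "Poly_Mapping.single (Word (l # us)) 1 = Poly_Mapping.single (Word [l]) (1::complex) * Poly_Mapping.single (Word us) 1"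
    by (simp add: mult_single plus_word_def)
  then have e: "cl (smash_tensor (Poly_Mapping.single (Word (l # us)) 1)) \<otimes>\<^bsub>HH\<^esub> ee =
    cl (smash_tensor (Poly_Mapping.single (Word [l]) 1)) \<otimes>\<^bsub>HH\<^esub> (cl (smash_tensor (Poly_Mapping.single (Word us) 1)) \<otimes>\<^bsub>HH\<^esub> ee)"
    by (simp add: st HQ.cls_mult[symmetric] Sm_tensor H.m_assoc HQ.cls_closed)
  show ?case unfolding e using X_DD[OF Cons] Y_DD[OF Cons] by (cases l) (simp_all add: single_letter Xc_def Yc_def)
qed

lemma tensor_DD:
  assumes "\<And>u. u \<in> Poly_Mapping.keys p \<Longrightarrow> length (letters u) \<le> d"
  shows "cl (smash_tensor p) \<otimes>\<^bsub>HH\<^esub> ee \<in> DD d"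
proof -
  have "cl (smash_tensor (\<Sum>u\<in>K. Poly_Mapping.single u (Poly_Mapping.lookup p u))) \<otimes>\<^bsub>HH\<^esub> ee \<in> DD d"
    if "finite K" "K \<subseteq> Poly_Mapping.keys p" for K
    using that
  proof (induction K rule: finite_induct)
    case empty
    have "cl \<zero>\<^bsub>Sm\<^esub> = \<zero>\<^bsub>HH\<^esub>" using HQ.cls_zero_iff by simp
    then show ?case using H.subspaceD[OF DD_subspace] by (simp add: smash_tensor_linear)
  next
    case (insert u K)
    let ?k = "Poly_Mapping.lookup p u" and ?s = "Poly_Mapping.single u (1::complex)"
    have "Poly_Mapping.single u ?k = tensor_scalar ?k * ?s" by (simp add: tensor_scalar_def mult_single)
    moreover have "cl (smash_tensor ?s) \<otimes>\<^bsub>HH\<^esub> ee \<in> DD d"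
      using word_DD[of "letters u"] DD_mono[of "length (letters u)" d] assms[of u] insert by auto
    ultimately show ?case using insert H.subspaceD[OF DD_subspace]
      by (simp add: smash_tensor_linear HQ.cls_add[symmetric] HQ.cls_smult[symmetric] Sm_tensor H.l_distr H.sm_mult_l HQ.cls_closed)
  qed
  from this[of "Poly_Mapping.keys p"] show ?thesis by (simp add: poly_mapping_monomials)
qed

lemma smash_decomp: assumes F: "F \<in> carrier Sm" shows "F = finsum Sm (\<lambda>w. smash_tensor (F w) \<otimes>\<^bsub>Sm\<^esub> smash_grp w) W"
proof -
  have "finsum Sm (\<lambda>w. smash_tensor (F w) \<otimes>\<^bsub>Sm\<^esub> smash_grp w) W = (\<Sum>w\<in>W. smash_tensor (F w) \<otimes>\<^bsub>Sm\<^esub> smash_grp w)"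
    using fin by (intro Sm_finsum) (auto intro: Sm_mult_closed)
  also have "\<dots> = F"
  proof
    fix w
    have e: "(w ** matrix_inv a = mat 1) = (a = w)" if "a \<in> W" for a
      using that by (metis inv_l inv_r matrix_mul_assoc matrix_mul_lid matrix_mul_rid)
    have "(\<Sum>a\<in>W. smash_tensor (F a) \<otimes>\<^bsub>Sm\<^esub> smash_grp a) w = (\<Sum>a\<in>W. if a = w then F w else 0)"
      unfolding sum_fun_apply by (intro sum.cong) (auto simp: mult_grp smash_tensor_def e)
    then show "(\<Sum>a\<in>W. smash_tensor (F a) \<otimes>\<^bsub>Sm\<^esub> smash_grp a) w = F w"
      using fin F by (auto simp: Sm_simps)
  qed
  finally show ?thesis by simp
qed

text \<open>The spanning half of the Poincare-Birkhoff-Witt property, with control of the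
  filtration: group elements on the right are absorbed by \<open>ee\<close>.\<close>

lemma filt_DD:
  assumes F: "F \<in> carrier Sm" "\<And>w u. u \<in> Poly_Mapping.keys (F w) \<Longrightarrow> length (letters u) \<le> d"
  shows "cl F \<otimes>\<^bsub>HH\<^esub> ee \<in> DD d"
proof -
  have c: "(\<lambda>w. cl (smash_tensor (F w)) \<otimes>\<^bsub>HH\<^esub> Gc w) \<in> W \<rightarrow> carrier HH" by (auto simp: HQ.cls_closed Sm_tensor)
  have "cl F = finsum HH (\<lambda>w. cl (smash_tensor (F w) \<otimes>\<^bsub>Sm\<^esub> smash_grp w)) W"
    by (subst smash_decomp[OF F(1)], rule HQ.cls_finsum[OF fin]) (rule Sm_mult_closed)
  also have "\<dots> = finsum HH (\<lambda>w. cl (smash_tensor (F w)) \<otimes>\<^bsub>HH\<^esub> Gc w) W"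
    by (rule H.finsum_cong'[OF refl c]) (simp add: HQ.cls_mult Sm_tensor Sm_grp Gc_def)
  finally have "cl F \<otimes>\<^bsub>HH\<^esub> ee = finsum HH (\<lambda>w. (cl (smash_tensor (F w)) \<otimes>\<^bsub>HH\<^esub> Gc w) \<otimes>\<^bsub>HH\<^esub> ee) W"
    by (simp add: H.finsum_ldistr[OF fin _ c])
  also have "\<dots> \<in> DD d"
    by (rule H.subspace_finsum[OF DD_subspace fin])
       (use F(2) in \<open>simp add: H.m_assoc HQ.cls_closed Sm_tensor G_ee tensor_DD\<close>)
  finally show ?thesis .
qed

section \<open>Normally ordered words are independent\<close>

lemma foldr_perm:
  assumes "\<And>i. a i \<in> carrier HH" "\<And>i j. a i \<otimes>\<^bsub>HH\<^esub> a j = a j \<otimes>\<^bsub>HH\<^esub> a i" "h \<in> carrier HH" "mset xs = mset ys"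
  shows "foldr (\<lambda>i h. a i \<otimes>\<^bsub>HH\<^esub> h) xs h = foldr (\<lambda>i h. a i \<otimes>\<^bsub>HH\<^esub> h) ys h"
proof -
  have c: "foldr (\<lambda>i h. a i \<otimes>\<^bsub>HH\<^esub> h) zs h \<in> carrier HH" for zs by (induction zs) (simp_all add: assms)
  have move: "foldr (\<lambda>i h. a i \<otimes>\<^bsub>HH\<^esub> h) (as @ y # bs) h = a y \<otimes>\<^bsub>HH\<^esub> foldr (\<lambda>i h. a i \<otimes>\<^bsub>HH\<^esub> h) (as @ bs) h" for as y bs
  proof (induction as)
    case (Cons x as)
    have this0: "a x \<otimes>\<^bsub>HH\<^esub> (a y \<otimes>\<^bsub>HH\<^esub> k) = a y \<otimes>\<^bsub>HH\<^esub> (a x \<otimes>\<^bsub>HH\<^esub> k)" if "k \<in> carrier HH" for k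
      using that assms(1,2) by (metis H.m_assoc)
    have "foldr (\<lambda>i h. a i \<otimes>\<^bsub>HH\<^esub> h) as (foldr (\<lambda>i h. a i \<otimes>\<^bsub>HH\<^esub> h) bs h) \<in> carrier HH"
      using c[of "as @ bs"] by simp
    from this[THEN this0] show ?case using Cons by simp
  qed simp
  show ?thesis using assms(4)
  proof (induction ys arbitrary: xs)
    case (Cons y ys)
    then have "y \<in> set xs" by (metis list.set_intros(1) set_mset_mset)
    then obtain as bs where "xs = as @ y # bs" by (meson split_list)
    moreover have "mset (as @ bs) = mset ys" using Cons(2) calculation by simp
    ultimately show ?case using Cons(1)[of "as @ bs"] move by simp
  qed simp
qed

definition lets :: "'n list \<Rightarrow> 'n list \<Rightarrow> 'n letter multiset" where
  "lets xs ys = mset (map Lx xs) + mset (map Ly ys)"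

lemma lets_eq: assumes "lets xs ys = lets xs' ys'" shows "mset xs = mset xs' \<and> mset ys = mset ys'"
proof -
  have 1: "count (lets as bs) (Lx i) = count (mset as) i" "count (lets as bs) (Ly i) = count (mset bs) i" for as bs i
  proof -
    have "count (lets as bs) (Lx i) = count (mset as) i \<and> count (lets as bs) (Ly i) = count (mset bs) i"
    proof (induction as)
      case Nil then show ?case by (induction bs) (simp_all add: lets_def)
    qed (simp_all add: lets_def)
    then show "count (lets as bs) (Lx i) = count (mset as) i" "count (lets as bs) (Ly i) = count (mset bs) i" by simp_all
  qed
  show ?thesis using assms by (metis 1 multiset_eqI)
qed

text \<open>An order of the letters is chosen; as covectors commute among themselves and so do
  vectors, the choice is immaterial.\<close>

definition nwM :: "'n letter multiset \<Rightarrow> 'n smash_elem set" where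
  "nwM M = (let (xs, ys) = (SOME (xs, ys). M = lets xs ys) in nwl xs ys)"

lemma nwM: "nwM (lets xs ys) = nwl xs ys"
proof -
  define q where "q = (SOME q. lets xs ys = lets (fst q) (snd q))"
  have q: "lets xs ys = lets (fst q) (snd q)" unfolding q_def by (rule someI[of _ "(xs, ys)"]) simp
  have "nwM (lets xs ys) = nwl (fst q) (snd q)"
    by (simp add: nwM_def q_def case_prod_unfold Let_def)
  also have "\<dots> = nwl xs ys"
    using lets_eq[OF q] unfolding nwl_def
    by (metis (no_types, lifting) foldr_perm[of "\<lambda>i. Xc (axis i 1)"] foldr_perm[of "\<lambda>i. Yc (axis i 1)"] XYG_closed X_comm Y_comm
        ee_closed nwl_closed nwl_def foldr.simps(1) id_apply)
  finally show ?thesis .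
qed

lemma nwM_closed [simp]: "nwM M \<in> carrier HH"
  by (simp add: nwM_def case_prod_beta)

lemma monM_simps: "monM (add_mset (Lx i) M) = vco i * monM M" "monM (add_mset (Ly i) M) = xco i * monM M" "monM {#} = 1"
  by (rule pf_eqI, simp add: monM_def pfs)+

lemma monM_v_const: "monM (lets [] ys) v \<xi> = monM (lets [] ys) v' \<xi>"
  by (induction ys) (simp_all add: lets_def monM_simps pfs)

lemma pdeg_monM: "pdeg (int (size M)) (monM M)"
proof (induction M)
  case empty then show ?case by (simp add: monM_simps pdeg_one)
next
  case (add l M)
  then show ?case using pdeg_vco[of "int (size M)"] pdeg_xco[of "int (size M)"]
    by (cases l) (simp_all add: monM_simps add.commute)
qed

text \<open>The vectors act first, on functions of \<open>\<xi>\<close> alone, hence by plain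
  multiplication (\<open>dunkl_const\<close>); the covectors multiply anyway. So no lower order
  terms appear.\<close>

lemma rhoH_nwl: "rhoH (nwl xs ys) 1 = monM (lets xs ys)"
proof (induction xs)
  case Nil
  show ?case
  proof (induction ys)
    case Nil
    have "Winv 1" by (simp add: Winv_def gact_simps)
    then show ?case by (simp add: nwl_Nil rhoH_ee_inv pol_one lets_def monM_simps)
  next
    case (Cons j ys)
    have "rhoH (nwl [] (j # ys)) 1 = dunkl (axis j 1) (monM (lets [] ys))"
      using Cons by (simp add: nwl_Nil rhoH_mult pol_one rhoH_Y pdeg_pol[OF pdeg_monM])
    also have "\<dots> = xco j * monM (lets [] ys)"
      using dunkl_const[OF pdeg_pol[OF pdeg_monM], of "lets [] ys"] monM_v_const by (simp add: xco_lin)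
    finally show ?case by (simp add: lets_def monM_simps)
  qed
next
  case (Cons i xs)
  then show ?case
    by (simp add: nwl_Nil rhoH_mult pol_one rhoH_X pol_rhoH lets_def monM_simps vco_lin pdeg_pol[OF pdeg_monM])
qed

text \<open>The \<open>nwM M\<close> have distinct leading monomials \<open>monM M\<close>, which gives linear independence.\<close>

lemma DD_normal_form:
  assumes "h \<in> DD d"
  shows "\<exists>K a. finite K \<and> (\<forall>M\<in>K. size M \<le> d \<and> (\<exists>xs ys. M = lets xs ys)) \<and> h = finsum HH (\<lambda>M. a M \<odot>\<^bsub>HH\<^esub> nwM M) K \<and>
     rhoH h 1 = (\<Sum>M\<in>K. cst (a M) * monM M)"
  using assms unfolding DD_def
proof induction
  case zero then show ?case by (intro exI[of _ "{}"]) (simp add: rhoH_zero pol_one)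
next
  case (add h b k)
  obtain xs ys where b: "b = nwl xs ys" "length xs + length ys \<le> d" using add(2) by (auto simp: BD_def)
  let ?N = "lets xs ys"
  obtain K a where K: "finite K" "\<forall>M\<in>K. size M \<le> d \<and> (\<exists>xs ys. M = lets xs ys)"
    "h = finsum HH (\<lambda>M. a M \<odot>\<^bsub>HH\<^esub> nwM M) K" "rhoH h 1 = (\<Sum>M\<in>K. cst (a M) * monM M)" using add(3) by blast
  have N: "size ?N \<le> d" using b by (simp add: lets_def)
  \<comment> \<open>The new term is merged with an existing one when its monomial already occurs, so
    that the monomials stay distinct.\<close>
  define a' where "a' = (if ?N \<in> K then a(?N := a ?N + k) else a(?N := k))"
  have hH: "h \<in> carrier HH" using DD_closed[of h d] add(1) by (simp add: DD_def)
  have cl: "(\<lambda>M. f M \<odot>\<^bsub>HH\<^esub> nwM M) \<in> L \<rightarrow> carrier HH" for f L by auto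
  have eq1: "finsum HH (\<lambda>M. a' M \<odot>\<^bsub>HH\<^esub> nwM M) (K - {?N}) = finsum HH (\<lambda>M. a M \<odot>\<^bsub>HH\<^esub> nwM M) (K - {?N})"
    by (rule H.finsum_cong'[OF refl cl]) (auto simp: a'_def)
  have eq2: "(\<Sum>M\<in>K - {?N}. cst (a' M) * monM M) = (\<Sum>M\<in>K - {?N}. cst (a M) * monM M)"
    by (rule sum.cong) (auto simp: a'_def)
  have ins: "finsum HH (\<lambda>M. f M \<odot>\<^bsub>HH\<^esub> nwM M) (insert ?N K) = f ?N \<odot>\<^bsub>HH\<^esub> b \<oplus>\<^bsub>HH\<^esub> finsum HH (\<lambda>M. f M \<odot>\<^bsub>HH\<^esub> nwM M) (K - {?N})" for f
    using H.finsum_insert[of "K - {?N}" ?N "\<lambda>M. f M \<odot>\<^bsub>HH\<^esub> nwM M", OF _ _ cl] K(1) by (simp add: nwM b insert_Diff_single)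
  let ?S = "finsum HH (\<lambda>M. a M \<odot>\<^bsub>HH\<^esub> nwM M) (K - {?N})"
  have S: "?S \<in> carrier HH" by (rule H.finsum_closed[OF cl])
  have bH: "b \<in> carrier HH" by (simp add: b)
  have A: "h \<oplus>\<^bsub>HH\<^esub> k \<odot>\<^bsub>HH\<^esub> b = finsum HH (\<lambda>M. a' M \<odot>\<^bsub>HH\<^esub> nwM M) (insert ?N K)"
  proof (cases "?N \<in> K")
    case True
    then have "h = a ?N \<odot>\<^bsub>HH\<^esub> b \<oplus>\<^bsub>HH\<^esub> ?S" using ins[of a] K(3) by (simp add: insert_absorb)
    then show ?thesis using True S bH unfolding ins eq1 by (simp add: a'_def H.sm_l_distr H.a_ac)
  next
    case False
    then show ?thesis using S bH K(3) unfolding ins eq1 by (simp add: a'_def H.a_comm)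
  qed
  have "rhoH (h \<oplus>\<^bsub>HH\<^esub> k \<odot>\<^bsub>HH\<^esub> b) 1 = (\<Sum>M\<in>K. cst (a M) * monM M) + cst k * monM ?N"
    using hH bH by (simp add: rhoH_add rhoH_smult pol_one K(4)) (simp add: b rhoH_nwl)
  also have "\<dots> = (\<Sum>M\<in>insert ?N K. cst (a' M) * monM M)"
  proof (cases "?N \<in> K")
    case True
    then show ?thesis using K(1) eq2
      by (simp add: sum.remove[of K ?N] insert_absorb) (simp add: a'_def cst_simps(4)[symmetric] algebra_simps)
  next
    case False
    then show ?thesis using K(1) eq2 by (simp add: a'_def add.commute)
  qed
  finally show ?case using K N A by (intro exI[of _ "insert ?N K"] exI[of _ a']) auto
qed

text \<open>By the normal form, the value on 1 lists the coefficients of \<open>h\<close> against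
  independent monomials. This is the other half of the Poincare-Birkhoff-Witt property.\<close>

lemma DD_injective: assumes "h \<in> DD d" "rhoH h 1 = 0" shows "h = \<zero>\<^bsub>HH\<^esub>"
proof -
  obtain K a where K: "finite K" "h = finsum HH (\<lambda>M. a M \<odot>\<^bsub>HH\<^esub> nwM M) K" "rhoH h 1 = (\<Sum>M\<in>K. cst (a M) * monM M)"
    using DD_normal_form[OF assms(1)] by blast
  then have "a M = 0" if "M \<in> K" for M using monomials_independent[of K a M] assms(2) that by simp
  then have "h = finsum HH (\<lambda>M. \<zero>\<^bsub>HH\<^esub>) K" unfolding K(2) by (intro H.finsum_cong') auto
  then show ?thesis by simp
qed

end

section \<open>The product of symbols\<close>

text \<open>The canonical bracket, oriented like the commutator of \<open>y\<close> with
  \<open>x\<close>: the bracket of \<open>xco i\<close> with \<open>vco i\<close> is 1.\<close>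

definition pb :: "('n::finite) pf \<Rightarrow> 'n pf \<Rightarrow> 'n pf" where
  "pb P Q = (\<Sum>i\<in>UNIV. dx (axis i 1) P * dv (axis i 1) Q - dv (axis i 1) P * dx (axis i 1) Q)"

lemma pdeg_pb: assumes "pdeg a P" "pdeg b Q" shows "pdeg (a + b - 2) (pb P Q)"
  unfolding pb_def
proof (rule pdeg_sum, rule pdeg_diff)
  fix i
  have e: "(a - 1) + (b - 1) = a + b - 2" by simp
  show "pdeg (a + b - 2) (dx (axis i 1) P * dv (axis i 1) Q)" "pdeg (a + b - 2) (dv (axis i 1) P * dx (axis i 1) Q)"
    using pdeg_mult[OF pdeg_dx[OF assms(1)] pdeg_dv[OF assms(2)]] pdeg_mult[OF pdeg_dv[OF assms(1)] pdeg_dx[OF assms(2)]]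
    unfolding e by blast+
qed

context refl_data
begin

text \<open>The counterpart of \<open>Delta\<close> in \<open>\<xi>\<close>, divided by the coroot.
  It sums up the terms that arise when a reflection is created inside a product of vectors and then
  acts on the vectors to its right.\<close>

definition nabla :: "'n cmat \<Rightarrow> 'n pf \<Rightarrow> 'n pf" where
  "nabla s P = (SOME Q. pol Q \<and> lin_x (\<alpha>' s) * Q = P - sx s P)"

text \<open>The multiple of the coroot that \<open>s\<close> subtracts from
  \<open>y\<close>.\<close>

definition cs :: "'n cmat \<Rightarrow> complex ^ 'n \<Rightarrow> complex" where
  "cs s y = (1 - inverse (lam s)) / br s * pairing (\<alpha> s) y"

lemma coroot_nz: assumes s: "s \<in> R" shows "lin_x (\<alpha>' s) \<noteq> 0"
proof
  assume "lin_x (\<alpha>' s) = 0"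
  then have "lin_x (\<alpha>' s) 0 (\<alpha> s) = 0" by (simp add: pfs)
  then show False using br[OF s] by (simp add: lin_apply br_def)
qed

lemma sx_lin_x: "s \<in> R \<Longrightarrow> sx s (lin_x y) = lin_x y - cst (cs s y) * lin_x (\<alpha>' s)"
  unfolding sx_simps refl_act by (simp add: lin_linear cs_def)

text \<open>The argument of \<open>Delta_exists\<close> with \<open>v\<close> and
  \<open>\<xi>\<close> exchanged; the twisted Leibniz rule now picks up \<open>cs s\<close>.\<close>

lemma nabla_exists:
  assumes s: "s \<in> R" shows "pdeg m P \<Longrightarrow> \<exists>Q. pdeg (m - 1) Q \<and> lin_x (\<alpha>' s) * Q = P - sx s P"
proof (induction rule: pdeg_induct)
  case (zero m) then show ?case by (intro exI[of _ 0]) (simp add: pdeg_zero sx_simps)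
next
  case (cst m k) then show ?case by (intro exI[of _ 0]) (simp add: pdeg_zero sx_simps)
next
  case (xco m P i)
  then obtain Q where Q: "pdeg (m - 1) Q" "lin_x (\<alpha>' s) * Q = P - sx s P" by blast
  let ?k = "cst (cs s (axis i 1))"
  have "lin_x (\<alpha>' s) * (xco i * Q + ?k * sx s P) = xco i * (lin_x (\<alpha>' s) * Q) + (?k * lin_x (\<alpha>' s)) * sx s P"
    by (simp add: algebra_simps)
  also have "\<dots> = xco i * P - sx s (xco i * P)"
    unfolding Q(2) xco_lin sx_simps(2) sx_lin_x[OF s] by (simp add: algebra_simps)
  finally show ?case using Q xco pdeg_xco[of "m - 1" Q i]
    by (intro exI[of _ "xco i * Q + ?k * sx s P"]) (simp add: pdeg_add pdeg_cmult pdeg_sv)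
next
  case (vco m P i)
  then obtain Q where Q: "pdeg (m - 1) Q" "lin_x (\<alpha>' s) * Q = P - sx s P" by blast
  have "lin_x (\<alpha>' s) * (vco i * Q) = vco i * (lin_x (\<alpha>' s) * Q)" by (simp add: algebra_simps)
  also have "\<dots> = vco i * P - sx s (vco i * P)"
    unfolding Q(2) vco_lin sx_simps by (simp add: algebra_simps)
  finally show ?case using pdeg_vco[OF Q(1), of i] by (intro exI[of _ "vco i * Q"]) simp
next
  case (add m P P')
  then obtain Q Q' where Q: "pdeg (m - 1) Q" "lin_x (\<alpha>' s) * Q = P - sx s P"
    "pdeg (m - 1) Q'" "lin_x (\<alpha>' s) * Q' = P' - sx s P'" by blast
  then show ?case by (intro exI[of _ "Q + Q'"]) (simp add: pdeg_add distrib_left sx_simps)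
qed

lemma nabla: assumes "s \<in> R" "pol P" shows "pol (nabla s P)" "lin_x (\<alpha>' s) * nabla s P = P - sx s P"
proof -
  have "\<exists>Q. pol Q \<and> lin_x (\<alpha>' s) * Q = P - sx s P" using nabla_exists[OF assms(1)] assms(2) unfolding pol_def by blast
  from someI_ex[OF this] show "pol (nabla s P)" "lin_x (\<alpha>' s) * nabla s P = P - sx s P" by (simp_all add: nabla_def)
qed

lemma nabla_eqI: assumes "s \<in> R" "pol P" "pol Q" "lin_x (\<alpha>' s) * Q = P - sx s P" shows "nabla s P = Q"
  using pol_cancel[of "lin_x (\<alpha>' s)" "nabla s P" Q] nabla[OF assms(1,2)] assms coroot_nz pol_lin by metis

lemma pdeg_nabla: assumes "s \<in> R" "pdeg m P" shows "pdeg (m - 1) (nabla s P)"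
  using nabla_exists[OF assms] nabla_eqI[OF assms(1)] assms(2) pdeg_pol by metis

lemma nabla_add: "s \<in> R \<Longrightarrow> pol P \<Longrightarrow> pol Q \<Longrightarrow> nabla s (P + Q) = nabla s P + nabla s Q"
  by (rule nabla_eqI) (simp_all add: pol_add nabla distrib_left sx_simps)

lemma nabla_invar: "s \<in> R \<Longrightarrow> pol P \<Longrightarrow> pol f \<Longrightarrow> sx s f = f \<Longrightarrow> nabla s (f * P) = f * nabla s P"
proof (rule nabla_eqI)
  assume a: "s \<in> R" "pol P" "pol f" "sx s f = f"
  have "lin_x (\<alpha>' s) * (f * nabla s P) = f * (lin_x (\<alpha>' s) * nabla s P)" by (simp add: algebra_simps)
  also have "\<dots> = f * P - sx s (f * P)" using a by (simp add: nabla sx_simps algebra_simps)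
  finally show "lin_x (\<alpha>' s) * (f * nabla s P) = f * P - sx s (f * P)" .
qed (auto intro: pol_intros nabla)

lemma nabla_one: "s \<in> R \<Longrightarrow> nabla s 1 = 0"
  by (rule nabla_eqI) (auto simp: sx_simps intro: pol_intros)

lemma nabla_lin_x: assumes s: "s \<in> R" and P: "pol P"
  shows "nabla s (lin_x y * P) = lin_x y * nabla s P + cst (cs s y) * sx s P"
proof (rule nabla_eqI[OF s])
  have "lin_x (\<alpha>' s) * (lin_x y * nabla s P + cst (cs s y) * sx s P) =
      lin_x y * (lin_x (\<alpha>' s) * nabla s P) + (cst (cs s y) * lin_x (\<alpha>' s)) * sx s P"
    by (simp add: algebra_simps)
  also have "\<dots> = lin_x y * P - sx s (lin_x y * P)"
    unfolding nabla(2)[OF s P] sx_simps(2) sx_lin_x[OF s] by (simp add: algebra_simps)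
  finally show "lin_x (\<alpha>' s) * (lin_x y * nabla s P + cst (cs s y) * sx s P) = lin_x y * P - sx s (lin_x y * P)" .
qed (auto intro: pol_intros pol_lin pol_sv nabla s P)

text \<open>\<open>E1 P Q\<close> is the first correction in the product of the normal ordered operator with symbol
  \<open>P\<close> and an invariant polynomial \<open>Q\<close>.  The constants \<open>K2 s\<close> are determined by \<open>K2 s * cs s y = - K s * \<alpha> s (y)\<close>.\<close>

definition K2 :: "'n cmat \<Rightarrow> complex" where "K2 s = - K s * br s / (1 - inverse (lam s))"

lemma K2: "s \<in> R \<Longrightarrow> K2 s * cs s y = - (K s * pairing (\<alpha> s) y)"
  using br[of s] lam_ne_1[of s] lam_nz[of s] by (simp add: K2_def cs_def field_simps)

definition E1 :: "'n pf \<Rightarrow> 'n pf \<Rightarrow> 'n pf" where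
  "E1 P Q = cst t * (\<Sum>i\<in>UNIV. dx (axis i 1) P * dv (axis i 1) Q) +
     (\<Sum>s\<in>R. cst (K2 s) * (nabla s P * Delta s (sx s Q)))"

lemma pdeg_E1: assumes "pdeg a P" "pdeg b Q" shows "pdeg (a + b - 2) (E1 P Q)"
proof -
  have e: "(a - 1) + (b - 1) = a + b - 2" by simp
  show ?thesis unfolding E1_def
    by (intro pdeg_add pdeg_cmult pdeg_sum; unfold e[symmetric])
      (intro pdeg_mult pdeg_dx pdeg_dv pdeg_nabla pdeg_Delta pdeg_sv assms | assumption)+
qed

lemma E1_add: "pol P \<Longrightarrow> pol P' \<Longrightarrow> E1 (P + P') Q = E1 P Q + E1 P' Q"
  unfolding E1_def by (simp add: dx_add nabla_add distrib_right distrib_left sum.distrib algebra_simps)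

lemma E1_vco: "pol P \<Longrightarrow> E1 (vco i * P) Q = vco i * E1 P Q"
proof -
  assume P: "pol P"
  have "sx s (vco i) = vco i" for s by (simp add: vco_lin sx_simps)
  then have "nabla s (vco i * P) = vco i * nabla s P" if "s \<in> R" for s using that P by (intro nabla_invar pol_vco)
  then show ?thesis unfolding E1_def using P
    by (simp add: dx_mult pol_vco dx_basic sum_distrib_left distrib_left mult_ac)
qed

lemma E1_cmult: "pol P \<Longrightarrow> E1 (cst k * P) Q = cst k * E1 P Q"
proof -
  assume P: "pol P"
  have "nabla s (cst k * P) = cst k * nabla s P" if "s \<in> R" for s using that P by (intro nabla_invar pol_cst) (simp_all add: sx_simps)
  then show ?thesis unfolding E1_def using P
    by (simp add: dx_cmult sum_distrib_left distrib_left mult.left_commute mult.assoc)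
qed

lemma E1_one: "E1 1 Q = 0"
proof -
  have "dx y 1 = 0" for y :: "complex ^ 'n" using dx_basic(1)[of y 1] by (simp add: cst_simps)
  then show ?thesis by (simp add: E1_def nabla_one)
qed

text \<open>The recursion is built to agree with \<open>dunkl_product\<close> term by term: the
  twisted Leibniz rule of \<open>nabla\<close> supplies \<open>sx s P\<close>, and \<open>K2\<close>
  its coefficient.\<close>

lemma E1_xco: assumes P: "pol P"
  shows "E1 (lin_x (axis j 1) * P) Q = lin_x (axis j 1) * E1 P Q + cst t * (P * dv (axis j 1) Q)
    - (\<Sum>s\<in>R. cst (K s * pairing (\<alpha> s) (axis j 1)) * (sx s P * Delta s (sx s Q)))"
proof -
  let ?y = "axis j 1"
  have "(\<Sum>i\<in>UNIV. dx (axis i 1) (lin_x ?y * P) * dv (axis i 1) Q) =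
     (\<Sum>i\<in>UNIV. lin_x ?y * (dx (axis i 1) P * dv (axis i 1) Q)) + (\<Sum>i\<in>UNIV. cst (pairing (axis i 1) ?y) * P * dv (axis i 1) Q)"
    unfolding dx_mult[OF pol_lin(2) P] dx_basic sum.distrib[symmetric] by (simp add: algebra_simps)
  also have "(\<Sum>i\<in>UNIV. cst (pairing (axis i 1) ?y) * P * dv (axis i 1) Q) = (\<Sum>i\<in>UNIV. if i = j then P * dv ?y Q else 0)"
  proof (rule sum.cong[OF refl])
    fix i
    have "pairing (axis i 1) ?y = (if i = j then 1 else 0)"
      by (simp only: pairing_simps) (auto simp: axis_def)
    then show "cst (pairing (axis i 1) ?y) * P * dv (axis i 1) Q = (if i = j then P * dv ?y Q else 0)"
      by (simp add: cst_simps del: pairing_simps)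
  qed
  finally have 1: "(\<Sum>i\<in>UNIV. dx (axis i 1) (lin_x ?y * P) * dv (axis i 1) Q) =
     lin_x ?y * (\<Sum>i\<in>UNIV. dx (axis i 1) P * dv (axis i 1) Q) + P * dv ?y Q" by (simp add: sum_distrib_left)
  have "cst (K2 s) * (nabla s (lin_x ?y * P) * Delta s (sx s Q)) = lin_x ?y * (cst (K2 s) * (nabla s P * Delta s (sx s Q)))
     - cst (K s * pairing (\<alpha> s) ?y) * (sx s P * Delta s (sx s Q))" if s: "s \<in> R" for s
  proof -
    have "cst (K2 s) * (nabla s (lin_x ?y * P) * Delta s (sx s Q)) = lin_x ?y * (cst (K2 s) * (nabla s P * Delta s (sx s Q)))
     + (cst (K2 s) * cst (cs s ?y)) * (sx s P * Delta s (sx s Q))"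
      unfolding nabla_lin_x[OF s P] by (simp add: algebra_simps)
    then show ?thesis unfolding cst_simps K2[OF s] by (simp add: cst_simps(5)[symmetric])
  qed
  then have 2: "(\<Sum>s\<in>R. cst (K2 s) * (nabla s (lin_x ?y * P) * Delta s (sx s Q))) =
     lin_x ?y * (\<Sum>s\<in>R. cst (K2 s) * (nabla s P * Delta s (sx s Q)))
     - (\<Sum>s\<in>R. cst (K s * pairing (\<alpha> s) ?y) * (sx s P * Delta s (sx s Q)))"
    by (simp add: sum_subtractf sum_distrib_left)
  show ?thesis unfolding E1_def 1 2 by (simp add: algebra_simps)
qed

text \<open>\<open>f\<close> is constant in \<open>v\<close>, so derivatives and divided differences
  fall on \<open>Q\<close> alone; the reflections still act on the \<open>\<xi>\<close> inside
  \<open>f\<close>.\<close>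

lemma dunkl_product:
  assumes f: "pol f" "\<And>v v' \<xi>. f v \<xi> = f v' \<xi>" and Q: "pol Q"
  shows "dunkl y (f * Q) = lin_x y * (f * Q) + cst t * (f * dv y Q)
    - (\<Sum>s\<in>R. cst (K s * pairing (\<alpha> s) y) * (sx s f * Delta s (sx s Q)))"
proof -
  have "(\<lambda>z. f (v + z *s y) \<xi>) = (\<lambda>z. f v \<xi>)" for v \<xi> using f(2) by blast
  then have d: "dv y f = 0" by (intro dv_eqI) (simp add: pfs)
  have i: "sv s (sx s f) = sx s f" for s
    by (rule pf_eqI) (simp add: sv_def sx_def subst_apply, rule f(2))
  have "Delta s (sx s (f * Q)) = sx s f * Delta s (sx s Q)" if "s \<in> R" for s
    unfolding sx_simps by (rule Delta_invar) (use that f Q pol_sv i in auto)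
  then show ?thesis unfolding dunkl_def dv_mult[OF f(1) Q] d by simp
qed

text \<open>Induction on the vectors: the corrections of \<open>dunkl_product\<close> are exactly
  those of \<open>E1_xco\<close>. What remains is the lower part of \<open>dunkl\<close> on the old
  \<open>E1\<close>, and \<open>dunkl\<close> on the old error. Invariance of \<open>Q\<close>
  serves at the right end of the word, where \<open>ee\<close> acts.\<close>

lemma DY_symbol:
  assumes Q: "pdeg m Q" "Winv Q"
  shows "pdeg (int (length ys) + m - 4) (rhoH (nwl [] ys) Q - monM (lets [] ys) * Q - E1 (monM (lets [] ys)) Q)"
proof (induction ys)
  case Nil
  have "rhoH ee Q = Q" using Q pdeg_pol rhoH_ee_inv by blast
  then show ?case by (simp add: nwl_Nil lets_def monM_simps E1_one pdeg_zero)
next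
  case (Cons j ys)
  let ?y = "axis j 1" and ?f = "monM (lets [] ys)"
  let ?k = "int (length ys)"
  have pQ: "pol Q" using Q pdeg_pol by blast
  have f: "pol ?f" "pdeg ?k ?f" using pdeg_monM[of "lets [] ys"] pdeg_pol by (auto simp: lets_def)
  define L where "L = rhoH (nwl [] ys) Q - ?f * Q - E1 ?f Q"
  have L: "pdeg (?k + m - 4) L" using Cons by (simp add: L_def)
  have E: "pdeg (?k + m - 2) (E1 ?f Q)" by (rule pdeg_E1[OF f(2) Q(1)])
  have p: "pol L" "pol (E1 ?f Q)" "pol (?f * Q)" using L E pdeg_pol f pQ pol_mult by blast+
  have "rhoH (nwl [] ys) Q = ?f * Q + (E1 ?f Q + L)" by (simp add: L_def)
  then have "rhoH (nwl [] (j # ys)) Q = dunkl ?y (?f * Q) + (dunkl ?y (E1 ?f Q) + dunkl ?y L)"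
    using p by (simp add: nwl_Nil rhoH_mult pQ rhoH_Y pol_rhoH pol_add dunkl_add)
  moreover have "monM (lets [] (j # ys)) = lin_x ?y * ?f" by (simp add: lets_def monM_simps xco_lin)
  ultimately have e: "rhoH (nwl [] (j # ys)) Q - monM (lets [] (j # ys)) * Q - E1 (monM (lets [] (j # ys))) Q
     = (dunkl ?y (E1 ?f Q) - lin_x ?y * E1 ?f Q) + dunkl ?y L"
    unfolding dunkl_product[OF f(1) monM_v_const pQ] by (simp add: E1_xco[OF f(1)] algebra_simps)
  have "pdeg (?k + m - 2 - 1) (dunkl ?y (E1 ?f Q) - lin_x ?y * E1 ?f Q)" by (rule pdeg_dunkl_low[OF E])
  moreover have "pdeg (?k + m - 2 - 1) (dunkl ?y L)" using pdeg_dunkl[OF L, of ?y] by (rule pdeg_mono) simp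
  ultimately have "pdeg (?k + m - 2 - 1) ((dunkl ?y (E1 ?f Q) - lin_x ?y * E1 ?f Q) + dunkl ?y L)" by (rule pdeg_add)
  then show ?case unfolding e by (rule pdeg_mono) simp
qed

text \<open>Covectors multiply from the left and \<open>E1\<close> is linear over the coordinates of
  \<open>v\<close>, so no new error arises.\<close>

lemma nwl_symbol:
  assumes Q: "pdeg m Q" "Winv Q"
  shows "pdeg (int (length xs + length ys) + m - 4) (rhoH (nwl xs ys) Q - monM (lets xs ys) * Q - E1 (monM (lets xs ys)) Q)"
proof (induction xs)
  case Nil then show ?case using DY_symbol[OF Q, of ys] by simp
next
  case (Cons i xs)
  have pQ: "pol Q" using Q pdeg_pol by blast
  have e: "rhoH (nwl (i # xs) ys) Q - monM (lets (i # xs) ys) * Q - E1 (monM (lets (i # xs) ys)) Q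
     = vco i * (rhoH (nwl xs ys) Q - monM (lets xs ys) * Q - E1 (monM (lets xs ys)) Q)"
    by (simp add: nwl_Nil rhoH_mult pQ rhoH_X pol_rhoH lets_def monM_simps E1_vco pdeg_pol[OF pdeg_monM] algebra_simps)
      (simp add: vco_lin)
  show ?case unfolding e by (rule pdeg_mono[OF pdeg_vco[OF Cons]]) simp
qed

lemma DD_symbol:
  assumes h: "h \<in> DD d" and Q: "pdeg m Q" "Winv Q"
  shows "pdeg (int d) (rhoH h 1) \<and> pdeg (int d + m - 4) (rhoH h Q - rhoH h 1 * Q - E1 (rhoH h 1) Q)"
  using h unfolding DD_def
proof induction
  case zero
  have "E1 0 Q = 0" using E1_cmult[OF pol_one, of 0 Q] by (simp add: cst_simps)
  then show ?case using pdeg_pol[OF Q(1)] by (simp add: rhoH_zero pol_one pdeg_zero)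
next
  case (add h b k)
  obtain xs ys where b: "b = nwl xs ys" "length xs + length ys \<le> d" using add(2) by (auto simp: BD_def)
  have pQ: "pol Q" using Q pdeg_pol by blast
  have hH: "h \<in> carrier HH" using DD_closed[of h d] add(1) by (simp add: DD_def)
  have bH: "b \<in> carrier HH" by (simp add: b)
  let ?M = "monM (lets xs ys)"
  have M: "pdeg (int d) ?M" using pdeg_mono[OF pdeg_monM[of "lets xs ys"], of "int d"] b by (simp add: lets_def)
  have r1: "rhoH (h \<oplus>\<^bsub>HH\<^esub> k \<odot>\<^bsub>HH\<^esub> b) 1 = rhoH h 1 + cst k * ?M"
    using hH bH by (simp add: rhoH_add rhoH_smult pol_one) (simp add: b rhoH_nwl)
  have rQ: "rhoH (h \<oplus>\<^bsub>HH\<^esub> k \<odot>\<^bsub>HH\<^esub> b) Q = rhoH h Q + cst k * rhoH b Q"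
    using hH bH by (simp add: rhoH_add rhoH_smult pQ)
  have e: "rhoH (h \<oplus>\<^bsub>HH\<^esub> k \<odot>\<^bsub>HH\<^esub> b) Q - rhoH (h \<oplus>\<^bsub>HH\<^esub> k \<odot>\<^bsub>HH\<^esub> b) 1 * Q - E1 (rhoH (h \<oplus>\<^bsub>HH\<^esub> k \<odot>\<^bsub>HH\<^esub> b) 1) Q =
    (rhoH h Q - rhoH h 1 * Q - E1 (rhoH h 1) Q) + cst k * (rhoH b Q - ?M * Q - E1 ?M Q)"
    unfolding r1 rQ using hH M
    by (simp add: E1_add E1_cmult pol_rhoH pol_one pdeg_pol[OF M] pol_cst pol_mult algebra_simps)
  have "pdeg (int d + m - 4) (rhoH b Q - ?M * Q - E1 ?M Q)"
    using pdeg_mono[OF nwl_symbol[OF Q, of xs ys], of "int d + m - 4"] b by simp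
  then show ?case unfolding e using add M by (simp add: r1 pdeg_add pdeg_cmult)
qed

text \<open>On invariants \<open>sv s\<close> undoes \<open>sx s\<close>. Multiplied by root and
  coroot, the term of \<open>s\<close> in \<open>E1 P Q\<close> therefore becomes minus
  \<open>(P - sx s P) * (Q - sx s Q)\<close> up to its constant, which is symmetric. So the
  parameters \<open>c\<close> drop out of commutators at this order.\<close>

lemma E1_antisym:
  assumes P: "pol P" "Winv P" and Q: "pol Q" "Winv Q"
  shows "E1 P Q - E1 Q P = cst t * pb P Q"
proof -
  have "nabla s P * Delta s (sx s Q) = nabla s Q * Delta s (sx s P)" if s: "s \<in> R" for s
  proof (rule pol_cancel[of "lin_x (\<alpha>' s) * lin_v (\<alpha> s)"])
    have g: "sv s (sx s F) = F" if "Winv F" for F using that s R_W by (simp add: sv_sx Winv_def)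
    have "lin_x (\<alpha>' s) * lin_v (\<alpha> s) * (nabla s F * Delta s (sx s F')) = (F - sx s F) * (sx s F' - F')"
      if "pol F" "pol F'" "Winv F'" for F F'
    proof -
      have "lin_x (\<alpha>' s) * lin_v (\<alpha> s) * (nabla s F * Delta s (sx s F')) = (lin_x (\<alpha>' s) * nabla s F) * (lin_v (\<alpha> s) * Delta s (sx s F'))"
        by (simp add: mult_ac)
      then show ?thesis using that by (simp add: nabla[OF s] Delta[OF s] pol_sv g)
    qed
    from this[OF P(1) Q] this[OF Q(1) P]
    show "lin_x (\<alpha>' s) * lin_v (\<alpha> s) * (nabla s P * Delta s (sx s Q)) = lin_x (\<alpha>' s) * lin_v (\<alpha> s) * (nabla s Q * Delta s (sx s P))"
      by (simp only:) (simp add: algebra_simps)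
    show "lin_x (\<alpha>' s) * lin_v (\<alpha> s) \<noteq> 0" using pol_domain[OF pol_lin(2) pol_lin(1)] root_nz[OF s] coroot_nz[OF s] by blast
  qed (use P Q s in \<open>auto intro!: pol_mult pol_lin nabla Delta pol_sv\<close>)
  then have "(\<Sum>s\<in>R. cst (K2 s) * (nabla s P * Delta s (sx s Q))) = (\<Sum>s\<in>R. cst (K2 s) * (nabla s Q * Delta s (sx s P)))"
    by (intro sum.cong) simp_all
  then show ?thesis unfolding E1_def pb_def
    by (simp add: sum_subtractf right_diff_distrib mult_ac)
qed

end

section \<open>The algebra \<open>eAe\<close>\<close>

context calg
begin

lemma minus_closed_of: "subspace_of V A \<Longrightarrow> x \<in> V \<Longrightarrow> \<ominus> x \<in> V"
  using subspaceD(1,4)[of V] sm_minus[of x] by (metis subset_iff)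

lemma subringI': assumes "subspace_of B A" "\<one> \<in> B" "\<And>x y. x \<in> B \<Longrightarrow> y \<in> B \<Longrightarrow> x \<otimes> y \<in> B" shows "subring B A"
  using subspaceD[OF assms(1)] assms by (intro subringI) (auto simp: minus_closed_of)

lemma generated_subalgebra:
  assumes S: "S \<subseteq> carrier A"
  shows "subring (generated_subalgebra A S) A" "subspace_of (generated_subalgebra A S) A" "S \<subseteq> generated_subalgebra A S"
proof -
  let ?B = "generated_subalgebra A S"
  have c: "subring (carrier A) A" "subspace_of (carrier A) A"
    using carrier_is_subring by (auto intro: subspaceI)
  have sub: "?B \<subseteq> carrier A" using c S by (auto simp: generated_subalgebra_def)
  show "S \<subseteq> ?B" by (auto simp: generated_subalgebra_def)
  show v: "subspace_of ?B A"
  proof (rule subspaceI[OF sub])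
    show "\<zero> \<in> ?B" using subspaceD(2) by (auto simp: generated_subalgebra_def)
    show "x \<oplus> y \<in> ?B" if "x \<in> ?B" "y \<in> ?B" for x y using that subspaceD(3) by (auto simp: generated_subalgebra_def)
    show "k \<odot> x \<in> ?B" if "x \<in> ?B" for k x using that subspaceD(4) by (auto simp: generated_subalgebra_def)
  qed
  show "subring ?B A"
  proof (rule subringI'[OF v])
    show "\<one> \<in> ?B" using subringE(3) by (auto simp: generated_subalgebra_def)
    show "x \<otimes> y \<in> ?B" if "x \<in> ?B" "y \<in> ?B" for x y using that unfolding generated_subalgebra_def by (blast intro: subringE(6))
  qed
qed

lemma generated_subalgebra_least:
  "subring B A \<Longrightarrow> subspace_of B A \<Longrightarrow> S \<subseteq> B \<Longrightarrow> generated_subalgebra A S \<subseteq> B"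
  by (auto simp: generated_subalgebra_def)

end

section \<open>The scaling action and polynomials of weight zero\<close>

definition sc :: "complex \<Rightarrow> ('n::finite) pf \<Rightarrow> 'n pf" where "sc r P = (\<lambda>v \<xi>. P (r *s v) (inverse r *s \<xi>))"

definition weight0 :: "('n::finite) pf \<Rightarrow> bool" where "weight0 P \<longleftrightarrow> (\<forall>r. r \<noteq> 0 \<longrightarrow> sc r P = P)"

lemma sc_subst: "sc r P = subst (mat r) (mat (inverse r)) P"
proof -
  have "mat r *v v = r *s v" "\<xi> v* mat r = r *s \<xi>" for r :: complex and v \<xi> :: "complex ^ 'a"
    by (simp_all add: vec_eq_iff matrix_vector_mult_def vector_matrix_mult_def mat_def if_distrib if_distribR mult.commute cong: if_cong)
  then show ?thesis by (simp add: sc_def subst_def)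
qed

lemma sc_simps: "sc r (P + Q) = sc r P + sc r Q" "sc r (P * Q) = sc r P * sc r Q"
   "sc r (P - Q) = sc r P - sc r Q" "sc r (cst k) = cst k" "sc r 0 = 0" "sc r 1 = 1"
   "sc r (lin_v x) = cst r * lin_v x" "sc r (lin_x y) = cst (inverse r) * lin_x y"
   "sc r (vco i) = cst r * vco i" "sc r (xco i) = cst (inverse r) * xco i"
  by (rule pf_eqI, simp add: sc_def pfs lin_apply)+

lemma sc_sum: "sc r (\<Sum>i\<in>I. f i) = (\<Sum>i\<in>I. sc r (f i))"
  by (induction I rule: infinite_finite_induct) (simp_all add: sc_simps)

lemma pol_sc: "pol P \<Longrightarrow> pol (sc r P)" by (simp add: sc_subst pol_subst)

lemma sc_subst_comm: "sc r (subst M N P) = subst M N (sc r P)"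
  by (rule pf_eqI) (simp add: sc_def subst_def matrix_vector_mult_scale vector_matrix_mult_scale)

lemma weight0_simps: "weight0 P \<Longrightarrow> weight0 Q \<Longrightarrow> weight0 (P + Q)" "weight0 P \<Longrightarrow> weight0 Q \<Longrightarrow> weight0 (P - Q)" "weight0 P \<Longrightarrow> weight0 Q \<Longrightarrow> weight0 (P * Q)"
  "weight0 (cst k)" "weight0 0" "weight0 1"
  by (simp_all add: weight0_def sc_simps)

context refl_data
begin

lemma sc_gact: "sc r (gact w P) = gact w (sc r P)" by (simp add: gact_def sc_subst_comm)

lemma weight0_gact: "weight0 P \<Longrightarrow> weight0 (gact w P)" by (simp add: weight0_def sc_gact)

lemma sc_Delta: assumes s: "s \<in> R" and P: "pol P" and r: "r \<noteq> 0" shows "Delta s (sc r P) = cst r * sc r (Delta s P)"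
proof (rule Delta_eqI[OF s])
  have "lin_v (\<alpha> s) * (cst r * sc r (Delta s P)) = sc r (lin_v (\<alpha> s) * Delta s P)"
    by (simp add: sc_simps mult_ac)
  then show "lin_v (\<alpha> s) * (cst r * sc r (Delta s P)) = sc r P - sv s (sc r P)"
    by (simp add: Delta[OF s P] sc_simps sv_def sc_subst_comm)
qed (auto intro!: pol_mult pol_cst pol_sc Delta s P)

text \<open>Multiplication by \<open>lin_x y\<close>, the derivative and the divided differences in
  \<open>v\<close> all shift the weight in the same way, opposite to a covector.\<close>

lemma sc_dunkl: assumes P: "pol P" and r: "r \<noteq> 0" shows "dunkl y (sc r P) = cst r * sc r (dunkl y P)"
proof -
  have i: "cst r * (cst (inverse r) * Q) = Q" for Q :: "'n pf"
    using r by (simp add: mult.assoc[symmetric] cst_simps)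
  have d: "dv y (sc r P) = cst r * sc r (dv y P)"
  proof -
    have "mat r *v y = r *s y"
      by (simp add: vec_eq_iff matrix_vector_mult_def mat_def if_distrib if_distribR cong: if_cong)
    then have "dv (mat r *v y) P = cst r * dv y P"
      using dv_linear[OF P, of r y 0 0] by (simp add: cst_simps)
    then show ?thesis by (simp add: sc_subst dv_subst[OF P] subst_simps)
  qed
  have D: "Delta s (sx s (sc r P)) = cst r * sc r (Delta s (sx s P))" if s: "s \<in> R" for s
    using sc_Delta[OF s pol_sv(2)[OF P] r] by (simp add: sx_def sc_subst_comm)
  have "cst r * sc r (dunkl y P) = cst r * (cst (inverse r) * lin_x y * sc r P) + cst t * (cst r * sc r (dv y P))
     - (\<Sum>s\<in>R. cst (K s * pairing (\<alpha> s) y) * (cst r * sc r (Delta s (sx s P))))"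
    unfolding dunkl_def sc_simps sc_sum by (simp add: algebra_simps sum_distrib_left)
  also have "cst r * (cst (inverse r) * lin_x y * sc r P) = lin_x y * sc r P" using i by (simp add: mult.assoc)
  finally show ?thesis by (simp add: dunkl_def d D)
qed

lemma weight0_XY: assumes "pol P" "weight0 P" shows "weight0 (lin_v x * dunkl y P)"
  unfolding weight0_def
proof (intro allI impI)
  fix r :: complex assume r: "r \<noteq> 0"
  have "sc r (lin_v x * dunkl y P) = lin_v x * (cst r * sc r (dunkl y P))" by (simp add: sc_simps mult_ac)
  also have "\<dots> = lin_v x * dunkl y P" using sc_dunkl[OF assms(1) r, of y] assms(2) r by (simp add: weight0_def)
  finally show "sc r (lin_v x * dunkl y P) = lin_v x * dunkl y P" .
qed

text \<open>The space \<open>S\<close>, which turns out to be the image of the spherical subalgebra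
  under evaluation at 1.\<close>

definition sph :: "'n pf \<Rightarrow> bool" where "sph P \<longleftrightarrow> pol P \<and> Winv P \<and> weight0 P"

lemma Winv_simps: "Winv P \<Longrightarrow> Winv Q \<Longrightarrow> Winv (P + Q)" "Winv P \<Longrightarrow> Winv Q \<Longrightarrow> Winv (P - Q)"
  "Winv P \<Longrightarrow> Winv Q \<Longrightarrow> Winv (P * Q)" "Winv (cst k)" "Winv 0" "Winv 1"
  by (simp_all add: Winv_def gact_simps)

lemma sph_simps: "sph P \<Longrightarrow> sph Q \<Longrightarrow> sph (P + Q)" "sph P \<Longrightarrow> sph Q \<Longrightarrow> sph (P - Q)"
  "sph P \<Longrightarrow> sph Q \<Longrightarrow> sph (P * Q)" "sph (cst k)" "sph 0" "sph 1"
  by (simp_all add: sph_def Winv_simps weight0_simps pol_intros)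

lemma sph_pol: "sph P \<Longrightarrow> pol P" by (simp add: sph_def)

section \<open>The subalgebra generated by the products \<open>x_i y_j\<close> and
  \<open>W\<close>\<close>

definition gens :: "'n smash_elem set set" where
  "gens = {Xc (axis i 1) \<otimes>\<^bsub>HH\<^esub> Yc (axis j 1) | i j. True} \<union> {Gc w | w. w \<in> W}"

definition Gl :: "'n smash_elem set set" where "Gl = generated_subalgebra HH gens"

lemma gens_carrier: "gens \<subseteq> carrier HH" by (auto simp: gens_def)

lemma Gl: "subring Gl HH" "subspace_of Gl HH" "gens \<subseteq> Gl"
  unfolding Gl_def by (rule H.generated_subalgebra[OF gens_carrier])+

lemma Gl_carrier: "h \<in> Gl \<Longrightarrow> h \<in> carrier HH" using H.subspaceD(1)[OF Gl(2)] by blast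
lemma Gl_mult: "h \<in> Gl \<Longrightarrow> h' \<in> Gl \<Longrightarrow> h \<otimes>\<^bsub>HH\<^esub> h' \<in> Gl" by (rule subringE(6)[OF Gl(1)])
lemma Gl_add: "h \<in> Gl \<Longrightarrow> h' \<in> Gl \<Longrightarrow> h \<oplus>\<^bsub>HH\<^esub> h' \<in> Gl" by (rule H.subspaceD(3)[OF Gl(2)])
lemma Gl_smult: "h \<in> Gl \<Longrightarrow> k \<odot>\<^bsub>HH\<^esub> h \<in> Gl" by (rule H.subspaceD(4)[OF Gl(2)])
lemma Gl_minus: "h \<in> Gl \<Longrightarrow> h' \<in> Gl \<Longrightarrow> h \<ominus>\<^bsub>HH\<^esub> h' \<in> Gl" by (rule H.subspaceD(5)[OF Gl(2)])
lemma Gl_G: "w \<in> W \<Longrightarrow> Gc w \<in> Gl" and Gl_XY: "Xc (axis i 1) \<otimes>\<^bsub>HH\<^esub> Yc (axis j 1) \<in> Gl"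
  using Gl(3) by (auto simp: gens_def)

lemma Gl_induct [consumes 1, case_names XY G zero one add mult smult]:
  assumes "h \<in> Gl" "\<And>i j. Pr (Xc (axis i 1) \<otimes>\<^bsub>HH\<^esub> Yc (axis j 1))" "\<And>w. w \<in> W \<Longrightarrow> Pr (Gc w)"
    "Pr \<zero>\<^bsub>HH\<^esub>" "Pr \<one>\<^bsub>HH\<^esub>"
    "\<And>h h'. h \<in> carrier HH \<Longrightarrow> h' \<in> carrier HH \<Longrightarrow> Pr h \<Longrightarrow> Pr h' \<Longrightarrow> Pr (h \<oplus>\<^bsub>HH\<^esub> h')"
    "\<And>h h'. h \<in> carrier HH \<Longrightarrow> h' \<in> carrier HH \<Longrightarrow> Pr h \<Longrightarrow> Pr h' \<Longrightarrow> Pr (h \<otimes>\<^bsub>HH\<^esub> h')"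
    "\<And>h k. h \<in> carrier HH \<Longrightarrow> Pr h \<Longrightarrow> Pr (k \<odot>\<^bsub>HH\<^esub> h)"
  shows "Pr h"
proof -
  let ?B = "{h \<in> carrier HH. Pr h}"
  have v: "subspace_of ?B HH" by (rule H.subspaceI) (auto intro: assms)
  have "subring ?B HH" by (rule H.subringI'[OF v]) (auto intro: assms)
  then have "Gl \<subseteq> ?B" unfolding Gl_def
    by (rule H.generated_subalgebra_least[OF _ v]) (auto simp: gens_def intro: assms)
  then show ?thesis using assms(1) by blast
qed

lemma Gl_weight0: "h \<in> Gl \<Longrightarrow> pol P \<Longrightarrow> weight0 P \<Longrightarrow> weight0 (rhoH h P)"
proof (induction arbitrary: P rule: Gl_induct)
  case (XY i j) then show ?case by (simp add: rhoH_mult rhoH_X rhoH_Y pol_dunkl weight0_XY)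
next
  case (G w) then show ?case by (simp add: rhoH_G weight0_gact)
next
  case zero then show ?case by (simp add: rhoH_zero weight0_simps)
next
  case one then show ?case by (simp add: rhoH_one)
next
  case (add h h') then show ?case by (simp add: rhoH_add weight0_simps)
next
  case (mult h h') then show ?case by (simp add: rhoH_mult pol_rhoH)
next
  case (smult h k) then show ?case by (simp add: rhoH_smult weight0_simps)
qed

lemma euler_op_zero: "euler_op 0 = 0" using euler_op_cmult[OF pol_zero, of 0] by (simp add: cst_simps)

text \<open>The contribution \<open>t\<close> of \<open>x_i\<close> and the contribution
  \<open>- t\<close> of \<open>y_j\<close> cancel on the generators, so the Euler element acts
  centrally.\<close>

lemma Gl_euler_op: "h \<in> Gl \<Longrightarrow> pol P \<Longrightarrow> euler_op (rhoH h P) = rhoH h (euler_op P)"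
proof (induction arbitrary: P rule: Gl_induct)
  case (XY i j)
  then show ?case
    by (simp add: rhoH_mult rhoH_X rhoH_Y pol_dunkl pol_euler_op euler_op_lin_v euler_op_dunkl) (simp add: algebra_simps)
next
  case (G w) then show ?case by (simp add: rhoH_G euler_op_gact pol_euler_op)
next
  case zero then show ?case by (simp add: rhoH_zero euler_op_zero pol_euler_op)
next
  case one then show ?case by (simp add: rhoH_one pol_euler_op)
next
  case (add h h') then show ?case by (simp add: rhoH_add euler_op_add pol_rhoH pol_euler_op)
next
  case (mult h h') then show ?case by (simp add: rhoH_mult pol_rhoH pol_euler_op)
next
  case (smult h k) then show ?case by (simp add: rhoH_smult euler_op_cmult pol_rhoH pol_euler_op)
qed

lemma Gl_av: assumes "L \<subseteq> W" shows "cl (av L) \<in> Gl"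
proof -
  have f: "finite L" using assms fin finite_subset by blast
  have "cl (finsum Sm smash_grp L) = finsum HH (\<lambda>w. cl (smash_grp w)) L"
    by (rule HQ.cls_finsum[OF f]) (use assms in \<open>auto intro: Sm_grp\<close>)
  also have "\<dots> \<in> Gl"
    by (rule H.subspace_finsum[OF Gl(2) f]) (use assms Gl_G in \<open>auto simp: Gc_def\<close>)
  finally have "(1 / of_nat (card L)) \<odot>\<^bsub>HH\<^esub> cl (finsum Sm smash_grp L) \<in> Gl" by (rule Gl_smult)
  moreover have "finsum Sm smash_grp L \<in> carrier Sm" by (rule S.finsum_closed) (use assms in \<open>auto intro: Sm_grp\<close>)
  ultimately show ?thesis by (simp add: av_def HQ.cls_smult)
qed

section \<open>The two idempotents and the Euler element\<close>

abbreviation "ZW \<equiv> group_center W"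

lemma ZW: "ZW \<subseteq> W" "mat 1 \<in> ZW" "a \<in> ZW \<Longrightarrow> b \<in> ZW \<Longrightarrow> a ** b \<in> ZW" "a \<in> ZW \<Longrightarrow> matrix_inv a \<in> ZW"
proof -
  show "ZW \<subseteq> W" by (auto simp: group_center_def)
  show "mat 1 \<in> ZW" using W_one by (auto simp: group_center_def)
  show "a \<in> ZW \<Longrightarrow> b \<in> ZW \<Longrightarrow> a ** b \<in> ZW"
  proof -
    assume ab: "a \<in> ZW" "b \<in> ZW"
    have "(a ** b) ** w = w ** (a ** b)" if "w \<in> W" for w
    proof -
      have c: "a ** w = w ** a" "b ** w = w ** b" using ab that by (auto simp: group_center_def)
      have "(a ** b) ** w = a ** (b ** w)" by (simp add: matrix_mul_assoc)
      also have "\<dots> = (a ** w) ** b" unfolding c(2) by (simp add: matrix_mul_assoc)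
      also have "\<dots> = w ** (a ** b)" unfolding c(1) by (simp add: matrix_mul_assoc)
      finally show ?thesis .
    qed
    moreover have "a ** b \<in> W" using ab W_mult unfolding group_center_def by blast
    ultimately show "a ** b \<in> ZW" unfolding group_center_def by blast
  qed
  assume a: "a \<in> ZW"
  have "matrix_inv a ** w = w ** matrix_inv a" if "w \<in> W" for w
  proof -
    have aW: "a \<in> W" and c: "a ** w = w ** a" using a that by (auto simp: group_center_def)
    have "matrix_inv a ** (a ** w) ** matrix_inv a = matrix_inv a ** (w ** a) ** matrix_inv a" using c by simp
    then show ?thesis by (simp add: matrix_mul_assoc inv_l[OF aW]) (simp add: matrix_mul_assoc[symmetric] inv_r[OF aW])
  qed
  moreover have "matrix_inv a \<in> W" using a W_inv unfolding group_center_def by blast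
  ultimately show "matrix_inv a \<in> ZW" unfolding group_center_def by blast
qed

definition aa :: "'n smash_elem set" where "aa = cl (av ZW)"

lemma aa_Gl: "aa \<in> Gl" and ee_Gl: "ee \<in> Gl" unfolding aa_def ee_def by (auto intro!: Gl_av ZW)

lemma aa_closed [simp]: "aa \<in> carrier HH" using aa_Gl Gl_carrier by blast

lemma aa_aa: "aa \<otimes>\<^bsub>HH\<^esub> aa = aa" and aa_ee: "aa \<otimes>\<^bsub>HH\<^esub> ee = ee" and ee_aa: "ee \<otimes>\<^bsub>HH\<^esub> aa = ee"
proof -
  have n: "ZW \<noteq> {}" using ZW(2) by blast
  note gW = grp_av[of W, OF subset_refl W_mult W_inv]
  note gZ = grp_av[of ZW, OF ZW(1) ZW(3) ZW(4)]
  have "av ZW \<otimes>\<^bsub>Sm\<^esub> av ZW = av ZW" "av ZW \<otimes>\<^bsub>Sm\<^esub> av W = av W" "av W \<otimes>\<^bsub>Sm\<^esub> av ZW = av W"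
    using gW gZ ZW(1) by (auto intro!: av_mult[OF ZW(1) n] av_closed)
  then show "aa \<otimes>\<^bsub>HH\<^esub> aa = aa" "aa \<otimes>\<^bsub>HH\<^esub> ee = ee" "ee \<otimes>\<^bsub>HH\<^esub> aa = ee"
    by (simp_all add: aa_def ee_def HQ.cls_mult av_closed ZW(1))
qed

definition eu :: "'n smash_elem set" where "eu = euler W \<alpha> \<alpha>' lam t c"

abbreviation "eu1 \<equiv> finsum Sm (\<lambda>i. smash_covec (axis i 1) \<otimes>\<^bsub>Sm\<^esub> smash_vec (axis i 1)) UNIV"
abbreviation "eu2 \<equiv> finsum Sm (\<lambda>s. (2 * c s / (1 - lam s)) \<odot>\<^bsub>Sm\<^esub> smash_grp s) R"

lemma eu12: "eu1 \<in> carrier Sm" "eu2 \<in> carrier Sm"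
  by (rule S.finsum_closed, force intro: Sm_mult_closed Sm_grp R_W S.sm_closed)+

lemma eu_cl: "eu = cl (eu1 \<ominus>\<^bsub>Sm\<^esub> eu2)"
  by (simp add: eu_def euler_def HH_cherednik)

lemma cl_eu1: "cl eu1 \<in> Gl" and cl_eu2: "cl eu2 \<in> Gl"
proof -
  have "cl eu1 = finsum HH (\<lambda>i. cl (smash_covec (axis i 1) \<otimes>\<^bsub>Sm\<^esub> smash_vec (axis i 1))) UNIV"
    by (rule HQ.cls_finsum) (auto intro: Sm_mult_closed)
  also have "\<dots> \<in> Gl"
    by (rule H.subspace_finsum[OF Gl(2)]) (use Gl_XY in \<open>auto simp: Xc_def Yc_def HQ.cls_mult Sm_tensor\<close>)
  finally show "cl eu1 \<in> Gl" .
  have "cl eu2 = finsum HH (\<lambda>s. cl ((2 * c s / (1 - lam s)) \<odot>\<^bsub>Sm\<^esub> smash_grp s)) R"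
    by (rule HQ.cls_finsum[OF finR]) (auto intro: Sm_grp R_W)
  also have "\<dots> \<in> Gl"
    by (rule H.subspace_finsum[OF Gl(2) finR])
      (use Gl_G R_W Gl_smult in \<open>auto simp: Gc_def HQ.cls_smult[symmetric] Sm_grp\<close>)
  finally show "cl eu2 \<in> Gl" .
qed

lemma eu_Gl: "eu \<in> Gl"
  using Gl_minus[OF cl_eu1 cl_eu2] eu12 by (simp add: eu_cl HQ.cls_minus)

lemma rhoH_eu: assumes P: "pol P" shows "rhoH eu P = euler_op P"
proof -
  have "eu1 = (\<Sum>i\<in>UNIV. smash_covec (axis i 1) \<otimes>\<^bsub>Sm\<^esub> smash_vec (axis i 1))"
    by (rule Sm_finsum) (auto intro: Sm_mult_closed)
  moreover have "eu2 = (\<Sum>s\<in>R. (2 * c s / (1 - lam s)) \<odot>\<^bsub>Sm\<^esub> smash_grp s)"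
    by (rule Sm_finsum[OF finR]) (auto intro: Sm_grp R_W)
  moreover have "rhoH eu P = rho eu1 P - rho eu2 P"
    using eu12 P by (simp add: eu_cl rhoH_cl rho_minus)
  ultimately show ?thesis unfolding euler_op_def
    by (simp add: rho_sum rho_mult P rho_tensor tens_vec tens_covec pol_dunkl rho_smult rho_grp R_W K_def vco_lin)
qed

text \<open>The Euler element commutes with the centre of \<open>W\<close>; otherwise \<open>a eu - \<zeta> a\<close> would not lie in \<open>a H\<^sup>g\<^sup>l a\<close>.\<close>

lemma eu_G: assumes z: "z \<in> ZW" shows "Gc z \<otimes>\<^bsub>HH\<^esub> eu = eu \<otimes>\<^bsub>HH\<^esub> Gc z"
proof -
  have zW: "z \<in> W" using z ZW by blast
  let ?g = "smash_grp z"
  have g: "?g \<in> carrier Sm" using zW by (rule Sm_grp)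
  \<comment> \<open>The canonical element built from a pair of dual bases, fixed by every element of
    \<open>W\<close>.\<close>
  define T where "T = (\<Sum>i\<in>UNIV. tensor_covec (axis i 1) * tensor_vec (axis i 1 :: complex ^ 'n))"
  have st: "smash_tensor (p * q) = smash_tensor p \<otimes>\<^bsub>Sm\<^esub> smash_tensor q" for p q :: "'n tensor"
  proof (rule Sm_eqI[OF Sm_tensor Sm_mult_closed])
    fix w assume w: "w \<in> W"
    have "(smash_tensor p \<otimes>\<^bsub>Sm\<^esub> smash_tensor q) w = (\<Sum>a\<in>W. if a = mat 1 then p * tensor_act (mat 1) (smash_tensor q (matrix_inv (mat 1) ** w)) else 0)"
      unfolding Sm_mult[OF w] by (rule sum.cong) (auto simp: smash_tensor_def)
    then show "smash_tensor (p * q) w = (smash_tensor p \<otimes>\<^bsub>Sm\<^esub> smash_tensor q) w"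
      using fin W_one by (auto simp: inv_one tensor_act_id smash_tensor_def)
  qed
  have e1: "eu1 = smash_tensor T"
  proof -
    have "eu1 = (\<Sum>i\<in>UNIV. smash_tensor (tensor_covec (axis i 1) * tensor_vec (axis i 1)))"
      by (subst Sm_finsum) (auto simp: st intro: Sm_mult_closed)
    also have "\<dots> = smash_tensor T"
      by (auto simp: smash_tensor_def T_def sum_fun_apply fun_eq_iff)
    finally show ?thesis .
  qed
  have "tensor_act z T = T"
  proof -
    have vc: "tensor_act z (tensor_covec (axis i 1)) = (\<Sum>k\<in>UNIV. tensor_scalar (matrix_inv z $ i $ k) * tensor_covec (axis k 1))" for i
    proof -
      have "axis i 1 v* matrix_inv z = (\<Sum>k\<in>UNIV. matrix_inv z $ i $ k *s axis k 1)"
        by (simp add: vec_eq_iff vector_matrix_mult_def axis_def if_distrib if_distribR cong: if_cong)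
      then show ?thesis by (simp only: tensor_act_covec dual_act_def tensor_covec_linear)
    qed
    have dk: "tensor_act z (tensor_vec (axis i 1)) = (\<Sum>l\<in>UNIV. tensor_scalar (z $ l $ i) * tensor_vec (axis l 1))" for i
    proof -
      have "z *v axis i 1 = (\<Sum>l\<in>UNIV. z $ l $ i *s axis l 1)"
        by (simp add: vec_eq_iff matrix_vector_mult_def axis_def if_distrib if_distribR cong: if_cong)
      then show ?thesis by (simp only: tensor_act_vec tensor_vec_linear)
    qed
    have e: "(\<Sum>i\<in>UNIV. matrix_inv z $ i $ k * z $ l $ i) = (if l = k then 1 else 0)" for k l
      using inv_r[OF zW] by (simp add: vec_eq_iff matrix_matrix_mult_def mat_def mult.commute)
    have cs: "(\<Sum>i\<in>I. tensor_scalar (f i)) = (tensor_scalar (\<Sum>i\<in>I. f i) :: 'n tensor)" for f :: "'n \<Rightarrow> complex" and I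
      by (induction I rule: infinite_finite_induct) (simp_all add: tensor_scalar_simps)
    have m: "(tensor_scalar a * p) * (tensor_scalar b * q) = tensor_scalar (a * b) * (p * q)" for a b and p q :: "'n tensor"
      unfolding mult.assoc tensor_scalar_left[of p] tensor_scalar_simps(4)[symmetric] by (rule refl)
    let ?x = "\<lambda>k. tensor_covec (axis k 1) :: 'n tensor" and ?y = "\<lambda>k. tensor_vec (axis k 1) :: 'n tensor"
    have "tensor_act z T = (\<Sum>i\<in>UNIV. (\<Sum>k\<in>UNIV. tensor_scalar (matrix_inv z $ i $ k) * ?x k) * (\<Sum>l\<in>UNIV. tensor_scalar (z $ l $ i) * ?y l))"
      by (simp only: T_def tensor_act_sum tensor_act_mult vc dk)
    also have "\<dots> = (\<Sum>i\<in>UNIV. \<Sum>k\<in>UNIV. \<Sum>l\<in>UNIV. tensor_scalar (matrix_inv z $ i $ k * z $ l $ i) * (?x k * ?y l))"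
      unfolding sum_product m by (rule refl)
    also have "\<dots> = (\<Sum>k\<in>UNIV. \<Sum>l\<in>UNIV. \<Sum>i\<in>UNIV. tensor_scalar (matrix_inv z $ i $ k * z $ l $ i) * (?x k * ?y l))"
      by (subst sum.swap, rule sum.cong[OF refl], rule sum.swap)
    also have "\<dots> = (\<Sum>k\<in>UNIV. \<Sum>l\<in>UNIV. tensor_scalar (if l = k then 1 else 0) * (?x k * ?y l))"
      by (simp only: sum_distrib_right[symmetric] cs e)
    also have "\<dots> = T"
      unfolding T_def by (rule sum.cong[OF refl]) (simp add: if_distrib if_distribR tensor_scalar_simps cong: if_cong)
    finally show ?thesis .
  qed
  then have 1: "?g \<otimes>\<^bsub>Sm\<^esub> eu1 = eu1 \<otimes>\<^bsub>Sm\<^esub> ?g" unfolding e1 grp_tensor[OF zW] by simp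
  have gc: "(\<lambda>s. (2 * c s / (1 - lam s)) \<odot>\<^bsub>Sm\<^esub> smash_grp s) \<in> R \<rightarrow> carrier Sm" by (auto intro: Sm_grp R_W)
  have zs: "?g \<otimes>\<^bsub>Sm\<^esub> smash_grp s = smash_grp s \<otimes>\<^bsub>Sm\<^esub> ?g" if "s \<in> R" for s
    using z R_W[OF that] zW by (simp add: grp_grp group_center_def)
  have 2: "?g \<otimes>\<^bsub>Sm\<^esub> eu2 = eu2 \<otimes>\<^bsub>Sm\<^esub> ?g"
    unfolding S.finsum_rdistr[OF finR g gc] S.finsum_ldistr[OF finR g gc]
    by (rule S.finsum_cong') (auto simp: S.sm_mult_r S.sm_mult_l g Sm_grp R_W zs)
  have "?g \<otimes>\<^bsub>Sm\<^esub> (eu1 \<ominus>\<^bsub>Sm\<^esub> eu2) = (eu1 \<ominus>\<^bsub>Sm\<^esub> eu2) \<otimes>\<^bsub>Sm\<^esub> ?g"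
    using eu12 g by (simp add: a_minus_def S.r_distr S.l_distr S.r_minus S.l_minus 1 2)
  then show ?thesis using eu12 g by (simp add: Gc_def eu_cl HQ.cls_mult)
qed

lemma eu_aa: "aa \<otimes>\<^bsub>HH\<^esub> eu = eu \<otimes>\<^bsub>HH\<^esub> aa"
proof -
  have f: "finite ZW" using ZW(1) fin finite_subset by blast
  have eH: "eu \<in> carrier HH" using eu_Gl Gl_carrier by blast
  have gc: "Gc \<in> ZW \<rightarrow> carrier HH" using ZW(1) by auto
  have fc: "finsum Sm smash_grp ZW \<in> carrier Sm" by (rule S.finsum_closed) (use ZW(1) in \<open>auto intro: Sm_grp\<close>)
  have "cl (finsum Sm smash_grp ZW) = finsum HH (\<lambda>w. cl (smash_grp w)) ZW"
    by (rule HQ.cls_finsum[OF f]) (use ZW(1) in \<open>auto intro: Sm_grp\<close>)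
  then have a: "aa = (1 / of_nat (card ZW)) \<odot>\<^bsub>HH\<^esub> finsum HH Gc ZW"
    using fc by (simp add: aa_def av_def HQ.cls_smult[symmetric] Gc_def[abs_def])
  have "finsum HH Gc ZW \<otimes>\<^bsub>HH\<^esub> eu = eu \<otimes>\<^bsub>HH\<^esub> finsum HH Gc ZW"
    unfolding H.finsum_rdistr[OF f eH gc] H.finsum_ldistr[OF f eH gc]
    by (rule H.finsum_cong') (use ZW(1) eH in \<open>auto simp: eu_G\<close>)
  then show ?thesis unfolding a using H.finsum_closed[OF gc] eH by (simp add: H.sm_mult_l H.sm_mult_r)
qed

end

section \<open>The filtration by word length\<close>

definition tlen :: "int \<Rightarrow> 'n tensor \<Rightarrow> bool" where
  "tlen d p \<longleftrightarrow> (\<forall>u\<in>Poly_Mapping.keys p. int (length (letters u)) \<le> d)"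

lemma tlen_add: "tlen d p \<Longrightarrow> tlen d q \<Longrightarrow> tlen d (p + q)"
  using Poly_Mapping.keys_add[of p q] by (auto simp: tlen_def)
lemma tlen_zero: "tlen d 0" by (simp add: tlen_def)
lemma tlen_mono: "tlen d p \<Longrightarrow> d \<le> d' \<Longrightarrow> tlen d' p" by (auto simp: tlen_def)
lemma tlen_sum: "(\<And>i. i \<in> I \<Longrightarrow> tlen d (f i)) \<Longrightarrow> tlen d (\<Sum>i\<in>I. f i)"
  by (induction I rule: infinite_finite_induct) (simp_all add: tlen_zero tlen_add)
lemma tlen_mult: assumes "tlen d p" "tlen d' q" shows "tlen (d + d') (p * q)"
  unfolding tlen_def
proof
  fix u assume "u \<in> Poly_Mapping.keys (p * q)"
  then obtain a b where ab: "a \<in> Poly_Mapping.keys p" "b \<in> Poly_Mapping.keys q" "u = a + b"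
    using Poly_Mapping.keys_mult[of p q] by blast
  then have "length (letters u) = length (letters a) + length (letters b)" by (simp add: plus_word_def)
  then show "int (length (letters u)) \<le> d + d'" using assms ab by (fastforce simp: tlen_def)
qed
lemma tlen_single: "int (length (letters u)) \<le> d \<Longrightarrow> tlen d (Poly_Mapping.single u k)"
  by (auto simp: tlen_def)
lemma tlen_scalar: "0 \<le> d \<Longrightarrow> tlen d (tensor_scalar k)"
  unfolding tensor_scalar_def by (rule tlen_single) (simp add: zero_word_def)
lemma tlen_vec: "tlen 1 (tensor_vec y)" "tlen 1 (tensor_covec y)"
  unfolding tensor_vec_def tensor_covec_def by (auto intro!: tlen_sum tlen_single)

lemma tlen_act: assumes "tlen d p" shows "tlen d (tensor_act w p)"
proof -
  have l: "tlen 1 (letter_act w l)" for l by (cases l) (simp_all add: tlen_vec)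
  have "tlen (int (length us)) (prod_list (map (letter_act w) us))" for us
  proof (induction us)
    case Nil then show ?case using tlen_scalar[of 0 1] by (simp add: tensor_scalar_simps)
  next
    case (Cons a us) then show ?case using tlen_mult[OF l Cons] by (simp add: add.commute)
  qed
  then have s: "tlen (0 + int (length us)) (tensor_scalar k * prod_list (map (letter_act w) us))" for k us
    by (intro tlen_mult tlen_scalar) simp_all
  have "tlen d (tensor_scalar k * prod_list (map (letter_act w) (letters u)))" if "u \<in> Poly_Mapping.keys p" for k u
    using assms that by (intro tlen_mono[OF s]) (simp add: tlen_def)
  then show ?thesis unfolding tensor_act_def by (intro tlen_sum)
qed

context refl_data
begin

definition filt :: "int \<Rightarrow> 'n smash_elem set set" where
  "filt i = cl ` {F \<in> carrier Sm. \<forall>w. tlen i (F w)}"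

lemma filt_eq: "cherednik_filtration W \<alpha> \<alpha>' t c i = filt i"
  by (simp add: cherednik_filtration_def filt_def HH_cherednik tlen_def)

lemma filt_add: "h \<in> filt i \<Longrightarrow> h' \<in> filt i \<Longrightarrow> h \<oplus>\<^bsub>HH\<^esub> h' \<in> filt i"
proof -
  assume "h \<in> filt i" "h' \<in> filt i"
  then obtain F F' where F: "F \<in> carrier Sm" "\<forall>w. tlen i (F w)" "h = cl F" "F' \<in> carrier Sm" "\<forall>w. tlen i (F' w)" "h' = cl F'"
    by (auto simp: filt_def)
  moreover have "F \<oplus>\<^bsub>Sm\<^esub> F' \<in> carrier Sm" "\<forall>w. tlen i ((F \<oplus>\<^bsub>Sm\<^esub> F') w)"
    using F by (auto simp: Sm_simps pfs tlen_add)
  ultimately show ?thesis by (auto simp: filt_def HQ.cls_add)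
qed
lemma filt_smult: "h \<in> filt i \<Longrightarrow> k \<odot>\<^bsub>HH\<^esub> h \<in> filt i"
proof -
  assume "h \<in> filt i"
  then obtain F where F: "F \<in> carrier Sm" "\<forall>w. tlen i (F w)" "h = cl F" by (auto simp: filt_def)
  moreover have "k \<odot>\<^bsub>Sm\<^esub> F \<in> carrier Sm" "\<forall>w. tlen i ((k \<odot>\<^bsub>Sm\<^esub> F) w)"
    using F tlen_mult[OF tlen_scalar[of 0 k]] by (auto simp: Sm_simps)
  ultimately show ?thesis by (auto simp: filt_def HQ.cls_smult)
qed
lemma filt_mult: "h \<in> filt i \<Longrightarrow> h' \<in> filt j \<Longrightarrow> h \<otimes>\<^bsub>HH\<^esub> h' \<in> filt (i + j)"
proof -
  assume "h \<in> filt i" "h' \<in> filt j"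
  then obtain F F' where F: "F \<in> carrier Sm" "\<forall>w. tlen i (F w)" "h = cl F" "F' \<in> carrier Sm" "\<forall>w. tlen j (F' w)" "h' = cl F'"
    by (auto simp: filt_def)
  have "tlen (i + j) ((F \<otimes>\<^bsub>Sm\<^esub> F') w)" for w
  proof (cases "w \<in> W")
    case True
    then show ?thesis unfolding Sm_mult[OF True] using F by (intro tlen_sum tlen_mult tlen_act) auto
  qed (simp add: Sm_mult_out tlen_zero)
  then show ?thesis using F Sm_mult_closed[of F F'] by (auto simp: filt_def HQ.cls_mult)
qed
lemma filt_mono: "i \<le> j \<Longrightarrow> filt i \<subseteq> filt j" by (auto simp: filt_def intro: tlen_mono)

lemma filt_ee: "ee \<in> filt 0"
  using av_closed[of W] by (auto simp: ee_def filt_def av_eq tlen_scalar tlen_zero)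

lemma filt_zero: "\<zero>\<^bsub>HH\<^esub> \<in> filt i"
proof -
  have "\<zero>\<^bsub>Sm\<^esub> \<in> carrier Sm" "\<forall>w. tlen i (\<zero>\<^bsub>Sm\<^esub> w)" by (auto simp: Sm_simps pfs tlen_zero)
  moreover have "cl \<zero>\<^bsub>Sm\<^esub> = \<zero>\<^bsub>HH\<^esub>" using HQ.cls_zero_iff by simp
  ultimately show ?thesis by (force simp: filt_def)
qed

lemma filt_XY: "Xc x \<in> filt 1" "Yc y \<in> filt 1"
  using Sm_tensor tlen_vec tlen_zero by (auto simp: Xc_def Yc_def filt_def smash_tensor_def intro!: imageI)

lemma carrier_filt: assumes "h \<in> carrier HH" obtains d where "h \<in> filt (int d)"
proof -
  obtain F where F: "F \<in> carrier Sm" "h = cl F" using assms by (rule HH_cases)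
  define N where "N = (\<Sum>w\<in>W. \<Sum>u\<in>Poly_Mapping.keys (F w). length (letters u))"
  have "tlen (int N) (F w)" for w
  proof (cases "w \<in> W")
    case True
    show ?thesis unfolding tlen_def
    proof
      fix u assume u: "u \<in> Poly_Mapping.keys (F w)"
      have "length (letters u) \<le> (\<Sum>u\<in>Poly_Mapping.keys (F w). length (letters u))" using u by (intro member_le_sum) auto
      also have "\<dots> \<le> N" unfolding N_def using True fin by (intro member_le_sum[of w]) auto
      finally show "int (length (letters u)) \<le> int N" by simp
    qed
  next
    case False then show ?thesis using F by (simp add: Sm_simps tlen_zero)
  qed
  then show ?thesis using that[of N] F by (auto simp: filt_def)
qed

lemma filt_DD': "h \<in> filt (int d) \<Longrightarrow> h \<otimes>\<^bsub>HH\<^esub> ee \<in> DD d"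
  unfolding filt_def using filt_DD by (fastforce simp: tlen_def)

lemma pdeg_filt: "h \<in> filt i \<Longrightarrow> pdeg m P \<Longrightarrow> pdeg (m + i) (rhoH h P)"
proof -
  assume "h \<in> filt i" and P: "pdeg m P"
  then obtain F where F: "F \<in> carrier Sm" "\<forall>w. tlen i (F w)" "h = cl F" by (auto simp: filt_def)
  then show ?thesis using P pdeg_pol[OF P] by (auto simp: rhoH_cl tlen_def intro!: pdeg_rho)
qed

text \<open>\<open>U\<close> is \<open>e H\<^sup>g\<^sup>l e\<close>.\<close>

definition U :: "'n smash_elem set set" where "U = {u \<in> Gl. ee \<otimes>\<^bsub>HH\<^esub> u = u \<and> u \<otimes>\<^bsub>HH\<^esub> ee = u}"

text \<open>Evaluation at the constant 1. By \<open>Th_inj\<close>, \<open>Th_sph_lift\<close>,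
  \<open>pdeg_Th\<close> and \<open>U_filt\<close> it identifies \<open>U\<close> with
  \<open>S\<close>, filtration against degree.\<close>

definition Th :: "'n smash_elem set \<Rightarrow> 'n pf" where "Th u = rhoH u 1"

lemma U_Gl: "u \<in> U \<Longrightarrow> u \<in> Gl" and U_carrier: "u \<in> U \<Longrightarrow> u \<in> carrier HH"
  and U_ee: "u \<in> U \<Longrightarrow> ee \<otimes>\<^bsub>HH\<^esub> u = u" "u \<in> U \<Longrightarrow> u \<otimes>\<^bsub>HH\<^esub> ee = u"
  using Gl_carrier by (auto simp: U_def)

lemma U_I: "h \<in> Gl \<Longrightarrow> ee \<otimes>\<^bsub>HH\<^esub> h \<otimes>\<^bsub>HH\<^esub> ee \<in> U"
proof -
  assume h: "h \<in> Gl"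
  then have hH: "h \<in> carrier HH" by (rule Gl_carrier)
  have "ee \<otimes>\<^bsub>HH\<^esub> (ee \<otimes>\<^bsub>HH\<^esub> h \<otimes>\<^bsub>HH\<^esub> ee) = (ee \<otimes>\<^bsub>HH\<^esub> ee) \<otimes>\<^bsub>HH\<^esub> h \<otimes>\<^bsub>HH\<^esub> ee"
    "(ee \<otimes>\<^bsub>HH\<^esub> h \<otimes>\<^bsub>HH\<^esub> ee) \<otimes>\<^bsub>HH\<^esub> ee = ee \<otimes>\<^bsub>HH\<^esub> h \<otimes>\<^bsub>HH\<^esub> (ee \<otimes>\<^bsub>HH\<^esub> ee)"
    using hH by (simp_all add: H.m_assoc)
  then show ?thesis using h ee_Gl by (simp add: U_def ee_ee Gl_mult)
qed

lemma U_I': "u \<in> Gl \<Longrightarrow> ee \<otimes>\<^bsub>HH\<^esub> u = u \<Longrightarrow> u \<otimes>\<^bsub>HH\<^esub> ee = u \<Longrightarrow> u \<in> U" by (simp add: U_def)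

lemma U_add: "u \<in> U \<Longrightarrow> v \<in> U \<Longrightarrow> u \<oplus>\<^bsub>HH\<^esub> v \<in> U"
  by (rule U_I') (auto simp: U_Gl Gl_add H.r_distr H.l_distr U_carrier U_ee)
lemma U_smult: "u \<in> U \<Longrightarrow> k \<odot>\<^bsub>HH\<^esub> u \<in> U"
  by (rule U_I') (auto simp: U_Gl Gl_smult H.sm_mult_l H.sm_mult_r U_carrier U_ee)
lemma U_minus: "u \<in> U \<Longrightarrow> v \<in> U \<Longrightarrow> u \<ominus>\<^bsub>HH\<^esub> v \<in> U"
  using U_add[OF _ U_smult[of v "-1"]] by (simp add: H.minus_sm U_carrier)
lemma U_mult: "u \<in> U \<Longrightarrow> v \<in> U \<Longrightarrow> u \<otimes>\<^bsub>HH\<^esub> v \<in> U"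
proof -
  assume uv: "u \<in> U" "v \<in> U"
  have "ee \<otimes>\<^bsub>HH\<^esub> (u \<otimes>\<^bsub>HH\<^esub> v) = (ee \<otimes>\<^bsub>HH\<^esub> u) \<otimes>\<^bsub>HH\<^esub> v" using uv by (simp add: H.m_assoc U_carrier)
  moreover have "(u \<otimes>\<^bsub>HH\<^esub> v) \<otimes>\<^bsub>HH\<^esub> ee = u \<otimes>\<^bsub>HH\<^esub> (v \<otimes>\<^bsub>HH\<^esub> ee)" using uv by (simp add: H.m_assoc U_carrier)
  ultimately show ?thesis using uv by (intro U_I') (simp_all only: U_ee U_Gl Gl_mult)
qed
lemma U_e: "ee \<in> U" by (rule U_I') (auto simp: ee_Gl ee_ee)
lemma U_zero: "\<zero>\<^bsub>HH\<^esub> \<in> U" using U_minus[OF U_e U_e] by (simp add: a_minus_def H.r_neg)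

lemma Winv_one: "Winv 1" by (simp add: Winv_simps)

lemma Th_S: "u \<in> U \<Longrightarrow> sph (Th u)"
proof -
  assume u: "u \<in> U"
  have p: "pol (Th u)" using u by (simp add: Th_def pol_rhoH U_carrier pol_one)
  have "Th u = rhoH ee (Th u)" unfolding Th_def using u rhoH_mult[of ee u 1] by (simp add: U_carrier pol_one U_ee)
  then have "Winv (Th u)" using Winv_rhoH_ee[OF p] by simp
  then show ?thesis using p u Gl_weight0[of u 1] by (simp add: sph_def Th_def U_Gl pol_one weight0_simps)
qed

text \<open>\<open>u = u e\<close> lies in some \<open>DD d\<close>, where the value on 1 determines
  the element.\<close>

lemma Th_inj0: assumes u: "u \<in> U" "Th u = 0" shows "u = \<zero>\<^bsub>HH\<^esub>"
proof -
  obtain d where "u \<in> filt (int d)" using carrier_filt U_carrier[OF u(1)] by blast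
  then have "u \<in> DD d" using filt_DD'[of u d] U_ee[OF u(1)] by simp
  then show ?thesis using DD_injective u(2) by (simp add: Th_def)
qed

lemma Th_add: "u \<in> U \<Longrightarrow> v \<in> U \<Longrightarrow> Th (u \<oplus>\<^bsub>HH\<^esub> v) = Th u + Th v"
  and Th_smult: "u \<in> U \<Longrightarrow> Th (k \<odot>\<^bsub>HH\<^esub> u) = cst k * Th u"
  and Th_minus: "u \<in> U \<Longrightarrow> v \<in> U \<Longrightarrow> Th (u \<ominus>\<^bsub>HH\<^esub> v) = Th u - Th v"
  and Th_mult: "u \<in> U \<Longrightarrow> v \<in> U \<Longrightarrow> Th (u \<otimes>\<^bsub>HH\<^esub> v) = rhoH u (Th v)"
  by (simp_all add: Th_def rhoH_add rhoH_smult rhoH_minus rhoH_mult U_carrier pol_one)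

lemma Th_inj: assumes "u \<in> U" "v \<in> U" "Th u = Th v" shows "u = v"
proof -
  have "u \<ominus>\<^bsub>HH\<^esub> v = \<zero>\<^bsub>HH\<^esub>" using Th_inj0[OF U_minus[OF assms(1,2)]] assms by (simp add: Th_minus)
  then show ?thesis using assms U_carrier by (simp add: H.r_right_minus_eq)
qed

lemma pdeg_Th: "u \<in> U \<Longrightarrow> u \<in> filt m \<Longrightarrow> pdeg m (Th u)"
  using pdeg_filt[of u m 0 1] pdeg_one[of 0] by (simp add: Th_def)

section \<open>Every polynomial in \<open>S\<close> is a value at 1\<close>

lemma pdeg_expansion: "pdeg m P \<Longrightarrow> \<exists>K a. finite K \<and> (\<forall>M\<in>K. int (size M) \<le> m) \<and> P = (\<Sum>M\<in>K. cst (a M) * monM M)"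
proof (induction rule: pdeg_induct)
  case (zero m) then show ?case by (intro exI[of _ "{}"]) simp
next
  case (cst m k) then show ?case by (intro exI[of _ "{{#}}"] exI[of _ "\<lambda>_. k"]) (simp add: monM_simps)
next
  case (vco m P i)
  then obtain K a where K: "finite K" "\<forall>M\<in>K. int (size M) \<le> m" "P = (\<Sum>M\<in>K. cst (a M) * monM M)" by blast
  have inj: "inj_on (add_mset (Lx i)) K" by (auto intro: inj_onI)
  have "vco i * P = (\<Sum>M\<in>K. cst (a M) * monM (add_mset (Lx i) M))"
    by (simp add: K(3) sum_distrib_left monM_simps mult.left_commute)
  also have "\<dots> = (\<Sum>M\<in>add_mset (Lx i) ` K. cst (a (M - {#Lx i#})) * monM M)"
    by (subst sum.reindex[OF inj]) simp
  finally show ?case using K by (intro exI[of _ "add_mset (Lx i) ` K"] exI[of _ "\<lambda>M. a (M - {#Lx i#})"]) auto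
next
  case (xco m P i)
  then obtain K a where K: "finite K" "\<forall>M\<in>K. int (size M) \<le> m" "P = (\<Sum>M\<in>K. cst (a M) * monM M)" by blast
  have inj: "inj_on (add_mset (Ly i)) K" by (auto intro: inj_onI)
  have "xco i * P = (\<Sum>M\<in>K. cst (a M) * monM (add_mset (Ly i) M))"
    by (simp add: K(3) sum_distrib_left monM_simps mult.left_commute)
  also have "\<dots> = (\<Sum>M\<in>add_mset (Ly i) ` K. cst (a (M - {#Ly i#})) * monM M)"
    by (subst sum.reindex[OF inj]) simp
  finally show ?case using K by (intro exI[of _ "add_mset (Ly i) ` K"] exI[of _ "\<lambda>M. a (M - {#Ly i#})"]) auto
next
  case (add m P Q)
  then obtain K a L b where K: "finite K" "\<forall>M\<in>K. int (size M) \<le> m" "P = (\<Sum>M\<in>K. cst (a M) * monM M)"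
    and L: "finite L" "\<forall>M\<in>L. int (size M) \<le> m" "Q = (\<Sum>M\<in>L. cst (b M) * monM M)" by blast
  let ?a = "\<lambda>M. (if M \<in> K then a M else 0) + (if M \<in> L then b M else 0)"
  have "P = (\<Sum>M\<in>K \<union> L. cst (if M \<in> K then a M else 0) * monM M)"
    unfolding K(3) using K(1) L(1) by (intro sum.mono_neutral_cong_left) (auto simp: cst_simps)
  moreover have "Q = (\<Sum>M\<in>K \<union> L. cst (if M \<in> L then b M else 0) * monM M)"
    unfolding L(3) using K(1) L(1) by (intro sum.mono_neutral_cong_left) (auto simp: cst_simps)
  ultimately have "P + Q = (\<Sum>M\<in>K \<union> L. cst (?a M) * monM M)"
    by (simp only: sum.distrib[symmetric] distrib_right[symmetric] cst_simps)
  then show ?case using K L by (intro exI[of _ "K \<union> L"] exI[of _ ?a]) auto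
qed

definition wtM :: "'n letter multiset \<Rightarrow> int" where
  "wtM M = int (size (filter_mset (\<lambda>l. \<exists>i. l = Lx i) M)) - int (size (filter_mset (\<lambda>l. \<exists>i. l = Ly i) M))"

lemma sc_monM: "r \<noteq> 0 \<Longrightarrow> sc r (monM M) = cst (r powi wtM M) * monM M"
proof (induction M)
  case empty then show ?case by (simp add: monM_simps sc_simps wtM_def cst_simps)
next
  case (add l M)
  have w: "wtM (add_mset (Lx i) M) = wtM M + 1" "wtM (add_mset (Ly i) M) = wtM M - 1" for i
    by (simp_all add: wtM_def)
  have p: "cst (r powi (wtM M - 1)) = cst (inverse r) * cst (r powi wtM M)"
    "cst (r powi (wtM M + 1)) = cst r * cst (r powi wtM M)"
    using add(2) by (simp_all add: cst_simps power_int_diff power_int_add field_simps)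
  then show ?case using add by (cases l) (simp_all add: monM_simps sc_simps w p mult_ac)
qed

lemma wtM_zero: assumes "wtM M = 0" shows "\<exists>xs ys. M = lets xs ys \<and> length xs = length ys"
proof -
  have "\<exists>xs ys. M = lets xs ys \<and> int (length xs) - int (length ys) = wtM M" for M
  proof (induction M)
    case empty then show ?case by (intro exI[of _ "[]"]) (simp add: lets_def wtM_def)
  next
    case (add l M)
    then obtain xs ys where M: "M = lets xs ys" "int (length xs) - int (length ys) = wtM M" by blast
    show ?case
    proof (cases l)
      case (Lx i) then show ?thesis using M by (intro exI[of _ "i # xs"] exI[of _ ys]) (simp add: lets_def wtM_def)
    next
      case (Ly i) then show ?thesis using M by (intro exI[of _ xs] exI[of _ "i # ys"]) (simp add: lets_def wtM_def)
    qed
  qed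
  then show ?thesis using assms by fastforce
qed

text \<open>Scaling by the single number 2 separates the weights: a monomial of weight
  \<open>k\<close> is multiplied by \<open>2 powi k\<close>, which is 1 only for
  \<open>k = 0\<close>.\<close>

lemma weight0_expansion:
  assumes "pdeg m P" "weight0 P"
  shows "\<exists>K a. finite K \<and> (\<forall>M\<in>K. int (size M) \<le> m \<and> wtM M = 0) \<and> P = (\<Sum>M\<in>K. cst (a M) * monM M)"
proof -
  obtain K a where K: "finite K" "\<forall>M\<in>K. int (size M) \<le> m" "P = (\<Sum>M\<in>K. cst (a M) * monM M)"
    using pdeg_expansion[OF assms(1)] by blast
  have "sc 2 P = (\<Sum>M\<in>K. cst (a M * 2 powi wtM M) * monM M)"
    unfolding K(3) sc_sum by (rule sum.cong) (simp_all add: sc_simps sc_monM cst_simps(3)[symmetric] mult.assoc)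
  then have "(\<Sum>M\<in>K. cst (a M * 2 powi wtM M) * monM M) = (\<Sum>M\<in>K. cst (a M) * monM M)"
    using assms(2) K(3) by (simp add: weight0_def)
  moreover have cd: "cst (x - y) = cst x - cst y" for x y by (rule pf_eqI) (simp add: pfs)
  ultimately have "(\<Sum>M\<in>K. cst (a M * 2 powi wtM M - a M) * monM M) = 0"
    by (simp add: cd left_diff_distrib sum_subtractf)
  then have "a M * 2 powi wtM M - a M = 0" if "M \<in> K" for M
    using monomials_independent[OF K(1), of "\<lambda>M. a M * 2 powi wtM M - a M"] that by simp
  then have "a M = 0 \<or> (2::complex) powi wtM M = 1" if "M \<in> K" for M using that by force
  moreover have "(2::complex) powi k = 1 \<Longrightarrow> k = 0" for k
  proof -
    assume "(2::complex) powi k = 1"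
    then have "norm ((2::complex) powi k) = 1" by simp
    then have "(2::real) powi k = 1" by (simp add: norm_power_int)
    then show "k = 0" using power_int_strict_increasing[of 0 k "2::real"] power_int_strict_increasing[of k 0 "2::real"]
      by (cases k "0::int" rule: linorder_cases) auto
  qed
  ultimately have z: "a M = 0" if "M \<in> K" "wtM M \<noteq> 0" for M using that by blast
  have "P = (\<Sum>M\<in>{M\<in>K. wtM M = 0}. cst (a M) * monM M)"
    unfolding K(3) using K(1) z by (intro sum.mono_neutral_right) (auto simp: cst_simps)
  then show ?thesis using K by (intro exI[of _ "{M\<in>K. wtM M = 0}"] exI[of _ a]) auto
qed

text \<open>Words in the generators \<open>x_i y_j\<close>, which are not normally ordered but
  visibly lie in \<open>Gl\<close>; they realise the monomials of weight zero up to lower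
  degree.\<close>

primrec xyw :: "('n \<times> 'n) list \<Rightarrow> 'n smash_elem set" where
  "xyw [] = ee"
| "xyw (p # ps) = (Xc (axis (fst p) 1) \<otimes>\<^bsub>HH\<^esub> Yc (axis (snd p) 1)) \<otimes>\<^bsub>HH\<^esub> xyw ps"

text \<open>Reordering costs commutators that replace two letters by group elements, so the
  deviation from the monomial lies two degrees lower.\<close>

lemma xyw_facts: "xyw ps \<in> Gl \<and> xyw ps \<otimes>\<^bsub>HH\<^esub> ee = xyw ps \<and> xyw ps \<in> filt (2 * int (length ps)) \<and>
    pdeg (2 * int (length ps) - 2) (rhoH (xyw ps) 1 - monM (lets (map fst ps) (map snd ps)))"
proof (induction ps)
  case Nil
  have "rhoH ee 1 = 1" by (rule rhoH_ee_inv[OF pol_one Winv_one])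
  then show ?case using ee_Gl filt_ee by (simp add: ee_ee lets_def monM_simps pdeg_zero)
next
  case (Cons p ps)
  let ?x = "axis (fst p) 1" and ?y = "axis (snd p) 1"
  let ?M = "monM (lets (map fst ps) (map snd ps))"
  have c: "xyw ps \<in> carrier HH" using Cons Gl_carrier by blast
  have f: "Xc ?x \<otimes>\<^bsub>HH\<^esub> Yc ?y \<in> filt 2" using filt_mult[OF filt_XY] by simp
  define D where "D = rhoH (xyw ps) 1 - ?M"
  have D: "pdeg (2 * int (length ps) - 2) D" using Cons by (simp add: D_def)
  have M: "pdeg (2 * int (length ps)) ?M" using pdeg_monM[of "lets (map fst ps) (map snd ps)"] by (simp add: lets_def)
  have pM: "pol ?M" "pol D" using M D pdeg_pol by blast+
  have "rhoH (xyw ps) 1 = ?M + D" by (simp add: D_def)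
  then have "rhoH (xyw (p # ps)) 1 = lin_v ?x * (dunkl ?y ?M + dunkl ?y D)"
    using c pM by (simp add: rhoH_mult pol_one pol_add rhoH_Y rhoH_X pol_dunkl dunkl_add)
  moreover have "monM (lets (map fst (p # ps)) (map snd (p # ps))) = lin_v ?x * (lin_x ?y * ?M)"
    by (simp add: lets_def monM_simps vco_lin xco_lin mult_ac)
  ultimately have e: "rhoH (xyw (p # ps)) 1 - monM (lets (map fst (p # ps)) (map snd (p # ps))) =
     lin_v ?x * ((dunkl ?y ?M - lin_x ?y * ?M) + dunkl ?y D)" by (simp add: algebra_simps)
  have "pdeg (2 * int (length ps) - 1) (dunkl ?y ?M - lin_x ?y * ?M)" by (rule pdeg_dunkl_low[OF M])
  moreover have "pdeg (2 * int (length ps) - 1) (dunkl ?y D)" using pdeg_dunkl[OF D, of ?y] by simp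
  ultimately have "pdeg (2 * int (length ps) - 1) ((dunkl ?y ?M - lin_x ?y * ?M) + dunkl ?y D)" by (rule pdeg_add)
  from pdeg_mult[OF pdeg_lin_v this, of ?x]
  have "pdeg (2 * int (length (p # ps)) - 2) (rhoH (xyw (p # ps)) 1 - monM (lets (map fst (p # ps)) (map snd (p # ps))))"
    unfolding e by (rule pdeg_mono) simp
  moreover have "xyw (p # ps) \<in> filt (2 * int (length (p # ps)))"
  proof -
    have "xyw ps \<in> filt (2 * int (length ps))" using Cons by blast
    from filt_mult[OF f this] have "xyw (p # ps) \<in> filt (2 + 2 * int (length ps))" by simp
    moreover have "2 + 2 * int (length ps) = 2 * int (length (p # ps))" by simp
    ultimately show ?thesis by metis
  qed
  moreover have "xyw (p # ps) \<in> Gl" using Cons Gl_mult[OF Gl_XY] by simp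
  moreover have "xyw (p # ps) \<otimes>\<^bsub>HH\<^esub> ee = xyw (p # ps)" using Cons c by (simp add: H.m_assoc)
  ultimately show ?case by blast
qed

definition sym :: "'n pf \<Rightarrow> 'n pf" where "sym P = rhoH ee P"

lemma pdeg_sym: "pdeg m P \<Longrightarrow> pdeg m (sym P)"
  using pdeg_filt[OF filt_ee] by (simp add: sym_def)

text \<open>The monomials of \<open>P\<close> need not be invariant, but \<open>sym\<close> fixes
  \<open>P\<close>. So each monomial may be lifted by a word \<open>xyw\<close>, and multiplying by
  \<open>ee\<close> averages the sum.\<close>

lemma Th_sph_lift_top:
  assumes "sph P" "pdeg m P"
  shows "\<exists>u\<in>U. u \<in> filt m \<and> pdeg (m - 1) (Th u - P)"
proof -
  have w: "weight0 P" using assms by (simp add: sph_def)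
  obtain K a where K: "finite K" "\<forall>M\<in>K. int (size M) \<le> m \<and> wtM M = 0" "P = (\<Sum>M\<in>K. cst (a M) * monM M)"
    using weight0_expansion[OF assms(2) w] by blast
  have "\<exists>u\<in>U. u \<in> filt m \<and> pdeg (m - 1) (Th u - sym (\<Sum>M\<in>K. cst (a M) * monM M))"
    using K(1,2)
  proof (induction K rule: finite_induct)
    case empty
    have "sym 0 = 0" using rhoH_pcmult[of ee 0 0] by (simp add: sym_def pol_zero cst_simps)
    moreover have "Th \<zero>\<^bsub>HH\<^esub> = 0" by (simp add: Th_def rhoH_zero pol_one)
    ultimately show ?case using U_zero filt_zero by (intro bexI[of _ "\<zero>\<^bsub>HH\<^esub>"]) (auto simp: pdeg_zero)
  next
    case (insert M K)
    then obtain u where u: "u \<in> U" "u \<in> filt m" "pdeg (m - 1) (Th u - sym (\<Sum>M\<in>K. cst (a M) * monM M))" by auto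
    obtain xs ys where M: "M = lets xs ys" "length xs = length ys" using wtM_zero insert by blast
    define ps where "ps = zip xs ys"
    have ps: "map fst ps = xs" "map snd ps = ys" using M by (simp_all add: ps_def)
    have "int (size M) = 2 * int (length ps)" using M by (simp add: lets_def ps_def)
    then have len: "2 * int (length ps) \<le> m" using insert by auto
    define v where "v = ee \<otimes>\<^bsub>HH\<^esub> xyw ps"
    note x = xyw_facts[of ps]
    have xH: "xyw ps \<in> carrier HH" using x Gl_carrier by blast
    have "v = ee \<otimes>\<^bsub>HH\<^esub> xyw ps \<otimes>\<^bsub>HH\<^esub> ee" using x xH by (simp add: v_def H.m_assoc)
    then have vU: "v \<in> U" using U_I x by simp
    have vf: "v \<in> filt m" using filt_mult[OF filt_ee] x filt_mono[OF len] by (auto simp: v_def)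
    have tm: "Th v - sym (monM M) = sym (rhoH (xyw ps) 1 - monM M)"
    proof -
      have "pol (monM M)" "pol (rhoH (xyw ps) 1)" using pdeg_pol[OF pdeg_monM] pol_rhoH[OF xH pol_one] by blast+
      then show ?thesis using rhoH_padd[of ee "monM M" "rhoH (xyw ps) 1 - monM M"] xH
        by (simp add: Th_def v_def rhoH_mult pol_one sym_def pol_diff)
    qed
    have "pdeg (2 * int (length ps) - 2) (rhoH (xyw ps) 1 - monM M)" using x M ps by simp
    then have "pdeg (2 * int (length ps) - 2) (sym (rhoH (xyw ps) 1 - monM M))" by (rule pdeg_sym)
    then have "pdeg (m - 1) (Th v - sym (monM M))" unfolding tm by (rule pdeg_mono) (use len in simp)
    then have tv: "pdeg (m - 1) (Th u - sym (\<Sum>M\<in>K. cst (a M) * monM M) + cst (a M) * (Th v - sym (monM M)))"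
      using u(3) by (intro pdeg_add pdeg_cmult)
    have pK: "pol (\<Sum>M\<in>K. cst (a M) * monM M)" using pdeg_pol[OF pdeg_monM] by (intro pol_sum pol_mult pol_cst)
    have si: "sym (\<Sum>M\<in>insert M K. cst (a M) * monM M) = cst (a M) * sym (monM M) + sym (\<Sum>M\<in>K. cst (a M) * monM M)"
      using insert(1,2) pK pdeg_pol[OF pdeg_monM, of M]
      by (simp add: sym_def rhoH_padd rhoH_pcmult pol_mult pol_cst)
    have "Th (u \<oplus>\<^bsub>HH\<^esub> a M \<odot>\<^bsub>HH\<^esub> v) - sym (\<Sum>M\<in>insert M K. cst (a M) * monM M)
       = Th u - sym (\<Sum>M\<in>K. cst (a M) * monM M) + cst (a M) * (Th v - sym (monM M))"
      unfolding si using u vU by (simp add: Th_add Th_smult U_smult algebra_simps)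
    then show ?case using tv u vU vf by (intro bexI[of _ "u \<oplus>\<^bsub>HH\<^esub> a M \<odot>\<^bsub>HH\<^esub> v"]) (auto simp: U_add U_smult filt_add filt_smult)
  qed
  moreover have "sym P = P" using assms unfolding sph_def sym_def by (simp add: rhoH_ee_inv)
  ultimately show ?thesis by (simp add: K(3))
qed

text \<open>The error of a lift of the leading part again lies in \<open>S\<close> and has smaller
  degree, so it can be lifted in turn and subtracted.\<close>

lemma Th_sph_lift: assumes "sph P" "pdeg m P" shows "\<exists>u\<in>U. u \<in> filt m \<and> Th u = P"
proof (cases "m < 0")
  case True
  then have "P = 0" using assms pdeg_neg by blast
  moreover have "Th \<zero>\<^bsub>HH\<^esub> = 0" by (simp add: Th_def rhoH_zero pol_one)
  ultimately show ?thesis using U_zero filt_zero by blast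
next
  case False
  \<comment> \<open>The shift by one lets the induction start at degree -1, where only the zero
    polynomial is left.\<close>
  have "\<exists>u\<in>U. u \<in> filt (int n - 1) \<and> Th u = P" if "sph P" "pdeg (int n - 1) P" for n P
    using that
  proof (induction n arbitrary: P)
    case 0
    then have "P = 0" using pdeg_neg by fastforce
    moreover have "Th \<zero>\<^bsub>HH\<^esub> = 0" by (simp add: Th_def rhoH_zero pol_one)
    ultimately show ?case using U_zero filt_zero by blast
  next
    case (Suc n)
    obtain u where u: "u \<in> U" "u \<in> filt (int n)" "pdeg (int n - 1) (Th u - P)"
      using Th_sph_lift_top[of P "int n"] Suc by auto
    have "sph (Th u - P)" using Th_S[OF u(1)] Suc sph_simps by blast
    then obtain v where v: "v \<in> U" "v \<in> filt (int n - 1)" "Th v = Th u - P" using Suc(1) u(3) by blast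
    have "v \<in> filt (int n)" using v filt_mono[of "int n - 1" "int n"] by auto
    then have "u \<ominus>\<^bsub>HH\<^esub> v \<in> filt (int n)" using u v by (simp add: H.minus_sm U_carrier filt_add filt_smult)
    moreover have "Th (u \<ominus>\<^bsub>HH\<^esub> v) = P" using u v by (simp add: Th_minus)
    ultimately show ?case using u v U_minus by force
  qed
  from this[of P "nat (m + 1)"] show ?thesis using assms False by simp
qed

text \<open>A polynomial of degree \<open>m\<close> has a lift in filtration degree
  \<open>m\<close>, and injectivity identifies this lift with \<open>u\<close>; so no element of
  high filtration degree can hide behind a polynomial of low degree.\<close>

lemma U_filt: assumes "u \<in> U" "pdeg m (Th u)" shows "u \<in> filt m"
  using Th_sph_lift[OF Th_S[OF assms(1)] assms(2)] Th_inj[OF _ assms(1)] by blast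

lemma U_symbol:
  assumes u: "u \<in> U" "pdeg (int d) (Th u)" and Q: "pdeg m Q" "Winv Q"
  shows "pdeg (int d + m - 4) (rhoH u Q - Th u * Q - E1 (Th u) Q)"
proof -
  have "u \<in> DD d" using filt_DD'[OF U_filt[OF u]] U_ee[OF u(1)] by simp
  from DD_symbol[OF this Q] show ?thesis by (simp add: Th_def)
qed

end

section \<open>The quotient by the Euler element\<close>

locale euler_data = refl_data W \<alpha> \<alpha>' lam t c
  for W :: "('n::finite) cmat set" and \<alpha> \<alpha>' lam t c +
  fixes \<zeta> :: complex
  assumes t_nz: "t \<noteq> 0" and card_n: "CARD('n) > 1"
begin

abbreviation "GlA \<equiv> HH\<lparr>carrier := Gl\<rparr>"
abbreviation "AG \<equiv> corner GlA aa"

lemma gl_eq: "gl_subalgebra W \<alpha> \<alpha>' t c = GlA"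
  by (simp add: gl_subalgebra_def HH_cherednik Gl_def gens_def Xc_def Yc_def Gc_def)

lemma average_eq: "average W \<alpha> \<alpha>' t c L = cl (av L)"
  by (simp add: average_def HH_cherednik av_def)

lemma AG_eq: "a_gl_a W \<alpha> \<alpha>' t c = AG"
  by (simp add: a_gl_a_def gl_eq average_eq aa_def)

lemma GlA_alg: "complex_algebra GlA" by (rule H.subalg[OF Gl(1,2)])

lemma carrier_AG: "carrier AG = {x \<in> Gl. aa \<otimes>\<^bsub>HH\<^esub> x = x \<and> x \<otimes>\<^bsub>HH\<^esub> aa = x}"
  using corner_carrier[OF GlA_alg, of aa] by (simp add: aa_Gl aa_aa)

lemma AG_simps: "mult AG = mult HH" "one AG = aa" "zero AG = zero HH" "add AG = add HH" "smult AG = smult HH"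
  by (simp_all add: corner_simps)

lemma AG_alg: "complex_algebra AG" using corner_alg[OF GlA_alg, of aa] by (simp add: aa_Gl aa_aa)

sublocale AG: calg AG by unfold_locales (rule AG_alg)

definition zz :: "'n smash_elem set" where "zz = aa \<otimes>\<^bsub>HH\<^esub> eu \<ominus>\<^bsub>HH\<^esub> \<zeta> \<odot>\<^bsub>HH\<^esub> aa"

lemma eu_closed [simp]: "eu \<in> carrier HH" using eu_Gl Gl_carrier by blast

lemma zz_AG: "zz \<in> carrier AG"
proof -
  have "zz \<in> Gl" unfolding zz_def by (intro Gl_minus Gl_mult Gl_smult aa_Gl eu_Gl)
  moreover have "aa \<otimes>\<^bsub>HH\<^esub> (aa \<otimes>\<^bsub>HH\<^esub> eu) = aa \<otimes>\<^bsub>HH\<^esub> eu" by (simp add: H.m_assoc[symmetric] aa_aa)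
  moreover have "(aa \<otimes>\<^bsub>HH\<^esub> eu) \<otimes>\<^bsub>HH\<^esub> aa = aa \<otimes>\<^bsub>HH\<^esub> eu"
    by (simp add: H.m_assoc eu_aa[symmetric]) (simp add: H.m_assoc[symmetric] aa_aa)
  ultimately show ?thesis
    by (simp add: carrier_AG zz_def H.minus_sm H.r_distr H.l_distr H.sm_mult_l H.sm_mult_r aa_aa)
qed

definition JJ :: "'n smash_elem set set" where "JJ = Idl\<^bsub>AG\<^esub> {zz}"

lemma JJ_eq: "euler_ideal W \<alpha> \<alpha>' lam t c \<zeta> = JJ"
  by (simp add: euler_ideal_def Let_def JJ_def AG_eq zz_def average_eq HH_cherednik aa_def eu_def)

lemma JJ_ideal: "ideal JJ AG" unfolding JJ_def by (rule AG.genideal_ideal) (use zz_AG in simp)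
lemma zz_JJ: "zz \<in> JJ" unfolding JJ_def using AG.genideal_self[of "{zz}"] zz_AG by simp

sublocale AQ: qalg AG JJ by (intro qalg.intro AG.calg_axioms JJ_ideal)

abbreviation "AA \<equiv> quot_alg AG JJ"
abbreviation "cA h \<equiv> JJ +>\<^bsub>AG\<^esub> h"

lemma AA_eq: "A_alg W \<alpha> \<alpha>' lam t c \<zeta> = AA" "A_class W \<alpha> \<alpha>' lam t c \<zeta> = (\<lambda>h. cA h)"
  by (simp_all add: A_alg_def A_class_def AG_eq JJ_eq fun_eq_iff)

definition shifted_euler :: "'n pf \<Rightarrow> 'n pf" where "shifted_euler P = euler_op P - cst \<zeta> * P"

lemma pol_shifted_euler: "pol P \<Longrightarrow> pol (shifted_euler P)" by (simp add: shifted_euler_def pol_euler_op pol_diff pol_mult pol_cst)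
lemma shifted_euler_add: "pol P \<Longrightarrow> pol Q \<Longrightarrow> shifted_euler (P + Q) = shifted_euler P + shifted_euler Q"
  by (simp add: shifted_euler_def euler_op_add algebra_simps)
lemma shifted_euler_zero: "shifted_euler 0 = 0" by (simp add: shifted_euler_def euler_op_zero)
lemma shifted_euler_rhoH: "h \<in> Gl \<Longrightarrow> pol P \<Longrightarrow> shifted_euler (rhoH h P) = rhoH h (shifted_euler P)"
proof -
  assume h: "h \<in> Gl" and P: "pol P"
  have "rhoH h (euler_op P) = rhoH h (shifted_euler P + cst \<zeta> * P)" by (simp add: shifted_euler_def)
  also have "\<dots> = rhoH h (shifted_euler P) + cst \<zeta> * rhoH h P"
    using h P by (simp add: rhoH_padd Gl_carrier pol_shifted_euler pol_mult pol_cst rhoH_pcmult)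
  finally show ?thesis using Gl_euler_op[OF h P] by (simp add: shifted_euler_def)
qed

lemma rhoH_zz: assumes "pol P" shows "rhoH zz P = shifted_euler (rhoH aa P)"
  unfolding zz_def using assms Gl_euler_op[OF aa_Gl assms]
  by (simp add: rhoH_minus rhoH_mult rhoH_smult rhoH_eu shifted_euler_def)

text \<open>The elements acting as \<open>shifted_euler\<close> after some element of
  \<open>Gl\<close> form an ideal, since \<open>shifted_euler\<close> commutes with the action of
  \<open>Gl\<close>; this ideal contains \<open>zz\<close>.\<close>

lemma JJ_rho: assumes "j \<in> JJ" shows "\<exists>b\<in>Gl. \<forall>P. pol P \<longrightarrow> rhoH j P = shifted_euler (rhoH b P)"
proof -
  let ?B = "{j \<in> carrier AG. \<exists>b\<in>Gl. \<forall>P. pol P \<longrightarrow> rhoH j P = shifted_euler (rhoH b P)}"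
  have AGl: "x \<in> Gl" if "x \<in> carrier AG" for x using that by (simp add: carrier_AG)
  have z: "\<zero>\<^bsub>AG\<^esub> \<in> ?B"
  proof -
    have "\<zero>\<^bsub>HH\<^esub> \<in> Gl" by (rule H.subspaceD(2)[OF Gl(2)])
    moreover have "\<zero>\<^bsub>AG\<^esub> \<in> carrier AG" by (rule AG.zero_closed)
    ultimately show ?thesis by (auto simp: AG_simps rhoH_zero shifted_euler_zero intro!: bexI[of _ "\<zero>\<^bsub>HH\<^esub>"])
  qed
  have a: "x \<oplus>\<^bsub>AG\<^esub> y \<in> ?B" if xy: "x \<in> ?B" "y \<in> ?B" for x y
  proof -
    obtain b b' where b: "b \<in> Gl" "\<forall>P. pol P \<longrightarrow> rhoH x P = shifted_euler (rhoH b P)" "b' \<in> Gl" "\<forall>P. pol P \<longrightarrow> rhoH y P = shifted_euler (rhoH b' P)"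
      using xy by blast
    have "x \<oplus>\<^bsub>AG\<^esub> y \<in> carrier AG" using xy by blast
    moreover have "rhoH (x \<oplus>\<^bsub>AG\<^esub> y) P = shifted_euler (rhoH (b \<oplus>\<^bsub>HH\<^esub> b') P)" if "pol P" for P
      using that b xy AGl by (simp add: AG_simps rhoH_add Gl_carrier shifted_euler_add pol_rhoH)
    ultimately show ?thesis using b Gl_add by blast
  qed
  have k: "k \<odot>\<^bsub>AG\<^esub> x \<in> ?B" if x: "x \<in> ?B" for k x
  proof -
    obtain b where b: "b \<in> Gl" "\<forall>P. pol P \<longrightarrow> rhoH x P = shifted_euler (rhoH b P)" using x by blast
    have "shifted_euler (cst k * Q) = cst k * shifted_euler Q" if "pol Q" for Q
      using that by (simp add: shifted_euler_def euler_op_cmult right_diff_distrib mult.left_commute)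
    then have "rhoH (k \<odot>\<^bsub>AG\<^esub> x) P = shifted_euler (rhoH (k \<odot>\<^bsub>HH\<^esub> b) P)" if "pol P" for P
      using that b x AGl by (simp add: AG_simps rhoH_smult Gl_carrier pol_rhoH)
    moreover have "k \<odot>\<^bsub>AG\<^esub> x \<in> carrier AG" using x by blast
    ultimately show ?thesis using b Gl_smult by blast
  qed
  have m: "\<ominus>\<^bsub>AG\<^esub> x \<in> ?B" if x: "x \<in> ?B" for x using k[OF x, of "-1"] x by (simp add: AG.sm_minus)
  have "ideal ?B AG"
  proof (rule idealI[OF AG.ring_axioms])
    show "subgroup ?B (add_monoid AG)"
    proof (rule AG.add.subgroupI)
      show "?B \<noteq> {}" using z by blast
    qed (use a m in auto)
    fix x y assume x: "x \<in> ?B" and y: "y \<in> carrier AG"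
    then obtain b where b: "b \<in> Gl" "\<forall>P. pol P \<longrightarrow> rhoH x P = shifted_euler (rhoH b P)" by blast
    have "rhoH (y \<otimes>\<^bsub>AG\<^esub> x) P = shifted_euler (rhoH (y \<otimes>\<^bsub>HH\<^esub> b) P)" if "pol P" for P
      using that b x y AGl shifted_euler_rhoH[of y "rhoH b P"] by (simp add: AG_simps rhoH_mult Gl_carrier pol_rhoH)
    moreover have "y \<otimes>\<^bsub>AG\<^esub> x \<in> carrier AG" "y \<otimes>\<^bsub>HH\<^esub> b \<in> Gl" using x y b AGl Gl_mult by blast+
    ultimately show "y \<otimes>\<^bsub>AG\<^esub> x \<in> ?B" by blast
    have "rhoH (x \<otimes>\<^bsub>AG\<^esub> y) P = shifted_euler (rhoH (b \<otimes>\<^bsub>HH\<^esub> y) P)" if "pol P" for P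
      using that b x y AGl by (simp add: AG_simps rhoH_mult Gl_carrier pol_rhoH)
    moreover have "x \<otimes>\<^bsub>AG\<^esub> y \<in> carrier AG" "b \<otimes>\<^bsub>HH\<^esub> y \<in> Gl" using x y b AGl Gl_mult by blast+
    ultimately show "x \<otimes>\<^bsub>AG\<^esub> y \<in> ?B" by blast
  qed
  moreover have "{zz} \<subseteq> ?B" using zz_AG aa_Gl rhoH_zz by blast
  ultimately have "JJ \<subseteq> ?B" unfolding JJ_def by (rule AG.genideal_minimal)
  then show ?thesis using assms by blast
qed

lemma U_AG: "u \<in> U \<Longrightarrow> u \<in> carrier AG"
proof -
  assume u: "u \<in> U"
  have "aa \<otimes>\<^bsub>HH\<^esub> (ee \<otimes>\<^bsub>HH\<^esub> u) = (aa \<otimes>\<^bsub>HH\<^esub> ee) \<otimes>\<^bsub>HH\<^esub> u" "(u \<otimes>\<^bsub>HH\<^esub> ee) \<otimes>\<^bsub>HH\<^esub> aa = u \<otimes>\<^bsub>HH\<^esub> (ee \<otimes>\<^bsub>HH\<^esub> aa)"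
    using u by (simp_all add: H.m_assoc U_carrier)
  then show ?thesis using u by (simp add: carrier_AG U_Gl U_ee aa_ee ee_aa)
qed

lemma sph_rhoH: assumes "h \<in> Gl" "sph P" shows "sph (rhoH ee (rhoH h P))"
  using assms Gl_weight0[OF ee_Gl] Gl_weight0[of h] by (simp add: sph_def Winv_rhoH_ee pol_rhoH Gl_carrier)

lemma sph_shifted_euler: assumes "sph P" shows "sph (shifted_euler P)"
proof -
  have "weight0 (euler_op P)" using assms Gl_weight0[OF eu_Gl] by (simp add: sph_def rhoH_eu)
  moreover have "gact w (euler_op P) = euler_op P" if "w \<in> W" for w
    using euler_op_gact[OF that, of P] assms that by (simp add: sph_def Winv_def)
  ultimately have "sph (euler_op P)" using assms by (simp add: sph_def Winv_def pol_euler_op)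
  then show ?thesis unfolding shifted_euler_def using assms by (intro sph_simps)
qed

text \<open>In one direction \<open>ee\<close> turns the witness of \<open>JJ_rho\<close> into a
  polynomial in \<open>S\<close>. In the other, \<open>zz\<close> times a lift of \<open>Q\<close>,
  cut down by \<open>ee\<close>, has the required value at 1 and lies in the ideal.\<close>

lemma U_JJ_iff: assumes u: "u \<in> U" shows "u \<in> JJ \<longleftrightarrow> (\<exists>Q. sph Q \<and> Th u = shifted_euler Q)"
proof
  assume "u \<in> JJ"
  then obtain b where b: "b \<in> Gl" "\<forall>P. pol P \<longrightarrow> rhoH u P = shifted_euler (rhoH b P)" using JJ_rho by blast
  have p: "pol (Th u)" "Winv (Th u)" using Th_S[OF u] by (simp_all add: sph_def)
  have "Th u = rhoH ee (Th u)" using p by (simp add: rhoH_ee_inv)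
  also have "\<dots> = shifted_euler (rhoH ee (rhoH b 1))"
    using b by (simp add: Th_def pol_one shifted_euler_rhoH ee_Gl pol_rhoH Gl_carrier)
  finally show "\<exists>Q. sph Q \<and> Th u = shifted_euler Q" using sph_rhoH[OF b(1) sph_simps(6)] by blast
next
  assume "\<exists>Q. sph Q \<and> Th u = shifted_euler Q"
  then obtain Q where Q: "sph Q" "Th u = shifted_euler Q" by blast
  obtain m where "pdeg m Q" using Q sph_pol pol_def by blast
  then obtain v where v: "v \<in> U" "Th v = Q" using Th_sph_lift[OF Q(1)] by blast
  have eAG: "ee \<in> carrier AG" "v \<in> carrier AG" using U_AG U_e v by blast+
  have zv: "zz \<otimes>\<^bsub>HH\<^esub> v \<in> JJ" using ideal.I_r_closed[OF JJ_ideal zz_JJ eAG(2)] by (simp add: AG_simps)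
  then have J: "ee \<otimes>\<^bsub>HH\<^esub> (zz \<otimes>\<^bsub>HH\<^esub> v) \<in> JJ" using ideal.I_l_closed[OF JJ_ideal _ eAG(1)] by (simp add: AG_simps)
  have zH: "zz \<in> carrier HH" "zz \<in> Gl" using zz_AG Gl_carrier by (auto simp: carrier_AG)
  have vH: "v \<in> carrier HH" using v U_carrier by blast
  have "ee \<otimes>\<^bsub>HH\<^esub> (zz \<otimes>\<^bsub>HH\<^esub> v) = ee \<otimes>\<^bsub>HH\<^esub> (zz \<otimes>\<^bsub>HH\<^esub> v) \<otimes>\<^bsub>HH\<^esub> ee"
    using zH vH U_ee(2)[OF v(1)] by (simp add: H.m_assoc)
  then have U': "ee \<otimes>\<^bsub>HH\<^esub> (zz \<otimes>\<^bsub>HH\<^esub> v) \<in> U" using U_I[of "zz \<otimes>\<^bsub>HH\<^esub> v"] zH v U_Gl Gl_mult by simp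
  have pQ: "pol Q" "Winv Q" using Q by (simp_all add: sph_def)
  \<comment> \<open>An invariant polynomial is fixed by the average over the centre, because
    \<open>aa\<close> is absorbed by \<open>ee\<close>.\<close>
  have a: "rhoH aa Q = Q"
  proof -
    have "Q = rhoH ee Q" using pQ by (simp add: rhoH_ee_inv)
    then have "rhoH aa Q = rhoH (aa \<otimes>\<^bsub>HH\<^esub> ee) Q" using pQ by (simp add: rhoH_mult)
    then show ?thesis using pQ by (simp add: aa_ee rhoH_ee_inv)
  qed
  have "Th (ee \<otimes>\<^bsub>HH\<^esub> (zz \<otimes>\<^bsub>HH\<^esub> v)) = rhoH ee (shifted_euler Q)"
    using zH vH v by (simp add: Th_def rhoH_mult pol_one pol_rhoH) (simp add: rhoH_zz pQ a flip: Th_def)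
  also have "\<dots> = Th u" using sph_shifted_euler[OF Q(1)] Q(2) by (simp add: sph_def rhoH_ee_inv)
  finally have "ee \<otimes>\<^bsub>HH\<^esub> (zz \<otimes>\<^bsub>HH\<^esub> v) = u" using Th_inj[OF U' u] by blast
  then show "u \<in> JJ" using J by simp
qed

definition sph_lift :: "'n pf \<Rightarrow> 'n smash_elem set" where "sph_lift P = (SOME u. u \<in> U \<and> Th u = P)"

lemma sph_lift: assumes "sph P" shows "sph_lift P \<in> U" "Th (sph_lift P) = P"
proof -
  obtain m where "pdeg m P" using assms sph_pol pol_def by blast
  then have "\<exists>u. u \<in> U \<and> Th u = P" using Th_sph_lift[OF assms] by blast
  from someI_ex[OF this] show "sph_lift P \<in> U" "Th (sph_lift P) = P" by (simp_all add: sph_lift_def)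
qed

lemma sph_lift_Th: "u \<in> U \<Longrightarrow> sph_lift (Th u) = u" using sph_lift[OF Th_S] Th_inj by blast

definition pr :: "'n pf \<Rightarrow> 'n smash_elem set set" where "pr P = cA (sph_lift P)"
text \<open>The product of \<open>U\<close>, transported to \<open>S\<close>.\<close>

definition star :: "'n pf \<Rightarrow> 'n pf \<Rightarrow> 'n pf" where "star P Q = rhoH (sph_lift P) Q"

abbreviation "EE \<equiv> corner AA (cA ee)"

lemma eAe_eq: "eAe W \<alpha> \<alpha>' lam t c \<zeta> = EE"
  by (simp add: eAe_def AA_eq average_eq ee_def)

lemma ee_AG: "ee \<in> carrier AG" by (rule U_AG[OF U_e])

lemma cA_ee: "cA ee \<in> carrier AA" "cA ee \<otimes>\<^bsub>AA\<^esub> cA ee = cA ee"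
  using ee_AG by (simp_all add: AQ.cls_closed AQ.cls_mult AG_simps ee_ee)

lemma EE_alg: "complex_algebra EE" by (rule corner_alg[OF AQ.Q_alg cA_ee])

lemma cA_corner: assumes "h \<in> carrier AG" shows "cA ee \<otimes>\<^bsub>AA\<^esub> cA h \<otimes>\<^bsub>AA\<^esub> cA ee = cA (ee \<otimes>\<^bsub>HH\<^esub> h \<otimes>\<^bsub>HH\<^esub> ee)"
proof -
  have "ee \<otimes>\<^bsub>HH\<^esub> h \<in> carrier AG" using AG.m_closed[OF ee_AG assms] by (simp add: AG_simps)
  then show ?thesis using ee_AG assms by (simp add: AQ.cls_mult AG_simps)
qed

lemma AG_Gl: "h \<in> carrier AG \<Longrightarrow> h \<in> Gl" by (simp add: carrier_AG)

lemma carrier_EE: "carrier EE = cA ` U"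
proof
  show "carrier EE \<subseteq> cA ` U"
  proof
    fix x assume "x \<in> carrier EE"
    then obtain h where "h \<in> carrier AG" "x = cA ee \<otimes>\<^bsub>AA\<^esub> cA h \<otimes>\<^bsub>AA\<^esub> cA ee"
      by (auto simp: corner_simps AQ.carrier_Q)
    then show "x \<in> cA ` U" using cA_corner U_I AG_Gl by blast
  qed
  show "cA ` U \<subseteq> carrier EE"
  proof
    fix x assume "x \<in> cA ` U"
    then obtain u where u: "u \<in> U" "x = cA u" by blast
    then have "x = cA ee \<otimes>\<^bsub>AA\<^esub> cA u \<otimes>\<^bsub>AA\<^esub> cA ee" using cA_corner[OF U_AG[OF u(1)]] by (simp add: U_ee)
    then show "x \<in> carrier EE" using U_AG[OF u(1)] AQ.cls_closed by (auto simp: corner_simps)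
  qed
qed

lemma EE_simps: "mult EE = mult AA" "one EE = cA ee" "zero EE = zero AA" "add EE = add AA" "smult EE = smult AA"
  by (simp_all add: corner_simps)

text \<open>\<open>ee\<close> has filtration degree 0, so a representative \<open>h\<close> can be
  replaced by its cut-down \<open>ee h ee\<close> in the same degree. Hence restricting the quotient
  filtration to the corner agrees with projecting the filtration of \<open>U\<close>.\<close>

lemma EE_filtration: "eAe_filtration W \<alpha> \<alpha>' lam t c \<zeta> i = cA ` (U \<inter> filt i)"
proof -
  have 1: "eAe_filtration W \<alpha> \<alpha>' lam t c \<zeta> i = cA ` (filt i \<inter> carrier AG) \<inter> carrier EE"
    by (simp add: eAe_filtration_def A_filtration_def filt_eq AG_eq AA_eq eAe_eq)
  show ?thesis unfolding 1
  proof safe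
    fix h assume h: "h \<in> filt i" "h \<in> carrier AG" and E: "cA h \<in> carrier EE"
    have "cA h = cA ee \<otimes>\<^bsub>AA\<^esub> cA h \<otimes>\<^bsub>AA\<^esub> cA ee"
      using E corner_carrier[OF AQ.Q_alg cA_ee] by simp
    then have e: "cA h = cA (ee \<otimes>\<^bsub>HH\<^esub> h \<otimes>\<^bsub>HH\<^esub> ee)" using cA_corner[OF h(2)] by simp
    have "ee \<otimes>\<^bsub>HH\<^esub> h \<otimes>\<^bsub>HH\<^esub> ee \<in> filt i" using filt_mult[OF filt_mult[OF filt_ee h(1)] filt_ee] by simp
    then show "cA h \<in> cA ` (U \<inter> filt i)" unfolding e using U_I[OF AG_Gl[OF h(2)]] by blast
  next
    fix u assume "u \<in> U" "u \<in> filt i"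
    then show "cA u \<in> cA ` (filt i \<inter> carrier AG)" "cA u \<in> carrier EE" using U_AG carrier_EE by blast+
  qed
qed

lemma sph_lift_add: "sph P \<Longrightarrow> sph Q \<Longrightarrow> sph_lift (P + Q) = sph_lift P \<oplus>\<^bsub>HH\<^esub> sph_lift Q"
  by (rule Th_inj) (simp_all add: sph_lift sph_simps U_add Th_add)
lemma sph_lift_smult: "sph P \<Longrightarrow> sph_lift (cst k * P) = k \<odot>\<^bsub>HH\<^esub> sph_lift P"
  by (rule Th_inj) (simp_all add: sph_lift sph_simps U_smult Th_smult)
lemma sph_star: "sph P \<Longrightarrow> sph Q \<Longrightarrow> sph (star P Q)"
  using Th_S[OF U_mult[OF sph_lift(1) sph_lift(1)]] by (simp add: star_def Th_mult sph_lift)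
lemma sph_lift_star: "sph P \<Longrightarrow> sph Q \<Longrightarrow> sph_lift (star P Q) = sph_lift P \<otimes>\<^bsub>HH\<^esub> sph_lift Q"
  by (rule Th_inj) (simp_all add: sph_lift sph_star U_mult Th_mult, simp add: star_def)

lemma pr_closed: "sph P \<Longrightarrow> pr P \<in> carrier EE" by (simp add: carrier_EE pr_def sph_lift)
lemma pr_surj: "x \<in> carrier EE \<Longrightarrow> \<exists>P. sph P \<and> x = pr P"
  using Th_S sph_lift_Th by (fastforce simp: carrier_EE pr_def)
lemma pr_add: "sph P \<Longrightarrow> sph Q \<Longrightarrow> pr (P + Q) = pr P \<oplus>\<^bsub>EE\<^esub> pr Q"
  by (simp add: pr_def sph_lift_add EE_simps AQ.cls_add U_AG sph_lift AG_simps)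
lemma pr_smult: "sph P \<Longrightarrow> pr (cst k * P) = k \<odot>\<^bsub>EE\<^esub> pr P"
  by (simp add: pr_def sph_lift_smult EE_simps AQ.cls_smult U_AG sph_lift AG_simps)
lemma pr_star: "sph P \<Longrightarrow> sph Q \<Longrightarrow> pr (star P Q) = pr P \<otimes>\<^bsub>EE\<^esub> pr Q"
  by (simp add: pr_def sph_lift_star EE_simps AQ.cls_mult U_AG sph_lift AG_simps)
lemma pr_one: "pr 1 = \<one>\<^bsub>EE\<^esub>"
proof -
  have "Th ee = 1" using rhoH_ee_inv[OF pol_one Winv_one] by (simp add: Th_def)
  then have "sph_lift 1 = ee" using sph_lift_Th[OF U_e] by simp
  then show ?thesis by (simp add: pr_def EE_simps)
qed
lemma pr_zero_iff: "sph P \<Longrightarrow> pr P = \<zero>\<^bsub>EE\<^esub> \<longleftrightarrow> (\<exists>Q. sph Q \<and> P = shifted_euler Q)"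
  using U_JJ_iff[of "sph_lift P"] by (simp add: pr_def EE_simps AQ.cls_zero_iff U_AG sph_lift)
lemma pr_filt: "eAe_filtration W \<alpha> \<alpha>' lam t c \<zeta> i = pr ` {P. sph P \<and> pdeg i P}"
  unfolding EE_filtration
proof safe
  fix u assume u: "u \<in> U" "u \<in> filt i"
  then have "cA u = pr (Th u)" "sph (Th u)" "pdeg i (Th u)" using sph_lift_Th Th_S pdeg_Th by (auto simp: pr_def)
  then show "cA u \<in> pr ` {P. sph P \<and> pdeg i P}" by blast
next
  fix P :: "'n pf" assume P: "sph P" "pdeg i P"
  then show "pr P \<in> cA ` (U \<inter> filt i)" using sph_lift[OF P(1)] U_filt by (auto simp: pr_def)
qed

lemma star_symbol:
  assumes P: "sph P" "pdeg a P" and Q: "sph Q" "pdeg b Q"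
  shows "pdeg (a + b - 4) (star P Q - P * Q - E1 P Q)"
\<comment> \<open>\<open>U_symbol\<close> expects a natural number as degree; for negative
  \<open>a\<close> all terms are zero.\<close>
proof (cases "a < 0")
  case True
  then have P0: "P = 0" using P pdeg_neg by blast
  have "E1 0 Q = 0" using E1_cmult[OF pol_one, of 0 Q] by (simp add: cst_simps)
  moreover have "star 0 Q = 0"
  proof -
    have "star (cst 0 * P) Q = cst 0 * star P Q" unfolding star_def sph_lift_smult[OF P(1)]
      using sph_lift[OF P(1)] Q by (intro rhoH_smult) (auto simp: U_carrier sph_pol)
    then show ?thesis by (simp add: cst_simps)
  qed
  ultimately show ?thesis by (simp add: P0 pdeg_zero)
next
  case False
  then show ?thesis using U_symbol[of "sph_lift P" "nat a" b Q] sph_lift[OF P(1)] P Q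
    by (simp add: star_def sph_def)
qed

lemma star_mult:
  assumes P: "sph P" "pdeg a P" and Q: "sph Q" "pdeg b Q"
  shows "pdeg (a + b - 2) (star P Q - P * Q)"
proof -
  have "pdeg (a + b - 2) ((star P Q - P * Q - E1 P Q) + E1 P Q)"
    using pdeg_mono[OF star_symbol[OF P Q]] pdeg_E1[OF P(2) Q(2)] by (intro pdeg_add) auto
  then show ?thesis by simp
qed

text \<open>The commutative products cancel in the difference, and \<open>E1_antisym\<close>
  evaluates the subleading terms.\<close>

lemma star_bracket:
  assumes P: "sph P" "pdeg a P" and Q: "sph Q" "pdeg b Q"
  shows "pdeg (a + b - 4) (star P Q - star Q P - cst t * pb P Q)"
proof -
  have e: "star P Q - star Q P - cst t * pb P Q = (star P Q - P * Q - E1 P Q) - (star Q P - Q * P - E1 Q P)"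
    using E1_antisym[of P Q] P Q by (simp add: sph_def algebra_simps)
  have "pdeg (a + b - 4) (star Q P - Q * P - E1 Q P)" using star_symbol[OF Q P] by (simp add: add.commute)
  then show ?thesis unfolding e by (rule pdeg_diff[OF star_symbol[OF P Q]])
qed

text \<open>The coordinates of \<open>v\<close> times the leading parts of the Dunkl operators add
  up to \<open>quad\<close>; their lower parts, the reflections and \<open>\<zeta>\<close> do not
  raise the degree.\<close>

lemma shifted_euler_symbol: assumes "sph Q" "pdeg m Q" shows "pdeg m (shifted_euler Q - quad * Q)"
proof -
  have "shifted_euler Q - quad * Q = (\<Sum>i\<in>UNIV. vco i * (dunkl (axis i 1) Q - lin_x (axis i 1) * Q)) - (\<Sum>s\<in>R. cst (K s) * gact s Q) - cst \<zeta> * Q"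
    unfolding shifted_euler_def euler_op_def quad_def
    by (simp add: xco_lin sum_distrib_right sum_distrib_left sum_subtractf right_diff_distrib mult_ac)
  moreover have "pdeg m (\<Sum>i\<in>UNIV. vco i * (dunkl (axis i 1) Q - lin_x (axis i 1) * Q))"
    by (intro pdeg_sum pdeg_vco' pdeg_dunkl_low assms)
  moreover have "pdeg m (\<Sum>s\<in>R. cst (K s) * gact s Q)" "pdeg m (cst \<zeta> * Q)"
    using assms by (auto intro!: pdeg_sum pdeg_cmult pdeg_gact)
  ultimately show ?thesis by (simp add: pdeg_diff)
qed

end

section \<open>The closure of the minimal nilpotent orbit\<close>

definition pull :: "(('n::finite) cmat \<Rightarrow> complex) \<Rightarrow> 'n pf" where "pull p = (\<lambda>v \<xi>. p (outer v \<xi>))"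

lemma pull_simps: "pull (\<lambda>_. k) = cst k" "pull (\<lambda>A. A $ i $ j) = vco i * xco j"
  "pull (\<lambda>A. p A + q A) = pull p + pull q" "pull (\<lambda>A. p A * q A) = pull p * pull q"
  by (rule pf_eqI, simp add: pull_def outer_def pfs)+

lemma pull_apply: "pull p v \<xi> = p (outer v \<xi>)" by (simp add: pull_def)

definition mat_scale :: "complex \<Rightarrow> ('n::finite) cmat \<Rightarrow> 'n cmat" where "mat_scale r A = (\<chi> i j. r * A $ i $ j)"

lemma mat_scale_outer: "mat_scale r (outer v \<xi>) = outer (r *s v) \<xi>" "mat_scale r (outer v \<xi>) = outer v (r *s \<xi>)"
  by (simp_all add: mat_scale_def outer_def vec_eq_iff)

lemma outer_zero: "outer v \<xi> = 0 \<longleftrightarrow> v = 0 \<or> \<xi> = 0" by (auto simp: outer_def vec_eq_iff)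

lemma pull_pol: "p \<in> polynomial_fun \<Longrightarrow> pol (pull p)"
  by (induction rule: polynomial_fun.induct) (simp_all add: pull_simps pol_intros)

lemma pull_weight0: "weight0 (pull (p :: ('n::finite) cmat \<Rightarrow> complex))"
proof -
  have "outer (r *s v) (inverse r *s \<xi>) = outer v \<xi>" if "r \<noteq> 0" for r and v \<xi> :: "complex ^ 'n"
    using that by (simp add: outer_def vec_eq_iff)
  then show ?thesis by (auto simp: weight0_def sc_def pull_def fun_eq_iff)
qed

lemma homog_polynomial: "homog_polynomial_fun d p \<Longrightarrow> p \<in> polynomial_fun \<and> (\<forall>r A. p (mat_scale r A) = r ^ d * p A)"
proof (induction rule: homog_polynomial_fun.induct)
  case (coord d p i j)
  then show ?case by (auto simp: mat_scale_def intro: polynomial_fun.mult polynomial_fun.coord)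
qed (auto simp: distrib_left intro: polynomial_fun.intros)

lemma polynomial_fun_zero: "(\<lambda>_. 0) \<in> polynomial_fun" by (rule polynomial_fun.const)

lemma polynomial_fun_sum: "(\<And>i. i \<in> I \<Longrightarrow> f i \<in> polynomial_fun) \<Longrightarrow> (\<lambda>A. \<Sum>i\<in>I. f i A) \<in> polynomial_fun"
  by (induction I rule: infinite_finite_induct) (auto intro: polynomial_fun.intros)

lemma polynomial_fun_minus: "p \<in> polynomial_fun \<Longrightarrow> q \<in> polynomial_fun \<Longrightarrow> (\<lambda>A. p A - q A) \<in> polynomial_fun"
  using polynomial_fun.add[OF _ polynomial_fun.mult[OF polynomial_fun.const[of "-1"]], of p q] by simp

lemma homog_zero: "homog_polynomial_fun d (\<lambda>_. 0)"
proof (induction d)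
  case 0 show ?case by (rule homog_polynomial_fun.const)
next
  case (Suc d) then show ?case using homog_polynomial_fun.coord[of d "\<lambda>_. 0"] by simp
qed

lemma homog_cmult: "homog_polynomial_fun d p \<Longrightarrow> homog_polynomial_fun d (\<lambda>A. k * p A)"
proof (induction rule: homog_polynomial_fun.induct)
  case (const l) show ?case by (rule homog_polynomial_fun.const)
next
  case (coord d p i j)
  then show ?case using homog_polynomial_fun.coord[of d "\<lambda>A. k * p A" i j] by (simp add: mult.assoc)
next
  case (add d p q)
  then show ?case using homog_polynomial_fun.add[of d "\<lambda>A. k * p A" "\<lambda>A. k * q A"] by (simp add: distrib_left)
qed

text \<open>The components beyond \<open>N\<close> are required to vanish, so that coefficients can
  later be compared in every degree.\<close>

definition homog_sum :: "(('n::finite) cmat \<Rightarrow> complex) \<Rightarrow> bool" where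
  "homog_sum p \<longleftrightarrow> (\<exists>N f. (\<forall>k. homog_polynomial_fun k (f k)) \<and> (\<forall>A. p A = (\<Sum>k\<le>N. f k A)) \<and> (\<forall>k>N. \<forall>A. f k A = 0))"

lemma homog_sum_add: assumes "homog_sum p" "homog_sum q" shows "homog_sum (\<lambda>A. p A + q A)"
proof -
  obtain N f where f: "\<forall>k. homog_polynomial_fun k (f k)" "\<forall>A. p A = (\<Sum>k\<le>N. f k A)" "\<forall>k>N. \<forall>A. f k A = 0"
    using assms(1) unfolding homog_sum_def by blast
  obtain M g where g: "\<forall>k. homog_polynomial_fun k (g k)" "\<forall>A. q A = (\<Sum>k\<le>M. g k A)" "\<forall>k>M. \<forall>A. g k A = 0"
    using assms(2) unfolding homog_sum_def by blast
  have "(\<Sum>k\<le>N. f k A) = (\<Sum>k\<le>max N M. f k A)" "(\<Sum>k\<le>M. g k A) = (\<Sum>k\<le>max N M. g k A)" for A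
    using f(3) g(3) by (intro sum.mono_neutral_left; auto)+
  then show ?thesis unfolding homog_sum_def
    using f g by (intro exI[of _ "max N M"] exI[of _ "\<lambda>k A. f k A + g k A"])
      (auto simp: sum.distrib intro: homog_polynomial_fun.add)
qed

lemma homog_sum_cmult: assumes "homog_sum p" shows "homog_sum (\<lambda>A. k * p A)"
proof -
  obtain N f where f: "\<forall>k. homog_polynomial_fun k (f k)" "\<forall>A. p A = (\<Sum>k\<le>N. f k A)" "\<forall>k>N. \<forall>A. f k A = 0"
    using assms(1) unfolding homog_sum_def by blast
  then show ?thesis unfolding homog_sum_def
    by (intro exI[of _ N] exI[of _ "\<lambda>j A. k * f j A"]) (auto simp: sum_distrib_left intro: homog_cmult)
qed

lemma homog_sum_coord: assumes "homog_sum p" shows "homog_sum (\<lambda>A. p A * A $ i $ j)"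
proof -
  obtain N f where f: "\<forall>k. homog_polynomial_fun k (f k)" "\<forall>A. p A = (\<Sum>k\<le>N. f k A)" "\<forall>k>N. \<forall>A. f k A = 0"
    using assms(1) unfolding homog_sum_def by blast
  define g where "g k = (case k of 0 \<Rightarrow> (\<lambda>_. 0) | Suc k \<Rightarrow> (\<lambda>A. f k A * A $ i $ j))" for k
  have "homog_polynomial_fun k (g k)" for k
    using f(1) by (cases k) (auto simp: g_def intro: homog_zero homog_polynomial_fun.coord)
  moreover have "p A * A $ i $ j = (\<Sum>k\<le>Suc N. g k A)" for A
    unfolding sum.atMost_Suc_shift using f(2) by (simp add: g_def sum_distrib_right)
  moreover have "g k A = 0" if "k > Suc N" for k A using that f(3) by (cases k) (auto simp: g_def)
  ultimately show ?thesis unfolding homog_sum_def by (intro exI[of _ "Suc N"] exI[of _ g]) blast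
qed

text \<open>The accumulated factor \<open>q\<close> reduces everything to multiplication by a single
  coordinate, so that two sums of homogeneous parts never have to be multiplied.\<close>

lemma homog_sum_polynomial: assumes "p \<in> polynomial_fun" shows "homog_sum p"
proof -
  have "homog_sum (\<lambda>A. q A * p A)" if "homog_sum q" for q
    using assms that
  proof (induction arbitrary: q rule: polynomial_fun.induct)
    case (const k) then show ?case using homog_sum_cmult[of q k] by (simp add: mult.commute)
  next
    case (coord i j) then show ?case by (rule homog_sum_coord)
  next
    case (add p p') then show ?case using homog_sum_add[of "\<lambda>A. q A * p A" "\<lambda>A. q A * p' A"] by (simp add: distrib_left)
  next
    case (mult p p')
    have "homog_sum (\<lambda>A. (q A * p A) * p' A)" using mult by blast
    then show ?case by (simp add: mult.assoc)
  qed
  moreover have "homog_sum (\<lambda>_. 1)"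
    unfolding homog_sum_def
    by (intro exI[of _ 0] exI[of _ "\<lambda>k A. if k = 0 then 1 else 0"])
      (auto intro: homog_polynomial_fun.const homog_zero)
  ultimately have "homog_sum (\<lambda>A. 1 * p A)" by blast
  then show ?thesis by simp
qed

lemma polynomial_fun_line: assumes "p \<in> polynomial_fun" shows "\<exists>q. \<forall>z. p (A + mat_scale z B) = poly q z"
  using assms
proof (induction rule: polynomial_fun.induct)
  case (const k) then show ?case by (intro exI[of _ "[:k:]"]) simp
next
  case (coord i j) then show ?case by (intro exI[of _ "[:A $ i $ j, B $ i $ j:]"]) (simp add: mat_scale_def)
next
  case (add p q)
  then obtain p' q' where "\<forall>z. p (A + mat_scale z B) = poly p' z" "\<forall>z. q (A + mat_scale z B) = poly q' z" by blast
  then show ?case by (intro exI[of _ "p' + q'"]) simp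
next
  case (mult p q)
  then obtain p' q' where "\<forall>z. p (A + mat_scale z B) = poly p' z" "\<forall>z. q (A + mat_scale z B) = poly q' z" by blast
  then show ?case by (intro exI[of _ "p' * q'"]) simp
qed

subsection \<open>Points of the closure\<close>

lemma outer_outer: "outer v \<xi> ** outer v' \<xi>' = mat_scale (pairing \<xi> v') (outer v \<xi>')"
  by (simp add: outer_def mat_scale_def matrix_matrix_mult_def vec_eq_iff pairing_def sum_distrib_left sum_distrib_right mult_ac)

lemma funpow_outer: "(((**) (outer v \<xi>)) ^^ Suc k) (mat 1) = mat_scale (pairing \<xi> v ^ k) (outer v \<xi>)"
proof (induction k)
  case 0 then show ?case by (simp add: mat_scale_def vec_eq_iff)
next
  case (Suc k)
  have m: "outer v \<xi> ** mat_scale r (outer v \<xi>) = mat_scale (r * pairing \<xi> v) (outer v \<xi>)" for r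
    unfolding mat_scale_outer(1)[of r] outer_outer by (simp add: mult.commute)
  have "(((**) (outer v \<xi>)) ^^ Suc (Suc k)) (mat 1) = outer v \<xi> ** (((**) (outer v \<xi>)) ^^ Suc k) (mat 1)" by simp
  then show ?case unfolding Suc m by (simp add: mult.commute)
qed

text \<open>The square of \<open>v \<xi>\<close> is \<open>\<xi>(v)\<close> times itself, so it is
  nilpotent exactly when \<open>\<xi>(v) = 0\<close>.\<close>

lemma O_min_eq: "(O_min :: ('n::finite) cmat set) = {outer v \<xi> | v \<xi>. pairing \<xi> v = 0 \<and> outer v \<xi> \<noteq> 0}"
proof (intro equalityI subsetI)
  fix A :: "'n cmat" assume A: "A \<in> O_min"
  then have "A \<noteq> 0 \<and> (\<exists>v \<xi>. A = outer v \<xi>)" using rank_eq_1[of A] by (simp add: O_min_def)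
  then obtain v \<xi> where v: "A = outer v \<xi>" "A \<noteq> 0" by blast
  obtain k where k: "(((**) A) ^^ k) (mat 1) = 0" using A by (auto simp: O_min_def nilpotent_mat_def)
  have "pairing \<xi> v = 0"
  proof (cases k)
    case 0
    then have "(mat 1 :: 'n cmat) = 0" using k by simp
    then have "(mat 1 :: 'n cmat) $ undefined $ undefined = 0" by simp
    then show ?thesis by (simp add: mat_def)
  next
    case (Suc j)
    then have "mat_scale (pairing \<xi> v ^ j) A = 0" using k funpow_outer[of j v \<xi>] by (simp only: v(1))
    moreover obtain i l where "A $ i $ l \<noteq> 0" using v(2) by (auto simp: vec_eq_iff)
    ultimately have "pairing \<xi> v ^ j = 0" by (auto simp: mat_scale_def vec_eq_iff)
    then show ?thesis by simp
  qed
  then show "A \<in> {outer v \<xi> | v \<xi>. pairing \<xi> v = 0 \<and> outer v \<xi> \<noteq> 0}" using v by blast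
next
  fix A :: "'n cmat" assume "A \<in> {outer v \<xi> | v \<xi>. pairing \<xi> v = 0 \<and> outer v \<xi> \<noteq> 0}"
  then obtain v \<xi> where v: "A = outer v \<xi>" "pairing \<xi> v = 0" "A \<noteq> 0" by blast
  have "(((**) A) ^^ Suc 1) (mat 1) = 0" unfolding v(1) funpow_outer by (simp add: v(2) mat_scale_def vec_eq_iff)
  then have "nilpotent_mat A" unfolding nilpotent_mat_def by blast
  then show "A \<in> O_min" using v rank_eq_1 by (auto simp: O_min_def)
qed

definition nil_cone :: "('n::finite) cmat set" where "nil_cone = {outer v \<xi> | v \<xi>. pairing \<xi> v = 0}"

lemma trace_outer: "trace (outer v \<xi>) = pairing \<xi> v"
  by (simp add: trace_def outer_def pairing_def mult.commute)

text \<open>The minors of size two and the trace are polynomial equations of the orbit, and they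
  leave only the matrices \<open>v \<xi>\<close> with \<open>\<xi>(v) = 0\<close>. Of these only 0
  is not in the orbit; it is a limit of orbit points along a line.\<close>

lemma O_min_closure_eq: assumes n: "CARD('n::finite) > 1" shows "(O_min_closure :: 'n cmat set) = nil_cone"
proof (intro equalityI subsetI)
  fix A :: "'n cmat" assume "A \<in> O_min_closure"
  then have A: "\<And>p. p \<in> polynomial_fun \<Longrightarrow> (\<And>v \<xi>. pairing \<xi> v = 0 \<Longrightarrow> p (outer v \<xi>) = 0) \<Longrightarrow> p A = 0"
    unfolding O_min_closure_def zariski_closure_def O_min_eq by blast
  have minor: "A $ i $ j * A $ k $ l - A $ i $ l * A $ k $ j = 0" for i j k l
    by (rule A) (auto intro!: polynomial_fun_minus polynomial_fun.mult polynomial_fun.coord simp: outer_def)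
  have tr: "trace A = 0"
    by (rule A) (auto simp: trace_outer, auto simp: trace_def intro!: polynomial_fun_sum polynomial_fun.coord)
  show "A \<in> nil_cone"
  proof (cases "A = 0")
    case True
    then show ?thesis unfolding nil_cone_def by (intro CollectI exI[of _ 0]) (simp add: outer_zero)
  next
    case False
    then obtain k l where kl: "A $ k $ l \<noteq> 0" by (auto simp: vec_eq_iff)
    \<comment> \<open>With the pivot \<open>(k, l)\<close>, the vanishing minors make every entry
      the product of an entry of column \<open>l\<close> and one of row \<open>k\<close>, divided by
      the pivot.\<close>
    define v where "v = (\<chi> i. A $ i $ l / A $ k $ l)"
    define \<xi> where "\<xi> = (\<chi> j. A $ k $ j)"
    have e: "A = outer v \<xi>" using minor[of _ _ k l] kl by (auto simp: outer_def v_def \<xi>_def vec_eq_iff field_simps)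
    then have "pairing \<xi> v = 0" using tr trace_outer by metis
    then show ?thesis unfolding nil_cone_def using e by blast
  qed
next
  fix A :: "'n cmat" assume "A \<in> nil_cone"
  then obtain v \<xi> where A: "A = outer v \<xi>" "pairing \<xi> v = 0" by (auto simp: nil_cone_def)
  show "A \<in> O_min_closure" unfolding O_min_closure_def zariski_closure_def
  proof (intro CollectI ballI impI)
    fix p :: "'n cmat \<Rightarrow> complex" assume p: "p \<in> polynomial_fun" "\<forall>B\<in>O_min. p B = 0"
    show "p A = 0"
    proof (cases "A = 0")
      case False then show ?thesis using A p(2) unfolding O_min_eq by blast
    next
      case True
      \<comment> \<open>Off the diagonal there is a matrix unit, as \<open>n > 1\<close>; its
        nonzero multiples lie in the orbit.\<close>
      obtain i j :: 'n where ij: "i \<noteq> j" using n card_le_Suc0_iff_eq[of "UNIV :: 'n set"] by auto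
      define B :: "'n cmat" where "B = outer (axis i 1) (axis j 1)"
      have B: "mat_scale z B \<in> O_min" if "z \<noteq> 0" for z
      proof -
        have "pairing (axis j 1) (z *s axis i 1) = 0"
          using ij by (simp add: pairing_def axis_def if_distrib if_distribR cong: if_cong)
        moreover have "outer (z *s axis i 1) (axis j 1) \<noteq> 0" using that by (simp add: outer_zero)
        ultimately show ?thesis unfolding B_def mat_scale_outer O_min_eq by blast
      qed
      obtain q where q: "\<And>z. p (0 + mat_scale z B) = poly q z" using polynomial_fun_line[OF p(1)] by blast
      \<comment> \<open>The factor \<open>[:0, 1:]\<close> covers \<open>z = 0\<close>, where the
        multiple leaves the orbit.\<close>
      have "poly (q * [:0, 1:]) z = 0" for z using q[of z] B[of z] p(2) by (cases "z = 0") auto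
      then have "q * [:0, 1:] = 0" using poly_all_0_iff_0 by blast
      then have "q = 0" by simp
      moreover have "mat_scale 0 B = 0" by (simp add: mat_scale_def vec_eq_iff)
      ultimately show ?thesis using q[of 0] True by simp
    qed
  qed
qed

subsection \<open>Divisibility by the quadric\<close>

lemma quad_apply: "quad v \<xi> = pairing \<xi> v"
  by (simp add: quad_def sum_fun_apply pfs pairing_def mult.commute)

lemma pol_quad: "pol quad" unfolding quad_def by (intro pol_intros)

lemma quad_nz: "(quad :: ('n::finite) pf) \<noteq> 0"
proof
  assume a: "(quad :: 'n pf) = 0"
  have "quad (axis undefined 1) (axis undefined 1 :: complex ^ 'n) = 1" 
    by (simp add: quad_apply pairing_def axis_def if_distrib if_distribR cong: if_cong)
  then show False by (simp add: a pfs)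
qed

text \<open>Pseudo-division by \<open>quad\<close>, viewed as a polynomial in the coordinate \<open>\<xi>\<^sub>a\<close> with leading coefficient \<open>v\<^sub>a\<close>.\<close>

lemma pseudo_division:
  assumes "pol P"
  shows "\<exists>d A B. pol A \<and> pol B \<and> vco a ^ d * P = quad * A + B \<and> (\<forall>v \<xi> \<xi>'. (\<forall>i. i \<noteq> a \<longrightarrow> \<xi> $ i = \<xi>' $ i) \<longrightarrow> B v \<xi> = B v \<xi>')"
  using assms
proof (induction rule: pol_induct)
  case (cst k)
  then show ?case by (rule exI[of _ 0], rule exI[of _ 0], rule exI[of _ "cst k"],
      intro conjI pol_zero pol_cst, simp_all add: pfs)
next
  case (vco P i)
  then obtain d A B where *: "pol A" "pol B" "vco a ^ d * P = quad * A + B"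
    "\<forall>v \<xi> \<xi>'. (\<forall>i. i \<noteq> a \<longrightarrow> \<xi> $ i = \<xi>' $ i) \<longrightarrow> B v \<xi> = B v \<xi>'" by blast
  have "vco a ^ d * (vco i * P) = vco i * (vco a ^ d * P)" by (rule mult.left_commute)
  also have "\<dots> = quad * (vco i * A) + vco i * B" unfolding *(3) by (simp add: algebra_simps)
  finally have "vco a ^ d * (vco i * P) = quad * (vco i * A) + vco i * B" .
  moreover have "pol (vco i * A)" "pol (vco i * B)" using * by (auto intro: pol_intros)
  moreover have "\<forall>v \<xi> \<xi>'. (\<forall>i. i \<noteq> a \<longrightarrow> \<xi> $ i = \<xi>' $ i) \<longrightarrow> (vco i * B) v \<xi> = (vco i * B) v \<xi>'" using *(4) by (simp add: pfs)
  ultimately show ?case by blast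
next
  case (xco P i)
  then obtain d A B where *: "pol A" "pol B" "vco a ^ d * P = quad * A + B"
    "\<forall>v \<xi> \<xi>'. (\<forall>i. i \<noteq> a \<longrightarrow> \<xi> $ i = \<xi>' $ i) \<longrightarrow> B v \<xi> = B v \<xi>'" by blast
  show ?case
  proof (cases "i = a")
    case False
    have "vco a ^ d * (xco i * P) = xco i * (vco a ^ d * P)" by (rule mult.left_commute)
    also have "\<dots> = quad * (xco i * A) + xco i * B" unfolding *(3) by (simp add: algebra_simps)
    finally have "vco a ^ d * (xco i * P) = quad * (xco i * A) + xco i * B" .
    moreover have "pol (xco i * A)" "pol (xco i * B)" using * by (auto intro: pol_intros)
    moreover have "\<forall>v \<xi> \<xi>'. (\<forall>i. i \<noteq> a \<longrightarrow> \<xi> $ i = \<xi>' $ i) \<longrightarrow> (xco i * B) v \<xi> = (xco i * B) v \<xi>'" using *(4) False by (auto simp: pfs)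
    ultimately show ?thesis by blast
  next
    case True
    define q' where "q' = (\<Sum>i\<in>UNIV - {a}. vco i * xco i :: 'a pf)"
    \<comment> \<open>Trading \<open>v_a\<close> times \<open>\<xi>_a\<close> for
      \<open>quad - q'\<close> removes the coordinate \<open>\<xi>_a\<close> at the price of one
      more factor \<open>v_a\<close>.\<close>
    have q: "vco a * xco a = quad - q'" unfolding quad_def q'_def by (subst sum.remove[of _ a]) auto
    have "vco a ^ Suc d * (xco i * P) = (vco a * xco a) * (vco a ^ d * P)" using True by (simp add: mult_ac)
    also have "\<dots> = quad * ((quad - q') * A + B) + - (q' * B)" unfolding q *(3) by (simp add: algebra_simps)
    finally have e: "vco a ^ Suc d * (xco i * P) = quad * ((quad - q') * A + B) + - (q' * B)" .
    have "pol q'" unfolding q'_def by (intro pol_intros)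
    then have "pol ((quad - q') * A + B)" "pol (- (q' * B))" using * by (auto intro!: pol_intros pol_quad)
    moreover have qi: "q' v \<xi> = q' v \<xi>'" if "\<forall>i. i \<noteq> a \<longrightarrow> \<xi> $ i = \<xi>' $ i" for v \<xi> \<xi>'
      unfolding q'_def sum_fun_apply using that by (intro sum.cong) (auto simp: pfs)
    moreover have "\<forall>v \<xi> \<xi>'. (\<forall>i. i \<noteq> a \<longrightarrow> \<xi> $ i = \<xi>' $ i) \<longrightarrow> (- (q' * B)) v \<xi> = (- (q' * B)) v \<xi>'" using *(4) qi
      by (simp add: pfs) metis
    ultimately show ?thesis using e by blast
  qed
next
  case (add P P')
  then obtain d A B where *: "pol A" "pol B" "vco a ^ d * P = quad * A + B"
    "\<forall>v \<xi> \<xi>'. (\<forall>i. i \<noteq> a \<longrightarrow> \<xi> $ i = \<xi>' $ i) \<longrightarrow> B v \<xi> = B v \<xi>'" by blast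
  from add obtain d' A' B' where **: "pol A'" "pol B'" "vco a ^ d' * P' = quad * A' + B'"
    "\<forall>v \<xi> \<xi>'. (\<forall>i. i \<noteq> a \<longrightarrow> \<xi> $ i = \<xi>' $ i) \<longrightarrow> B' v \<xi> = B' v \<xi>'" by blast
  have pw: "pol (vco a ^ n)" for n by (induction n) (auto intro: pol_intros)
  have vi: "(vco a ^ n) v \<xi> = (vco a ^ n) v \<xi>'" for n v \<xi> \<xi>' by (induction n) (auto simp: pfs)
  have "vco a ^ (d + d') * (P + P') = vco a ^ d' * (vco a ^ d * P) + vco a ^ d * (vco a ^ d' * P')"
    by (simp add: power_add algebra_simps)
  also have "\<dots> = quad * (vco a ^ d' * A + vco a ^ d * A') + (vco a ^ d' * B + vco a ^ d * B')"
    unfolding *(3) **(3) by (simp add: algebra_simps)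
  finally have "vco a ^ (d + d') * (P + P') = quad * (vco a ^ d' * A + vco a ^ d * A') + (vco a ^ d' * B + vco a ^ d * B')" .
  moreover have "pol (vco a ^ d' * A + vco a ^ d * A')" "pol (vco a ^ d' * B + vco a ^ d * B')"
    using * ** pw by (auto intro!: pol_intros)
  moreover have "\<forall>v \<xi> \<xi>'. (\<forall>i. i \<noteq> a \<longrightarrow> \<xi> $ i = \<xi>' $ i) \<longrightarrow> (vco a ^ d' * B + vco a ^ d * B') v \<xi> = (vco a ^ d' * B + vco a ^ d * B') v \<xi>'"
    unfolding plus_fun_apply times_fun_apply using *(4) **(4) vi by metis
  ultimately show ?case by blast
qed

text \<open>At \<open>v_a = 0\<close> the left side vanishes, while \<open>quad\<close> does not
  vanish identically, as \<open>n > 1\<close>. So \<open>A\<close> vanishes there and is divisible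
  by \<open>v_a\<close>.\<close>

lemma quad_divides_cancel:
  assumes n: "CARD('n::finite) > 1" and P: "pol P" and A: "pol A" and e: "vco a * P = quad * (A :: 'n pf)"
  shows "\<exists>A'. pol A' \<and> A = vco a * A'"
proof -
  \<comment> \<open>\<open>M\<close> sets the coordinate \<open>v_a\<close> to 0 and keeps the
    others.\<close>
  define M :: "'n cmat" where "M = (\<chi> i j. if i = j \<and> i \<noteq> a then 1 else 0)"
  have Mv: "M *v v = (\<chi> i. if i = a then 0 else v $ i)" for v
    by (auto simp: M_def matrix_vector_mult_def vec_eq_iff if_distrib if_distribR cong: if_cong)
  let ?s = "subst M (mat 1)"
  have vc: "?s (vco i) = (if i = a then 0 else vco i)" "?s (xco i) = xco i" for i
    by (auto intro!: pf_eqI simp: subst_apply pfs Mv)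
  have div: "\<exists>D. pol D \<and> Q - ?s Q = vco a * D" if "pol Q" for Q :: "'n pf"
    using that
  proof (induction rule: pol_induct)
    case (cst k) then show ?case by (intro exI[of _ 0]) (simp add: subst_simps pol_zero)
  next
    case (vco Q i)
    then obtain D where D: "pol D" "Q - ?s Q = vco a * D" by blast
    show ?case
    proof (cases "i = a")
      case True then show ?thesis using vco by (intro exI[of _ Q]) (simp add: subst_simps vc)
    next
      case False
      have "vco i * Q - ?s (vco i * Q) = vco i * (Q - ?s Q)" using False by (simp add: subst_simps vc algebra_simps)
      then show ?thesis using D by (intro exI[of _ "vco i * D"]) (auto simp: mult.left_commute intro: pol_intros)
    qed
  next
    case (xco Q i)
    then obtain D where D: "pol D" "Q - ?s Q = vco a * D" by blast
    have "xco i * Q - ?s (xco i * Q) = xco i * (Q - ?s Q)" by (simp add: subst_simps vc algebra_simps)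
    then show ?case using D by (intro exI[of _ "xco i * D"]) (auto simp: mult.left_commute intro: pol_intros)
  next
    case (add Q Q')
    then obtain D D' where D: "pol D" "Q - ?s Q = vco a * D" "pol D'" "Q' - ?s Q' = vco a * D'" by blast
    have "Q + Q' - ?s (Q + Q') = (Q - ?s Q) + (Q' - ?s Q')" by (simp add: subst_simps)
    then show ?case using D by (intro exI[of _ "D + D'"]) (auto simp: distrib_left intro: pol_intros)
  qed
  have "?s quad * ?s A = ?s (vco a * P)" by (simp only: e subst_simps)
  also have "\<dots> = 0" by (simp add: subst_simps vc)
  finally have "?s quad * ?s A = 0" .
  moreover have "?s quad \<noteq> 0"
  proof
    assume z: "?s quad = 0"
    obtain b where b: "b \<noteq> a" 
      using n card_le_Suc0_iff_eq[of "UNIV :: 'n set"] by (metis One_nat_def UNIV_I finite linorder_not_less)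
    have "?s quad (axis b 1) (axis b 1) = 1" using b
      by (simp add: subst_apply quad_apply Mv pairing_def axis_def if_distrib if_distribR cong: if_cong)
    then show False by (simp add: z pfs)
  qed
  ultimately have "?s A = 0" using pol_domain[of "?s quad" "?s A"] pol_subst[OF pol_quad] pol_subst[OF A] by blast
  then show ?thesis using div[OF A] by auto
qed

text \<open>For \<open>v_a\<close> nonzero every point can be moved onto the cone by changing
  \<open>\<xi>_a\<close> alone, so the remainder of the pseudo-division vanishes. The powers of
  \<open>v_a\<close> it introduced are then cancelled.\<close>

lemma quad_divides:
  assumes n: "CARD('n::finite) > 1" and P: "pol (P :: 'n pf)" and z: "\<And>v \<xi>. pairing \<xi> v = 0 \<Longrightarrow> P v \<xi> = 0"
  shows "\<exists>A. pol A \<and> P = quad * A"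
proof -
  fix a :: 'n
  obtain d A B where *: "pol A" "pol B" "vco a ^ d * P = quad * A + B"
    "\<forall>v \<xi> \<xi>'. (\<forall>i. i \<noteq> a \<longrightarrow> \<xi> $ i = \<xi>' $ i) \<longrightarrow> B v \<xi> = B v \<xi>'" using pseudo_division[OF P] by metis
  have "(vco a * B) v \<xi> = 0" for v \<xi>
  proof (cases "v $ a = 0")
    case True then show ?thesis by (simp add: pfs)
  next
    case False
    \<comment> \<open>Subtracting this multiple of the basis covector makes the pairing with
      \<open>v\<close> zero; \<open>B\<close> does not notice the change.\<close>
    define \<xi>' where "\<xi>' = \<xi> - (pairing \<xi> v / v $ a) *s axis a 1"
    have p: "pairing \<xi>' v = 0" using False by (simp add: \<xi>'_def)
    have "B v \<xi> = B v \<xi>'" using *(4) by (auto simp: \<xi>'_def axis_def)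
    also have "\<dots> = (quad * A + B) v \<xi>'" using p by (simp add: pfs quad_apply)
    also have "\<dots> = (vco a ^ d * P) v \<xi>'" using *(3) by simp
    also have "\<dots> = 0" using z[OF p] by (simp add: pfs)
    finally show ?thesis by (simp add: pfs)
  qed
  then have "vco a * B = 0" by (intro pf_eqI) (simp add: pfs)
  moreover have va: "vco a \<noteq> (0 :: 'n pf)"
  proof
    assume "vco a = (0 :: 'n pf)"
    then have "vco a (axis a 1) (0 :: complex ^ 'n) = 0" by (simp add: pfs)
    then show False by (simp add: pfs)
  qed
  ultimately have "B = 0" using pol_domain[OF pol_vco *(2)] by blast
  then have "vco a ^ d * P = quad * A" using * by simp
  \<comment> \<open>The factors \<open>v_a\<close> are removed one at a time, each being a divisor
    of \<open>A\<close>.\<close>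
  then show ?thesis using *(1)
  proof (induction d arbitrary: A)
    case 0 then show ?case by auto
  next
    case (Suc d)
    have pw: "pol (vco a ^ d * P)" using P by (intro pol_mult) (induction d, auto intro: pol_intros)
    have e: "vco a * (vco a ^ d * P) = quad * A" using Suc(2) by (simp add: mult.assoc)
    obtain A' where A': "pol A'" "A = vco a * A'" using quad_divides_cancel[OF n pw Suc(3) e] by blast
    have "vco a * (vco a ^ d * P) = vco a * (quad * A')" using e A' by (simp add: mult_ac)
    then have "vco a ^ d * P = quad * A'"
      using pol_cancel[OF pol_vco va pw] A' pol_mult[OF pol_quad] by blast
    then show ?case using Suc(1) A' by blast
  qed
qed

subsection \<open>The Poisson bracket\<close>

text \<open>Because of the trace form, the entry \<open>(i, j)\<close> of the gradient is the
  derivative in the matrix entry \<open>(j, i)\<close>; this transposition runs through all index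
  computations below.\<close>

lemma gradient_has:
  assumes "p \<in> polynomial_fun"
  shows "((\<lambda>z. p (A + (\<chi> k l. if k = j \<and> l = i then z else 0))) has_field_derivative gradient p A $ i $ j) (at 0)"
proof -
  have "(\<chi> k l. if k = j \<and> l = i then z else 0) = mat_scale z (\<chi> k l. if k = j \<and> l = i then 1 else 0)" for z
    by (simp add: mat_scale_def vec_eq_iff)
  then obtain q where "\<And>z. p (A + (\<chi> k l. if k = j \<and> l = i then z else 0)) = poly q z"
    using polynomial_fun_line[OF assms] by metis
  then have "(\<lambda>z. p (A + (\<chi> k l. if k = j \<and> l = i then z else 0))) = poly q" by auto
  then show ?thesis unfolding gradient_def
    by simp (metis DERIV_deriv_iff_field_differentiable field_differentiable_def poly_DERIV)
qed

lemma gradient_eqI: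
  "((\<lambda>z. p (A + (\<chi> k l. if k = j \<and> l = i then z else 0))) has_field_derivative D) (at 0) \<Longrightarrow> gradient p A $ i $ j = D"
  by (simp add: gradient_def DERIV_imp_deriv)

lemma zero_mat: "A + (\<chi> k l. 0) = (A :: ('n::finite) cmat)"
  by (simp add: vec_eq_iff)

lemma gradient_simps:
  "gradient (\<lambda>_. c) A $ i $ j = 0"
  "gradient (\<lambda>A. A $ k $ l) A $ i $ j = (if k = j \<and> l = i then 1 else 0)"
  "p \<in> polynomial_fun \<Longrightarrow> q \<in> polynomial_fun \<Longrightarrow> gradient (\<lambda>A. p A + q A) A $ i $ j = gradient p A $ i $ j + gradient q A $ i $ j"
  "p \<in> polynomial_fun \<Longrightarrow> q \<in> polynomial_fun \<Longrightarrow> gradient (\<lambda>A. p A * q A) A $ i $ j = gradient p A $ i $ j * q A + p A * gradient q A $ i $ j"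
proof -
  show "gradient (\<lambda>_. c) A $ i $ j = 0" by (rule gradient_eqI) simp
  show "gradient (\<lambda>A. A $ k $ l) A $ i $ j = (if k = j \<and> l = i then 1 else 0)"
    by (rule gradient_eqI) (auto intro!: derivative_eq_intros)
  assume pq: "p \<in> polynomial_fun" "q \<in> polynomial_fun"
  show "gradient (\<lambda>A. p A + q A) A $ i $ j = gradient p A $ i $ j + gradient q A $ i $ j"
    by (rule gradient_eqI) (intro DERIV_add gradient_has pq)
  show "gradient (\<lambda>A. p A * q A) A $ i $ j = gradient p A $ i $ j * q A + p A * gradient q A $ i $ j"
    by (rule gradient_eqI) (rule DERIV_cong[OF DERIV_mult[OF gradient_has[OF pq(1)] gradient_has[OF pq(2)]]], simp add: zero_mat)
qed

lemma kks_eq: "kks_bracket p q A = (\<Sum>i\<in>UNIV. \<Sum>k\<in>UNIV. \<Sum>j\<in>UNIV.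
    A $ i $ k * (gradient p A $ k $ j * gradient q A $ j $ i - gradient q A $ k $ j * gradient p A $ j $ i))"
  by (simp add: kks_bracket_def trace_def matrix_matrix_mult_def sum_distrib_left sum_subtractf right_diff_distrib)

lemma pull_dv: "p \<in> polynomial_fun \<Longrightarrow> dv (axis j 1) (pull p) = (\<Sum>i\<in>UNIV. pull (\<lambda>A. gradient p A $ i $ j) * xco i)"
proof (induction rule: polynomial_fun.induct)
  case (const k) then show ?case by (simp add: pull_simps dv_basic gradient_simps cst_simps)
next
  case (coord k l)
  have "(\<Sum>i\<in>UNIV. pull (\<lambda>A. gradient (\<lambda>A. A $ k $ l) A $ i $ j) * xco i) = (\<Sum>i\<in>UNIV. if i = l then cst (if k = j then 1 else 0) * xco l else 0)"
    by (rule sum.cong) (auto simp: gradient_simps pull_simps cst_simps)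
  then show ?case by (simp add: pull_simps dv_mult pol_vco pol_xco dv_basic axis_def)
next
  case (add p q)
  then show ?case by (simp add: pull_simps dv_add pull_pol gradient_simps distrib_right sum.distrib)
next
  case (mult p q)
  then show ?case
    by (simp add: pull_simps dv_mult pull_pol gradient_simps)
      (rule pf_eqI, simp add: pfs sum_fun_apply distrib_right distrib_left sum.distrib sum_distrib_left mult_ac)
qed

lemma pull_dx: "p \<in> polynomial_fun \<Longrightarrow> dx (axis j 1) (pull p) = (\<Sum>i\<in>UNIV. pull (\<lambda>A. gradient p A $ j $ i) * vco i)"
proof (induction rule: polynomial_fun.induct)
  case (const k) then show ?case by (simp add: pull_simps dx_basic gradient_simps cst_simps)
next
  case (coord k l)
  have "(\<Sum>i\<in>UNIV. pull (\<lambda>A. gradient (\<lambda>A. A $ k $ l) A $ j $ i) * vco i) = (\<Sum>i\<in>UNIV. if i = k then cst (if l = j then 1 else 0) * vco k else 0)"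
    by (rule sum.cong) (auto simp: gradient_simps pull_simps cst_simps)
  then show ?case by (simp add: pull_simps dx_mult pol_vco pol_xco dx_basic axis_def mult.commute)
next
  case (add p q)
  then show ?case by (simp add: pull_simps dx_add pull_pol gradient_simps distrib_right sum.distrib)
next
  case (mult p q)
  then show ?case
    by (simp add: pull_simps dx_mult pull_pol gradient_simps)
      (rule pf_eqI, simp add: pfs sum_fun_apply distrib_right distrib_left sum.distrib sum_distrib_left mult_ac)
qed

text \<open>The chain rule turns both sides into the same triple sum. The sign reflects the
  orientation of \<open>pb\<close>; it is removed by the final rescaling of degrees.\<close>

lemma pull_kks: assumes p: "p \<in> polynomial_fun" and q: "q \<in> polynomial_fun"
  shows "pull (kks_bracket p q) = - pb (pull p) (pull q)"
proof (rule pf_eqI)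
  fix v \<xi> :: "complex ^ 'a"
  let ?P = "\<lambda>i j. gradient p (outer v \<xi>) $ i $ j" and ?Q = "\<lambda>i j. gradient q (outer v \<xi>) $ i $ j"
  have d: "dv (axis j 1) (pull f) v \<xi> = (\<Sum>k\<in>UNIV. gradient f (outer v \<xi>) $ k $ j * \<xi> $ k)"
    "dx (axis j 1) (pull f) v \<xi> = (\<Sum>k\<in>UNIV. gradient f (outer v \<xi>) $ j $ k * v $ k)" if "f \<in> polynomial_fun" for f j
    by (simp_all add: pull_dv[OF that] pull_dx[OF that] sum_fun_apply pfs pull_apply)
  have s1: "(\<Sum>j\<in>UNIV. (\<Sum>i\<in>UNIV. F j i * v $ i) * (\<Sum>k\<in>UNIV. F' k j * \<xi> $ k)) = (\<Sum>i\<in>UNIV. \<Sum>k\<in>UNIV. \<Sum>j\<in>UNIV. v $ i * \<xi> $ k * (F' k j * F j i))"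
    for F F' :: "'a \<Rightarrow> 'a \<Rightarrow> complex"
  proof -
    have "(\<Sum>j\<in>UNIV. (\<Sum>i\<in>UNIV. F j i * v $ i) * (\<Sum>k\<in>UNIV. F' k j * \<xi> $ k)) = (\<Sum>j\<in>UNIV. \<Sum>i\<in>UNIV. \<Sum>k\<in>UNIV. v $ i * \<xi> $ k * (F' k j * F j i))"
      unfolding sum_product by (simp add: mult_ac)
    also have "\<dots> = (\<Sum>i\<in>UNIV. \<Sum>j\<in>UNIV. \<Sum>k\<in>UNIV. v $ i * \<xi> $ k * (F' k j * F j i))" by (rule sum.swap)
    also have "\<dots> = (\<Sum>i\<in>UNIV. \<Sum>k\<in>UNIV. \<Sum>j\<in>UNIV. v $ i * \<xi> $ k * (F' k j * F j i))"
      by (rule sum.cong[OF refl]) (rule sum.swap)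
    finally show ?thesis .
  qed
  have "pb (pull p) (pull q) v \<xi> = (\<Sum>j\<in>UNIV. (\<Sum>i\<in>UNIV. ?P j i * v $ i) * (\<Sum>k\<in>UNIV. ?Q k j * \<xi> $ k))
     - (\<Sum>j\<in>UNIV. (\<Sum>i\<in>UNIV. ?Q j i * v $ i) * (\<Sum>k\<in>UNIV. ?P k j * \<xi> $ k))"
    unfolding pb_def by (simp add: sum_fun_apply pfs d p q sum_subtractf mult.commute)
  also have "\<dots> = - kks_bracket p q (outer v \<xi>)"
    unfolding s1 kks_eq by (simp add: outer_def right_diff_distrib sum_subtractf mult_ac)
  finally show "pull (kks_bracket p q) v \<xi> = (- pb (pull p) (pull q)) v \<xi>" by (simp add: pull_apply pfs)
qed

lemma pb_simps:
  "pol P \<Longrightarrow> pol P' \<Longrightarrow> pb (P + P') Q = pb P Q + pb P' Q"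
  "pol Q \<Longrightarrow> pol Q' \<Longrightarrow> pb P (Q + Q') = pb P Q + pb P Q'"
  "pol P \<Longrightarrow> pol P' \<Longrightarrow> pb (P * P') Q = P * pb P' Q + pb P Q * P'"
  "pol Q \<Longrightarrow> pol Q' \<Longrightarrow> pb P (Q * Q') = Q * pb P Q' + pb P Q * Q'"
  "pb (cst k) Q = 0" "pb P (cst k) = 0" "pb P Q = - pb Q P"
  by (simp_all add: pb_def dv_add dx_add dv_mult dx_mult dv_basic dx_basic sum.distrib[symmetric] sum_distrib_left sum_distrib_right
      sum_negf[symmetric] algebra_simps)

lemma pol_pb: "pol P \<Longrightarrow> pol Q \<Longrightarrow> pol (pb P Q)"
  unfolding pb_def by (intro pol_intros pol_dv pol_dx)

lemma pb_coord:
  "pb (vco i) (vco j) \<in> range cst" "pb (xco i) (vco j) \<in> range cst"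
  "pb (vco i) (xco j) \<in> range cst" "pb (xco i) (xco j) \<in> range cst"
proof -
  have c: "cst a \<in> range cst" "(0 :: 'a pf) \<in> range cst" for a :: complex
    using cst_simps(1) by (blast, metis rangeI)
  have m: "f * g \<in> range cst" "f - g \<in> range cst" if h: "f \<in> range cst" "g \<in> range cst" for f g :: "'a pf"
  proof -
    obtain a b where ab: "f = cst a" "g = cst b" using h by blast
    have "f * g = cst (a * b)" "f - g = cst (a - b)" unfolding ab by (rule pf_eqI, simp add: pfs)+
    then show "f * g \<in> range cst" "f - g \<in> range cst" by simp_all
  qed
  have p: "f + g \<in> range cst" if "f \<in> range cst" "g \<in> range cst" for f g :: "'a pf"
    using m(2)[OF that(1) m(2)[OF c(2) that(2)]] by simp
  have s: "(\<Sum>i\<in>I. f i) \<in> range cst" if "\<And>i. f i \<in> range cst" for f :: "'a \<Rightarrow> 'a pf" and I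
    by (induction I rule: infinite_finite_induct) (simp_all add: c p that)
  show "pb (vco i) (vco j) \<in> range cst" "pb (xco i) (vco j) \<in> range cst"
    "pb (vco i) (xco j) \<in> range cst" "pb (xco i) (xco j) \<in> range cst"
    unfolding pb_def dv_basic dx_basic by (intro s m c)+
qed

definition jacobiator :: "('n::finite) pf \<Rightarrow> 'n pf \<Rightarrow> 'n pf \<Rightarrow> 'n pf" where
  "jacobiator P Q S = pb P (pb Q S) + pb Q (pb S P) + pb S (pb P Q)"

lemma jacobiator_rotate: "jacobiator P Q S = jacobiator Q S P" by (simp add: jacobiator_def algebra_simps)

text \<open>The products of two first-order brackets cancel in pairs by antisymmetry. So the
  jacobiator is a derivation in its first argument, and coordinates suffice.\<close>

lemma jacobiator_mult: assumes "pol P" "pol P'" "pol Q" "pol S"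
  shows "jacobiator (P * P') Q S = P * jacobiator P' Q S + jacobiator P Q S * P'"
proof -
  have 1: "pb (P * P') (pb Q S) = P * pb P' (pb Q S) + pb P (pb Q S) * P'" using assms by (simp add: pb_simps(3))
  have 2: "pb Q (pb S (P * P')) = P * pb Q (pb S P') + pb Q P * pb S P' + pb S P * pb Q P' + pb Q (pb S P) * P'"
    by (simp add: pb_simps(2,4) assms pol_pb pol_mult distrib_left distrib_right add_ac mult_ac)
  have 3: "pb S (pb (P * P') Q) = P * pb S (pb P' Q) + pb S P * pb P' Q + pb P Q * pb S P' + pb S (pb P Q) * P'"
    by (simp add: pb_simps(2,3,4) assms pol_pb pol_mult distrib_left distrib_right add_ac mult_ac)
  have "pb P' Q = - pb Q P'" "pb P Q = - pb Q P" by (rule pb_simps(7))+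
  then show ?thesis unfolding jacobiator_def 1 2 3 by (simp add: algebra_simps)
qed

lemma jacobiator_induct:
  assumes Q: "pol Q" and S: "pol S" and v: "\<And>i. jacobiator (vco i) Q S = 0" and x: "\<And>i. jacobiator (xco i) Q S = 0"
  shows "pol P \<Longrightarrow> jacobiator P Q S = 0"
proof (induction rule: pol_induct)
  case (cst k)
  have "pb S (pb (cst k) Q) = 0" using pb_simps(6)[of S 0] by (simp add: pb_simps(5) cst_simps)
  moreover have "pb Q (pb S (cst k)) = 0" using pb_simps(6)[of Q 0] by (simp add: pb_simps(6) cst_simps)
  ultimately show ?case by (simp add: jacobiator_def pb_simps(5))
next
  case (vco P i) then show ?case using Q S by (simp add: jacobiator_mult pol_vco v)
next
  case (xco P i) then show ?case using Q S by (simp add: jacobiator_mult pol_xco x)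
next
  case (add P P')
  have "pol P" "pol P'" using add by blast+
  then have "jacobiator (P + P') Q S = jacobiator P Q S + jacobiator P' Q S"
    using Q S by (simp add: jacobiator_def pb_simps(1,2) pol_pb algebra_simps)
  then show ?case using add by simp
qed

text \<open>For coordinates the inner brackets are constant. The three arguments are then freed one
  after another, each being rotated into the first position.\<close>

lemma jacobi: assumes "pol P" "pol Q" "pol S" shows "jacobiator P Q S = 0"
proof -
  have c: "jacobiator a b d = 0" if "a \<in> range vco \<union> range xco" "b \<in> range vco \<union> range xco" "d \<in> range vco \<union> range xco" for a b d :: "'a pf"
  proof -
    have "pb x y \<in> range cst" if "x \<in> range vco \<union> range xco" "y \<in> range vco \<union> range xco" for x y :: "'a pf"
      using that by (elim UnE imageE) (simp_all add: pb_coord)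
    then have "pb a b \<in> range cst" "pb b d \<in> range cst" "pb d a \<in> range cst" using that by blast+
    then obtain k k' k'' where "pb a b = cst k" "pb b d = cst k'" "pb d a = cst k''" by blast
    then show ?thesis by (simp add: jacobiator_def pb_simps(6))
  qed
  have g: "pol a" if "a \<in> range vco \<union> range xco" for a :: "'a pf" using that pol_vco pol_xco by auto
  have 1: "jacobiator P a b = 0" if "pol P" "a \<in> range vco \<union> range xco" "b \<in> range vco \<union> range xco" for P a b :: "'a pf"
    by (rule jacobiator_induct[OF g[OF that(2)] g[OF that(3)] _ _ that(1)]) (auto intro!: c that)
  have 2: "jacobiator P Q b = 0" if "pol P" "pol Q" "b \<in> range vco \<union> range xco" for P Q b :: "'a pf"
  proof -
    have "jacobiator Q b P = 0"
    proof (rule jacobiator_induct[OF g[OF that(3)] that(1) _ _ that(2)])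
      show "jacobiator (vco i) b P = 0" "jacobiator (xco i) b P = 0" for i
        using 1[OF that(1), of "vco i" b] 1[OF that(1), of "xco i" b] that(3) by (simp_all add: jacobiator_rotate[of P])
    qed
    then show ?thesis by (simp add: jacobiator_rotate[of P])
  qed
  have "jacobiator S P Q = 0"
    by (rule jacobiator_induct[OF assms(1,2) _ _ assms(3)]) (use 2[OF assms(1,2)] in \<open>simp_all add: jacobiator_rotate[of P] jacobiator_rotate[of Q]\<close>)
  then show ?thesis by (simp add: jacobiator_rotate[of S])
qed

text \<open>\<open>quad\<close> is the pullback of the trace, which is central in
  \<open>gl(n)\<close>; in other words it generates the scaling action, under which pulled back
  functions are invariant.\<close>

lemma pb_quad: assumes "q \<in> polynomial_fun" shows "pb quad (pull q) = 0"
proof -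
  have x: "dx (axis i 1) quad = vco i" and v: "dv (axis i 1) quad = xco i" for i :: 'a
  proof -
    have q: "quad = (pull trace :: 'a pf)" by (rule pf_eqI) (simp add: quad_apply pull_apply trace_outer)
    have tp: "trace \<in> (polynomial_fun :: ('a cmat \<Rightarrow> complex) set)"
      unfolding trace_def[abs_def] by (intro polynomial_fun_sum polynomial_fun.coord)
    have g: "gradient trace A $ k $ j = (if k = j then 1 else 0)" for A :: "'a cmat" and k j
    proof (rule gradient_eqI)
      have "trace (A + (\<chi> k' l. if k' = j \<and> l = k then z else 0)) = trace A + (if k = j then z else 0)" for z
        by (cases "k = j") (auto simp: trace_def sum.distrib intro!: sum.neutral)
      then show "((\<lambda>z. trace (A + (\<chi> k' l. if k' = j \<and> l = k then z else 0))) has_field_derivative (if k = j then 1 else 0)) (at 0)"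
        by (auto intro!: derivative_eq_intros)
    qed
    have g': "pull (\<lambda>A. gradient trace A $ k $ j) = (if k = j then cst 1 else 0 :: 'a pf)" for k j
      unfolding g by (simp add: pull_simps cst_simps)
    show "dx (axis i 1) quad = vco i" "dv (axis i 1) quad = xco i"
      unfolding q pull_dx[OF tp] pull_dv[OF tp] g' by (simp_all add: cst_simps if_distrib if_distribR cong: if_cong)
  qed
  have "(\<Sum>i\<in>UNIV. vco i * dv (axis i 1) (pull q)) = (\<Sum>i\<in>UNIV. xco i * dx (axis i 1) (pull q))"
    unfolding pull_dv[OF assms] pull_dx[OF assms] sum_distrib_left
    by (subst sum.swap) (simp add: mult_ac)
  then show ?thesis by (simp add: pb_def x v sum_subtractf)
qed

section \<open>Invariant functions on the cone\<close>

text \<open>Homogeneity for nonzero \<open>r\<close> extends to \<open>r = 0\<close>, as both sides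
  are polynomials in \<open>r\<close>; then \<open>pdeg_phom\<close> gives the degree bound.\<close>

lemma phomI:
  assumes P: "pol P" and s: "\<And>r v \<xi>. r \<noteq> 0 \<Longrightarrow> P (r *s v) (r *s \<xi>) = r ^ d * P v \<xi>"
  shows "phom (int d) P"
proof (rule pdeg_phom[OF P])
  fix r v \<xi>
  obtain p :: "complex poly" where "\<And>r. P (0 + r *s v) (0 + r *s \<xi>) = poly p r" using pol_line[OF P] by blast
  then have p: "P (r *s v) (r *s \<xi>) = poly p r" for r by simp
  have "poly ([:0, 1:] * (p - Polynomial.monom (P v \<xi>) d)) r = 0" for r
    using s[of r v \<xi>] p[of r] by (cases "r = 0") (auto simp: poly_monom)
  then have "[:0, 1:] * (p - Polynomial.monom (P v \<xi>) d) = 0" using poly_all_0_iff_0 by blast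
  then have "p = Polynomial.monom (P v \<xi>) d" by simp
  then show "P (r *s v) (r *s \<xi>) = r ^ d * P v \<xi>" by (simp add: p poly_monom)
qed

lemma subst_scale: "phom m P \<Longrightarrow> subst (mat r) (mat r) P = cst (r ^ nat m) * P"
proof -
  have "mat r *v v = r *s v" "v v* mat r = r *s v" for v :: "complex ^ 'a"
    by (simp_all add: vec_eq_iff matrix_vector_mult_def vector_matrix_mult_def mat_def if_distrib if_distribR cong: if_cong)
  then show "phom m P \<Longrightarrow> ?thesis" by (intro pf_eqI) (simp add: subst_apply pfs phom_def)
qed

lemma pb_cmult: "pol P \<Longrightarrow> pb (cst k * P) Q = cst k * pb P Q" "pol Q \<Longrightarrow> pb P (cst k * Q) = cst k * pb P Q"
  by (simp_all add: pb_simps(3,4) pol_cst pb_simps(5,6))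

lemma pb_zero: "pb 0 Q = 0" "pb P 0 = 0" using pb_simps(5)[of 0 Q] pb_simps(6)[of P 0] by (simp_all add: cst_simps)

lemma pb_sum: "(\<And>i. i \<in> I \<Longrightarrow> pol (f i)) \<Longrightarrow> pb (\<Sum>i\<in>I. f i) Q = (\<Sum>i\<in>I. pb (f i) Q)"
    "(\<And>i. i \<in> I \<Longrightarrow> pol (f i)) \<Longrightarrow> pb Q (\<Sum>i\<in>I. f i) = (\<Sum>i\<in>I. pb Q (f i))"
  by (induction I rule: infinite_finite_induct) (simp_all add: pb_zero pb_simps(1,2) pol_sum)

lemma phom_pb:
  assumes P: "phom a P" and Q: "phom b Q" and ab: "0 \<le> a" "0 \<le> b" "2 \<le> a + b"
  shows "phom (a + b - 2) (pb P Q)"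
proof -
  have pP: "pol P" and pQ: "pol Q" using P Q pdeg_pol by (auto simp: phom_def)
  have "phom (int (nat (a + b - 2))) (pb P Q)"
  proof (rule phomI[OF pol_pb[OF pP pQ]])
  fix r :: complex and v \<xi> :: "complex ^ 'a" assume r: "r \<noteq> 0"
  let ?s = "subst (mat r) (mat r)"
  have m: "mat r *v y = r *s y" "y v* mat r = r *s y" for y :: "complex ^ 'a"
    by (simp_all add: vec_eq_iff matrix_vector_mult_def vector_matrix_mult_def mat_def if_distrib if_distribR cong: if_cong)
  have d: "dv y (?s S) = cst r * ?s (dv y S)" "dx y (?s S) = cst r * ?s (dx y S)" if "pol S" for y and S :: "'a pf"
    using that dv_linear[OF that, of r y 0 0] dx_linear[OF that, of r y 0 0]
    by (simp_all add: dv_subst dx_subst m subst_simps cst_simps)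
  have ss: "?s (\<Sum>i\<in>I. f i) = (\<Sum>i\<in>I. ?s (f i))" for f :: "'a \<Rightarrow> 'a pf" and I
    by (induction I rule: infinite_finite_induct) (simp_all add: subst_simps)
  \<comment> \<open>Each of the two derivatives contributes one factor \<open>r\<close>.\<close>
  have "pb (?s P) (?s Q) = cst (r * r) * ?s (pb P Q)"
    unfolding pb_def ss using pP pQ
    by (simp add: d subst_simps sum_distrib_left cst_simps(3)[symmetric] right_diff_distrib mult_ac)
  moreover have "pb (?s P) (?s Q) = cst (r ^ nat a * r ^ nat b) * pb P Q"
    by (simp add: subst_scale[OF P] subst_scale[OF Q] pb_cmult pP pQ pol_mult pol_cst cst_simps(3)[symmetric] mult.assoc)
  ultimately have "cst (r * r) * ?s (pb P Q) = cst (r ^ nat a * r ^ nat b) * pb P Q" by simp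
  then have "(cst (r * r) * ?s (pb P Q)) v \<xi> = (cst (r ^ nat a * r ^ nat b) * pb P Q) v \<xi>" by simp
  then have "r * r * pb P Q (r *s v) (r *s \<xi>) = r ^ nat a * r ^ nat b * pb P Q v \<xi>"
    using m by (simp add: pfs subst_apply)
  moreover have "r ^ nat a * r ^ nat b = r * r * r ^ nat (a + b - 2)"
  proof -
    have "nat a + nat b = 2 + nat (a + b - 2)" using ab by linarith
    then show ?thesis by (metis power_add power2_eq_square)
  qed
  ultimately show "pb P Q (r *s v) (r *s \<xi>) = r ^ nat (a + b - 2) * pb P Q v \<xi>" using r by simp
  qed
  then show ?thesis using ab by simp
qed

lemma pb_low: "pdeg a P \<Longrightarrow> pdeg b Q \<Longrightarrow> a + b < 2 \<Longrightarrow> pb P Q = 0"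
  using pdeg_neg[OF pdeg_pb] by fastforce

text \<open>Scaling by -1 negates both \<open>v\<close> and \<open>\<xi>\<close>; it fixes
  \<open>P\<close> by weight and negates it by odd degree.\<close>

lemma phom_odd: assumes "weight0 P" "phom k P" "odd k" "0 \<le> k" shows "P = 0"
proof (rule pf_eqI)
  fix v \<xi>
  have "sc (-1) P = P" using assms(1) by (simp add: weight0_def)
  then have "P (-1 *s v) (inverse (-1) *s \<xi>) = P v \<xi>" unfolding sc_def by (rule fun_cong[OF fun_cong])
  moreover have "P (-1 *s v) (-1 *s \<xi>) = (-1) ^ nat k * P v \<xi>" using assms(2) unfolding phom_def by blast
  moreover have "odd (nat k)" using assms(3,4) by (simp add: even_nat_iff)
  ultimately have "P v \<xi> = - P v \<xi>" by simp
  then show "P v \<xi> = 0 v \<xi>" by (simp add: pfs)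
qed

lemma pull_homog:
  fixes p :: "('n::finite) cmat \<Rightarrow> complex"
  assumes "homog_polynomial_fun d p" shows "phom (int (2 * d)) (pull p)"
proof (rule pdeg_phom)
  have p: "p \<in> polynomial_fun" "\<And>r A. p (mat_scale r A) = r ^ d * p A" using homog_polynomial[OF assms] by blast+
  show "pol (pull p)" by (rule pull_pol[OF p(1)])
  fix r and v \<xi> :: "complex ^ 'n"
  have "outer (r *s v) (r *s \<xi>) = mat_scale (r * r) (outer v \<xi>)" by (simp add: outer_def mat_scale_def vec_eq_iff)
  then show "pull p (r *s v) (r *s \<xi>) = r ^ (2 * d) * pull p v \<xi>"
    by (simp add: pull_apply p(2) power_mult power2_eq_square)
qed

lemma sum_power_eq:
  assumes "\<And>r :: complex. (\<Sum>k\<in>K. r ^ k * a k) = (\<Sum>k\<in>L. r ^ k * b k)" "finite K" "finite L"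
    "\<And>k. k \<notin> K \<Longrightarrow> a k = 0" "\<And>k. k \<notin> L \<Longrightarrow> b k = 0"
  shows "a k = b k"
proof -
  have "poly (\<Sum>k\<in>K. Polynomial.monom (a k) k) r = poly (\<Sum>k\<in>L. Polynomial.monom (b k) k) r" for r
    using assms(1)[of r] by (simp add: poly_sum poly_monom mult.commute)
  then have "(\<Sum>k\<in>K. Polynomial.monom (a k) k) = (\<Sum>k\<in>L. Polynomial.monom (b k) k)"
    by (intro poly_eq_poly_eq_iff[THEN iffD1] ext)
  moreover have "Polynomial.coeff (\<Sum>j\<in>J. Polynomial.monom (f j) j) k = (if k \<in> J then f k else 0)"
    if "finite J" for J and f :: "nat \<Rightarrow> complex"
    using that by (simp add: coeff_sum)
  ultimately have "(if k \<in> K then a k else 0) = (if k \<in> L then b k else 0)" using assms(2,3) by metis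
  then show ?thesis using assms(4,5) by (auto split: if_splits)
qed

lemma outer_nil_cone: "pairing \<xi> v = 0 \<Longrightarrow> outer v \<xi> \<in> nil_cone" by (auto simp: nil_cone_def)

context refl_data
begin

lemma pull_monM: "length xs = length ys \<Longrightarrow> \<exists>p\<in>polynomial_fun. pull p = monM (lets xs (ys :: 'n list))"
proof (induction xs ys rule: list_induct2)
  case Nil
  show ?case by (rule bexI[OF _ polynomial_fun.const[of 1]]) (simp add: lets_def monM_simps pull_simps cst_simps)
next
  case (Cons x xs y ys)
  then obtain p where p: "p \<in> polynomial_fun" "pull p = monM (lets xs ys)" by blast
  have "monM (lets (x # xs) (y # ys)) = (vco x * xco y) * monM (lets xs ys)"
    by (simp add: lets_def monM_simps mult.assoc)
  also have "\<dots> = pull (\<lambda>A. A $ x $ y * p A)" by (simp only: pull_simps p)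
  finally show ?case using polynomial_fun.mult[OF polynomial_fun.coord p(1)] by (intro bexI) auto
qed

text \<open>A monomial of weight zero has as many coordinates of \<open>v\<close> as of
  \<open>\<xi>\<close>; pairing them off turns it into a product of matrix entries.\<close>

lemma pull_surj: assumes "pol P" "weight0 (P :: 'n pf)" shows "\<exists>p\<in>polynomial_fun. pull p = P"
proof -
  obtain m where "pdeg m P" using assms(1) pol_def by blast
  then obtain L a where L: "finite L" "\<forall>M\<in>L. int (size M) \<le> m \<and> wtM M = 0" "P = (\<Sum>M\<in>L. cst (a M) * monM M)"
    using weight0_expansion[OF _ assms(2)] by blast
  have "\<exists>p\<in>polynomial_fun. pull p = (\<Sum>M\<in>L. cst (a M) * monM M)"
    using L(1,2)
  proof (induction L rule: finite_induct)
    case empty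
    show ?case using polynomial_fun_zero pull_simps(1)[of 0] by (auto simp: cst_simps)
  next
    case (insert M L)
    then obtain p where p: "p \<in> polynomial_fun" "pull p = (\<Sum>M\<in>L. cst (a M) * monM M)" by blast
    obtain xs ys where xy: "M = lets xs ys" "length xs = length ys" using insert wtM_zero by blast
    then obtain q where q: "q \<in> polynomial_fun" "pull q = monM M" using pull_monM by blast
    have "pull (\<lambda>A. a M * q A + p A) = cst (a M) * monM M + (\<Sum>M\<in>L. cst (a M) * monM M)"
      by (simp only: pull_simps p q)
    then show ?case using insert(1,2) polynomial_fun.add[OF polynomial_fun.mult[OF polynomial_fun.const q(1)] p(1)]
      by (intro bexI) auto
  qed
  then show ?thesis by (simp only: L(3))
qed

text \<open>\<open>W\<close> acts contragrediently on vectors and covectors, so brackets of linear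
  forms are preserved; the Leibniz rule extends this to both arguments in turn.\<close>

lemma gact_pb: assumes w: "w \<in> W" and P: "pol P" and Q: "pol Q" shows "gact w (pb P Q) = pb (gact w P) (gact w Q)"
proof -
  let ?G = "\<lambda>P Q. gact w (pb P Q) = pb (gact w P) (gact w Q)"
  have pg: "pol (gact w S)" if "pol S" for S using that by (rule pol_gact)
  have pairs: "pb (lin_v x) (lin_v x') = 0" "pb (lin_x y) (lin_x y') = 0"
    "pb (lin_x y) (lin_v x) = cst (pairing x y)" "pb (lin_v x) (lin_x y) = - cst (pairing x y)" for x x' y y' :: "complex ^ 'n"
  proof -
    have s: "(\<Sum>i\<in>I. cst (f i)) = cst (\<Sum>i\<in>I. f i)" for f :: "'n \<Rightarrow> complex" and I
      by (induction I rule: infinite_finite_induct) (simp_all add: cst_simps)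
    show "pb (lin_v x) (lin_v x') = 0" "pb (lin_x y) (lin_x y') = 0" "pb (lin_x y) (lin_v x) = cst (pairing x y)"
      by (simp_all add: pb_def dv_basic dx_basic s cst_simps(3)) (simp add: pairing_def mult.commute)
    then show "pb (lin_v x) (lin_x y) = - cst (pairing x y)" using pb_simps(7)[of "lin_v x" "lin_x y"] by simp
  qed
  have inv: "pairing (x v* matrix_inv w) (w *v y) = pairing x y" for x y
    using w by (simp add: pairing_matrix[symmetric] matrix_vector_mul_assoc inv_l)
  have base: "?G l l'" if "l \<in> range vco \<union> range xco" "l' \<in> range vco \<union> range xco" for l l'
    using that by (elim UnE imageE) (simp_all add: vco_lin xco_lin pairs gact_simps inv cst_simps)
  have lp: "pol l" if "l \<in> range vco \<union> range xco" for l :: "'n pf" using that pol_vco pol_xco by auto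
  have mult: "?G S (l * Q)" if "?G S l" "?G S Q" "pol l" "pol Q" for S l Q
    using that by (simp add: pb_simps(4) gact_simps pg)
  have swap: "?G Q P" if "?G P Q" for P Q
    using that pb_simps(7)[of P Q] pb_simps(7)[of "gact w P" "gact w Q"] by (simp add: gact_simps)
  have pls: "?G S (P + Q)" if "?G S P" "?G S Q" "pol P" "pol Q" for S P Q
    using that by (simp add: pb_simps(2) gact_simps pg)
  have step: "?G l Q" if l: "\<And>l'. l' \<in> range vco \<union> range xco \<Longrightarrow> ?G l l'" and "pol Q" for l Q
    using that(2)
  proof (induction rule: pol_induct)
    case (cst k) show ?case by (simp add: gact_simps pb_simps(6))
  next
    case (vco Q i) then show ?case using mult l[of "vco i"] pol_vco by blast
  next
    case (xco Q i) then show ?case using mult l[of "xco i"] pol_xco by blast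
  next
    case (add P Q) then show ?case using pls by blast
  qed
  have "?G l P" if "l \<in> range vco \<union> range xco" for l using step[OF base[OF that] P] .
  then have "?G P Q" by (intro step[OF swap Q]) blast
  then show ?thesis .
qed

lemma sph_pb: assumes "sph P" "sph Q" shows "sph (pb P Q)"
proof -
  have p: "pol P" "pol Q" "weight0 P" "weight0 Q" "Winv P" "Winv Q" using assms by (simp_all add: sph_def)
  obtain p q where pq: "p \<in> polynomial_fun" "pull p = P" "q \<in> polynomial_fun" "pull q = Q" using pull_surj p by metis
  \<comment> \<open>Weight zero is read off from the bracket being, up to sign, a pullback from
    matrices.\<close>
  have "weight0 (- pb P Q)" using pull_kks[OF pq(1,3)] pull_weight0[of "kks_bracket p q"] by (simp add: pq)
  then have "weight0 (0 - - pb P Q)" by (intro weight0_simps)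
  moreover have "Winv (pb P Q)" using p(5,6) gact_pb[OF _ p(1,2)] by (simp add: Winv_def)
  ultimately show ?thesis using pol_pb[OF p(1,2)] by (simp add: sph_def)
qed

lemma sph_uminus: "sph P \<Longrightarrow> sph (- P)" using sph_simps(2)[OF sph_simps(5)] by fastforce

lemma sph_sum: "(\<And>i. i \<in> I \<Longrightarrow> sph (f i)) \<Longrightarrow> sph (\<Sum>i\<in>I. f i)"
  by (induction I rule: infinite_finite_induct) (auto intro: sph_simps)

text \<open>A linear substitution fixing \<open>P\<close> sends its leading form to a leading form
  of \<open>P\<close> again, and that is unique.\<close>

lemma sph_ptop: assumes P: "sph P" "pdeg m P" shows "sph (ptop m P)"
proof -
  note T = ptop[OF P(2)]
  have "subst M N (ptop m P) = ptop m P" if "subst M N P = P" for M N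
    using phom_unique[OF phom_diff[OF phom_subst[OF T(1), of M N] T(1)]]
      pdeg_diff[OF T(2) pdeg_subst[OF T(2), of M N]] that by (simp add: subst_simps)
  then have "Winv (ptop m P)" "weight0 (ptop m P)"
    using P(1) by (simp_all add: sph_def Winv_def weight0_def gact_def sc_subst)
  then show ?thesis using T(1) pdeg_pol by (auto simp: sph_def phom_def)
qed

lemma sph_quad: "sph quad"
proof -
  have "gact w quad = quad" if "w \<in> W" for w
    by (rule pf_eqI) (simp add: gact_def subst_apply quad_apply pairing_matrix inv_covec(1)[OF that])
  moreover have "weight0 quad"
    unfolding weight0_def
  proof (intro allI impI)
    fix r :: complex assume "r \<noteq> 0"
    then show "sc r quad = quad" by (intro pf_eqI) (simp add: sc_def quad_apply)
  qed
  ultimately show ?thesis by (simp add: sph_def pol_quad Winv_def)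
qed

lemma sph_homogeneous_sum:
  assumes "sph P"
  obtains N T where "\<And>k. sph (T k)" "\<And>k. phom (int k) (T k)" "\<And>k. N < k \<Longrightarrow> T k = 0" "P = (\<Sum>k\<le>N. T k)"
proof -
  have *: "\<exists>T. (\<forall>k. sph (T k) \<and> phom (int k) (T k) \<and> (n \<le> k \<longrightarrow> T k = 0)) \<and> P = (\<Sum>k<n. T k)"
    if "sph P" "pdeg (int n - 1) P" for P n
    using that
  proof (induction n arbitrary: P)
    case 0
    then have "P = 0" using pdeg_neg by fastforce
    then show ?case by (intro exI[of _ "\<lambda>_. 0"]) (simp add: sph_simps phom_zero)
  next
    case (Suc n)
    have n: "pdeg (int n) P" using Suc.prems(2) by simp
    have "sph (P - ptop (int n) P)" by (intro sph_simps Suc.prems sph_ptop n)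
    then obtain T where T: "\<forall>k. sph (T k) \<and> phom (int k) (T k) \<and> (n \<le> k \<longrightarrow> T k = 0)" "P - ptop (int n) P = (\<Sum>k<n. T k)"
      using Suc.IH[of "P - ptop (int n) P"] ptop(2)[OF n] by blast
    have "(\<Sum>k<n. T k) = (\<Sum>k<n. (T(n := ptop (int n) P)) k)" by (rule sum.cong) auto
    then have "P = (\<Sum>k<Suc n. (T(n := ptop (int n) P)) k)" using T(2) by (simp add: algebra_simps)
    then show ?case using T(1) sph_ptop[OF Suc.prems(1) n] ptop(1)[OF n]
      by (intro exI[of _ "T(n := ptop (int n) P)"]) auto
  qed
  obtain m where "pdeg m P" using sph_pol[OF assms] pol_def by blast
  then have "pdeg (int (Suc (nat m)) - 1) P" by (rule pdeg_mono) simp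
  from *[OF assms this] that show ?thesis by (metis Suc_leI lessThan_Suc_atMost)
qed

definition unpull :: "'n pf \<Rightarrow> 'n cmat \<Rightarrow> complex" where "unpull P = (SOME p. p \<in> polynomial_fun \<and> pull p = P)"

lemma unpull: assumes "sph P" shows "unpull P \<in> polynomial_fun" "pull (unpull P) = P"
proof -
  have "\<exists>p. p \<in> polynomial_fun \<and> pull p = P" using pull_surj[of P] assms by (auto simp: sph_def)
  from someI_ex[OF this] show "unpull P \<in> polynomial_fun" "pull (unpull P) = P" by (simp_all add: unpull_def)
qed

text \<open>The choice in \<open>unpull\<close> is immaterial: points of the cone are of the form
  \<open>v \<xi>\<close>, where the value is that of \<open>P\<close>
  (\<open>to_cone_apply\<close>).\<close>

definition to_cone :: "'n pf \<Rightarrow> 'n cmat \<Rightarrow> complex" where "to_cone P = restrict (unpull P) nil_cone"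

lemma to_cone_apply: "sph P \<Longrightarrow> pairing \<xi> v = 0 \<Longrightarrow> to_cone P (outer v \<xi>) = P v \<xi>"
  using unpull(2)[of P] pull_apply[of "unpull P" v \<xi>] by (simp add: to_cone_def outer_nil_cone)

lemma nil_cone_eqI: assumes "\<And>v \<xi>. pairing \<xi> v = 0 \<Longrightarrow> f (outer v \<xi>) = g (outer v \<xi>)"
    "f \<in> extensional nil_cone" "g \<in> extensional nil_cone" shows "f = g"
  using assms by (intro extensionalityI[of f nil_cone g]) (auto simp: nil_cone_def)

lemma to_cone_ext: "to_cone P \<in> extensional nil_cone" by (simp add: to_cone_def)

lemma to_cone_eqI: "sph P \<Longrightarrow> f \<in> extensional nil_cone \<Longrightarrow> (\<And>v \<xi>. pairing \<xi> v = 0 \<Longrightarrow> f (outer v \<xi>) = P v \<xi>) \<Longrightarrow> f = to_cone P"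
  by (rule nil_cone_eqI) (auto simp: to_cone_apply to_cone_ext)

end

lemma phom_quad: "phom 2 quad"
  using pdeg_phom[OF pol_quad, of 2] by (simp add: quad_apply power2_eq_square mult.assoc)

text \<open>A leading form of \<open>A\<close> above degree \<open>k - 2\<close> would have a
  nonzero product with \<open>quad\<close>, too high to be cancelled by the lower terms or absorbed
  by \<open>Z\<close>. Applied with \<open>Z\<close> the image of \<open>A\<close> under
  \<open>shifted_euler\<close>, this makes the quotient filtration strict.\<close>

lemma pdeg_quad_lower:
  assumes A: "pol A" "\<And>m. pdeg m A \<Longrightarrow> pdeg (m + 1) (Z - quad * A)" and Z: "pdeg k Z"
  shows "pdeg (k - 2) A"
proof -
  have *: "pdeg (k - 2 + int n) A \<Longrightarrow> pdeg (k - 2) A" for n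
  proof (induction n)
    case (Suc n)
    define m where "m = k - 2 + int (Suc n)"
    have m: "pdeg m A" using Suc.prems by (simp add: m_def)
    show ?case
    proof (cases "m < 0")
      case True then show ?thesis using pdeg_neg[OF m] by (simp add: pdeg_zero)
    next
      case False
      let ?T = "ptop m A"
      note T = ptop[OF m]
      have "quad * ?T = Z - (Z - quad * A) - quad * (A - ?T)" by (simp add: right_diff_distrib)
      moreover have "pdeg (m + 1) Z" using Z by (rule pdeg_mono) (simp add: m_def)
      moreover have "pdeg (2 + (m - 1)) (quad * (A - ?T))"
        using phom_quad T(2) by (intro pdeg_mult) (auto simp: phom_def)
      then have "pdeg (m + 1) (quad * (A - ?T))" by (simp add: add.commute)
      ultimately have "pdeg (m + 1) (quad * ?T)" using A(2)[OF m] pdeg_diff by metis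
      moreover have "phom (2 + m) (quad * ?T)" using phom_mult[OF phom_quad T(1)] False by simp
      ultimately have "quad * ?T = 0" using phom_unique[of "2 + m" "quad * ?T"] by (simp add: add.commute)
      then have "?T = 0" using pol_domain[OF pol_quad] quad_nz T(1) pdeg_pol phom_def by blast
      then have "pdeg (m - 1) A" using T(2) by simp
      moreover have "m - 1 = k - 2 + int n" by (simp add: m_def)
      ultimately show ?thesis using Suc.IH by simp
    qed
  qed simp
  obtain m where "pdeg m A" using A(1) pol_def by blast
  then have "pdeg (k - 2 + int (nat (m - k + 2))) A" by (rule pdeg_mono) simp
  then show ?thesis by (rule *)
qed

lemma pb_uminus: "pol P \<Longrightarrow> pb (- P) Q = - pb P Q" "pol Q \<Longrightarrow> pb P (- Q) = - pb P Q"
proof -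
  have m: "- G = cst (-1) * G" for G :: "'a pf" by (rule pf_eqI) (simp add: pfs)
  show "pol P \<Longrightarrow> pb (- P) Q = - pb P Q" "pol Q \<Longrightarrow> pb P (- Q) = - pb P Q"
    unfolding m[of P] m[of Q] m[of "pb P Q"] by (rule pb_cmult; simp)+
qed

context euler_data
begin

section \<open>Invariant functions on the cone, described through \<open>S\<close>\<close>

abbreviation "BB \<equiv> invariant_ring W nil_cone"

lemma BB_simps: "f \<otimes>\<^bsub>BB\<^esub> g = (\<lambda>A\<in>nil_cone. f A * g A)" "f \<oplus>\<^bsub>BB\<^esub> g = (\<lambda>A\<in>nil_cone. f A + g A)"
  "k \<odot>\<^bsub>BB\<^esub> f = (\<lambda>A\<in>nil_cone. k * f A)" "\<one>\<^bsub>BB\<^esub> = (\<lambda>A\<in>nil_cone. 1)" "\<zero>\<^bsub>BB\<^esub> = (\<lambda>A\<in>nil_cone. 0)"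
  "pbracket BB f g = (\<lambda>A\<in>nil_cone. kks_bracket (polynomial_extension nil_cone f) (polynomial_extension nil_cone g) A)"
  "carrier BB = {restrict p nil_cone | p. p \<in> polynomial_fun} \<inter> W_invariant W nil_cone"
  "homog BB j = (if even j then {restrict p nil_cone | p. homog_polynomial_fun (j div 2) p} else {\<lambda>A\<in>nil_cone. 0}) \<inter> W_invariant W nil_cone"
  by (simp_all add: invariant_ring_def coordinate_ring_def)

lemma to_cone_add: "sph P \<Longrightarrow> sph Q \<Longrightarrow> to_cone P \<oplus>\<^bsub>BB\<^esub> to_cone Q = to_cone (P + Q)"
  by (rule to_cone_eqI) (auto simp: BB_simps(1-5) to_cone_apply outer_nil_cone pfs sph_simps)
lemma to_cone_mult: "sph P \<Longrightarrow> sph Q \<Longrightarrow> to_cone P \<otimes>\<^bsub>BB\<^esub> to_cone Q = to_cone (P * Q)"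
  by (rule to_cone_eqI) (auto simp: BB_simps(1-5) to_cone_apply outer_nil_cone pfs sph_simps)
lemma to_cone_smult: "sph P \<Longrightarrow> k \<odot>\<^bsub>BB\<^esub> to_cone P = to_cone (cst k * P)"
  by (rule to_cone_eqI) (auto simp: BB_simps(1-5) to_cone_apply outer_nil_cone pfs sph_simps)
lemma to_cone_one: "\<one>\<^bsub>BB\<^esub> = to_cone 1"
  by (rule to_cone_eqI) (auto simp: BB_simps(1-5) outer_nil_cone pfs sph_simps)
lemma to_cone_zero: "\<zero>\<^bsub>BB\<^esub> = to_cone 0"
  by (rule to_cone_eqI) (auto simp: BB_simps(1-5) outer_nil_cone pfs sph_simps)

lemma to_cone_eq_iff: "sph P \<Longrightarrow> sph Q \<Longrightarrow> to_cone P = to_cone Q \<longleftrightarrow> (\<forall>v \<xi>. pairing \<xi> v = 0 \<longrightarrow> P v \<xi> = Q v \<xi>)"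
  using to_cone_eqI[OF _ to_cone_ext, of Q P] by (metis to_cone_apply)

lemma conj_outer: "(w :: 'n cmat) ** outer v \<xi> ** matrix_inv w = outer (w *v v) (\<xi> v* matrix_inv w)"
  by (rule outer_mult)

lemma pairing_conj: "w \<in> W \<Longrightarrow> pairing (\<xi> v* matrix_inv w) (w *v v) = pairing \<xi> v"
  by (simp add: pairing_matrix[symmetric] inv_vec)

lemma to_cone_inv: assumes P: "sph P" shows "to_cone P \<in> W_invariant W nil_cone"
  unfolding W_invariant_def
proof (intro CollectI ballI)
  fix w and A :: "'n cmat" assume w: "w \<in> W" and "A \<in> nil_cone"
  then obtain v \<xi> where A: "A = outer v \<xi>" "pairing \<xi> v = 0" by (auto simp: nil_cone_def)
  have "gact w P = P" using P w by (simp add: sph_def Winv_def)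
  then have "gact w P (w *v v) (\<xi> v* matrix_inv w) = P (w *v v) (\<xi> v* matrix_inv w)" by simp
  then have "P (w *v v) (\<xi> v* matrix_inv w) = P v \<xi>"
    by (simp add: gact_def subst_apply inv_vec[OF w] inv_covec[OF w])
  then show "to_cone P (w ** A ** matrix_inv w) = to_cone P A"
    using A w P by (simp add: conj_outer to_cone_apply pairing_conj)
qed

lemma to_cone_carrier: "sph P \<Longrightarrow> to_cone P \<in> carrier BB"
  using unpull(1) to_cone_inv by (auto simp: BB_simps(7) to_cone_def)

text \<open>An extension of an invariant function need not be invariant. Averaging it over
  \<open>W\<close> does not change it on the cone and keeps weight and degree.\<close>

lemma to_cone_sym:
  assumes p: "p \<in> polynomial_fun" "restrict p nil_cone \<in> W_invariant W nil_cone"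
  shows "\<exists>P. sph P \<and> restrict p nil_cone = to_cone P \<and> (\<forall>k. phom k (pull p) \<longrightarrow> phom k P)"
proof -
  let ?P = "rhoH ee (pull p)"
  have pp: "pol (pull p)" by (rule pull_pol[OF p(1)])
  have P: "sph ?P" using pp Gl_weight0[OF ee_Gl pp pull_weight0] by (simp add: sph_def Winv_rhoH_ee pol_rhoH)
  have "restrict p nil_cone (outer v \<xi>) = ?P v \<xi>" if vx: "pairing \<xi> v = 0" for v \<xi>
  proof -
    have "gact w (pull p) v \<xi> = p (outer v \<xi>)" if w: "w \<in> W" for w
    proof -
      have c: "w ** outer (matrix_inv w *v v) (\<xi> v* w) ** matrix_inv w = outer v \<xi>"
        by (simp add: conj_outer inv_vec[OF w] inv_covec[OF w])
      have "pairing (\<xi> v* w) (matrix_inv w *v v) = 0"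
        using vx by (simp add: pairing_matrix[symmetric] inv_vec[OF w])
      then have "outer (matrix_inv w *v v) (\<xi> v* w) \<in> nil_cone" by (rule outer_nil_cone)
      then have "restrict p nil_cone (w ** outer (matrix_inv w *v v) (\<xi> v* w) ** matrix_inv w) =
          restrict p nil_cone (outer (matrix_inv w *v v) (\<xi> v* w))"
        using p(2) w unfolding W_invariant_def by blast
      then show ?thesis unfolding c
        using outer_nil_cone[OF vx] \<open>outer (matrix_inv w *v v) (\<xi> v* w) \<in> nil_cone\<close>
        by (simp add: gact_def subst_apply pull_apply)
    qed
    then have "?P v \<xi> = p (outer v \<xi>)" using fin W_one by (auto simp: rhoH_ee[OF pp] pfs sum_fun_apply)
    then show ?thesis using outer_nil_cone[OF vx] by simp
  qed
  then have "restrict p nil_cone = to_cone ?P" by (intro to_cone_eqI P) auto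
  moreover have "phom k ?P" if "phom k (pull p)" for k
    unfolding rhoH_ee[OF pp] gact_def by (intro phom_cmult phom_sum phom_subst that)
  ultimately show ?thesis using P by blast
qed

lemma BB_cases: assumes "f \<in> carrier BB" obtains P where "sph P" "f = to_cone P"
  using assms to_cone_sym unfolding BB_simps(7) by blast

text \<open>Degree in \<open>v\<close> and \<open>\<xi>\<close> together is twice the degree in
  matrix entries, which is the grading of the coordinate ring; odd degrees vanish by
  \<open>phom_odd\<close>.\<close>

lemma homog_BB: "homog BB k = to_cone ` {P. sph P \<and> phom (int k) P}"
proof (intro equalityI subsetI)
  fix f assume f: "f \<in> homog BB k"
  show "f \<in> to_cone ` {P. sph P \<and> phom (int k) P}"
  proof (cases "even k")
    case True
    then obtain p where p: "f = restrict p nil_cone" "homog_polynomial_fun (k div 2) p" "f \<in> W_invariant W nil_cone"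
      using f by (auto simp: BB_simps(8))
    have "phom (int k) (pull p)" using pull_homog[OF p(2)] True by simp
    then show ?thesis using to_cone_sym[of p] p homog_polynomial[OF p(2)] by blast
  next
    case False
    then have "f = to_cone 0" using f by (auto simp: BB_simps(8) to_cone_zero[symmetric] BB_simps(5))
    then show ?thesis by (auto simp: sph_simps phom_zero)
  qed
next
  fix f assume "f \<in> to_cone ` {P. sph P \<and> phom (int k) P}"
  then obtain P where P: "sph P" "phom (int k) P" "f = to_cone P" by blast
  show "f \<in> homog BB k"
  proof (cases "even k")
    case True
    then obtain d where d: "k = 2 * d" by blast
    obtain N g where g: "\<forall>j. homog_polynomial_fun j (g j)" "\<forall>A. unpull P A = (\<Sum>j\<le>N. g j A)" "\<forall>j>N. \<forall>A. g j A = 0"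
      using homog_sum_polynomial[OF unpull(1)[OF P(1)]] unfolding homog_sum_def by blast
    \<comment> \<open>\<open>unpull P\<close> need not be homogeneous, but on matrices
      \<open>v \<xi>\<close> its component of degree \<open>d\<close> already takes the values of
      \<open>P\<close>.\<close>
    have "g d (outer v \<xi>) = P v \<xi>" for v \<xi>
    proof -
      have "(\<Sum>j\<le>N. s ^ j * g j (outer v \<xi>)) = (\<Sum>j\<in>{d}. s ^ j * (if j = d then P v \<xi> else 0))" for s
      proof -
        \<comment> \<open>Scaling \<open>v\<close> and \<open>\<xi>\<close> by \<open>r\<close>
          scales the matrix by \<open>r * r\<close>, hence the square root.\<close>
        define r where "r = csqrt s"
        have r: "r * r = s" by (metis r_def power2_csqrt power2_eq_square)
        have "(\<Sum>j\<le>N. s ^ j * g j (outer v \<xi>)) = (\<Sum>j\<le>N. g j (outer (r *s v) (r *s \<xi>)))"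
        proof (rule sum.cong[OF refl])
          fix j
          have "outer (r *s v) (r *s \<xi>) = mat_scale s (outer v \<xi>)" by (simp add: outer_def mat_scale_def vec_eq_iff r[symmetric])
          then show "s ^ j * g j (outer v \<xi>) = g j (outer (r *s v) (r *s \<xi>))" using homog_polynomial g(1) by metis
        qed
        also have "\<dots> = pull (unpull P) (r *s v) (r *s \<xi>)" using g(2) by (simp add: pull_apply)
        also have "\<dots> = r ^ (2 * d) * P v \<xi>" using P(2) by (simp add: unpull(2)[OF P(1)] phom_def d nat_mult_distrib)
        finally show ?thesis by (simp add: power_mult power2_eq_square r)
      qed
      then have "g d (outer v \<xi>) = (if d = d then P v \<xi> else 0)"
        by (rule sum_power_eq[where k = d]) (use g(3) in auto)
      then show ?thesis by simp
    qed
    then have "f = restrict (g d) nil_cone" unfolding P(3) by (intro to_cone_eqI[symmetric] P(1)) (simp_all add: outer_nil_cone)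
    then show ?thesis using g(1) to_cone_inv[OF P(1)] P(3) d by (auto simp: BB_simps(8))
  next
    case False
    then have "P = 0" using phom_odd[of P "int k"] P by (simp add: sph_def)
    then show ?thesis using False P to_cone_inv[OF P(1)] by (auto simp: BB_simps(8) to_cone_zero[symmetric] BB_simps(5))
  qed
qed

text \<open>The quotient by \<open>quad\<close> is unique, so invariance, weight and homogeneity
  pass from \<open>P\<close> and \<open>quad\<close> to it.\<close>

lemma to_cone_zero_homog:
  assumes P: "sph P" "phom (int k) P" and z: "to_cone P = \<zero>\<^bsub>BB\<^esub>"
  shows "\<exists>R. sph R \<and> phom (int k - 2) R \<and> P = quad * R"
proof -
  have "P v \<xi> = 0" if "pairing \<xi> v = 0" for v \<xi>
    using z that P(1) to_cone_eq_iff[OF P(1) sph_simps(5)] by (simp add: to_cone_zero pfs)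
  then obtain A where A: "pol A" "P = quad * A" using quad_divides[OF card_n sph_pol[OF P(1)]] by blast
  have c: "G = A" if "pol G" "quad * G = P" for G
    using pol_cancel[OF pol_quad quad_nz that(1) A(1)] that A(2) by simp
  have "Winv A" unfolding Winv_def
  proof
    fix w assume w: "w \<in> W"
    have "quad * gact w A = gact w P" using sph_quad w by (simp add: A gact_simps sph_def Winv_def)
    then show "gact w A = A" using c[OF pol_gact[OF A(1)]] P w by (simp add: sph_def Winv_def)
  qed
  moreover have "weight0 A" unfolding weight0_def
  proof (intro allI impI)
    fix r :: complex assume r: "r \<noteq> 0"
    have "quad * sc r A = sc r P" using sph_quad r by (simp add: A sc_simps sph_def weight0_def)
    then show "sc r A = A" using c[OF pol_sc[OF A(1)]] P r by (simp add: sph_def weight0_def)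
  qed
  ultimately have "sph A" using A by (simp add: sph_def)
  have lo: "pdeg (int k - 2) A"
    by (rule pdeg_quad_lower[OF A(1)]) (use P(2) A(2) in \<open>auto simp: phom_def pdeg_zero\<close>)
  have "phom (int k - 2) A"
  proof (cases "k < 2")
    case True then show ?thesis using pdeg_neg[OF lo] by (simp add: phom_zero)
  next
    case False
    have "phom (int (k - 2)) A"
    proof (rule phomI[OF A(1)])
      fix r :: complex and v \<xi> :: "complex ^ 'n" assume r: "r \<noteq> 0"
      define G where "G = cst (inverse r ^ (k - 2)) * subst (mat r) (mat r) A"
      have e: "r * r * r ^ (k - 2) = r ^ k" using False by (metis add_diff_inverse_nat power2_eq_square power_add)
      have "quad * G = cst (inverse r ^ k) * subst (mat r) (mat r) (quad * A)"
      proof -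
        have q: "subst (mat r) (mat r) quad = cst (r * r) * quad" using subst_scale[OF phom_quad, of r] by (simp add: power2_eq_square)
        have "cst (inverse r ^ k) * subst (mat r) (mat r) (quad * A) = quad * (cst (inverse r ^ k * (r * r)) * subst (mat r) (mat r) A)"
          unfolding subst_simps q by (simp add: cst_simps(3)[symmetric] mult_ac)
        moreover have "inverse r ^ k * (r * r) = inverse r ^ (k - 2)"
          using e r by (simp add: power_inverse field_simps)
        ultimately show ?thesis by (simp add: G_def)
      qed
      also have "\<dots> = P" using r subst_scale[OF P(2), of r] A(2)
        by (simp add: cst_simps(3) mult.assoc[symmetric] power_inverse cst_simps(2))
      finally have "G = A" using c A(1) by (simp add: G_def pol_mult pol_cst pol_subst)
      then have "G v \<xi> = A v \<xi>" by simp
      moreover have "mat r *v v = r *s v" "\<xi> v* mat r = r *s \<xi>"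
        by (simp_all add: vec_eq_iff matrix_vector_mult_def vector_matrix_mult_def mat_def if_distrib if_distribR cong: if_cong)
      ultimately show "A (r *s v) (r *s \<xi>) = r ^ (k - 2) * A v \<xi>"
        using r by (simp add: G_def pfs subst_apply power_inverse field_simps)
    qed
    then show ?thesis using False by (simp add: of_nat_diff)
  qed
  then show ?thesis using \<open>sph A\<close> A(2) by blast
qed

text \<open>After pullback two extensions differ by a multiple of \<open>quad\<close>. By
  \<open>pb_quad\<close> the bracket of this difference is again a multiple of \<open>quad\<close>,
  so it vanishes on the cone.\<close>

lemma pb_mod_quad:
  assumes p: "p \<in> polynomial_fun" "p' \<in> polynomial_fun" "q \<in> polynomial_fun"
    and e: "\<And>v \<xi>. pairing \<xi> v = 0 \<Longrightarrow> pull p v \<xi> = pull p' v \<xi>" and vx: "pairing \<xi> v = 0"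
  shows "pb (pull p) (pull q) v \<xi> = pb (pull p') (pull (q :: 'n cmat \<Rightarrow> complex)) v \<xi>"
proof -
  have "\<exists>A. pol A \<and> pull p - pull p' = quad * A"
    by (rule quad_divides[OF card_n]) (auto simp: pfs e intro: pol_diff pull_pol p)
  then obtain A where A: "pol A" "pull p = pull p' + quad * A" by (metis diff_add_cancel add.commute)
  have "pb (pull p) (pull q) = pb (pull p') (pull q) + quad * pb A (pull q)"
    unfolding A(2) using A(1) p by (simp add: pb_simps(1,3) pull_pol pol_quad pol_mult pb_quad)
  then show ?thesis using vx by (simp add: pfs quad_apply)
qed

lemma pbracket_to_cone: assumes P: "sph P" and Q: "sph Q" shows "pbracket BB (to_cone P) (to_cone Q) = to_cone (- pb P Q)"
proof (rule to_cone_eqI)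
  show "sph (- pb P Q)" by (intro sph_uminus sph_pb P Q)
  show "pbracket BB (to_cone P) (to_cone Q) \<in> extensional nil_cone" by (simp add: BB_simps(6))
  have pe: "polynomial_extension nil_cone (to_cone S) \<in> polynomial_fun \<and> restrict (polynomial_extension nil_cone (to_cone S)) nil_cone = to_cone S" if "sph S" for S
  proof -
    have "\<exists>p. p \<in> polynomial_fun \<and> restrict p nil_cone = to_cone S" using unpull(1)[OF that]
      by (intro exI[of _ "unpull S"] conjI) (simp_all only: to_cone_def)
    from someI_ex[OF this] show ?thesis unfolding polynomial_extension_def .
  qed
  define p q where "p = polynomial_extension nil_cone (to_cone P)" and "q = polynomial_extension nil_cone (to_cone Q)"
  have pq: "p \<in> polynomial_fun" "q \<in> polynomial_fun" using pe P Q by (simp_all add: p_def q_def)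
  have a: "pull (polynomial_extension nil_cone (to_cone S)) v \<xi> = pull (unpull S) v \<xi>" if "sph S" "pairing \<xi> v = 0" for S v \<xi>
  proof -
    have "restrict (polynomial_extension nil_cone (to_cone S)) nil_cone (outer v \<xi>) = to_cone S (outer v \<xi>)" using pe[OF that(1)] by simp
    then show ?thesis using that outer_nil_cone[OF that(2)] by (simp add: pull_apply to_cone_def)
  qed
  fix v \<xi> :: "complex ^ 'n" assume vx: "pairing \<xi> v = 0"
  \<comment> \<open>The chosen extensions are exchanged for \<open>unpull\<close> one argument at a
    time, with antisymmetry in between.\<close>
  have "pb (pull p) (pull q) v \<xi> = pb P (pull q) v \<xi>"
    using pb_mod_quad[OF pq(1) unpull(1)[OF P] pq(2) a[OF P, folded p_def] vx] by (simp add: unpull(2)[OF P])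
  also have "\<dots> = - pb (pull q) P v \<xi>" by (subst pb_simps(7)) (simp add: pfs)
  also have "\<dots> = - pb Q P v \<xi>"
    using pb_mod_quad[OF pq(2) unpull(1)[OF Q] unpull(1)[OF P] a[OF Q, folded q_def] vx] by (simp add: unpull(2)[OF P] unpull(2)[OF Q])
  also have "\<dots> = pb P Q v \<xi>" by (subst (2) pb_simps(7)) (simp add: pfs)
  finally have "pb (pull p) (pull q) v \<xi> = pb P Q v \<xi>" .
  moreover have "kks_bracket p q (outer v \<xi>) = - pb (pull p) (pull q) v \<xi>"
    using fun_cong[OF fun_cong[OF pull_kks[OF pq]], of v \<xi>] by (simp add: pull_apply pfs)
  ultimately show "pbracket BB (to_cone P) (to_cone Q) (outer v \<xi>) = (- pb P Q) v \<xi>"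
    using outer_nil_cone[OF vx] by (simp add: BB_simps(6) pfs flip: p_def q_def)
qed

lemmas to_cone_simps = to_cone_add to_cone_mult to_cone_smult to_cone_one to_cone_zero pbracket_to_cone

lemma BB_cring: "cring BB"
proof (rule cringI)
  show "abelian_group BB"
  proof (rule abelian_groupI)
    fix x assume "x \<in> carrier BB"
    then obtain P where P: "sph P" "x = to_cone P" by (rule BB_cases)
    then show "\<exists>y\<in>carrier BB. y \<oplus>\<^bsub>BB\<^esub> x = \<zero>\<^bsub>BB\<^esub>"
      by (intro bexI[of _ "to_cone (- P)"]) (simp_all add: to_cone_simps sph_uminus to_cone_carrier)
  qed (auto elim!: BB_cases simp: to_cone_simps sph_simps to_cone_carrier add_ac)
  show "Group.comm_monoid BB"
    by (rule comm_monoidI) (auto elim!: BB_cases simp: to_cone_simps sph_simps to_cone_carrier mult_ac)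
qed (auto elim!: BB_cases simp: to_cone_simps sph_simps distrib_right)

lemma BB_alg: "complex_algebra BB"
proof (rule complex_algebraI)
  show "ring BB" using BB_cring by (simp add: cring_def)
qed (auto elim!: BB_cases simp: to_cone_simps sph_simps to_cone_carrier cst_simps(3,4)[symmetric] cst_simps(2) distrib_right distrib_left mult.assoc,
   auto elim!: BB_cases simp: to_cone_simps sph_simps mult.left_commute)

sublocale BB: calg BB by unfold_locales (rule BB_alg)

lemma BB_uminus: "sph P \<Longrightarrow> \<ominus>\<^bsub>BB\<^esub> to_cone P = to_cone (- P)"
  by (rule BB.minus_equality) (simp_all add: to_cone_simps sph_uminus to_cone_carrier)

lemma finsum_to_cone: "finite L \<Longrightarrow> (\<And>k. k \<in> L \<Longrightarrow> sph (T k)) \<Longrightarrow> finsum BB (\<lambda>k. to_cone (T k)) L = to_cone (\<Sum>k\<in>L. T k)"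
proof (induction L rule: finite_induct)
  case (insert k L)
  have "finsum BB (\<lambda>k. to_cone (T k)) (insert k L) = to_cone (T k) \<oplus>\<^bsub>BB\<^esub> finsum BB (\<lambda>k. to_cone (T k)) L"
    using insert by (intro BB.finsum_insert) (auto simp: to_cone_carrier)
  then show ?case using insert by (simp add: to_cone_add sph_sum)
qed (simp add: to_cone_zero)

text \<open>The cone is stable under scaling, so at each of its points the components are the
  coefficients of one polynomial in \<open>r\<close>.\<close>

lemma decomp_unique:
  assumes T: "\<And>k. sph (T k) \<and> phom (int k) (T k)" and S: "\<And>k. sph (S k) \<and> phom (int k) (S k)"
    and L: "finite L" "\<And>k. k \<notin> L \<Longrightarrow> to_cone (T k) = \<zero>\<^bsub>BB\<^esub>" and M: "finite M" "\<And>k. k \<notin> M \<Longrightarrow> to_cone (S k) = \<zero>\<^bsub>BB\<^esub>"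
    and e: "to_cone (\<Sum>k\<in>L. T k) = to_cone (\<Sum>k\<in>M. S k)"
  shows "to_cone (T k) = to_cone (S k)"
proof -
  have "T k v \<xi> = S k v \<xi>" if vx: "pairing \<xi> v = 0" for v \<xi>
  proof (rule sum_power_eq[where K = L and L = M])
    fix r :: complex
    have vr: "pairing (r *s \<xi>) (r *s v) = 0" using vx by simp
    have "(\<Sum>k\<in>L. T k) (r *s v) (r *s \<xi>) = (\<Sum>k\<in>M. S k) (r *s v) (r *s \<xi>)"
      using e vr to_cone_eq_iff[OF sph_sum[of L T] sph_sum[of M S]] T S by simp
    then show "(\<Sum>k\<in>L. r ^ k * T k v \<xi>) = (\<Sum>k\<in>M. r ^ k * S k v \<xi>)"
      using T S by (simp add: sum_fun_apply phom_def)
  next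
    fix k assume "k \<notin> L"
    then show "T k v \<xi> = 0" using L(2) T vx to_cone_eq_iff[of "T k" 0] by (simp add: to_cone_zero sph_simps pfs)
  next
    fix k assume "k \<notin> M"
    then show "S k v \<xi> = 0" using M(2) S vx to_cone_eq_iff[of "S k" 0] by (simp add: to_cone_zero sph_simps pfs)
  qed (use L M in auto)
  then show ?thesis using T S by (simp add: to_cone_eq_iff)
qed

lemma BB_homog_cases: assumes "x \<in> homog BB k" obtains P where "sph P" "phom (int k) P" "x = to_cone P"
  using assms unfolding homog_BB by blast

lemma BB_graded: "graded_poisson_algebra BB"
  unfolding graded_poisson_algebra_def
proof (intro conjI allI ballI)
  show "complex_algebra BB" by (rule BB_alg)
  show "cring BB" by (rule BB_cring)
  show "subspace_of (homog BB k) BB" for k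
  proof (rule BB.subspaceI)
    show "\<zero>\<^bsub>BB\<^esub> \<in> homog BB k" using sph_simps phom_zero by (force simp: homog_BB to_cone_zero)
  qed (auto simp: homog_BB to_cone_carrier to_cone_simps intro!: imageI sph_simps phom_add phom_cmult)
  show "\<exists>!f. (\<forall>k. f k \<in> homog BB k) \<and> finite {k. f k \<noteq> \<zero>\<^bsub>BB\<^esub>} \<and> b = (\<Oplus>\<^bsub>BB\<^esub>k\<in>{k. f k \<noteq> \<zero>\<^bsub>BB\<^esub>}. f k)"
    if b: "b \<in> carrier BB" for b
  proof -
    obtain P where P: "sph P" "b = to_cone P" using b by (rule BB_cases)
    obtain N T where T: "\<And>k. sph (T k)" "\<And>k. phom (int k) (T k)" "\<And>k. N < k \<Longrightarrow> T k = 0" "P = (\<Sum>k\<le>N. T k)"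
      using sph_homogeneous_sum[OF P(1)] by blast
    let ?L = "{k. to_cone (T k) \<noteq> \<zero>\<^bsub>BB\<^esub>}"
    have LN: "?L \<subseteq> {..N}" using T(3) by (auto simp: to_cone_zero)
    then have fL: "finite ?L" using finite_subset by blast
    \<comment> \<open>Components that vanish on the cone are dropped; they may be nonzero as
      polynomials.\<close>
    have "b = to_cone (\<Sum>k\<in>?L. T k)"
      unfolding P(2)
    proof (rule to_cone_eqI[OF _ to_cone_ext])
      fix v \<xi> :: "complex ^ 'n" assume vx: "pairing \<xi> v = 0"
      have "(\<Sum>k\<in>?L. T k v \<xi>) = (\<Sum>k\<le>N. T k v \<xi>)"
        using vx LN T(1) to_cone_eq_iff[OF T(1) sph_simps(5)]
        by (intro sum.mono_neutral_left) (auto simp: to_cone_zero pfs)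
      then show "to_cone P (outer v \<xi>) = (\<Sum>k\<in>?L. T k) v \<xi>"
        using P(1) vx by (simp add: to_cone_apply T(4) sum_fun_apply)
    qed (intro sph_sum T)
    then have bL: "b = finsum BB (\<lambda>k. to_cone (T k)) ?L" using finsum_to_cone[OF fL T(1)] by simp
    show ?thesis
    proof (rule ex1I[of _ "\<lambda>k. to_cone (T k)"])
      show "(\<forall>k. to_cone (T k) \<in> homog BB k) \<and> finite ?L \<and> b = (\<Oplus>\<^bsub>BB\<^esub>k\<in>?L. to_cone (T k))"
        using bL fL T by (auto simp: homog_BB)
      fix g assume g: "(\<forall>k. g k \<in> homog BB k) \<and> finite {k. g k \<noteq> \<zero>\<^bsub>BB\<^esub>} \<and> b = (\<Oplus>\<^bsub>BB\<^esub>k\<in>{k. g k \<noteq> \<zero>\<^bsub>BB\<^esub>}. g k)"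
      then have "\<forall>k. \<exists>S. sph S \<and> phom (int k) S \<and> g k = to_cone S" by (auto simp: homog_BB)
      then obtain S where S: "\<And>k. sph (S k) \<and> phom (int k) (S k)" "\<And>k. g k = to_cone (S k)" by metis
      let ?M = "{k. to_cone (S k) \<noteq> \<zero>\<^bsub>BB\<^esub>}"
      have gS: "g = (\<lambda>k. to_cone (S k))" using S(2) by auto
      have M: "finite ?M" "b = finsum BB (\<lambda>k. to_cone (S k)) ?M" using g unfolding gS by blast+
      have "to_cone (S k) = to_cone (T k)" for k
      proof (rule decomp_unique[where L = ?M and M = ?L])
        show "to_cone (\<Sum>k\<in>?M. S k) = to_cone (\<Sum>k\<in>?L. T k)"
          using finsum_to_cone[OF M(1), of S] S(1) M(2) finsum_to_cone[OF fL T(1)] bL by simp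
      qed (use M fL S T in auto)
      then show "g = (\<lambda>k. to_cone (T k))" using S(2) by auto
    qed
  qed
  show "\<one>\<^bsub>BB\<^esub> \<in> homog BB 0"
    using sph_simps(6) pdeg_phom[OF pol_one, of 0] by (force simp: homog_BB to_cone_one pfs)
  show "x \<otimes>\<^bsub>BB\<^esub> y \<in> homog BB (i + j)" if "x \<in> homog BB i" "y \<in> homog BB j" for i j x y
    using that phom_mult[of "int i" _ "int j"]
    by (elim BB_homog_cases) (auto simp: homog_BB to_cone_mult intro!: imageI sph_simps)
  show "pbracket BB x y \<in> (if i + j < 2 then {\<zero>\<^bsub>BB\<^esub>} else homog BB (i + j - 2))"
    if xy: "x \<in> homog BB i" "y \<in> homog BB j" for i j x y
  proof -
    obtain P where P: "sph P" "phom (int i) P" "x = to_cone P" using xy(1) by (rule BB_homog_cases)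
    obtain Q where Q: "sph Q" "phom (int j) Q" "y = to_cone Q" using xy(2) by (rule BB_homog_cases)
    show ?thesis
    proof (cases "i + j < 2")
      case True
      then have "pb P Q = 0" using pb_low[of "int i" P "int j" Q] P Q by (simp add: phom_def)
      then show ?thesis using True by (simp add: P Q pbracket_to_cone to_cone_zero)
    next
      case False
      then have "phom (int (i + j - 2)) (- pb P Q)"
        using phom_uminus[OF phom_pb[OF P(2) Q(2)]] by (simp add: of_nat_diff)
      then show ?thesis using False P Q by (auto simp: homog_BB pbracket_to_cone intro!: imageI sph_uminus sph_pb)
    qed
  qed
  show "pbracket BB x (pbracket BB y z) \<oplus>\<^bsub>BB\<^esub> pbracket BB y (pbracket BB z x) \<oplus>\<^bsub>BB\<^esub> pbracket BB z (pbracket BB x y) = \<zero>\<^bsub>BB\<^esub>"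
    if xyz: "x \<in> carrier BB" "y \<in> carrier BB" "z \<in> carrier BB" for x y z
  proof -
    obtain P Q S where P: "sph P" "x = to_cone P" "sph Q" "y = to_cone Q" "sph S" "z = to_cone S" using xyz by (metis BB_cases)
    then show ?thesis using jacobi[of P Q S]
      by (simp add: pbracket_to_cone to_cone_add sph_pb sph_uminus sph_simps pb_uminus pol_pb sph_pol to_cone_zero jacobiator_def)
  qed
next
  fix x y assume xy: "x \<in> carrier BB" "y \<in> carrier BB"
  then obtain P Q where P: "sph P" "x = to_cone P" "sph Q" "y = to_cone Q" by (metis BB_cases)
  show "pbracket BB x y \<in> carrier BB" using P by (simp add: pbracket_to_cone to_cone_carrier sph_uminus sph_pb)
  show "pbracket BB x y = \<ominus>\<^bsub>BB\<^esub> pbracket BB y x"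
    using P pb_simps(7)[of P Q] by (simp add: pbracket_to_cone BB_uminus sph_uminus sph_pb)
  show "pbracket BB (k \<odot>\<^bsub>BB\<^esub> x) y = k \<odot>\<^bsub>BB\<^esub> pbracket BB x y" for k
    using P by (simp add: pbracket_to_cone to_cone_smult sph_uminus sph_pb sph_simps pb_cmult sph_pol)
  fix z assume "z \<in> carrier BB"
  then obtain S where S: "sph S" "z = to_cone S" by (rule BB_cases)
  show "pbracket BB (x \<oplus>\<^bsub>BB\<^esub> y) z = pbracket BB x z \<oplus>\<^bsub>BB\<^esub> pbracket BB y z"
    using P S by (simp add: pbracket_to_cone to_cone_add sph_uminus sph_pb sph_simps pb_simps(1) sph_pol)
  show "pbracket BB x (y \<otimes>\<^bsub>BB\<^esub> z) = pbracket BB x y \<otimes>\<^bsub>BB\<^esub> z \<oplus>\<^bsub>BB\<^esub> y \<otimes>\<^bsub>BB\<^esub> pbracket BB x z"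
    using P S by (simp add: minus_diff_commute pbracket_to_cone to_cone_add to_cone_mult sph_uminus sph_pb sph_simps pb_simps(4) sph_pol)
qed

end

section \<open>Symbols of filtered algebras\<close>

locale filt_alg = calg A for A :: "(complex, 'a) module" (structure) +
  fixes F :: "int \<Rightarrow> 'a set"
  assumes filtered: "filtered_algebra A F"
    and comm: "\<And>i j x y. x \<in> F i \<Longrightarrow> y \<in> F j \<Longrightarrow> commutator A x y \<in> F (i + j - 2)"
begin

lemma F_sub: "subspace_of (F i) A" and F_mono: "i \<le> j \<Longrightarrow> F i \<subseteq> F j"
  and F_mult: "x \<in> F i \<Longrightarrow> y \<in> F j \<Longrightarrow> x \<otimes> y \<in> F (i + j)"
  using filtered unfolding filtered_algebra_def by blast+

lemmas F_D = subspaceD[OF F_sub]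

lemma F_carrier: "x \<in> F i \<Longrightarrow> x \<in> carrier A" using F_D(1) by blast

lemma F_asub: "abelian_subgroup (F i) A"
proof (rule abelian_subgroupI3)
  show "additive_subgroup (F i) A"
    using F_sub unfolding submodule_def by (simp add: additive_subgroup.intro)
qed (rule is_abelian_group)

lemma coset_mem: "y \<in> F i +> x \<longleftrightarrow> (\<exists>h\<in>F i. y = h \<oplus> x)" by (auto simp: a_r_coset_def')

lemma coset_eq: assumes "x \<in> carrier A" "y \<in> carrier A" shows "F i +> x = F i +> y \<longleftrightarrow> x \<ominus> y \<in> F i"
proof
  assume e: "F i +> x = F i +> y"
  have "x \<in> F i +> x" unfolding coset_mem using assms F_D(2) by (intro bexI[of _ \<zero>]) auto
  then have "x \<in> F i +> y" using e by simp
  then obtain h where h: "h \<in> F i" "x = h \<oplus> y" unfolding coset_mem by blast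
  then have "x \<ominus> y = h" using assms F_carrier by (simp add: a_minus_def a_assoc r_neg)
  then show "x \<ominus> y \<in> F i" using h by simp
next
  assume h: "x \<ominus> y \<in> F i"
  have "x = (x \<ominus> y) \<oplus> y" using assms by (simp add: a_minus_def a_assoc l_neg)
  then have "x \<in> F i +> y" using h unfolding coset_mem by blast
  then show "F i +> x = F i +> y" using abelian_subgroup.a_repr_independence'[OF F_asub] assms(2) by metis
qed

lemma coset_zero: "F i = F i +> \<zero>" using a_coset_add_zero[OF F_D(1)] by simp

abbreviation "G k \<equiv> gr_piece A F k"

text \<open>\<open>gr_piece\<close> forms its quotient inside a record with smaller carrier; cosets
  do not see the carrier.\<close>

lemma coset_sub: "a_r_coset (A\<lparr>carrier := B\<rparr>) = a_r_coset A" by (intro ext) (simp add: a_r_coset_def')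

lemma gr_carrier: "carrier (G k) = (\<lambda>x. F (int k - 1) +> x) ` F (int k)"
  by (auto simp: gr_piece_def quot_alg_def FactRing_def A_RCOSETS_def' coset_sub)

lemma gr_zero: "\<zero>\<^bsub>G k\<^esub> = F (int k - 1)" by (simp add: gr_piece_def quot_alg_def FactRing_def)

lemma gr_add: assumes "x \<in> carrier A" "y \<in> carrier A"
  shows "(F (int k - 1) +> x) \<oplus>\<^bsub>G k\<^esub> (F (int k - 1) +> y) = F (int k - 1) +> (x \<oplus> y)"
proof -
  have "set_add (A\<lparr>carrier := B\<rparr>) = set_add A" for B by (intro ext) (simp add: set_add_def')
  then show ?thesis using abelian_subgroup.a_rcos_sum[OF F_asub assms]
    by (simp add: gr_piece_def quot_alg_def FactRing_def)
qed

text \<open>Operations on classes are defined as unions over representatives; independence of the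
  representative collapses the union.\<close>

lemma coset_UN: assumes "x \<in> carrier A" "\<And>y. y \<in> F i +> x \<Longrightarrow> f y = f x" shows "(\<Union>y\<in>F i +> x. f y) = f x"
proof -
  have "x \<in> F i +> x" unfolding coset_mem using assms F_D(2) by (intro bexI[of _ \<zero>]) auto
  then show ?thesis using assms(2) by blast
qed

lemma gr_smult: assumes x: "x \<in> carrier A"
  shows "a \<odot>\<^bsub>G k\<^esub> (F (int k - 1) +> x) = F (int k - 1) +> (a \<odot> x)"
proof -
  have "a \<odot>\<^bsub>G k\<^esub> (F (int k - 1) +> x) = (\<Union>y\<in>F (int k - 1) +> x. F (int k - 1) +> (a \<odot> y))"
    by (simp add: gr_piece_def quot_alg_def coset_sub)
  also have "\<dots> = F (int k - 1) +> (a \<odot> x)"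
  proof (rule coset_UN[OF x])
    fix y assume "y \<in> F (int k - 1) +> x"
    then obtain h where h: "h \<in> F (int k - 1)" "y = h \<oplus> x" unfolding coset_mem by blast
    then have "a \<odot> y \<ominus> a \<odot> x = a \<odot> h" using x F_carrier by (simp add: sm_r_distr a_minus_def a_assoc r_neg)
    then show "F (int k - 1) +> (a \<odot> y) = F (int k - 1) +> (a \<odot> x)"
      using h x F_carrier F_D(4) by (simp add: coset_eq)
  qed
  finally show ?thesis .
qed

lemma gr_group: "abelian_group (G k)"
proof (rule abelian_groupI)
  have z: "\<zero>\<^bsub>G k\<^esub> = F (int k - 1) +> \<zero>" unfolding gr_zero by (rule coset_zero)
  show "\<zero>\<^bsub>G k\<^esub> \<in> carrier (G k)" unfolding z gr_carrier using F_D(2) by blast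
  fix x assume "x \<in> carrier (G k)"
  then obtain x' where x: "x' \<in> F (int k)" "x = F (int k - 1) +> x'" by (auto simp: gr_carrier)
  note xc = F_carrier[OF x(1)]
  show "\<zero>\<^bsub>G k\<^esub> \<oplus>\<^bsub>G k\<^esub> x = x" unfolding z x(2) using xc by (simp add: gr_add)
  have "(-1) \<odot> x' \<in> F (int k)" using x F_D(4) by blast
  then show "\<exists>y\<in>carrier (G k). y \<oplus>\<^bsub>G k\<^esub> x = \<zero>\<^bsub>G k\<^esub>" unfolding z x(2) gr_carrier
    using xc by (intro bexI[of _ "F (int k - 1) +> ((-1) \<odot> x')"]) (auto simp: gr_add sm_minus l_neg)
  fix y assume "y \<in> carrier (G k)"
  then obtain y' where y: "y' \<in> F (int k)" "y = F (int k - 1) +> y'" by (auto simp: gr_carrier)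
  note yc = F_carrier[OF y(1)]
  show "x \<oplus>\<^bsub>G k\<^esub> y \<in> carrier (G k)" using x y xc yc F_D(3) by (auto simp: gr_add gr_carrier)
  show "x \<oplus>\<^bsub>G k\<^esub> y = y \<oplus>\<^bsub>G k\<^esub> x" using x y xc yc by (simp add: gr_add a_comm)
  fix z assume "z \<in> carrier (G k)"
  then obtain z' where z: "z' \<in> F (int k)" "z = F (int k - 1) +> z'" by (auto simp: gr_carrier)
  then show "x \<oplus>\<^bsub>G k\<^esub> y \<oplus>\<^bsub>G k\<^esub> z = x \<oplus>\<^bsub>G k\<^esub> (y \<oplus>\<^bsub>G k\<^esub> z)"
    using x y xc yc F_carrier by (simp add: gr_add a_assoc)
qed

lemma coset_F: assumes "x \<in> F (int i)" "y \<in> F (int i - 1) +> x"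
  obtains h where "h \<in> F (int i - 1)" "y = h \<oplus> x" "y \<in> F (int i)"
proof -
  obtain h where h: "h \<in> F (int i - 1)" "y = h \<oplus> x" using assms(2) unfolding coset_mem by blast
  moreover have "h \<in> F (int i)" using h(1) F_mono[of "int i - 1" "int i"] by auto
  ultimately show ?thesis using that assms(1) F_D(3) by blast
qed

lemma symbol_mult: assumes x: "x \<in> F (int i)" and y: "y \<in> F (int j)"
  shows "symbol_mult A F i j (F (int i - 1) +> x) (F (int j - 1) +> y) = F (int i + int j - 1) +> (x \<otimes> y)"
proof -
  note c = F_carrier[OF x] F_carrier[OF y]
  have e: "F (int i + int j - 1) +> (x' \<otimes> y') = F (int i + int j - 1) +> (x \<otimes> y)"
    if x': "x' \<in> F (int i - 1) +> x" and y': "y' \<in> F (int j - 1) +> y" for x' y'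
  proof -
    obtain h where h: "h \<in> F (int i - 1)" "x' = h \<oplus> x" "x' \<in> F (int i)" using coset_F[OF x x'] .
    obtain g where g: "g \<in> F (int j - 1)" "y' = g \<oplus> y" "y' \<in> F (int j)" using coset_F[OF y y'] .
    note c' = F_carrier[OF h(1)] F_carrier[OF g(1)] F_carrier[OF h(3)] F_carrier[OF g(3)]
    have "h \<otimes> y' \<in> F (int i - 1 + int j)" "x \<otimes> g \<in> F (int i + (int j - 1))"
      using h g x F_mult by blast+
    then have m: "h \<otimes> y' \<in> F (int i + int j - 1)" "x \<otimes> g \<in> F (int i + int j - 1)" by (simp_all add: algebra_simps)
    have "x' \<otimes> y' = (h \<otimes> y' \<oplus> x \<otimes> g) \<oplus> x \<otimes> y"
      using c c' by (simp add: h(2) l_distr) (simp add: g(2) r_distr a_assoc)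
    then have "x' \<otimes> y' \<ominus> x \<otimes> y = h \<otimes> y' \<oplus> x \<otimes> g" using c c' by (simp add: a_minus_def a_assoc r_neg)
    then show ?thesis using c c' m F_D(3) by (simp add: coset_eq)
  qed
  have xy: "x \<in> F (int i - 1) +> x" "y \<in> F (int j - 1) +> y"
    unfolding coset_mem using c F_D(2) by (auto intro!: bexI[of _ \<zero>])
  show ?thesis unfolding symbol_mult_def using e xy by blast
qed

lemma commutator_closed: "x \<in> carrier A \<Longrightarrow> y \<in> carrier A \<Longrightarrow> commutator A x y \<in> carrier A"
  by (simp add: commutator_def)

text \<open>Changing a representative by lower order changes the commutator by something one degree
  below the bracket, thanks to \<open>comm\<close>.\<close>

lemma symbol_bracket: assumes x: "x \<in> F (int i)" and y: "y \<in> F (int j)"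
  shows "symbol_bracket A F i j (F (int i - 1) +> x) (F (int j - 1) +> y) = F (int i + int j - 3) +> commutator A x y"
proof -
  note c = F_carrier[OF x] F_carrier[OF y]
  have e: "F (int i + int j - 3) +> commutator A x' y' = F (int i + int j - 3) +> commutator A x y"
    if x': "x' \<in> F (int i - 1) +> x" and y': "y' \<in> F (int j - 1) +> y" for x' y'
  proof -
    obtain h where h: "h \<in> F (int i - 1)" "x' = h \<oplus> x" "x' \<in> F (int i)" using coset_F[OF x x'] .
    obtain g where g: "g \<in> F (int j - 1)" "y' = g \<oplus> y" "y' \<in> F (int j)" using coset_F[OF y y'] .
    note c' = F_carrier[OF h(1)] F_carrier[OF g(1)] F_carrier[OF h(3)] F_carrier[OF g(3)]
    have "commutator A h y' \<in> F (int i - 1 + int j - 2)" "commutator A x g \<in> F (int i + (int j - 1) - 2)"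
      using h g x comm by blast+
    then have m: "commutator A h y' \<in> F (int i + int j - 3)" "commutator A x g \<in> F (int i + int j - 3)"
      by (simp_all add: algebra_simps)
    have l: "commutator A (u \<oplus> v) z = commutator A u z \<oplus> commutator A v z" "commutator A z (u \<oplus> v) = commutator A z u \<oplus> commutator A z v"
      if "u \<in> carrier A" "v \<in> carrier A" "z \<in> carrier A" for u v z
      using that by (simp_all add: commutator_def a_minus_def l_distr r_distr minus_add a_ac)
    have "commutator A x' y' = (commutator A h y' \<oplus> commutator A x g) \<oplus> commutator A x y"
      using c c' l(1)[of h x y'] l(2)[of g y x] by (simp add: h(2)) (simp add: g(2) a_assoc commutator_closed)
    then have "commutator A x' y' \<ominus> commutator A x y = commutator A h y' \<oplus> commutator A x g"
      using c c' by (simp add: a_minus_def a_assoc r_neg commutator_closed)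
    then show ?thesis using c c' m F_D(3) by (simp add: coset_eq commutator_closed)
  qed
  have xy: "x \<in> F (int i - 1) +> x" "y \<in> F (int j - 1) +> y"
    unfolding coset_mem using c F_D(2) by (auto intro!: bexI[of _ \<zero>])
  show ?thesis unfolding symbol_bracket_def using e xy by blast
qed

end

text \<open>Total degrees beyond \<open>N + M\<close> contribute nothing. The slack \<open>d\<close>
  is 2 for the bracket, which lowers degrees by two.\<close>

lemma sum_triangle:
  fixes h :: "nat \<Rightarrow> nat \<Rightarrow> 'a :: comm_monoid_add"
  assumes "\<And>i j. N < i \<or> M < j \<Longrightarrow> h i j = 0"
  shows "(\<Sum>i\<le>N. \<Sum>j\<le>M. h i j) = (\<Sum>k\<le>N + M + d. \<Sum>i\<le>k. h i (k - i))"
proof -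
  have fin: "finite {(i, j). i + j \<le> N + M + d}"
    by (rule finite_subset[of _ "{..N + M + d} \<times> {..N + M + d}"]) auto
  have "(\<Sum>i\<le>N. \<Sum>j\<le>M. h i j) = (\<Sum>(i, j)\<in>{..N} \<times> {..M}. h i j)" by (rule sum.cartesian_product)
  also have "\<dots> = (\<Sum>(i, j)\<in>{(i, j). i + j \<le> N + M + d}. h i j)"
    using assms fin by (intro sum.mono_neutral_left) (auto intro!: leI)
  also have "\<dots> = (\<Sum>k\<le>N + M + d. \<Sum>i\<le>k. h i (k - i))" by (rule sum.triangle_reindex_eq)
  finally show ?thesis .
qed

section \<open>The associated graded algebra\<close>

context euler_data
begin

text \<open>By \<open>pr_filt\<close> this is the filtration of \<open>eAe\<close>, expressed
  through polynomials.\<close>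

definition FF :: "int \<Rightarrow> 'n smash_elem set set set" where "FF i = pr ` {P. sph P \<and> pdeg i P}"

sublocale EE: calg EE by unfold_locales (rule EE_alg)

lemma pr_diff: "sph P \<Longrightarrow> sph Q \<Longrightarrow> pr (P - Q) = pr P \<ominus>\<^bsub>EE\<^esub> pr Q"
proof -
  assume P: "sph P" "sph Q"
  have e: "P - Q = P + cst (-1) * Q" by (rule pf_eqI) (simp add: pfs)
  show ?thesis unfolding e using P by (simp add: pr_add pr_smult sph_simps EE.minus_sm pr_closed)
qed

lemma pr_zero: "pr 0 = \<zero>\<^bsub>EE\<^esub>" using pr_zero_iff[of 0] sph_simps(5) shifted_euler_zero by metis

lemma pr_commutator: "sph P \<Longrightarrow> sph Q \<Longrightarrow> commutator EE (pr P) (pr Q) = pr (star P Q - star Q P)"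
  by (simp add: commutator_def pr_star pr_diff sph_star)

lemma pdeg_star: assumes "sph P" "pdeg a P" "sph Q" "pdeg b Q" shows "pdeg (a + b) (star P Q)"
proof -
  have "pdeg (a + b) ((star P Q - P * Q) + P * Q)"
    using pdeg_mono[OF star_mult[OF assms]] pdeg_mult[OF assms(2,4)] by (intro pdeg_add) auto
  then show ?thesis by simp
qed

lemma pdeg_star_commutator: assumes "sph P" "pdeg a P" "sph Q" "pdeg b Q" shows "pdeg (a + b - 2) (star P Q - star Q P)"
proof -
  have "star P Q - star Q P = (star P Q - star Q P - cst t * pb P Q) + cst t * pb P Q" by simp
  moreover have "pdeg (a + b - 2) (star P Q - star Q P - cst t * pb P Q)"
    by (rule pdeg_mono[OF star_bracket[OF assms]]) simp
  ultimately show ?thesis using pdeg_add[OF _ pdeg_cmult[OF pdeg_pb[OF assms(2,4)]]] by metis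
qed

lemma FF_filtered: "filtered_algebra EE FF"
  unfolding filtered_algebra_def
proof (intro conjI allI ballI impI)
  show "complex_algebra EE" by (rule EE_alg)
  show "subspace_of (FF i) EE" for i
  proof (rule EE.subspaceI)
    show "\<zero>\<^bsub>EE\<^esub> \<in> FF i" unfolding FF_def pr_zero[symmetric] by (intro imageI) (simp add: sph_simps pdeg_zero)
  qed (auto simp: FF_def pr_closed pr_add[symmetric] pr_smult[symmetric] intro!: imageI sph_simps pdeg_add pdeg_cmult)
  show "FF i \<subseteq> FF j" if "i \<le> j" for i j using that pdeg_mono by (auto simp: FF_def)
  show "FF i = {\<zero>\<^bsub>EE\<^esub>}" if "i < 0" for i
  proof -
    have "{P. sph P \<and> pdeg i P} = {0}" using that pdeg_neg sph_simps(5) pdeg_zero by blast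
    then show ?thesis by (simp add: FF_def pr_zero)
  qed
  show "\<one>\<^bsub>EE\<^esub> \<in> FF 0" unfolding FF_def pr_one[symmetric] by (intro imageI) (simp add: sph_simps pdeg_one)
  show "x \<otimes>\<^bsub>EE\<^esub> y \<in> FF (i + j)" if "x \<in> FF i" "y \<in> FF j" for i j x y
    using that by (auto simp: FF_def pr_star[symmetric] intro!: imageI sph_star pdeg_star)
  show "(\<Union>i. FF i) = carrier EE"
  proof (intro equalityI subsetI)
    fix x assume "x \<in> carrier EE"
    then obtain P where P: "sph P" "x = pr P" using pr_surj by blast
    then obtain m where "pdeg m P" using sph_pol pol_def by blast
    then show "x \<in> (\<Union>i. FF i)" using P by (auto simp: FF_def)
  qed (auto simp: FF_def pr_closed)
qed

lemma FF_comm: "x \<in> FF i \<Longrightarrow> y \<in> FF j \<Longrightarrow> commutator EE x y \<in> FF (i + j - 2)"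
  by (auto simp: FF_def pr_commutator intro!: imageI sph_simps sph_star pdeg_star_commutator)

sublocale FA: filt_alg EE FF
  by (intro filt_alg.intro EE.calg_axioms) (unfold_locales, rule FF_filtered, rule FF_comm)

definition symb :: "nat \<Rightarrow> 'n pf \<Rightarrow> 'n smash_elem set set set" where "symb k P = FF (int k - 1) +>\<^bsub>EE\<^esub> pr P"

lemma symb_eq: "sph P \<Longrightarrow> sph Q \<Longrightarrow> symb k P = symb k Q \<longleftrightarrow> pr (P - Q) \<in> FF (int k - 1)"
  by (simp add: symb_def FA.coset_eq pr_closed pr_diff)

lemma symb_eqI: "sph P \<Longrightarrow> sph Q \<Longrightarrow> pdeg (int k - 1) (P - Q) \<Longrightarrow> symb k P = symb k Q"
  by (auto simp: symb_eq FF_def intro!: imageI sph_simps)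

text \<open>This identifies the associated graded of \<open>S\<close> modulo
  \<open>eu - \<zeta>\<close> with \<open>S\<close> modulo \<open>quad\<close>. If
  \<open>P - P'\<close> is \<open>shifted_euler Q\<close> with \<open>P'\<close> of lower degree,
  strictness bounds \<open>Q\<close> by degree \<open>k - 2\<close>, and comparing leading forms
  gives \<open>P = quad * T\<close>. Conversely \<open>quad * R'\<close> drops in degree when
  \<open>shifted_euler R'\<close> is subtracted.\<close>

lemma pr_lower_iff:
  assumes P: "sph P" "phom (int k) P"
  shows "pr P \<in> FF (int k - 1) \<longleftrightarrow> to_cone P = \<zero>\<^bsub>BB\<^esub>"
proof
  assume "pr P \<in> FF (int k - 1)"
  then obtain P' where P': "sph P'" "pdeg (int k - 1) P'" "pr P = pr P'" by (auto simp: FF_def)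
  then have "pr (P - P') = \<zero>\<^bsub>EE\<^esub>" using P by (simp add: pr_diff pr_closed EE.r_right_minus_eq)
  then obtain Q where Q: "sph Q" "P - P' = shifted_euler Q" using pr_zero_iff P P' sph_simps(2) by metis
  have Zl: "pdeg m (shifted_euler Q - quad * Q)" if "pdeg m Q" for m
    using shifted_euler_symbol[OF Q(1) that] .
  have pk: "pdeg (int k) P" using P by (simp add: phom_def)
  have "pdeg (int k) (shifted_euler Q)" unfolding Q(2)[symmetric]
    by (rule pdeg_diff[OF pk pdeg_mono[OF P'(2)]]) simp
  then have lo: "pdeg (int k - 2) Q"
    by (intro pdeg_quad_lower[OF sph_pol[OF Q(1)]]) (auto intro: pdeg_mono[OF Zl])
  show "to_cone P = \<zero>\<^bsub>BB\<^esub>"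
  proof -
    define T where "T = ptop (int k - 2) Q"
    note T = ptop[OF lo, folded T_def]
    have ph: "phom (int k) (quad * T)"
    proof (cases "k < 2")
      case True
      moreover have "pdeg (int k - 2) T" using T(1) by (simp add: phom_def)
      ultimately have "T = 0" by (intro pdeg_neg[of "int k - 2"]) simp_all
      then show ?thesis by (simp add: phom_zero)
    next
      case False then show ?thesis using phom_mult[OF phom_quad T(1)] by simp
    qed
    have "P - quad * T = P' + (shifted_euler Q - quad * Q) + quad * (Q - T)"
      using Q(2) by (simp add: right_diff_distrib algebra_simps)
    moreover have "pdeg (int k - 1) (shifted_euler Q - quad * Q)" by (rule pdeg_mono[OF Zl[OF lo]]) simp
    moreover have "pdeg (2 + (int k - 2 - 1)) (quad * (Q - T))"
      using phom_quad T(2) by (intro pdeg_mult) (auto simp: phom_def)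
    then have "pdeg (int k - 1) (quad * (Q - T))" by simp
    ultimately have "pdeg (int k - 1) (P - quad * T)" using P'(2) by (simp add: pdeg_add)
    then have "P = quad * T" using phom_unique[OF phom_diff[OF P(2) ph]] by simp
    then show ?thesis using P(1) by (simp add: to_cone_zero to_cone_eq_iff sph_simps pfs quad_apply)
  qed
next
  assume "to_cone P = \<zero>\<^bsub>BB\<^esub>"
  then obtain R' where R': "sph R'" "phom (int k - 2) R'" "P = quad * R'" using to_cone_zero_homog[OF P] by blast
  have e: "pr (P - shifted_euler R') = pr P"
  proof -
    have "pr (shifted_euler R') = \<zero>\<^bsub>EE\<^esub>" using pr_zero_iff[OF sph_shifted_euler[OF R'(1)]] R'(1) by blast
    then show ?thesis using P(1) R'(1) by (simp add: pr_diff sph_shifted_euler EE.minus_sm pr_closed)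
  qed
  have "pdeg (int k - 1) (P - shifted_euler R')"
  proof -
    have "pdeg (int k - 2) (shifted_euler R' - quad * R')"
      using shifted_euler_symbol[OF R'(1), of "int k - 2"] R'(2) by (simp add: phom_def)
    then have "pdeg (int k - 2) (- (shifted_euler R' - quad * R'))" by (rule pdeg_uminus)
    then have "pdeg (int k - 2) (P - shifted_euler R')" unfolding R'(3) by simp
    then show ?thesis by (rule pdeg_mono) simp
  qed
  moreover have "sph (P - shifted_euler R')" by (intro sph_simps sph_shifted_euler P R')
  ultimately have "pr (P - shifted_euler R') \<in> FF (int k - 1)" unfolding FF_def by blast
  then show "pr P \<in> FF (int k - 1)" by (simp only: e)
qed

lemma symb_homog_eq:
  assumes "sph P" "phom (int k) P" "sph Q" "phom (int k) Q"
  shows "symb k P = symb k Q \<longleftrightarrow> to_cone P = to_cone Q"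
proof -
  have "symb k P = symb k Q \<longleftrightarrow> to_cone (P - Q) = \<zero>\<^bsub>BB\<^esub>"
    using assms by (simp add: symb_eq pr_lower_iff sph_simps phom_diff)
  also have "\<dots> \<longleftrightarrow> to_cone P = to_cone Q" using assms by (simp add: to_cone_zero to_cone_eq_iff sph_simps pfs)
  finally show ?thesis .
qed

abbreviation "Gk k \<equiv> gr_piece EE FF k"

lemma Gk_zero: "\<zero>\<^bsub>Gk k\<^esub> = symb k 0" using FA.coset_zero by (simp add: FA.gr_zero symb_def pr_zero)

lemma Gk_add: "sph P \<Longrightarrow> sph Q \<Longrightarrow> symb k P \<oplus>\<^bsub>Gk k\<^esub> symb k Q = symb k (P + Q)"
  by (simp add: symb_def FA.gr_add pr_closed pr_add)

lemma Gk_smult: "sph P \<Longrightarrow> a \<odot>\<^bsub>Gk k\<^esub> symb k P = symb k (cst a * P)"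
  by (simp add: symb_def FA.gr_smult pr_closed pr_smult)

text \<open>Replacing a representative by its leading form changes it only by lower order, so every
  class has a homogeneous representative.\<close>

lemma Gk_carrier: "carrier (Gk k) = symb k ` {P. sph P \<and> phom (int k) P}"
proof (intro equalityI subsetI)
  fix x assume "x \<in> carrier (Gk k)"
  then obtain P where P: "sph P" "pdeg (int k) P" "x = symb k P" by (auto simp: FA.gr_carrier FF_def symb_def)
  have "x = symb k (ptop (int k) P)" unfolding P(3)
    by (rule symb_eqI) (use P sph_ptop ptop(2) in auto)
  then show "x \<in> symb k ` {P. sph P \<and> phom (int k) P}" using P sph_ptop ptop(1) by blast
qed (auto simp: FA.gr_carrier FF_def symb_def phom_def)

lemma Gk_finsum:
  assumes "finite I" "\<And>i. i \<in> I \<Longrightarrow> sph (T i) \<and> phom (int k) (T i)"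
  shows "finsum (Gk k) (\<lambda>i. symb k (T i)) I = symb k (\<Sum>i\<in>I. T i)"
proof -
  interpret Gk: abelian_group "Gk k" by (rule FA.gr_group)
  show ?thesis using assms
  proof (induction I rule: finite_induct)
    case (insert i I)
    have "finsum (Gk k) (\<lambda>i. symb k (T i)) (insert i I) = symb k (T i) \<oplus>\<^bsub>Gk k\<^esub> finsum (Gk k) (\<lambda>i. symb k (T i)) I"
      using insert by (intro Gk.finsum_insert) (auto simp: Gk_carrier)
    then show ?case using insert by (simp add: Gk_add sph_sum)
  qed (simp add: Gk_zero)
qed

abbreviation "CG \<equiv> assoc_graded EE FF"

text \<open>Representatives of the components of a graded element. They are eventually zero as
  polynomials and not only as classes, so that sums over all degrees are finite.\<close>

definition homog_family :: "(nat \<Rightarrow> 'n pf) \<Rightarrow> bool" where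
  "homog_family f \<longleftrightarrow> (\<forall>k. sph (f k) \<and> phom (int k) (f k)) \<and> (\<exists>N. \<forall>k>N. f k = 0)"

definition graded_of :: "(nat \<Rightarrow> 'n pf) \<Rightarrow> nat \<Rightarrow> 'n smash_elem set set set" where "graded_of f = (\<lambda>k. symb k (f k))"

lemma famD: "homog_family f \<Longrightarrow> sph (f k)" "homog_family f \<Longrightarrow> phom (int k) (f k)" "homog_family f \<Longrightarrow> pdeg (int k) (f k)"
  by (simp_all add: homog_family_def phom_def)

lemma homog_family_bound: assumes "homog_family f" "homog_family g" obtains N where "\<And>k. N < k \<Longrightarrow> f k = 0" "\<And>k. N < k \<Longrightarrow> g k = 0"
proof -
  obtain N M where "\<forall>k>N. f k = 0" "\<forall>k>M. g k = 0" using assms unfolding homog_family_def by blast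
  then show ?thesis using that[of "max N M"] by auto
qed

lemma CG_simps: "carrier CG = {f. (\<forall>k. f k \<in> carrier (Gk k)) \<and> finite {k. f k \<noteq> \<zero>\<^bsub>Gk k\<^esub>}}"
  "f \<otimes>\<^bsub>CG\<^esub> g = (\<lambda>k. \<Oplus>\<^bsub>Gk k\<^esub>i\<in>{..k}. symbol_mult EE FF i (k - i) (f i) (g (k - i)))"
  "\<one>\<^bsub>CG\<^esub> = (\<lambda>k. if k = 0 then FF (-1) +>\<^bsub>EE\<^esub> \<one>\<^bsub>EE\<^esub> else \<zero>\<^bsub>Gk k\<^esub>)"
  "f \<oplus>\<^bsub>CG\<^esub> g = (\<lambda>k. f k \<oplus>\<^bsub>Gk k\<^esub> g k)"
  "a \<odot>\<^bsub>CG\<^esub> f = (\<lambda>k. a \<odot>\<^bsub>Gk k\<^esub> f k)"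
  "pbracket CG f g = (\<lambda>k. \<Oplus>\<^bsub>Gk k\<^esub>i\<in>{..k + 2}. symbol_bracket EE FF i (k + 2 - i) (f i) (g (k + 2 - i)))"
  "homog CG j = {f \<in> carrier CG. \<forall>i. i \<noteq> j \<longrightarrow> f i = \<zero>\<^bsub>Gk i\<^esub>}"
  by (simp_all add: assoc_graded_def Let_def)

lemma CG_carrier: "carrier CG = graded_of ` {f. homog_family f}"
proof (intro equalityI subsetI)
  fix x assume "x \<in> carrier CG"
  then have x: "\<And>k. x k \<in> carrier (Gk k)" "finite {k. x k \<noteq> \<zero>\<^bsub>Gk k\<^esub>}" by (auto simp: CG_simps(1))
  \<comment> \<open>A zero class gets the representative 0, which keeps the family finitely
    supported.\<close>
  have "\<exists>P. sph P \<and> phom (int k) P \<and> x k = symb k P \<and> (x k = \<zero>\<^bsub>Gk k\<^esub> \<longrightarrow> P = 0)" for k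
    using x(1)[of k] sph_simps(5) phom_zero Gk_zero unfolding Gk_carrier by (cases "x k = \<zero>\<^bsub>Gk k\<^esub>") auto
  then obtain f where f: "\<And>k. sph (f k) \<and> phom (int k) (f k) \<and> x k = symb k (f k) \<and> (x k = \<zero>\<^bsub>Gk k\<^esub> \<longrightarrow> f k = 0)"
    by metis
  obtain N where "\<forall>k\<in>{k. x k \<noteq> \<zero>\<^bsub>Gk k\<^esub>}. k \<le> N" using x(2) by (meson finite_nat_set_iff_bounded_le)
  then have "\<forall>k>N. f k = 0" using f by (metis (mono_tags, lifting) mem_Collect_eq not_le)
  then have "homog_family f" "x = graded_of f" using f by (auto simp: homog_family_def graded_of_def)
  then show "x \<in> graded_of ` {f. homog_family f}" by blast
next
  fix x assume "x \<in> graded_of ` {f. homog_family f}"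
  then obtain f where f: "homog_family f" "x = graded_of f" by blast
  obtain N where N: "\<And>k. N < k \<Longrightarrow> f k = 0" using f(1) by (auto simp: homog_family_def)
  have "{k. x k \<noteq> \<zero>\<^bsub>Gk k\<^esub>} \<subseteq> {..N}" using N by (auto simp: f(2) graded_of_def Gk_zero intro: leI)
  then show "x \<in> carrier CG" using finite_subset f famD by (auto simp: CG_simps(1) Gk_carrier graded_of_def)
qed

text \<open>Commutators of symbols are \<open>t\<close> times the bracket of polynomials, which pulls back minus the
  bracket of the orbit.  Multiplying degree \<open>k\<close> by \<open>\<mu> ^ k\<close> absorbs the factor \<open>- t\<close>.\<close>

definition \<mu> :: complex where "\<mu> = csqrt (- t)"
lemma \<mu>: "\<mu> * \<mu> = - t" "\<mu> \<noteq> 0" using power2_csqrt[of "- t"] t_nz by (auto simp: \<mu>_def power2_eq_square)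

definition regrade :: "(nat \<Rightarrow> 'n pf) \<Rightarrow> 'n pf" where "regrade f = (\<Sum>k\<in>{k. f k \<noteq> 0}. cst (\<mu> ^ k) * f k)"

lemma regrade_eq: assumes "\<And>k. N < k \<Longrightarrow> f k = 0" shows "regrade f = (\<Sum>k\<le>N. cst (\<mu> ^ k) * f k)"
  unfolding regrade_def using assms by (intro sum.mono_neutral_left) (auto intro: leI)

lemma sph_regrade: "homog_family f \<Longrightarrow> sph (regrade f)" unfolding regrade_def by (intro sph_sum sph_simps famD)

definition conv :: "(nat \<Rightarrow> 'n pf) \<Rightarrow> (nat \<Rightarrow> 'n pf) \<Rightarrow> nat \<Rightarrow> 'n pf" where "conv f g k = (\<Sum>i\<le>k. f i * g (k - i))"
definition brk :: "(nat \<Rightarrow> 'n pf) \<Rightarrow> (nat \<Rightarrow> 'n pf) \<Rightarrow> nat \<Rightarrow> 'n pf" where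
  "brk f g k = (\<Sum>i\<le>k + 2. cst t * pb (f i) (g (k + 2 - i)))"

lemma conv_homog: "homog_family f \<Longrightarrow> homog_family g \<Longrightarrow> i \<le> k \<Longrightarrow> sph (f i * g (k - i)) \<and> phom (int k) (f i * g (k - i))"
  using phom_mult[OF famD(2) famD(2), of f g i "k - i"] by (simp add: sph_simps famD)

lemma brk_homog:
  assumes "homog_family f" "homog_family g" "i \<le> k + 2"
  shows "sph (cst t * pb (f i) (g (k + 2 - i))) \<and> phom (int k) (cst t * pb (f i) (g (k + 2 - i)))"
proof -
  have "int i + int (k + 2 - i) - 2 = int k" "2 \<le> int i + int (k + 2 - i)" using assms(3) by auto
  then have "phom (int k) (pb (f i) (g (k + 2 - i)))"
    using phom_pb[OF famD(2)[OF assms(1), of i] famD(2)[OF assms(2), of "k + 2 - i"]] by simp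
  then show ?thesis using assms by (simp add: sph_simps sph_pb famD phom_cmult)
qed

lemma homog_family_conv: assumes f: "homog_family f" and g: "homog_family g" shows "homog_family (conv f g)"
proof -
  obtain N where N: "\<And>k. N < k \<Longrightarrow> f k = 0" "\<And>k. N < k \<Longrightarrow> g k = 0" using homog_family_bound[OF f g] by blast
  have "conv f g k = 0" if "N + N < k" for k
    unfolding conv_def
  proof (intro sum.neutral ballI)
    fix i assume "i \<in> {..k}"
    then have "N < i \<or> N < k - i" using that by auto
    then show "f i * g (k - i) = 0" using N by auto
  qed
  moreover have "sph (conv f g k) \<and> phom (int k) (conv f g k)" for k
    unfolding conv_def using conv_homog[OF f g] by (auto intro!: sph_sum phom_sum)
  ultimately show ?thesis unfolding homog_family_def by blast
qed

lemma homog_family_brk: assumes f: "homog_family f" and g: "homog_family g" shows "homog_family (brk f g)"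
proof -
  obtain N where N: "\<And>k. N < k \<Longrightarrow> f k = 0" "\<And>k. N < k \<Longrightarrow> g k = 0" using homog_family_bound[OF f g] by blast
  have "brk f g k = 0" if "N + N < k" for k
    unfolding brk_def
  proof (intro sum.neutral ballI)
    fix i assume "i \<in> {..k + 2}"
    then have "N < i \<or> N < k + 2 - i" using that by auto
    then show "cst t * pb (f i) (g (k + 2 - i)) = 0" using N by (auto simp: pb_zero)
  qed
  moreover have "sph (brk f g k) \<and> phom (int k) (brk f g k)" for k
    unfolding brk_def by (intro conjI sph_sum phom_sum) (simp_all only: atMost_iff brk_homog[OF f g])
  ultimately show ?thesis unfolding homog_family_def by blast
qed

lemma pr_FF: "sph P \<Longrightarrow> pdeg i P \<Longrightarrow> pr P \<in> FF i" by (auto simp: FF_def)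

text \<open>\<open>star\<close> deviates from the product of polynomials only two degrees down,
  which a symbol does not see.\<close>

lemma graded_of_mult: assumes f: "homog_family f" and g: "homog_family g" shows "graded_of f \<otimes>\<^bsub>CG\<^esub> graded_of g = graded_of (conv f g)"
proof
  fix k
  have s: "symbol_mult EE FF i (k - i) (graded_of f i) (graded_of g (k - i)) = symb k (f i * g (k - i))" if i: "i \<le> k" for i
  proof -
    note fi = famD(1,3)[OF f, of i] and gi = famD(1,3)[OF g, of "k - i"]
    have k: "int i + int (k - i) = int k" using i by simp
    have "symbol_mult EE FF i (k - i) (graded_of f i) (graded_of g (k - i)) = symb k (star (f i) (g (k - i)))"
      unfolding graded_of_def symb_def using FA.symbol_mult[OF pr_FF[OF fi] pr_FF[OF gi]] fi gi
      by (simp only: k pr_star)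
    also have "\<dots> = symb k (f i * g (k - i))"
    proof (rule symb_eqI)
      show "pdeg (int k - 1) (star (f i) (g (k - i)) - f i * g (k - i))"
        using pdeg_mono[OF star_mult[OF fi gi]] i by simp
    qed (use fi gi in \<open>simp_all add: sph_star sph_simps\<close>)
    finally show ?thesis .
  qed
  interpret Gk: abelian_group "Gk k" by (rule FA.gr_group)
  have "(graded_of f \<otimes>\<^bsub>CG\<^esub> graded_of g) k = finsum (Gk k) (\<lambda>i. symb k (f i * g (k - i))) {..k}"
    unfolding CG_simps(2) using conv_homog[OF f g] by (intro Gk.finsum_cong') (auto simp: s Gk_carrier)
  also have "\<dots> = symb k (conv f g k)" unfolding conv_def using conv_homog[OF f g] by (intro Gk_finsum) auto
  finally show "(graded_of f \<otimes>\<^bsub>CG\<^esub> graded_of g) k = graded_of (conv f g) k" by (simp add: graded_of_def)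
qed

text \<open>Here the error bound of \<open>star_bracket\<close> pays off: it lies four degrees below
  the product, hence below the bracket, which sits two degrees down.\<close>

lemma graded_of_bracket: assumes f: "homog_family f" and g: "homog_family g" shows "pbracket CG (graded_of f) (graded_of g) = graded_of (brk f g)"
proof
  fix k
  have s: "symbol_bracket EE FF i (k + 2 - i) (graded_of f i) (graded_of g (k + 2 - i)) = symb k (cst t * pb (f i) (g (k + 2 - i)))"
    if i: "i \<le> k + 2" for i
  proof -
    note fi = famD(1,3)[OF f, of i] and gi = famD(1,3)[OF g, of "k + 2 - i"]
    have k: "int i + int (k + 2 - i) - 3 = int k - 1" "int i + int (k + 2 - i) - 4 \<le> int k - 1" using i by auto
    have "symbol_bracket EE FF i (k + 2 - i) (graded_of f i) (graded_of g (k + 2 - i)) =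
        symb k (star (f i) (g (k + 2 - i)) - star (g (k + 2 - i)) (f i))"
      unfolding graded_of_def symb_def using FA.symbol_bracket[OF pr_FF[OF fi] pr_FF[OF gi]] fi gi
      by (simp only: k pr_commutator)
    also have "\<dots> = symb k (cst t * pb (f i) (g (k + 2 - i)))"
    proof (rule symb_eqI)
      show "pdeg (int k - 1) (star (f i) (g (k + 2 - i)) - star (g (k + 2 - i)) (f i) - cst t * pb (f i) (g (k + 2 - i)))"
        by (rule pdeg_mono[OF star_bracket[OF fi gi] k(2)])
    qed (use fi gi in \<open>simp_all add: sph_star sph_simps sph_pb\<close>)
    finally show ?thesis .
  qed
  interpret Gk: abelian_group "Gk k" by (rule FA.gr_group)
  have "pbracket CG (graded_of f) (graded_of g) k = finsum (Gk k) (\<lambda>i. symb k (cst t * pb (f i) (g (k + 2 - i)))) {..k + 2}"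
    unfolding CG_simps(6)
  proof (rule Gk.finsum_cong'[OF refl])
    show "(\<lambda>i. symb k (cst t * pb (f i) (g (k + 2 - i)))) \<in> {..k + 2} \<rightarrow> carrier (Gk k)"
      unfolding Gk_carrier using brk_homog[OF f g] by blast
  qed (simp only: s atMost_iff)
  also have "\<dots> = symb k (brk f g k)" unfolding brk_def using brk_homog[OF f g] by (intro Gk_finsum) auto
  finally show "pbracket CG (graded_of f) (graded_of g) k = graded_of (brk f g) k" by (simp add: graded_of_def)
qed

lemma regrade_conv: assumes f: "homog_family f" and g: "homog_family g" shows "regrade (conv f g) = regrade f * regrade g"
proof -
  obtain N where N: "\<And>k. N < k \<Longrightarrow> f k = 0" "\<And>k. N < k \<Longrightarrow> g k = 0" using homog_family_bound[OF f g] by blast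
  have tf: "regrade f = (\<Sum>k\<le>N. cst (\<mu> ^ k) * f k)" by (rule regrade_eq) (rule N)
  have tg: "regrade g = (\<Sum>k\<le>N. cst (\<mu> ^ k) * g k)" by (rule regrade_eq) (rule N)
  have c0: "conv f g k = 0" if "N + N < k" for k
    unfolding conv_def
  proof (intro sum.neutral ballI)
    fix i assume "i \<in> {..k}"
    then have "N < i \<or> N < k - i" using that by auto
    then show "f i * g (k - i) = 0" using N by auto
  qed
  have "regrade f * regrade g = (\<Sum>i\<le>N. \<Sum>j\<le>N. cst (\<mu> ^ (i + j)) * (f i * g j))"
    unfolding tf tg sum_product by (simp add: power_add cst_simps(3)[symmetric] mult_ac)
  also have "\<dots> = (\<Sum>k\<le>N + N + 0. \<Sum>i\<le>k. cst (\<mu> ^ (i + (k - i))) * (f i * g (k - i)))"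
    by (rule sum_triangle) (use N in auto)
  also have "\<dots> = (\<Sum>k\<le>N + N. cst (\<mu> ^ k) * conv f g k)"
    unfolding conv_def sum_distrib_left by (intro sum.cong) auto
  also have "\<dots> = regrade (conv f g)" by (rule regrade_eq[symmetric]) (rule c0)
  finally show ?thesis by simp
qed

lemma regrade_brk: assumes f: "homog_family f" and g: "homog_family g" shows "regrade (brk f g) = - pb (regrade f) (regrade g)"
proof -
  obtain N where N: "\<And>k. N < k \<Longrightarrow> f k = 0" "\<And>k. N < k \<Longrightarrow> g k = 0" using homog_family_bound[OF f g] by blast
  have tf: "regrade f = (\<Sum>k\<le>N. cst (\<mu> ^ k) * f k)" by (rule regrade_eq) (rule N)
  have tg: "regrade g = (\<Sum>k\<le>N. cst (\<mu> ^ k) * g k)" by (rule regrade_eq) (rule N)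
  have c0: "brk f g k = 0" if "N + N < k" for k
    unfolding brk_def
  proof (intro sum.neutral ballI)
    fix i assume "i \<in> {..k + 2}"
    then have "N < i \<or> N < k + 2 - i" using that by auto
    then show "cst t * pb (f i) (g (k + 2 - i)) = 0" using N by (auto simp: pb_zero)
  qed
  define h where "h i j = cst (\<mu> ^ (i + j)) * pb (f i) (g j)" for i j
  have h0: "h i j = 0" if "i + j < 2" for i j
    using pb_low[OF famD(3)[OF f] famD(3)[OF g], of i j] that by (simp add: h_def)
  have p: "pol (f i)" "pol (g i)" for i using f g famD(1) sph_pol by blast+
  have "pb (regrade f) (regrade g) = (\<Sum>i\<le>N. \<Sum>j\<le>N. h i j)"
    unfolding tf tg
    by (subst sum.swap) (simp add: pb_sum pb_cmult p pol_mult pol_cst pol_sum h_def power_add cst_simps(3)[symmetric] sum_distrib_left mult.assoc mult.left_commute)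
  also have "\<dots> = (\<Sum>k\<le>N + N + 2. \<Sum>i\<le>k. h i (k - i))"
    by (rule sum_triangle) (use N in \<open>auto simp: h_def pb_zero\<close>)
  also have "\<dots> = (\<Sum>k\<le>Suc (Suc (N + N)). \<Sum>i\<le>k. h i (k - i))" by simp
  \<comment> \<open>Total degrees 0 and 1 carry no bracket, so the sum may be shifted by
    two.\<close>
  also have "\<dots> = (\<Sum>k\<le>N + N. \<Sum>i\<le>k + 2. h i (k + 2 - i))"
    unfolding sum.atMost_Suc_shift[of _ "Suc (N + N)"] sum.atMost_Suc_shift[of _ "N + N"] by (simp add: h0)
  also have "\<dots> = (\<Sum>k\<le>N + N. - (cst (\<mu> ^ k) * brk f g k))"
  proof (rule sum.cong[OF refl])
    fix k
    have "h i (k + 2 - i) = - (cst (\<mu> ^ k) * (cst t * pb (f i) (g (k + 2 - i))))" if "i \<le> k + 2" for i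
    proof -
      \<comment> \<open>The two factors \<open>\<mu>\<close> in excess of degree \<open>k\<close>
        supply the constant \<open>- t\<close>.\<close>
      have "\<mu> ^ (i + (k + 2 - i)) = \<mu> ^ k * (\<mu> * \<mu>)" using that by (simp add: mult_ac)
      then have "\<mu> ^ (i + (k + 2 - i)) = - (\<mu> ^ k * t)" unfolding \<mu>(1) by simp
      then show ?thesis by (simp add: h_def cst_simps(3)[symmetric] cst_simps(5)[symmetric] mult.assoc)
    qed
    then show "(\<Sum>i\<le>k + 2. h i (k + 2 - i)) = - (cst (\<mu> ^ k) * brk f g k)"
      unfolding brk_def sum_distrib_left sum_negf[symmetric] by (intro sum.cong) auto
  qed
  also have "\<dots> = - regrade (brk f g)" by (subst regrade_eq[of "N + N"]) (use c0 in \<open>simp_all add: sum_negf\<close>)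
  finally show ?thesis by simp
qed

text \<open>Independent of the chosen family: families with the same symbols agree on the cone in
  every degree (\<open>graded_of_eq_iff\<close>).\<close>

definition \<phi> :: "(nat \<Rightarrow> 'n smash_elem set set set) \<Rightarrow> 'n cmat \<Rightarrow> complex" where
  "\<phi> x = to_cone (regrade (SOME f. homog_family f \<and> graded_of f = x))"

lemma graded_of_eq_iff: "homog_family f \<Longrightarrow> homog_family g \<Longrightarrow> graded_of f = graded_of g \<longleftrightarrow> (\<forall>k. to_cone (f k) = to_cone (g k))"
  by (simp add: graded_of_def fun_eq_iff symb_homog_eq famD)

lemma regrade_to_cone_cong:
  assumes f: "homog_family f" and g: "homog_family g" and e: "\<And>k. to_cone (f k) = to_cone (g k)" shows "to_cone (regrade f) = to_cone (regrade g)"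
proof -
  obtain N where N: "\<And>k. N < k \<Longrightarrow> f k = 0" "\<And>k. N < k \<Longrightarrow> g k = 0" using homog_family_bound[OF f g] by blast
  have tf: "regrade f = (\<Sum>k\<le>N. cst (\<mu> ^ k) * f k)" by (rule regrade_eq) (rule N)
  have tg: "regrade g = (\<Sum>k\<le>N. cst (\<mu> ^ k) * g k)" by (rule regrade_eq) (rule N)
  have "regrade f v \<xi> = regrade g v \<xi>" if "pairing \<xi> v = 0" for v \<xi>
    unfolding tf tg sum_fun_apply
    using e that f g by (intro sum.cong) (simp_all add: pfs to_cone_eq_iff famD)
  then show ?thesis using f g by (simp add: to_cone_eq_iff sph_regrade)
qed

lemma \<phi>_graded_of: assumes f: "homog_family f" shows "\<phi> (graded_of f) = to_cone (regrade f)"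
proof -
  let ?g = "SOME g. homog_family g \<and> graded_of g = graded_of f"
  have g: "homog_family ?g \<and> graded_of ?g = graded_of f" by (rule someI[of _ f]) (simp add: f)
  then show ?thesis unfolding \<phi>_def using graded_of_eq_iff[of ?g f] f by (intro regrade_to_cone_cong) auto
qed

lemma homog_family_add: "homog_family f \<Longrightarrow> homog_family g \<Longrightarrow> homog_family (\<lambda>k. f k + g k)"
  using homog_family_bound[of f g] unfolding homog_family_def by (metis add.right_neutral sph_simps(1) phom_add)

lemma homog_family_cmult: "homog_family f \<Longrightarrow> homog_family (\<lambda>k. cst (a k) * f k)"
  unfolding homog_family_def by (metis sph_simps(3,4) mult_zero_right phom_cmult)

lemma regrade_add: assumes "homog_family f" "homog_family g" shows "regrade (\<lambda>k. f k + g k) = regrade f + regrade g"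
proof -
  obtain N where N: "\<And>k. N < k \<Longrightarrow> f k = 0" "\<And>k. N < k \<Longrightarrow> g k = 0" using homog_family_bound[OF assms] by blast
  have tf: "regrade f = (\<Sum>k\<le>N. cst (\<mu> ^ k) * f k)" by (rule regrade_eq) (rule N)
  have tg: "regrade g = (\<Sum>k\<le>N. cst (\<mu> ^ k) * g k)" by (rule regrade_eq) (rule N)
  show ?thesis unfolding tf tg
    by (subst regrade_eq[of N]) (use N in \<open>simp_all add: distrib_left sum.distrib\<close>)
qed

lemma regrade_single: "regrade (\<lambda>i. if i = k then P else 0) = cst (\<mu> ^ k) * P"
  by (subst regrade_eq[of k]) (simp_all add: if_distrib cong: if_cong)

lemma homog_family_single: "sph P \<Longrightarrow> phom (int k) P \<Longrightarrow> homog_family (\<lambda>i. if i = k then P else 0)"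
  unfolding homog_family_def by (auto simp: sph_simps phom_zero)

lemma \<phi>_surj: assumes "sph P" obtains f where "homog_family f" "to_cone P = \<phi> (graded_of f)"
proof -
  obtain N T where T: "\<And>k. sph (T k)" "\<And>k. phom (int k) (T k)" "\<And>k. N < k \<Longrightarrow> T k = 0" "P = (\<Sum>k\<le>N. T k)"
    using sph_homogeneous_sum[OF assms] by blast
  then have "homog_family T" unfolding homog_family_def by blast
  then have f: "homog_family (\<lambda>k. cst (inverse \<mu> ^ k) * T k)" by (rule homog_family_cmult)
  \<comment> \<open>The powers of \<open>inverse \<mu>\<close> undo the rescaling built into
    \<open>regrade\<close>.\<close>
  have "regrade (\<lambda>k. cst (inverse \<mu> ^ k) * T k) = (\<Sum>k\<le>N. cst (\<mu> ^ k) * (cst (inverse \<mu> ^ k) * T k))"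
    by (rule regrade_eq) (simp add: T)
  also have "\<dots> = P" unfolding T(4)
    by (rule sum.cong) (simp_all add: mult.assoc[symmetric] cst_simps(3) power_mult_distrib[symmetric] \<mu> cst_simps(2))
  finally show ?thesis using that[OF f] by (simp add: \<phi>_graded_of f)
qed

lemma \<phi>_inj: assumes f: "homog_family f" and g: "homog_family g" and e: "\<phi> (graded_of f) = \<phi> (graded_of g)" shows "graded_of f = graded_of g"
proof -
  obtain N where N: "\<And>k. N < k \<Longrightarrow> f k = 0" "\<And>k. N < k \<Longrightarrow> g k = 0" using homog_family_bound[OF f g] by blast
  have tf: "regrade f = (\<Sum>k\<le>N. cst (\<mu> ^ k) * f k)" by (rule regrade_eq) (rule N)
  have tg: "regrade g = (\<Sum>k\<le>N. cst (\<mu> ^ k) * g k)" by (rule regrade_eq) (rule N)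
  have "to_cone (\<Sum>k\<le>N. cst (\<mu> ^ k) * f k) = to_cone (\<Sum>k\<le>N. cst (\<mu> ^ k) * g k)"
    using e f g by (simp add: \<phi>_graded_of tf tg)
  then have "to_cone (cst (\<mu> ^ k) * f k) = to_cone (cst (\<mu> ^ k) * g k)" for k
    by (intro decomp_unique[of "\<lambda>k. cst (\<mu> ^ k) * f k" "\<lambda>k. cst (\<mu> ^ k) * g k" "{..N}" "{..N}"])
      (use f g N in \<open>simp_all add: sph_simps famD phom_cmult to_cone_zero\<close>)
  then have "to_cone (f k) = to_cone (g k)" for k
    using f g \<mu>(2) by (simp add: to_cone_eq_iff sph_simps famD pfs)
  then show ?thesis using f g by (simp add: graded_of_eq_iff)
qed

lemma graded_of_ops:
  "homog_family f \<Longrightarrow> homog_family g \<Longrightarrow> graded_of f \<oplus>\<^bsub>CG\<^esub> graded_of g = graded_of (\<lambda>k. f k + g k)"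
  "homog_family f \<Longrightarrow> a \<odot>\<^bsub>CG\<^esub> graded_of f = graded_of (\<lambda>k. cst a * f k)"
  "\<one>\<^bsub>CG\<^esub> = graded_of (\<lambda>k. if k = 0 then 1 else 0)"
proof -
  show "homog_family f \<Longrightarrow> homog_family g \<Longrightarrow> graded_of f \<oplus>\<^bsub>CG\<^esub> graded_of g = graded_of (\<lambda>k. f k + g k)"
    by (simp add: CG_simps(4) graded_of_def Gk_add famD)
  show "homog_family f \<Longrightarrow> a \<odot>\<^bsub>CG\<^esub> graded_of f = graded_of (\<lambda>k. cst a * f k)"
    by (simp add: CG_simps(5) graded_of_def Gk_smult famD)
  have "FF (-1) +>\<^bsub>EE\<^esub> \<one>\<^bsub>EE\<^esub> = symb 0 1" by (simp add: symb_def pr_one)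
  then show "\<one>\<^bsub>CG\<^esub> = graded_of (\<lambda>k. if k = 0 then 1 else 0)" by (intro HOL.ext) (simp add: CG_simps(3) graded_of_def Gk_zero)
qed

lemma regrade_smult: assumes "homog_family f" shows "regrade (\<lambda>k. cst a * f k) = cst a * regrade f"
proof -
  obtain N where N: "\<And>k. N < k \<Longrightarrow> f k = 0" using assms by (auto simp: homog_family_def)
  have tf: "regrade f = (\<Sum>k\<le>N. cst (\<mu> ^ k) * f k)" by (rule regrade_eq) (rule N)
  show ?thesis unfolding tf
    by (subst regrade_eq[of N]) (use N in \<open>simp_all add: sum_distrib_left mult.left_commute\<close>)
qed

lemma CG_cases: assumes "x \<in> carrier CG" obtains f where "homog_family f" "x = graded_of f"
  using assms unfolding CG_carrier by blast

lemma CG_homog: "homog CG k = (\<lambda>P. graded_of (\<lambda>i. if i = k then P else 0)) ` {P. sph P \<and> phom (int k) P}"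
proof (intro equalityI subsetI)
  fix x assume x: "x \<in> homog CG k"
  then have xc: "x \<in> carrier CG" and xz: "\<And>i. i \<noteq> k \<Longrightarrow> x i = \<zero>\<^bsub>Gk i\<^esub>" by (auto simp: CG_simps(7))
  obtain f where f: "homog_family f" "x = graded_of f" using xc by (rule CG_cases)
  have "x = graded_of (\<lambda>i. if i = k then f k else 0)"
    using xz f(2) by (auto simp: graded_of_def fun_eq_iff Gk_zero)
  then show "x \<in> (\<lambda>P. graded_of (\<lambda>i. if i = k then P else 0)) ` {P. sph P \<and> phom (int k) P}"
    using famD[OF f(1)] by blast
next
  fix x assume "x \<in> (\<lambda>P. graded_of (\<lambda>i. if i = k then P else 0)) ` {P. sph P \<and> phom (int k) P}"
  then obtain P where P: "sph P" "phom (int k) P" "x = graded_of (\<lambda>i. if i = k then P else 0)" by blast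
  then have "x \<in> carrier CG" using homog_family_single CG_carrier by blast
  then show "x \<in> homog CG k" unfolding CG_simps(7) by (simp add: P(3) graded_of_def Gk_zero)
qed

lemma \<phi>_iso: "graded_poisson_iso \<phi> CG BB"
  unfolding graded_poisson_iso_def
proof (intro conjI allI ballI)
  have hom: "\<phi> \<in> ring_hom CG BB"
  proof (rule ring_hom_memI)
    fix x assume "x \<in> carrier CG"
    then obtain f where f: "homog_family f" "x = graded_of f" by (rule CG_cases)
    then show "\<phi> x \<in> carrier BB" by (simp add: \<phi>_graded_of to_cone_carrier sph_regrade)
    fix y assume "y \<in> carrier CG"
    then obtain g where g: "homog_family g" "y = graded_of g" by (rule CG_cases)
    show "\<phi> (x \<otimes>\<^bsub>CG\<^esub> y) = \<phi> x \<otimes>\<^bsub>BB\<^esub> \<phi> y"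
      using f g by (simp add: graded_of_mult \<phi>_graded_of homog_family_conv regrade_conv to_cone_mult sph_regrade)
    show "\<phi> (x \<oplus>\<^bsub>CG\<^esub> y) = \<phi> x \<oplus>\<^bsub>BB\<^esub> \<phi> y"
      using f g by (simp add: graded_of_ops \<phi>_graded_of homog_family_add regrade_add to_cone_add sph_regrade)
  next
    have "phom (int 0) 1" using pdeg_phom[OF pol_one, of 0] by (simp add: pfs)
    then have "homog_family (\<lambda>k. if k = 0 then 1 else 0)" using homog_family_single[OF sph_simps(6)] by blast
    then show "\<phi> \<one>\<^bsub>CG\<^esub> = \<one>\<^bsub>BB\<^esub>" by (simp add: graded_of_ops(3) \<phi>_graded_of regrade_single to_cone_one cst_simps)
  qed
  moreover have "bij_betw \<phi> (carrier CG) (carrier BB)"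
  proof (rule bij_betw_imageI)
    show "inj_on \<phi> (carrier CG)" by (rule inj_onI) (metis CG_cases \<phi>_inj)
    show "\<phi> ` carrier CG = carrier BB"
    proof (intro equalityI subsetI)
      fix y assume "y \<in> carrier BB"
      then obtain P where "sph P" "y = to_cone P" by (rule BB_cases)
      then show "y \<in> \<phi> ` carrier CG" using \<phi>_surj CG_carrier by (metis (mono_tags, lifting) imageI mem_Collect_eq)
    qed (use hom in \<open>auto simp: ring_hom_def\<close>)
  qed
  ultimately show "\<phi> \<in> ring_iso CG BB" by (simp add: ring_iso_def)
  fix x assume "x \<in> carrier CG"
  then obtain f where f: "homog_family f" "x = graded_of f" by (rule CG_cases)
  show "\<phi> (a \<odot>\<^bsub>CG\<^esub> x) = a \<odot>\<^bsub>BB\<^esub> \<phi> x" for a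
    using f by (simp add: graded_of_ops \<phi>_graded_of homog_family_cmult regrade_smult to_cone_smult sph_regrade)
  fix y assume "y \<in> carrier CG"
  then obtain g where g: "homog_family g" "y = graded_of g" by (rule CG_cases)
  show "\<phi> (pbracket CG x y) = pbracket BB (\<phi> x) (\<phi> y)"
    using f g by (simp add: graded_of_bracket \<phi>_graded_of homog_family_brk regrade_brk pbracket_to_cone sph_regrade)
next
  fix k
  have "\<phi> ` homog CG k = (\<lambda>P. to_cone (cst (\<mu> ^ k) * P)) ` {P. sph P \<and> phom (int k) P}"
    unfolding CG_homog image_image by (rule image_cong) (auto simp: \<phi>_graded_of homog_family_single regrade_single)
  also have "\<dots> = to_cone ` {P. sph P \<and> phom (int k) P}"
  proof (intro equalityI subsetI)
    fix x assume "x \<in> to_cone ` {P. sph P \<and> phom (int k) P}"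
    then obtain P where P: "sph P" "phom (int k) P" "x = to_cone P" by blast
    have "cst (\<mu> ^ k) * (cst (inverse \<mu> ^ k) * P) = P"
      using \<mu>(2) by (simp add: mult.assoc[symmetric] cst_simps(3) power_mult_distrib[symmetric] cst_simps(2))
    then show "x \<in> (\<lambda>P. to_cone (cst (\<mu> ^ k) * P)) ` {P. sph P \<and> phom (int k) P}"
      using P by (intro image_eqI[of _ _ "cst (inverse \<mu> ^ k) * P"]) (simp_all add: sph_simps phom_cmult)
  qed (auto intro!: imageI sph_simps phom_cmult)
  finally show "\<phi> ` homog CG k = homog BB k" by (simp only: homog_BB)
qed

lemma filtered_quantization_EE: "filtered_quantization EE FF BB"
  unfolding filtered_quantization_def using FF_filtered FF_comm BB_graded \<phi>_iso by blast

end

theorem theorem8p9: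
  fixes W :: "(complex ^ 'n ^ 'n::finite) set"
    and \<alpha> \<alpha>' :: "complex ^ 'n ^ 'n \<Rightarrow> complex ^ 'n"
    and lam :: "complex ^ 'n ^ 'n \<Rightarrow> complex"
    and c :: "complex ^ 'n ^ 'n \<Rightarrow> complex"
    and t \<zeta> :: complex
  assumes "complex_reflection_group W"
    and "irreducible_group W"
    and "CARD('n) > 1"
    and "reflection_data W \<alpha> \<alpha>' lam"
    and "conj_invariant W c"
    and "t \<noteq> 0"
  shows "filtered_quantization (eAe W \<alpha> \<alpha>' lam t c \<zeta>) (eAe_filtration W \<alpha> \<alpha>' lam t c \<zeta>)
           (invariant_ring W O_min_closure)"
proof -
  have "euler_data W \<alpha> \<alpha>' lam t c"
    using assms by (intro euler_data.intro refl_data.intro euler_data_axioms.intro) (simp_all add: complex_reflection_group_def)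
  then interpret euler_data W \<alpha> \<alpha>' lam t c \<zeta> .
  have "eAe_filtration W \<alpha> \<alpha>' lam t c \<zeta> = FF" by (intro HOL.ext) (simp add: pr_filt FF_def)
  then show ?thesis using filtered_quantization_EE by (simp add: eAe_eq O_min_closure_eq[OF assms(3)])
qed

end
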